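(* Let $W=G(r,p,n)$ and suppose $\kappa=0$ and the parameters $c_s$ are generic. Then $L(\mathbf{1})$ is the coinvariant ring for $G(r,p,n)$, that is, $L(\mathbf 1)=S/I$ where $S=S(\mathfrak{h}^* )$ and $I$ is the ideal of $S$ generated by the positive degree $W$-invariant polynomials, and it has basis (the images in $L(\mathbf 1)$ of) $\{f_{\lambda_v}\ |\ v\in G(r,1,n)_p\}$, where $$G(r,1,n)_p=\left\{[\zeta^{k_1}w(1),\dots,\zeta^{k_n}w(n)]\in G(r,1,n)\ |\ 0\le k_n\le r/p-1\right\}.$$ Furthermore, as a module for the generalized graded affine Hecke algebra $\mathcal{H}$, $L(\mathbf{1})$ decomposes into irreducibles as $$L(\mathbf{1})=\bigoplus_{d\in D_p}\mathrm{span}\{f_{\lambda_v}\ |\ v\in G(r,1,n)_p\ \text{and}\ \mathrm{des}(v)=d\},$$ where the spans are over the ground field, no two of which are isomorphic.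
   Context: Groups. Let $r,p,n$ be positive integers with $p\mid r$, and $\zeta=e^{2\pi i/r}$. $G(r,p,n)$ is the group of $n\times n$ monomial matrices whose non-zero entries are $r$th roots of $1$ and such that the product of the non-zero entries is an $(r/p)$th root of $1$. Let $\zeta_i$ be the diagonal matrix with $\zeta$ in position $i$ and $1$'s elsewhere, $s_{ij}$ the transposition matrix interchanging coordinates $i$ and $j$, and $s_i=s_{i,i+1}$. $W=G(r,p,n)$ acts on $\mathfrak{h}$ with standard basis $y_1,\dots,y_n$, and on $\mathfrak{h}^*$ with dual basis $x_1,\dots,x_n$ (so $\zeta_i x_i=\zeta^{-1}x_i$). Parameters and ground field. Let $\kappa$, $c_0$, and $c_l$ for $1\le l\le r-1$ with $p\mid l$, be independent variables over $\mathbb{C}$; put $c_l=0$ for $1\le l\le r-1$ with $p\nmid l$. Here $c_0$ is the parameter of all the reflections $\zeta_i^l s_{ij}\zeta_i^{-l}$ and $c_l$ that of the reflections $\zeta_i^l$ ($1\le i\le n$). Before specialization the ground field is the field of rational functions over $\mathbb{C}$ in all these variables. In the theorem $\kappa$ is specialized to $0$ and the other parameters remain generic (independent variables), so the ground field is the field of rational functions over $\mathbb{C}$ in $c_0$ and the $c_l$ with $p\mid l$. Vector spaces $\mathfrak{h},\mathfrak{h}^*$ are extended to the ground field. Rational Cherednik algebra. The rational Cherednik algebra for $G(r,1,n)$ is the algebra generated by the polynomial rings in $x_1,\dots,x_n$ and in $y_1,\dots,y_n$ and the group algebra of $G(r,1,n)$ (basis $t_w$), with relations $t_wx=(wx)t_w$,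 $t_wy=(wy)t_w$ for $x\in\mathfrak{h}^*$, $y\in\mathfrak{h}$, $$y_ix_j=x_jy_i+c_0\sum_{l=0}^{r-1}\zeta^{-l}t_{\zeta_i^ls_{ij}\zeta_i^{-l}}\quad(i\ne j),$$ $$y_ix_i=x_iy_i+\kappa-\sum_{l=1}^{r-1}c_l(1-\zeta^{-l})t_{\zeta_i^l}-c_0\sum_{j\ne i}\sum_{l=0}^{r-1}t_{\zeta_i^ls_{ij}\zeta_i^{-l}}.$$ The rational Cherednik algebra $\mathbb{H}$ for $W=G(r,p,n)$ is the subalgebra generated by $G(r,p,n)$, the $x_i$ and the $y_i$. The polynomial representation $M(\mathbf 1)$ is the $\mathbb{H}$-module induced from the trivial representation $\mathbf 1$ of $W$, extended to the subalgebra generated by $W$ and the $y_i$ with all $y_i$ acting by $0$; as a vector space $M(\mathbf 1)=S(\mathfrak{h}^* )$, the polynomial ring in $x_1,\dots,x_n$, with the $x_i$ acting by multiplication, $W$ acting naturally, and the $y_i$ acting by Dunkl operators. $M(\mathbf 1)$ has a unique maximal proper graded submodule, and $L(\mathbf 1)$ is the corresponding irreducible quotient. Hecke algebra. For $1\le i\le n$ put $$z_i=y_ix_i+c_0\sum_{1\le j<i}\sum_{l=0}^{r-1}t_{\zeta_i^ls_{ij}\zeta_i^{-l}}.$$ Let $\mathfrak{t}$ be the (commutative) subalgebra of $\mathbb{H}$ generated by $z_1,\dots,z_n$, the $t_{\zeta_i}^p$ ($1\le i\le n$) and the $t_{\zeta_i^{-1}\zeta_{i+1}}$ ($1\le i\le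 n-1$). The generalized graded affine Hecke algebra $\mathcal{H}$ is the subalgebra of $\mathbb{H}$ generated by the group algebra of $W$ and $\mathfrak{t}$. Non-symmetric Jack polynomials. For $\mu\in\mathbb{Z}_{\ge0}^n$ let $w_\mu\in S_n$ be the shortest permutation such that $w_\mu^{-1}.\mu$ is a partition (weakly decreasing), where $(w^{-1}.\mu)_j=\mu_{w(j)}$, and let $v_\mu=w_0w_\mu^{-1}$ with $w_0$ the longest element of $S_n$, i.e. $v_\mu(i)=n+1-w_\mu^{-1}(i)$. For $j\in\mathbb{Z}/r\mathbb{Z}$ put $d_j=\sum_{l=1}^{r/p-1}c_{lp}\zeta^{lpj}$. When $\kappa$ is an independent variable, there is for each $\mu$ a unique $f_\mu\in S(\mathfrak{h}^* )$ in which $x^\mu=x_1^{\mu_1}\cdots x_n^{\mu_n}$ has coefficient $1$ and which satisfies, for all $i$, $$z_i.f_\mu=\left((\mu_i+1)\kappa-(d_0-d_{-\mu_i-1})-r(v_\mu(i)-1)c_0\right)f_\mu,$$ together with $t_{\zeta_i^p}.f_\mu=\zeta^{-p\mu_i}f_\mu$ and $t_{\zeta_i\zeta_{i+1}^{-1}}.f_\mu=\zeta^{\mu_{i+1}-\mu_i}f_\mu$. The $f_\mu$ form a basis of $S(\mathfrak{h}^* )$, and $f_\mu$ equals $x^\mu$ plus lower terms for a certain partial order on $\mathbb{Z}_{\ge0}^n$ extending dominance order on partitions. The coefficients of $f_\mu$ have no pole at $\kappa=0$; in the theorem $f_\mu$ denotes the specialization at $\kappa=0$. Colored permutations and descents.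 Each element of $G(r,1,n)$ is written uniquely as $v=[\zeta^{k_1}w(1),\dots,\zeta^{k_n}w(n)]=w\zeta_1^{k_1}\cdots\zeta_n^{k_n}$ with $w\in S_n$ and $0\le k_i\le r-1$. A descent of $v$ is an integer $1\le i\le n-1$ such that $k_i<k_{i+1}$, or $k_i=k_{i+1}$ and $w(i)>w(i+1)$. The Steinberg weight of $v$ is $\lambda_v=(d_1(v),\dots,d_n(v))\in\mathbb{Z}_{\ge0}^n$, where $$d_i(v)=r\,\bigl|\{j\ge w^{-1}(i)\ |\ j\text{ is a descent of }v\}\bigr|+k_{w^{-1}(i)}.$$ The colored descent class of $v$ is $\mathrm{des}(v)=(d(v),(k_1,\dots,k_n))$, where $d(v)$ is the set of descents of $v$. $D_p$ is the set of all descent classes of elements of $G(r,1,n)$ satisfying $k_n\le r/p-1$. *)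

theory Defs
  imports
    "HOL-Library.Poly_Mapping"
    "HOL-Computational_Algebra.Polynomial"
    "HOL-Computational_Algebra.Fraction_Field"
    "HOL-Combinatorics.Permutations"
    "HOL-Algebra.QuotRing"
    "HOL-Algebra.Generated_Rings"
    "Jordan_Normal_Form.Matrix"
    Complex_Main
begin

text \<open>
  Coordinates are numbered \<open>0, \<dots>, n - 1\<close> throughout (instead of \<open>1, \<dots>, n\<close>), and so are the values
  of permutations.  The field of rational functions over the complex numbers in independent
  variables indexed by the type \<open>'l\<close> is the fraction field of the polynomial ring
  \<open>('l \<Rightarrow>\<^sub>0 nat) \<Rightarrow>\<^sub>0 complex\<close>.
\<close>

type_synonym 'l ratfun = "(('l \<Rightarrow>\<^sub>0 nat) \<Rightarrow>\<^sub>0 complex) fract"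

definition ratfun_const :: "complex \<Rightarrow> 'l::linorder ratfun" where
  "ratfun_const a = Fract (Poly_Mapping.single 0 a) 1"

definition ratfun_var :: "'l::linorder \<Rightarrow> 'l ratfun" where
  "ratfun_var l = Fract (Poly_Mapping.single (Poly_Mapping.single l 1) 1) 1"


section \<open>Polynomials in \<open>x\<^sub>0, \<dots>, x\<^sub>n\<^sub>-\<^sub>1\<close>\<close>

type_synonym 'k mpol = "(nat \<Rightarrow>\<^sub>0 nat) \<Rightarrow>\<^sub>0 'k"

definition xvar :: "nat \<Rightarrow> 'k::field mpol" where
  "xvar i = Poly_Mapping.single (Poly_Mapping.single i 1) 1"

definition pscale :: "'k::field \<Rightarrow> 'k mpol \<Rightarrow> 'k mpol" where
  "pscale a f = Poly_Mapping.single 0 a * f"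

definition in_vars :: "nat \<Rightarrow> (nat \<Rightarrow>\<^sub>0 nat) set" where
  "in_vars n = {m. Poly_Mapping.keys m \<subseteq> {..<n}}"

definition poly_ring :: "nat \<Rightarrow> 'k::field mpol ring" where
  "poly_ring n = \<lparr>carrier = {f. Poly_Mapping.keys f \<subseteq> in_vars n},
     monoid.mult = (*), one = 1, zero = 0, add = (+)\<rparr>"

definition mdeg :: "(nat \<Rightarrow>\<^sub>0 nat) \<Rightarrow> nat" where
  "mdeg m = (\<Sum>i\<in>Poly_Mapping.keys m. Poly_Mapping.lookup m i)"

definition hom_part :: "nat \<Rightarrow> 'k::field mpol \<Rightarrow> 'k mpol" where
  "hom_part d f = (\<Sum>m | m \<in> Poly_Mapping.keys f \<and> mdeg m = d.
     Poly_Mapping.single m (Poly_Mapping.lookup f m))"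

definition psubst :: "(nat \<Rightarrow> 'k mpol) \<Rightarrow> 'k::field mpol \<Rightarrow> 'k mpol" where
  "psubst \<sigma> f = (\<Sum>m\<in>Poly_Mapping.keys f. pscale (Poly_Mapping.lookup f m)
     (\<Prod>i\<in>Poly_Mapping.keys m. \<sigma> i ^ Poly_Mapping.lookup m i))"

definition pderivative :: "nat \<Rightarrow> 'k::field mpol \<Rightarrow> 'k mpol" where
  "pderivative i f = (\<Sum>m\<in>Poly_Mapping.keys f. Poly_Mapping.single (m - Poly_Mapping.single i 1)
     (of_nat (Poly_Mapping.lookup m i) * Poly_Mapping.lookup f m))"

text \<open>Only meaningful for \<open>g \<noteq> 0\<close> dividing \<open>f\<close>.\<close>

definition exact_quot :: "'k::field mpol \<Rightarrow> 'k mpol \<Rightarrow> 'k mpol" where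
  "exact_quot f g = (THE q. g * q = f)"


section \<open>The groups \<open>G(r,p,n)\<close>\<close>

definition zeta :: "nat \<Rightarrow> complex" where
  "zeta r = exp (2 * of_real pi * \<i> / of_nat r)"

definition monomial_mat :: "nat \<Rightarrow> complex mat \<Rightarrow> bool" where
  "monomial_mat n A \<longleftrightarrow> A \<in> carrier_mat n n \<and>
     (\<forall>i<n. \<exists>!j. j < n \<and> A $$ (i, j) \<noteq> 0) \<and> (\<forall>j<n. \<exists>!i. i < n \<and> A $$ (i, j) \<noteq> 0)"

definition nonzero_pos :: "nat \<Rightarrow> complex mat \<Rightarrow> (nat \<times> nat) set" where
  "nonzero_pos n A = {(i, j). i < n \<and> j < n \<and> A $$ (i, j) \<noteq> 0}"

definition Grpn :: "nat \<Rightarrow> nat \<Rightarrow> nat \<Rightarrow> complex mat set" where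
  "Grpn r p n = {A. monomial_mat n A \<and> (\<forall>ij\<in>nonzero_pos n A. (A $$ ij) ^ r = 1) \<and>
     (\<Prod>ij\<in>nonzero_pos n A. A $$ ij) ^ (r div p) = 1}"

definition inv_mat :: "nat \<Rightarrow> complex mat \<Rightarrow> complex mat" where
  "inv_mat n A = (THE B. B \<in> carrier_mat n n \<and> A * B = 1\<^sub>m n \<and> B * A = 1\<^sub>m n)"

text \<open>\<open>zeta_mat r n i l\<close> is \<open>\<zeta>\<^sub>i\<^sup>l\<close>, \<open>swap_mat n i j\<close> is \<open>s\<^sub>i\<^sub>j\<close>, and \<open>refl_mat r n i j l\<close> is
  the reflection \<open>\<zeta>\<^sub>i\<^sup>l s\<^sub>i\<^sub>j \<zeta>\<^sub>i\<^sup>-\<^sup>l\<close>.\<close>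

definition zeta_mat :: "nat \<Rightarrow> nat \<Rightarrow> nat \<Rightarrow> int \<Rightarrow> complex mat" where
  "zeta_mat r n i l = mat n n (\<lambda>(a, b). if a = b then (if a = i then zeta r powi l else 1) else 0)"

definition swap_mat :: "nat \<Rightarrow> nat \<Rightarrow> nat \<Rightarrow> complex mat" where
  "swap_mat n i j = mat n n (\<lambda>(a, b). if a = Transposition.transpose i j b then 1 else 0)"

definition refl_mat :: "nat \<Rightarrow> nat \<Rightarrow> nat \<Rightarrow> nat \<Rightarrow> nat \<Rightarrow> complex mat" where
  "refl_mat r n i j l = zeta_mat r n i (int l) * swap_mat n i j * zeta_mat r n i (- int l)"


section \<open>Colored permutations and descents\<close>

text \<open>For \<open>v = w \<zeta>\<^sub>0\<^bsup>k\<^sub>0\<^esup> \<cdots> \<zeta>\<^sub>n\<^sub>-\<^sub>1\<^bsup>k\<^sub>n\<^sub>-\<^sub>1\<^esup>\<close> one has \<open>v y\<^sub>j = \<zeta>\<^bsup>k\<^sub>j\<^esup> y\<^bsub>w(j)\<^esub>\<close>, so \<open>w(j)\<close> and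
  \<open>k\<^sub>j\<close> are read off the \<open>j\<close>th column of \<open>v\<close>.\<close>

definition perm_of :: "nat \<Rightarrow> complex mat \<Rightarrow> nat \<Rightarrow> nat" where
  "perm_of n v j = (THE i. i < n \<and> v $$ (i, j) \<noteq> 0)"

definition color_of :: "nat \<Rightarrow> nat \<Rightarrow> complex mat \<Rightarrow> nat \<Rightarrow> nat" where
  "color_of r n v j = (THE k. k < r \<and> v $$ (perm_of n v j, j) = zeta r ^ k)"

definition descents :: "nat \<Rightarrow> nat \<Rightarrow> complex mat \<Rightarrow> nat set" where
  "descents r n v = {i. Suc i < n \<and>
     (color_of r n v i < color_of r n v (Suc i) \<or>
      color_of r n v i = color_of r n v (Suc i) \<and> perm_of n v i > perm_of n v (Suc i))}"

definition steinberg_weight :: "nat \<Rightarrow> nat \<Rightarrow> complex mat \<Rightarrow> (nat \<Rightarrow>\<^sub>0 nat)" where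
  "steinberg_weight r n v = (\<Sum>i<n. let j = the_inv_into {..<n} (perm_of n v) i in
     Poly_Mapping.single i (r * card {j'. j \<le> j' \<and> j' \<in> descents r n v} + color_of r n v j))"

definition colored_descent_class :: "nat \<Rightarrow> nat \<Rightarrow> complex mat \<Rightarrow> nat set \<times> nat list" where
  "colored_descent_class r n v = (descents r n v, map (color_of r n v) [0..<n])"

definition G1_sub :: "nat \<Rightarrow> nat \<Rightarrow> nat \<Rightarrow> complex mat set" where
  "G1_sub r p n = {v \<in> Grpn r 1 n. color_of r n v (n - 1) \<le> r div p - 1}"

definition descent_classes :: "nat \<Rightarrow> nat \<Rightarrow> nat \<Rightarrow> (nat set \<times> nat list) set" where
  "descent_classes r p n = colored_descent_class r n ` G1_sub r p n"

definition inversions :: "nat \<Rightarrow> (nat \<Rightarrow> nat) \<Rightarrow> nat" where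
  "inversions n w = card {(i, j). i < j \<and> j < n \<and> w j < w i}"

definition w_of :: "nat \<Rightarrow> (nat \<Rightarrow>\<^sub>0 nat) \<Rightarrow> nat \<Rightarrow> nat" where
  "w_of n \<mu> = (ARG_MIN (inversions n) w. w permutes {..<n} \<and>
     (\<forall>i j. i \<le> j \<and> j < n \<longrightarrow> Poly_Mapping.lookup \<mu> (w j) \<le> Poly_Mapping.lookup \<mu> (w i)))"

text \<open>With values in \<open>{0, \<dots>, n - 1}\<close>, this is \<open>v\<^sub>\<mu>(i) - 1\<close> of the 1-based convention.\<close>

definition v_of :: "nat \<Rightarrow> (nat \<Rightarrow>\<^sub>0 nat) \<Rightarrow> nat \<Rightarrow> nat" where
  "v_of n \<mu> i = n - 1 - inv_into UNIV (w_of n \<mu>) i"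


section \<open>Free algebras\<close>

datatype 'a free_word = Word (letters: "'a list")

instantiation free_word :: (type) monoid_add
begin

definition zero_free_word :: "'a free_word" where
  "0 = Word []"

definition plus_free_word :: "'a free_word \<Rightarrow> 'a free_word \<Rightarrow> 'a free_word" where
  "u + v = Word (letters u @ letters v)"

instance
  by standard (simp_all add: zero_free_word_def plus_free_word_def)

end

type_synonym ('a, 'k) free_alg = "'a free_word \<Rightarrow>\<^sub>0 'k"

definition fgen :: "'a \<Rightarrow> ('a, 'k::field) free_alg" where
  "fgen a = Poly_Mapping.single (Word [a]) 1"

definition fscalar :: "'k \<Rightarrow> ('a, 'k::field) free_alg" where
  "fscalar a = Poly_Mapping.single 0 a"

definition free_algebra :: "'a set \<Rightarrow> ('a, 'k::field) free_alg ring" where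
  "free_algebra A = \<lparr>carrier = {a. \<forall>w\<in>Poly_Mapping.keys a. set (letters w) \<subseteq> A},
     monoid.mult = (*), one = 1, zero = 0, add = (+)\<rparr>"

definition free_act :: "('a \<Rightarrow> 'k mpol \<Rightarrow> 'k mpol) \<Rightarrow> ('a, 'k::field) free_alg \<Rightarrow> 'k mpol \<Rightarrow> 'k mpol" where
  "free_act \<rho> a f = (\<Sum>w\<in>Poly_Mapping.keys a.
     pscale (Poly_Mapping.lookup a w) (foldr \<rho> (letters w) f))"


section \<open>Modules over an algebra\<close>

text \<open>Here \<open>A\<close> is (the carrier of) an algebra over the ground field that contains the scalars and acts
  on the additive group of \<open>M\<close> by \<open>act\<close>; subgroups stable under \<open>A\<close> and additive maps commuting
  with \<open>A\<close> are therefore automatically linear.\<close>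

definition alg_submodule ::
    "'h set \<Rightarrow> ('h \<Rightarrow> 'm \<Rightarrow> 'm) \<Rightarrow> ('m, 'x) ring_scheme \<Rightarrow> 'm set \<Rightarrow> bool" where
  "alg_submodule A act M U \<longleftrightarrow> subgroup U (add_monoid M) \<and> (\<forall>h\<in>A. \<forall>u\<in>U. act h u \<in> U)"

definition alg_irreducible ::
    "'h set \<Rightarrow> ('h \<Rightarrow> 'm \<Rightarrow> 'm) \<Rightarrow> ('m, 'x) ring_scheme \<Rightarrow> 'm set \<Rightarrow> bool" where
  "alg_irreducible A act M U \<longleftrightarrow> alg_submodule A act M U \<and> U \<noteq> {\<zero>\<^bsub>M\<^esub>} \<and>
     (\<forall>V. alg_submodule A act M V \<and> V \<subseteq> U \<longrightarrow> V = {\<zero>\<^bsub>M\<^esub>} \<or> V = U)"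

definition alg_isomorphic ::
    "'h set \<Rightarrow> ('h \<Rightarrow> 'm \<Rightarrow> 'm) \<Rightarrow> ('m, 'x) ring_scheme \<Rightarrow> 'm set \<Rightarrow> 'm set \<Rightarrow> bool" where
  "alg_isomorphic A act M U V \<longleftrightarrow> (\<exists>\<phi>. bij_betw \<phi> U V \<and>
     (\<forall>a\<in>U. \<forall>b\<in>U. \<phi> (a \<oplus>\<^bsub>M\<^esub> b) = \<phi> a \<oplus>\<^bsub>M\<^esub> \<phi> b) \<and>
     (\<forall>h\<in>A. \<forall>a\<in>U. \<phi> (act h a) = act h (\<phi> a)))"

definition internal_direct_sum :: "('m, 'x) ring_scheme \<Rightarrow> 'i set \<Rightarrow> ('i \<Rightarrow> 'm set) \<Rightarrow> bool" where
  "internal_direct_sum M D U \<longleftrightarrow> (\<forall>d\<in>D. U d \<subseteq> carrier M) \<and>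
     (\<forall>a\<in>carrier M. \<exists>!u. u \<in> (\<Pi>\<^sub>E d\<in>D. U d) \<and> a = finsum M u D)"


section \<open>Rational Cherednik algebras\<close>

datatype cgen = GenX nat | GenY nat | GenT "complex mat"

text \<open>\<open>\<iota>\<close> is the embedding of the complex numbers into the ground field; \<open>c 0\<close> is the parameter of the
  reflections \<open>\<zeta>\<^sub>i\<^sup>l s\<^sub>i\<^sub>j \<zeta>\<^sub>i\<^sup>-\<^sup>l\<close> and \<open>c l\<close> that of \<open>\<zeta>\<^sub>i\<^sup>l\<close> for \<open>1 \<le> l \<le> r - 1\<close>.\<close>

locale cherednik =
  fixes r p n :: nat
    and \<iota> :: "complex \<Rightarrow> 'k::field"
    and \<kappa> :: 'k
    and c :: "nat \<Rightarrow> 'k"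
begin

definition zpow :: "int \<Rightarrow> 'k" where
  "zpow l = \<iota> (zeta r powi l)"

definition cherednik_gens :: "cgen set" where
  "cherednik_gens = GenX ` {..<n} \<union> GenY ` {..<n} \<union> GenT ` Grpn r 1 n"

abbreviation FX :: "nat \<Rightarrow> (cgen, 'k) free_alg" where "FX i \<equiv> fgen (GenX i)"
abbreviation FY :: "nat \<Rightarrow> (cgen, 'k) free_alg" where "FY i \<equiv> fgen (GenY i)"
abbreviation FT :: "complex mat \<Rightarrow> (cgen, 'k) free_alg" where "FT g \<equiv> fgen (GenT g)"

definition cherednik_rels :: "(cgen, 'k) free_alg set" where
  "cherednik_rels =
     {FX i * FX j - FX j * FX i | i j. i < n \<and> j < n} \<union>
     {FY i * FY j - FY j * FY i | i j. i < n \<and> j < n} \<union>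
     {FT (1\<^sub>m n) - 1} \<union>
     {FT g * FT h - FT (g * h) | g h. g \<in> Grpn r 1 n \<and> h \<in> Grpn r 1 n} \<union>
     {FT g * FX j - (\<Sum>i<n. fscalar (\<iota> (inv_mat n g $$ (j, i))) * FX i) * FT g | g j.
        g \<in> Grpn r 1 n \<and> j < n} \<union>
     {FT g * FY j - (\<Sum>i<n. fscalar (\<iota> (g $$ (i, j))) * FY i) * FT g | g j.
        g \<in> Grpn r 1 n \<and> j < n} \<union>
     {FY i * FX j - (FX j * FY i
        + fscalar (c 0) * (\<Sum>l<r. fscalar (zpow (- int l)) * FT (refl_mat r n i j l))) | i j.
        i < n \<and> j < n \<and> i \<noteq> j} \<union>
     {FY i * FX i - (FX i * FY i + fscalar \<kappa>
        - (\<Sum>l = 1..<r. fscalar (c l * (1 - zpow (- int l))) * FT (zeta_mat r n i (int l)))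
        - fscalar (c 0) * (\<Sum>j\<in>{..<n} - {i}. \<Sum>l<r. FT (refl_mat r n i j l))) | i. i < n}"

definition cherednik_full :: "(cgen, 'k) free_alg set ring" where
  "cherednik_full =
     (let F = free_algebra cherednik_gens in F Quot (genideal F cherednik_rels))"

definition cclass :: "(cgen, 'k) free_alg \<Rightarrow> (cgen, 'k) free_alg set" where
  "cclass a = (let F = free_algebra cherednik_gens in genideal F cherednik_rels +>\<^bsub>F\<^esub> a)"

definition subalgebra_gen :: "(cgen, 'k) free_alg set set \<Rightarrow> (cgen, 'k) free_alg set set" where
  "subalgebra_gen B = generate_ring cherednik_full (range (\<lambda>a. cclass (fscalar a)) \<union> B)"

definition cherednik_alg :: "(cgen, 'k) free_alg set set" where
  "cherednik_alg = subalgebra_gen ((\<lambda>g. cclass (FT g)) ` Grpn r p n \<union>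
     (\<lambda>i. cclass (FX i)) ` {..<n} \<union> (\<lambda>i. cclass (FY i)) ` {..<n})"

definition z_elt :: "nat \<Rightarrow> (cgen, 'k) free_alg set" where
  "z_elt i = cclass (FY i * FX i + fscalar (c 0) * (\<Sum>j<i. \<Sum>l<r. FT (refl_mat r n i j l)))"

definition t_alg :: "(cgen, 'k) free_alg set set" where
  "t_alg = subalgebra_gen (z_elt ` {..<n} \<union>
     (\<lambda>i. cclass (FT (zeta_mat r n i (int p)))) ` {..<n} \<union>
     (\<lambda>i. cclass (FT (zeta_mat r n i (- 1) * zeta_mat r n (Suc i) 1))) ` {..<n - 1})"

definition hecke_alg :: "(cgen, 'k) free_alg set set" where
  "hecke_alg = subalgebra_gen ((\<lambda>g. cclass (FT g)) ` Grpn r p n \<union> t_alg)"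


subsection \<open>The polynomial representation\<close>

text \<open>The contragredient action: \<open>g x\<^sub>j = \<Sum>\<^sub>i (g\<^sup>-\<^sup>1)\<^sub>j\<^sub>i x\<^sub>i\<close>, extended multiplicatively.\<close>

definition group_act :: "complex mat \<Rightarrow> 'k mpol \<Rightarrow> 'k mpol" where
  "group_act g = psubst (\<lambda>j. \<Sum>i<n. pscale (\<iota> (inv_mat n g $$ (j, i))) (xvar i))"

text \<open>The reflection \<open>s = \<zeta>\<^sub>i\<^sup>l s\<^sub>i\<^sub>j \<zeta>\<^sub>i\<^sup>-\<^sup>l\<close> maps \<open>x\<^sub>i\<close> to \<open>\<zeta>\<^sup>l x\<^sub>j\<close>, so \<open>f - s f\<close> is divisible by
  \<open>x\<^sub>i - \<zeta>\<^sup>l x\<^sub>j\<close>.  These operators are the ones forced by \<open>y\<^sub>i 1 = 0\<close> and the commutation relations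
  of \<open>y\<^sub>i\<close> with the \<open>x\<^sub>j\<close>.\<close>

definition dunkl :: "nat \<Rightarrow> 'k mpol \<Rightarrow> 'k mpol" where
  "dunkl i f = pscale \<kappa> (pderivative i f)
     - (\<Sum>l = 1..<r. pscale (c l) (exact_quot (f - group_act (zeta_mat r n i (int l)) f) (xvar i)))
     - pscale (c 0) (\<Sum>j\<in>{..<n} - {i}. \<Sum>l<r.
         exact_quot (f - group_act (refl_mat r n i j l) f) (xvar i - pscale (zpow (int l)) (xvar j)))"

fun gen_act :: "cgen \<Rightarrow> 'k mpol \<Rightarrow> 'k mpol" where
  "gen_act (GenX i) f = xvar i * f"
| "gen_act (GenY i) f = dunkl i f"
| "gen_act (GenT g) f = group_act g f"

text \<open>The action of a residue class; it does not depend on the representative because the operators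
  \<open>gen_act\<close> satisfy the defining relations.\<close>

definition poly_act :: "(cgen, 'k) free_alg set \<Rightarrow> 'k mpol \<Rightarrow> 'k mpol" where
  "poly_act h = free_act gen_act (SOME a. a \<in> h)"

definition graded_proper_submodule :: "'k mpol set \<Rightarrow> bool" where
  "graded_proper_submodule N \<longleftrightarrow> alg_submodule cherednik_alg poly_act (poly_ring n) N \<and>
     (\<forall>f\<in>N. \<forall>d. hom_part d f \<in> N) \<and> N \<noteq> carrier (poly_ring n)"

definition max_submodule :: "'k mpol set" where
  "max_submodule = (THE N. graded_proper_submodule N \<and>
     (\<forall>N'. graded_proper_submodule N' \<and> N \<subseteq> N' \<longrightarrow> N' = N))"

text \<open>The quotient ring is used as the carrier of the quotient module: \<open>max_submodule\<close> is stable under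
  multiplication by the \<open>x\<^sub>i\<close>, hence an ideal.\<close>

definition L1 :: "'k mpol set ring" where
  "L1 = poly_ring n Quot max_submodule"

definition L1_class :: "'k mpol \<Rightarrow> 'k mpol set" where
  "L1_class f = max_submodule +>\<^bsub>poly_ring n\<^esub> f"

definition L1_act :: "(cgen, 'k) free_alg set \<Rightarrow> 'k mpol set \<Rightarrow> 'k mpol set" where
  "L1_act h a = L1_class (poly_act h (SOME f. f \<in> a))"

definition L1_scale :: "'k \<Rightarrow> 'k mpol set \<Rightarrow> 'k mpol set" where
  "L1_scale u a = L1_class (pscale u (SOME f. f \<in> a))"

definition L1_basis :: "'i set \<Rightarrow> ('i \<Rightarrow> 'k mpol set) \<Rightarrow> bool" where
  "L1_basis I b \<longleftrightarrow> b ` I \<subseteq> carrier L1 \<and>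
     (\<forall>a\<in>carrier L1. \<exists>!u. u \<in> (I \<rightarrow>\<^sub>E UNIV) \<and> a = finsum L1 (\<lambda>i. L1_scale (u i) (b i)) I)"

definition positive_invariants :: "'k mpol set" where
  "positive_invariants = {f \<in> carrier (poly_ring n).
     (\<exists>d>0. hom_part d f = f) \<and> (\<forall>g\<in>Grpn r p n. group_act g f = f)}"

definition coinvariant_ring :: "'k mpol set ring" where
  "coinvariant_ring = poly_ring n Quot (genideal (poly_ring n) positive_invariants)"


subsection \<open>Non-symmetric Jack polynomials\<close>

definition d_param :: "int \<Rightarrow> 'k" where
  "d_param j = (\<Sum>l = 1..<r div p. c (l * p) * zpow (int (l * p) * j))"

definition jack :: "(nat \<Rightarrow>\<^sub>0 nat) \<Rightarrow> 'k mpol" where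
  "jack \<mu> = (let m = (\<lambda>i. int (Poly_Mapping.lookup \<mu> i)) in
     THE f. f \<in> carrier (poly_ring n) \<and> Poly_Mapping.lookup f \<mu> = 1 \<and>
       (\<forall>i<n. poly_act (z_elt i) f =
          pscale (of_int (m i + 1) * \<kappa> - (d_param 0 - d_param (- m i - 1))
            - of_nat (r * v_of n \<mu> i) * c 0) f) \<and>
       (\<forall>i<n. poly_act (cclass (FT (zeta_mat r n i (int p)))) f = pscale (zpow (- int p * m i)) f) \<and>
       (\<forall>i. Suc i < n \<longrightarrow>
          poly_act (cclass (FT (zeta_mat r n i 1 * zeta_mat r n (Suc i) (- 1)))) f =
            pscale (zpow (m (Suc i) - m i)) f))"

end

text \<open>For a generic \<open>\<kappa>\<close> the ground field is \<open>K(\<kappa>)\<close>, the fraction field of \<open>K[\<kappa>]\<close>, where \<open>K\<close> is the field of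
  rational functions in the remaining parameters; \<open>spec0\<close> is the value at \<open>\<kappa> = 0\<close> of an element
  of \<open>K(\<kappa>)\<close> without a pole there.\<close>

definition kconst :: "'k::field \<Rightarrow> 'k poly fract" where
  "kconst a = Fract [:a:] 1"

definition kvar :: "'k::field poly fract" where
  "kvar = Fract [:0, 1:] 1"

definition spec0 :: "'k::field poly fract \<Rightarrow> 'k" where
  "spec0 q = (THE a. \<exists>u w. q = Fract u w \<and> poly w 0 \<noteq> 0 \<and> a = poly u 0 / poly w 0)"

definition jack0 ::
    "nat \<Rightarrow> nat \<Rightarrow> nat \<Rightarrow> (complex \<Rightarrow> 'k) \<Rightarrow> (nat \<Rightarrow> 'k::field) \<Rightarrow> (nat \<Rightarrow>\<^sub>0 nat) \<Rightarrow> 'k mpol" where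
  "jack0 r p n \<iota> c \<mu> = Poly_Mapping.map spec0
     (cherednik.jack r p n (\<lambda>a. kconst (\<iota> a)) kvar (\<lambda>l. kconst (c l)) \<mu>)"

end

theory Submission
  imports Defs
begin

text \<open>
  At \<open>\<kappa> = 0\<close> the operators \<open>z\<^sub>i\<close> and the elements of \<open>W\<close> commute with multiplication by elements of the
  ring \<open>A\<close> of invariants, and the \<open>f\<^bsub>\<lambda>\<^sub>v\<^esub>\<close> have pairwise distinct weights because \<open>c\<^sub>0 \<noteq> 0\<close>; so they are
  linearly independent over \<open>A\<close>.  Every exponent is \<open>\<lambda>\<^sub>v\<close> plus a permutation \<open>w(\<nu>)\<close> of the exponent of a
  monomial symmetric invariant, where \<open>w\<close> underlies \<open>v\<close>.  Counting in each degree, \<open>S\<close> is free over \<open>A\<close>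
  with basis the \<open>f\<^bsub>\<lambda>\<^sub>v\<^esub>\<close>, and these form a basis of \<open>S/I\<close>.

  By the intertwining relations \<open>s\<^sub>i f\<^bsub>\<lambda>\<^sub>v\<^esub>\<close> is a multiple of \<open>f\<^bsub>\<lambda>\<^sub>v\<^esub>\<close> plus a vector of the weight of
  \<open>s\<^sub>i v\<close> and of the degree of \<open>\<lambda>\<^sub>v\<close>.  If \<open>s\<^sub>i v\<close> and \<open>v\<close> have the same descent class, this vector is a
  non-zero multiple of \<open>f\<close> at \<open>s\<^sub>i v\<close>; otherwise the degrees of the two weights differ and it lies in \<open>I\<close>.
  As each descent class is connected under such moves and the weights are distinct, the descent
  classes span irreducible, pairwise non-isomorphic \<open>\<H>\<close>-modules.

  A graded \<open>H\<close>-submodule not contained in \<open>I\<close> contains modulo \<open>I\<close> some \<open>f\<^bsub>\<lambda>\<^sub>v\<^esub>\<close>.  In minimal degree it is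
  killed by all \<open>y\<^sub>i\<close> modulo \<open>I\<close>, as is its whole descent class.  Comparing the eigenvalue of the last \<open>z\<^sub>i\<close>
  with the commutation relation, genericity forces \<open>v\<close> to fix the last position with color \<open>0\<close>, and
  the only class all of whose members do so is that of the identity.  Hence the submodule contains
  \<open>1\<close>, and \<open>I\<close> is the maximal proper graded submodule.
\<close>

section \<open>Polynomials\<close>

text \<open>At \<kappa> = 0 the eigenvalues no longer determine the exponent: multiplying
  \<open>F v\<close> by an invariant keeps all of them. So the Jack polynomials are built over
  K(\<kappa>) by intertwiners, identified there by uniqueness, and then specialized. The only
  denominators are differences of two eigenvalues with congruent exponents, whose value at \<kappa>
  = 0 is a non-zero integer multiple of \<open>c 0\<close>. For the weights \<lambda>_v with equal
  colors at the positions a, b of the values i, i + 1, this difference is r * c 0 * (a - b), so the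
  intertwiner is s_i + 1/(a - b). It can vanish only for a - b = 1 or -1, which is exactly where
  exchanging i and i + 1 changes the descent class. The count in each degree replaces the structure
  theorem for invariants: the decomposition of exponents assigns to each monomial its own product of
  some \<open>F v\<close> with a monomial symmetric invariant, so linear independence over the
  invariants, which distinct weights give, already forces spanning. Equivariance, commutativity and
  specialization of the Dunkl operators are inductions over multiplication by variables, so only the
  commutation relations enter and not the quotients.\<close>

abbreviation coef :: "('a \<Rightarrow>\<^sub>0 'b::zero) \<Rightarrow> 'a \<Rightarrow> 'b" where "coef \<equiv> Poly_Mapping.lookup"
abbreviation supp :: "('a \<Rightarrow>\<^sub>0 'b::zero) \<Rightarrow> 'a set" where "supp \<equiv> Poly_Mapping.keys"
abbreviation mon :: "(nat \<Rightarrow>\<^sub>0 nat) \<Rightarrow> 'k::field mpol" where "mon m \<equiv> Poly_Mapping.single m 1"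
definition unit_exp :: "nat \<Rightarrow> (nat \<Rightarrow>\<^sub>0 nat)" where "unit_exp i = Poly_Mapping.single i 1"

lemma coef_unit_exp [simp]: "coef (unit_exp i) j = (if j = i then 1 else 0)"
  by (simp add: unit_exp_def lookup_single when_def)

lemma supp_unit_exp [simp]: "supp (unit_exp i) = {i}"
  by (simp add: unit_exp_def)

lemma xvar_eq_mon: "xvar i = mon (unit_exp i)"
  by (simp add: xvar_def unit_exp_def)

definition polys :: "nat \<Rightarrow> 'k::field mpol set" where "polys n = {f. supp f \<subseteq> in_vars n}"

lemma carrier_poly_ring [simp]: "carrier (poly_ring n) = polys n"
  by (simp add: poly_ring_def polys_def)

lemma poly_mapping_sum_single: "f = (\<Sum>m\<in>supp f. Poly_Mapping.single m (coef f m))"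
  by (rule poly_mapping_eqI)
     (auto simp: lookup_sum lookup_single when_def sum.delta in_keys_iff)

lemma coef_pscale [simp]: "coef (pscale a f) m = a * coef f m"
  by (simp add: pscale_def mult_map_scale_conv_mult[symmetric] Poly_Mapping.map.rep_eq when_def)

lemma pscale_add_right: "pscale a (f + g) = pscale a f + pscale a g"
  by (simp add: pscale_def distrib_left)

lemma pscale_add_left: "pscale (a + b) f = pscale a f + pscale b f"
  by (simp add: pscale_def single_add distrib_right)

lemma pscale_pscale [simp]: "pscale a (pscale b f) = pscale (a * b) f"
  by (simp add: pscale_def mult_single mult.assoc[symmetric])

lemma pscale_one [simp]: "pscale 1 f = f"
  by (simp add: pscale_def)

lemma pscale_zero_left [simp]: "pscale 0 f = 0"
  by (simp add: pscale_def)

lemma pscale_zero_right [simp]: "pscale a 0 = 0"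
  by (simp add: pscale_def)

lemma pscale_minus_left: "pscale (- a) f = - pscale a f"
  by (simp add: pscale_def single_uminus)

lemma pscale_diff_left: "pscale (a - b) f = pscale a f - pscale b f"
  by (simp add: pscale_def single_diff left_diff_distrib)

lemma pscale_diff_right: "pscale a (f - g) = pscale a f - pscale a g"
  by (simp add: pscale_def right_diff_distrib)

lemma pscale_sum_right: "pscale a (sum f A) = (\<Sum>x\<in>A. pscale a (f x))"
  by (simp add: pscale_def sum_distrib_left)

lemma pscale_sum_left: "pscale (sum a A) f = (\<Sum>x\<in>A. pscale (a x) f)"
  by (induction A rule: infinite_finite_induct) (auto simp: pscale_add_left)

lemma pscale_mult_left: "pscale a f * g = pscale a (f * g)"
  by (simp add: pscale_def mult.assoc)

lemma pscale_mult_right: "f * pscale a g = pscale a (f * g)"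
  by (simp add: pscale_def mult.left_commute)

lemma pscale_single: "pscale a (Poly_Mapping.single m b) = Poly_Mapping.single m (a * b)"
  by (simp add: pscale_def mult_single)

interpretation mpol: vector_space "pscale :: 'k \<Rightarrow> 'k mpol \<Rightarrow> 'k::field mpol"
  by unfold_locales (simp_all add: pscale_add_right pscale_add_left)

lemma supp_pscale_subset: "supp (pscale a f) \<subseteq> supp f"
  by (auto simp: in_keys_iff)

lemma polys_0 [simp, intro]: "0 \<in> polys n" by (simp add: polys_def)

lemma polys_1 [simp, intro]: "1 \<in> polys n" by (simp add: polys_def in_vars_def)

lemma polys_add [simp, intro]: "f \<in> polys n \<Longrightarrow> g \<in> polys n \<Longrightarrow> f + g \<in> polys n"
  using keys_add[of f g] by (fastforce simp: polys_def)

lemma polys_uminus [simp, intro]: "f \<in> polys n \<Longrightarrow> - f \<in> polys n"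
  by (auto simp: polys_def in_keys_iff)

lemma polys_diff [simp, intro]: "f \<in> polys n \<Longrightarrow> g \<in> polys n \<Longrightarrow> f - g \<in> polys n"
  by (metis diff_conv_add_uminus polys_add polys_uminus)

lemma in_vars_add: "m \<in> in_vars n \<Longrightarrow> m' \<in> in_vars n \<Longrightarrow> m + m' \<in> in_vars n"
  using keys_add[of m m'] by (fastforce simp: in_vars_def)

lemma in_vars_iff: "m \<in> in_vars n \<longleftrightarrow> (\<forall>i\<ge>n. coef m i = 0)"
  unfolding in_vars_def by (fastforce simp: in_keys_iff subset_iff not_less[symmetric])

lemma polys_mult [simp, intro]: "f \<in> polys n \<Longrightarrow> g \<in> polys n \<Longrightarrow> f * g \<in> polys n"
  using keys_mult[of f g] in_vars_add[of _ n] by (fastforce simp: polys_def)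

lemma polys_pscale [simp, intro]: "f \<in> polys n \<Longrightarrow> pscale a f \<in> polys n"
  using supp_pscale_subset[of a f] by (auto simp: polys_def)

lemma polys_xvar [simp, intro]: "i < n \<Longrightarrow> xvar i \<in> polys n"
  by (auto simp: polys_def xvar_eq_mon in_vars_def)

lemma polys_sum [intro]: "(\<And>x. x \<in> A \<Longrightarrow> f x \<in> polys n) \<Longrightarrow> sum f A \<in> polys n"
  by (induction A rule: infinite_finite_induct) auto

lemma polys_mon [simp]: "mon m \<in> polys n \<longleftrightarrow> m \<in> in_vars n"
  by (auto simp: polys_def)

lemma xvar_neq_0 [simp]: "xvar i \<noteq> 0"
  by (metis xvar_eq_mon lookup_single_eq lookup_zero zero_neq_one)

lemma xvar_mult_mon: "xvar i * mon m = mon (unit_exp i + m)"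
  by (simp add: xvar_eq_mon mult_single)

section \<open>Degrees and induction over monomials\<close>

lemma mdeg_superset:
  assumes "finite A" "supp m \<subseteq> A" shows "mdeg m = (\<Sum>i\<in>A. coef m i)"
  unfolding mdeg_def by (rule sum.mono_neutral_left) (use assms in \<open>auto simp: in_keys_iff\<close>)

lemma mdeg_add [simp]: "mdeg (m + m') = mdeg m + mdeg m'"
proof -
  have "mdeg (m + m') = (\<Sum>i\<in>supp m \<union> supp m'. coef (m + m') i)"
    by (rule mdeg_superset) (use keys_add[of m m'] in auto)
  also have "\<dots> = (\<Sum>i\<in>supp m \<union> supp m'. coef m i) + (\<Sum>i\<in>supp m \<union> supp m'. coef m' i)"
    by (simp add: lookup_add sum.distrib)
  also have "\<dots> = mdeg m + mdeg m'"
    using mdeg_superset[of "supp m \<union> supp m'" m] mdeg_superset[of "supp m \<union> supp m'" m'] by simp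
  finally show ?thesis .
qed

lemma mdeg_zero [simp]: "mdeg 0 = 0" by (simp add: mdeg_def)

lemma mdeg_unit_exp [simp]: "mdeg (unit_exp i) = 1" by (simp add: mdeg_def)

lemma mdeg_eq_0_iff [simp]: "mdeg m = 0 \<longleftrightarrow> m = 0"
  by (auto simp: mdeg_def in_keys_iff) (metis poly_mapping_eqI lookup_zero)

lemma mdeg_in_vars: "m \<in> in_vars n \<Longrightarrow> mdeg m = (\<Sum>i<n. coef m i)"
  by (rule mdeg_superset) (auto simp: in_vars_def)

lemma unit_exp_add_diff: "coef m i \<noteq> 0 \<Longrightarrow> unit_exp i + (m - unit_exp i) = m"
  by (rule poly_mapping_eqI) (auto simp: lookup_add lookup_minus)

lemma exp_nonzero_coef: "m \<noteq> 0 \<Longrightarrow> \<exists>i. coef m i \<noteq> 0"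
  by (metis lookup_zero poly_mapping_eqI)

lemma mon_induct [consumes 1, case_names zero step]:
  assumes "m \<in> in_vars n" and "P 0"
    and step: "\<And>i m. i < n \<Longrightarrow> m \<in> in_vars n \<Longrightarrow> P m \<Longrightarrow> P (unit_exp i + m)"
  shows "P m"
proof -
  have "\<forall>m. m \<in> in_vars n \<longrightarrow> mdeg m = d \<longrightarrow> P m" for d
  proof (induction d)
    case 0
    show ?case using assms(2) by simp
  next
    case (Suc d)
    show ?case
    proof (intro allI impI)
      fix m assume m: "m \<in> in_vars n" and deg: "mdeg m = Suc d"
      from deg have "m \<noteq> 0" by auto
      from exp_nonzero_coef[OF this] obtain i where i: "coef m i \<noteq> 0" by blast
      have eq: "unit_exp i + (m - unit_exp i) = m" by (rule unit_exp_add_diff[OF i])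
      have "mdeg (unit_exp i + (m - unit_exp i)) = Suc d" by (simp only: eq deg)
      then have d: "mdeg (m - unit_exp i) = d" by (simp only: mdeg_add mdeg_unit_exp)
      have m': "m - unit_exp i \<in> in_vars n" using m by (simp add: in_vars_iff lookup_minus)
      have "i < n" using m i unfolding in_vars_iff by (meson not_le)
      from step[OF this m'] Suc.IH m' d have "P (unit_exp i + (m - unit_exp i))" by blast
      then show "P m" by (simp only: eq)
    qed
  qed
  then show ?thesis using assms(1) by blast
qed

text \<open>\<open>R\<close> will be the ring of elements of \<open>K(\<kappa>)\<close> without a pole at \<open>\<kappa> = 0\<close>.\<close>

lemma polys_induct_scalars [consumes 2, case_names zero one var scale add]:
  assumes "f \<in> polys n" and "\<And>m. coef f m \<in> R"
    and zero: "P 0" and one: "P 1"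
    and var: "\<And>i f. i < n \<Longrightarrow> f \<in> polys n \<Longrightarrow> P f \<Longrightarrow> P (xvar i * f)"
    and scale: "\<And>a f. a \<in> R \<Longrightarrow> f \<in> polys n \<Longrightarrow> P f \<Longrightarrow> P (pscale a f)"
    and add: "\<And>f g. f \<in> polys n \<Longrightarrow> g \<in> polys n \<Longrightarrow> P f \<Longrightarrow> P g \<Longrightarrow> P (f + g)"
  shows "P f"
proof -
  have mon: "P (mon m)" if "m \<in> in_vars n" for m
    using that
  proof (induction rule: mon_induct)
    case zero then show ?case using one by simp
  next
    case (step i m)
    then show ?case using var[of i "mon m"] by (simp add: xvar_mult_mon)
  qed
  have trm: "P (Poly_Mapping.single m (coef f m))" if "m \<in> supp f" for m
  proof -
    have "m \<in> in_vars n" using assms(1) that by (auto simp: polys_def)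
    then show ?thesis using scale[OF assms(2), of "mon m" m] mon by (simp add: pscale_single)
  qed
  have "P (\<Sum>m\<in>A. Poly_Mapping.single m (coef f m)) \<and> (\<Sum>m\<in>A. Poly_Mapping.single m (coef f m)) \<in> polys n"
    if "finite A" "A \<subseteq> supp f" for A
    using that
  proof (induction A)
    case empty then show ?case using zero by simp
  next
    case (insert m A)
    have "Poly_Mapping.single m (coef f m) \<in> polys n"
      using assms(1) insert.prems by (auto simp: polys_def)
    then show ?case using insert trm[of m] add by auto
  qed
  from this[of "supp f"] show ?thesis using poly_mapping_sum_single[of f] by simp
qed

lemmas polys_induct [consumes 1, case_names zero one var scale add] =
  polys_induct_scalars[where R = UNIV, OF _ UNIV_I]

subsection \<open>Linear extension\<close>

text \<open>Substitution, partial derivatives and the action of the free algebra are all linear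
  extensions of a map on basis elements, hence the arbitrary index type.\<close>

definition linext :: "('a \<Rightarrow> 'k mpol) \<Rightarrow> ('a \<Rightarrow>\<^sub>0 'k) \<Rightarrow> 'k::field mpol" where
  "linext \<phi> f = (\<Sum>m\<in>supp f. pscale (coef f m) (\<phi> m))"

lemma linext_superset:
  assumes "finite A" "supp f \<subseteq> A" shows "linext \<phi> f = (\<Sum>m\<in>A. pscale (coef f m) (\<phi> m))"
  unfolding linext_def by (rule sum.mono_neutral_left) (use assms in \<open>auto simp: in_keys_iff\<close>)

lemma linext_0 [simp]: "linext \<phi> 0 = 0" by (simp add: linext_def)

lemma linext_add: "linext \<phi> (f + g) = linext \<phi> f + linext \<phi> g"
proof -
  let ?A = "supp f \<union> supp g"
  have "linext \<phi> (f + g) = (\<Sum>m\<in>?A. pscale (coef (f + g) m) (\<phi> m))"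
    by (rule linext_superset) (use keys_add[of f g] in auto)
  then show ?thesis
    using linext_superset[of ?A f \<phi>] linext_superset[of ?A g \<phi>]
    by (simp add: lookup_add pscale_add_left sum.distrib)
qed

lemma linext_uminus: "linext \<phi> (- f) = - linext \<phi> f"
  by (simp add: linext_def pscale_minus_left sum_negf)

lemma linext_diff: "linext \<phi> (f - g) = linext \<phi> f - linext \<phi> g"
  by (metis linext_add linext_uminus add_uminus_conv_diff)

lemma linext_sum: "linext \<phi> (sum f A) = (\<Sum>x\<in>A. linext \<phi> (f x))"
  by (induction A rule: infinite_finite_induct) (auto simp: linext_add)

lemma linext_single [simp]: "linext \<phi> (Poly_Mapping.single m a) = pscale a (\<phi> m)"
  by (cases "a = 0") (auto simp: linext_def)

lemma linext_pscale: "linext \<phi> (pscale a f) = pscale a (linext \<phi> f)"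
proof -
  have "linext \<phi> (pscale a f) = (\<Sum>m\<in>supp f. pscale (coef (pscale a f) m) (\<phi> m))"
    by (rule linext_superset) (use supp_pscale_subset in auto)
  then show ?thesis by (simp add: linext_def pscale_sum_right)
qed

lemma linext_mult:
  assumes "\<And>m m'. m \<in> supp f \<Longrightarrow> m' \<in> supp g \<Longrightarrow> \<phi> (m + m') = \<phi> m * \<phi> m'"
  shows "linext \<phi> (f * g) = linext \<phi> f * linext \<phi> (g :: 'k::field mpol)"
proof -
  have "f * g = (\<Sum>m\<in>supp f. \<Sum>m'\<in>supp g. Poly_Mapping.single (m + m') (coef f m * coef g m'))"
    using arg_cong2[OF poly_mapping_sum_single[of f] poly_mapping_sum_single[of g], of "(*)"]
    by (simp add: sum_product mult_single)
  then have "linext \<phi> (f * g) = (\<Sum>m\<in>supp f. \<Sum>m'\<in>supp g. pscale (coef f m * coef g m') (\<phi> (m + m')))"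
    by (simp add: linext_sum)
  also have "\<dots> = (\<Sum>m\<in>supp f. \<Sum>m'\<in>supp g. pscale (coef f m) (\<phi> m) * pscale (coef g m') (\<phi> m'))"
    by (intro sum.cong refl) (simp add: assms pscale_mult_left pscale_mult_right)
  also have "\<dots> = linext \<phi> f * linext \<phi> g" by (simp add: linext_def sum_product)
  finally show ?thesis .
qed

definition mon_subst :: "(nat \<Rightarrow> 'k mpol) \<Rightarrow> (nat \<Rightarrow>\<^sub>0 nat) \<Rightarrow> 'k::field mpol" where
  "mon_subst \<sigma> m = (\<Prod>i\<in>supp m. \<sigma> i ^ coef m i)"

lemma psubst_linext: "psubst \<sigma> = linext (mon_subst \<sigma>)"
  by (rule ext) (simp add: psubst_def linext_def mon_subst_def)

lemma mon_subst_superset: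
  assumes "finite A" "supp m \<subseteq> A" shows "mon_subst \<sigma> m = (\<Prod>i\<in>A. \<sigma> i ^ coef m i)"
  unfolding mon_subst_def by (rule prod.mono_neutral_left) (use assms in \<open>auto simp: in_keys_iff\<close>)

lemma mon_subst_add: "mon_subst \<sigma> (m + m') = mon_subst \<sigma> m * mon_subst \<sigma> m'"
proof -
  let ?A = "supp m \<union> supp m'"
  have "mon_subst \<sigma> (m + m') = (\<Prod>i\<in>?A. \<sigma> i ^ coef (m + m') i)"
    by (rule mon_subst_superset) (use keys_add[of m m'] in auto)
  then show ?thesis
    using mon_subst_superset[of ?A m \<sigma>] mon_subst_superset[of ?A m' \<sigma>]
    by (simp add: lookup_add power_add prod.distrib)
qed

lemma psubst_add: "psubst \<sigma> (f + g) = psubst \<sigma> f + psubst \<sigma> g"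
  by (simp add: psubst_linext linext_add)

lemma psubst_diff: "psubst \<sigma> (f - g) = psubst \<sigma> f - psubst \<sigma> g"
  by (simp add: psubst_linext linext_diff)

lemma psubst_pscale: "psubst \<sigma> (pscale a f) = pscale a (psubst \<sigma> f)"
  by (simp add: psubst_linext linext_pscale)

lemma psubst_0 [simp]: "psubst \<sigma> 0 = 0"
  by (simp add: psubst_linext)

lemma psubst_mult: "psubst \<sigma> (f * g) = psubst \<sigma> f * psubst \<sigma> g"
  by (simp add: psubst_linext linext_mult mon_subst_add)

lemma psubst_mon: "psubst \<sigma> (mon m) = mon_subst \<sigma> m"
  by (simp add: psubst_linext)

lemma psubst_1 [simp]: "psubst \<sigma> 1 = 1"
  using psubst_mon[of \<sigma> 0] by (simp add: mon_subst_def)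

lemma psubst_xvar [simp]: "psubst \<sigma> (xvar i) = \<sigma> i"
  by (simp add: xvar_eq_mon psubst_mon mon_subst_def)

subsection \<open>Homogeneous parts\<close>

text \<open>Zero is homogeneous of every degree; degree comparisons therefore carry non-vanishing
  hypotheses.\<close>

definition homog :: "nat \<Rightarrow> 'k::field mpol \<Rightarrow> bool" where
  "homog d f \<longleftrightarrow> (\<forall>m\<in>supp f. mdeg m = d)"

lemma coef_hom_part: "coef (hom_part d f) m = (if mdeg m = d then coef f m else 0)"
proof -
  have fin: "finite {m \<in> supp f. mdeg m = d}" by simp
  have "coef (hom_part d f) m = (\<Sum>m'\<in>{m \<in> supp f. mdeg m = d}. if m' = m then coef f m' else 0)"
    unfolding hom_part_def lookup_sum by (intro sum.cong) (auto simp: lookup_single when_def)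
  also have "\<dots> = (if mdeg m = d then coef f m else 0)"
    using fin by (simp add: sum.delta in_keys_iff)
  finally show ?thesis .
qed

lemma hom_part_homog: "homog d f \<Longrightarrow> hom_part e f = (if e = d then f else 0)"
  by (rule poly_mapping_eqI) (auto simp: coef_hom_part homog_def in_keys_iff)

lemma homog_iff: "homog d f \<longleftrightarrow> hom_part d f = f"
  by (metis (no_types, lifting) coef_hom_part hom_part_homog homog_def in_keys_iff)

lemma homog_hom_part [simp]: "homog d (hom_part d f)"
  by (auto simp: homog_def in_keys_iff coef_hom_part split: if_splits)

lemma hom_part_add: "hom_part d (f + g) = hom_part d f + hom_part d g"
  by (rule poly_mapping_eqI) (auto simp: coef_hom_part lookup_add)

lemma hom_part_diff: "hom_part d (f - g) = hom_part d f - hom_part d g"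
  by (rule poly_mapping_eqI) (auto simp: coef_hom_part lookup_minus)

lemma hom_part_0 [simp]: "hom_part d 0 = 0"
  by (rule poly_mapping_eqI) (auto simp: coef_hom_part)

lemma hom_part_sum: "hom_part d (sum f A) = (\<Sum>x\<in>A. hom_part d (f x))"
  by (induction A rule: infinite_finite_induct) (auto simp: hom_part_add)

lemma polys_hom_part [simp, intro]: "f \<in> polys n \<Longrightarrow> hom_part d f \<in> polys n"
  by (auto simp: polys_def in_keys_iff coef_hom_part subset_iff split: if_splits)

text \<open>The bound is uniform in \<open>M\<close> so that the range can be enlarged to contain a
  degree of interest.\<close>

lemma sum_hom_part:
  obtains N where "\<And>M. M \<ge> N \<Longrightarrow> (\<Sum>d<M. hom_part d f) = f"
proof
  define N where "N = Suc (Max (insert 0 (mdeg ` supp f)))"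
  fix M assume M: "M \<ge> N"
  show "(\<Sum>d<M. hom_part d f) = f"
  proof (rule poly_mapping_eqI)
    fix m
    have "coef (\<Sum>d<M. hom_part d f) m = (\<Sum>d<M. if d = mdeg m then coef f m else 0)"
      unfolding lookup_sum by (intro sum.cong) (auto simp: coef_hom_part)
    also have "\<dots> = (if mdeg m < M then coef f m else 0)" by (simp add: sum.delta)
    also have "\<dots> = coef f m"
    proof (cases "m \<in> supp f")
      case True
      then have "mdeg m \<le> Max (insert 0 (mdeg ` supp f))" by (intro Max_ge) auto
      then show ?thesis using M N_def by auto
    next
      case False then show ?thesis by (simp add: in_keys_iff)
    qed
    finally show "coef (\<Sum>d<M. hom_part d f) m = coef f m" .
  qed
qed

lemma homog_0 [simp]: "homog d 0" by (simp add: homog_def)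

lemma homog_1 [simp]: "homog 0 1" by (simp add: homog_def)

lemma homog_add: "homog d f \<Longrightarrow> homog d g \<Longrightarrow> homog d (f + g)"
  using keys_add[of f g] by (auto simp: homog_def)

lemma homog_pscale: "homog d f \<Longrightarrow> homog d (pscale a f)"
  using supp_pscale_subset[of a f] by (auto simp: homog_def)

lemma homog_uminus: "homog d f \<Longrightarrow> homog d (- f)"
  by (auto simp: homog_def in_keys_iff)

lemma homog_diff: "homog d f \<Longrightarrow> homog d g \<Longrightarrow> homog d (f - g)"
  by (metis diff_conv_add_uminus homog_add homog_uminus)

lemma homog_sum: "(\<And>x. x \<in> A \<Longrightarrow> homog d (f x)) \<Longrightarrow> homog d (sum f A)"
  by (induction A rule: infinite_finite_induct) (auto simp: homog_add)

lemma homog_mult: "homog d f \<Longrightarrow> homog e g \<Longrightarrow> homog (d + e) (f * g)"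
  unfolding homog_def using keys_mult[of f g] by fastforce

lemma homog_xvar: "homog 1 (xvar i)"
  by (simp add: homog_def xvar_eq_mon)

lemma hom_part_mult_homog:
  assumes "homog e g" shows "hom_part d (f * g) = (if e \<le> d then hom_part (d - e) f * g else 0)"
proof -
  obtain N where N: "\<And>M. M \<ge> N \<Longrightarrow> (\<Sum>d<M. hom_part d f) = f" using sum_hom_part by blast
  let ?M = "max N (Suc d)"
  have "f * g = (\<Sum>k<?M. hom_part k f * g)" using N[of ?M] by (metis max.cobounded1 sum_distrib_right)
  then have "hom_part d (f * g) = (\<Sum>k<?M. hom_part d (hom_part k f * g))" by (simp add: hom_part_sum)
  also have "\<dots> = (\<Sum>k<?M. if k + e = d then hom_part k f * g else 0)"
    by (intro sum.cong refl) (subst hom_part_homog[OF homog_mult[OF homog_hom_part assms]], auto)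
  also have "\<dots> = (\<Sum>k<?M. if k = d - e then (if e \<le> d then hom_part k f * g else 0) else 0)"
    by (intro sum.cong refl) auto
  also have "\<dots> = (if e \<le> d then hom_part (d - e) f * g else 0)"
    by (auto simp: sum.delta less_max_iff_disj)
  finally show ?thesis .
qed

text \<open>The degree \<open>d\<close> part of the product is the degree \<open>d - e\<close> part
  of \<open>f\<close> times \<open>g\<close>; there are no zero divisors, so \<open>g\<close>
  cancels.\<close>

lemma homog_factor:
  assumes "homog d (f * g)" "homog e g" "g \<noteq> 0" "f \<noteq> 0" shows "e \<le> d \<and> homog (d - e) f"
proof -
  have "f * g = hom_part d (f * g)" using assms(1) by (simp add: homog_iff)
  also have "\<dots> = (if e \<le> d then hom_part (d - e) f * g else 0)" by (rule hom_part_mult_homog[OF assms(2)])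
  finally have eq: "f * g = (if e \<le> d then hom_part (d - e) f * g else 0)" .
  have "e \<le> d" using eq assms(3,4) by (auto split: if_splits)
  moreover from this eq have "f = hom_part (d - e) f" using assms(3) by auto
  ultimately show ?thesis by (simp add: homog_iff)
qed

subsection \<open>The polynomial ring as a carrier-based ring\<close>

lemma poly_ring_simps [simp]:
  "mult (poly_ring n) = (*)" "one (poly_ring n) = 1" "zero (poly_ring n) = 0" "add (poly_ring n) = (+)"
  by (simp_all add: poly_ring_def)

lemma cring_poly_ring: "cring (poly_ring n :: 'k::field mpol ring)"
proof (rule cringI)
  show "abelian_group (poly_ring n :: 'k mpol ring)"
  proof (rule abelian_groupI)
    fix x :: "'k mpol" assume "x \<in> carrier (poly_ring n)"
    then show "\<exists>y\<in>carrier (poly_ring n). y \<oplus>\<^bsub>poly_ring n\<^esub> x = \<zero>\<^bsub>poly_ring n\<^esub>"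
      by (intro bexI[of _ "- x"]) auto
  qed (auto simp: add.assoc add.commute)
  show "comm_monoid (poly_ring n :: 'k mpol ring)"
    by (rule comm_monoidI) (auto simp: mult.assoc mult.commute)
qed (auto simp: distrib_right)

lemma a_inv_poly_ring [simp]: "f \<in> polys n \<Longrightarrow> \<ominus>\<^bsub>poly_ring n\<^esub> f = - (f :: 'k::field mpol)"
proof -
  assume f: "f \<in> polys n"
  interpret cring "poly_ring n :: 'k mpol ring" by (rule cring_poly_ring)
  show ?thesis using f minus_equality[of "- f" f] by simp
qed

section \<open>Roots of unity and monomial matrices\<close>

abbreviation pinv :: "(nat \<Rightarrow> nat) \<Rightarrow> nat \<Rightarrow> nat" where "pinv \<equiv> inv_into UNIV"

lemma zeta_cis: "zeta r = cis (2 * pi / real r)"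
  by (simp add: zeta_def cis_conv_exp field_simps)

lemma zeta_neq_0 [simp]: "zeta r \<noteq> 0"
  by (simp add: zeta_def)

lemma zeta_power: "zeta r ^ k = cis (2 * pi * real k / real r)"
  by (simp add: zeta_cis DeMoivre field_simps)

lemma zeta_power_inj: "inj_on (\<lambda>k. zeta r ^ k) {..<r}"
proof (cases "r = 0")
  case False
  then have "inj_on (\<lambda>k. cis (2 * pi * real k / real r)) {..<r}"
    using bij_betw_roots_unity[of r] by (auto simp: bij_betw_def)
  then show ?thesis by (simp add: zeta_power)
qed simp

lemma zeta_power_r [simp]: "0 < r \<Longrightarrow> zeta r ^ r = 1"
  by (simp add: zeta_power)

lemma zeta_powi_mod:
  assumes "0 < r" shows "zeta r powi k = zeta r ^ nat (k mod int r)"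
proof -
  have "zeta r powi k = zeta r powi (int r * (k div int r)) * zeta r powi (k mod int r)"
    using power_int_add[of "zeta r" "int r * (k div int r)" "k mod int r"] by simp
  also have "zeta r powi (int r * (k div int r)) = 1"
    using assms by (simp only: power_int_mult power_int_of_nat zeta_power_r power_int_1_left)
  also have "zeta r powi (k mod int r) = zeta r powi int (nat (k mod int r))"
    using assms by simp
  finally show ?thesis by (simp only: power_int_of_nat mult_1)
qed

lemma zeta_powi_eq_iff:
  assumes "0 < r" shows "zeta r powi k = zeta r powi l \<longleftrightarrow> k mod int r = l mod int r"
proof
  assume "zeta r powi k = zeta r powi l"
  then have "zeta r ^ nat (k mod int r) = zeta r ^ nat (l mod int r)"
    by (simp add: zeta_powi_mod[OF assms])
  moreover have "nat (k mod int r) \<in> {..<r}" "nat (l mod int r) \<in> {..<r}"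
    using assms by (auto simp: nat_less_iff)
  ultimately have "nat (k mod int r) = nat (l mod int r)"
    using zeta_power_inj[of r] by (auto dest: inj_onD)
  then show "k mod int r = l mod int r"
    using assms by (metis eq_nat_nat_iff of_nat_0_less_iff pos_mod_sign)
next
  assume "k mod int r = l mod int r"
  then show "zeta r powi k = zeta r powi l" by (simp add: zeta_powi_mod[OF assms])
qed

lemma zeta_powi_eq_1_iff: "0 < r \<Longrightarrow> zeta r powi k = 1 \<longleftrightarrow> int r dvd k"
  using zeta_powi_eq_iff[of r k 0] by (simp add: dvd_eq_mod_eq_0)

lemma roots_of_unity_zeta:
  assumes "0 < r" "z ^ r = 1" shows "\<exists>k<r. z = zeta r ^ k"
  using bij_betw_roots_unity[OF assms(1)] assms(2)
  by (force simp: bij_betw_def zeta_power)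

text \<open>Normal form of a monomial matrix: the permutation \<open>w\<close> after a diagonal
  matrix, with \<open>k b\<close> the exponent in column \<open>b\<close>. Integer exponents keep
  products and inverses in this form; only their residues modulo \<open>r\<close> matter
  (\<open>mk_mat_cong\<close>).\<close>

definition mk_mat :: "nat \<Rightarrow> nat \<Rightarrow> (nat \<Rightarrow> nat) \<Rightarrow> (nat \<Rightarrow> int) \<Rightarrow> complex mat" where
  "mk_mat r n w k = mat n n (\<lambda>(a, b). if a = w b then zeta r powi k b else 0)"

lemma mk_mat_carrier [simp]: "mk_mat r n w k \<in> carrier_mat n n" "dim_row (mk_mat r n w k) = n"
  "dim_col (mk_mat r n w k) = n"
  by (simp_all add: mk_mat_def)

lemma mk_mat_entry [simp]:
  "a < n \<Longrightarrow> b < n \<Longrightarrow> mk_mat r n w k $$ (a, b) = (if a = w b then zeta r powi k b else 0)"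
  by (simp add: mk_mat_def)

lemma permutes_less: "w permutes {..<n} \<Longrightarrow> w j < n \<longleftrightarrow> j < (n::nat)"
  using permutes_in_image[of w "{..<n}" j] by simp

lemma mk_mat_mult:
  assumes "w' permutes {..<n}"
  shows "mk_mat r n w k * mk_mat r n w' k' = mk_mat r n (w \<circ> w') (\<lambda>j. k (w' j) + k' j)"
proof (rule eq_matI)
  fix a b assume "a < dim_row (mk_mat r n (w \<circ> w') (\<lambda>j. k (w' j) + k' j))"
    "b < dim_col (mk_mat r n (w \<circ> w') (\<lambda>j. k (w' j) + k' j))"
  then have a: "a < n" and b: "b < n" by simp_all
  have "(mk_mat r n w k * mk_mat r n w' k') $$ (a, b) =
      (\<Sum>c = 0..<n. mk_mat r n w k $$ (a, c) * mk_mat r n w' k' $$ (c, b))"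
    using a b by (simp add: scalar_prod_def)
  also have "\<dots> = (\<Sum>c = 0..<n. if c = w' b then mk_mat r n w k $$ (a, c) * zeta r powi k' b else 0)"
    using b by (intro sum.cong) auto
  also have "\<dots> = mk_mat r n w k $$ (a, w' b) * zeta r powi k' b"
    using b permutes_less[OF assms, of b] by (simp add: sum.delta)
  also have "\<dots> = mk_mat r n (w \<circ> w') (\<lambda>j. k (w' j) + k' j) $$ (a, b)"
    using a b permutes_less[OF assms, of b] by (simp add: power_int_add)
  finally show "(mk_mat r n w k * mk_mat r n w' k') $$ (a, b) =
    mk_mat r n (w \<circ> w') (\<lambda>j. k (w' j) + k' j) $$ (a, b)" .
qed simp_all

lemma mk_mat_cong:
  assumes "0 < r" "\<And>j. j < n \<Longrightarrow> w j = w' j" "\<And>j. j < n \<Longrightarrow> k j mod int r = k' j mod int r"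
  shows "mk_mat r n w k = mk_mat r n w' k'"
proof -
  have "zeta r powi k j = zeta r powi k' j" if "j < n" for j
    using zeta_powi_eq_iff[OF assms(1), of "k j" "k' j"] assms(3)[OF that] by simp
  then show ?thesis by (intro eq_matI) (auto simp: assms(2))
qed

lemma mk_mat_id: "mk_mat r n id (\<lambda>j. 0) = 1\<^sub>m n"
  by (rule eq_matI) auto

lemma inv_mat_mk_mat:
  assumes w: "w permutes {..<n}"
  shows "inv_mat n (mk_mat r n w k) = mk_mat r n (pinv w) (\<lambda>j. - k (pinv w j))"
proof -
  let ?B = "mk_mat r n (pinv w) (\<lambda>j. - k (pinv w j))"
  have 1: "mk_mat r n w k * ?B = 1\<^sub>m n"
    using mk_mat_mult[OF permutes_inv[OF w], of r w k "\<lambda>j. - k (pinv w j)"] permutes_inv_o(1)[OF w]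
    by (simp add: mk_mat_id)
  have 2: "?B * mk_mat r n w k = 1\<^sub>m n"
    using mk_mat_mult[OF w, of r "pinv w" "\<lambda>j. - k (pinv w j)" k] permutes_inv_o(2)[OF w]
    by (simp add: mk_mat_id permutes_inverses[OF w])
  show ?thesis unfolding inv_mat_def
  proof (rule the_equality)
    show "?B \<in> carrier_mat n n \<and> mk_mat r n w k * ?B = 1\<^sub>m n \<and> ?B * mk_mat r n w k = 1\<^sub>m n"
      using 1 2 by simp
    fix C assume C: "C \<in> carrier_mat n n \<and> mk_mat r n w k * C = 1\<^sub>m n \<and> C * mk_mat r n w k = 1\<^sub>m n"
    have "C = C * (mk_mat r n w k * ?B)" using C right_mult_one_mat[of C n n] by (simp add: 1)
    also have "\<dots> = (C * mk_mat r n w k) * ?B"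
      by (rule assoc_mult_mat[symmetric]) (use C in auto)
    also have "\<dots> = ?B" using C by simp
    finally show "C = ?B" .
  qed
qed

lemma nonzero_pos_mk_mat:
  assumes w: "w permutes {..<n}" shows "nonzero_pos n (mk_mat r n w k) = (\<lambda>j. (w j, j)) ` {..<n}"
proof -
  have "(a, b) \<in> nonzero_pos n (mk_mat r n w k) \<longleftrightarrow> (a, b) \<in> (\<lambda>j. (w j, j)) ` {..<n}" for a b
  proof (cases "a < n \<and> b < n")
    case True
    then show ?thesis by (auto simp: nonzero_pos_def)
  next
    case False
    then show ?thesis using permutes_less[OF w, of b] by (auto simp: nonzero_pos_def)
  qed
  then show ?thesis by auto
qed

lemma prod_nonzero_pos_mk_mat:
  assumes w: "w permutes {..<n}"
  shows "(\<Prod>ij\<in>nonzero_pos n (mk_mat r n w k). mk_mat r n w k $$ ij) = zeta r powi (\<Sum>j<n. k j)"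
proof -
  have "(\<Prod>ij\<in>nonzero_pos n (mk_mat r n w k). mk_mat r n w k $$ ij) = (\<Prod>j<n. zeta r powi k j)"
    unfolding nonzero_pos_mk_mat[OF w]
    by (subst prod.reindex) (auto simp: inj_on_def permutes_less[OF w] intro!: prod.cong)
  also have "\<dots> = zeta r powi (\<Sum>j<n. k j)"
    by (induction n) (auto simp: power_int_add)
  finally show ?thesis .
qed

lemma zeta_powi_div_eq_1_iff:
  assumes "0 < r" "p dvd r"
  shows "(zeta r powi s) ^ (r div p) = 1 \<longleftrightarrow> int p dvd s"
proof -
  obtain q where q: "r = p * q" using assms(2) by blast
  with assms(1) have "0 < p" "0 < q" by auto
  then have "r div p = q" using q by simp
  have "(zeta r powi s) ^ q = zeta r powi (s * int q)"
    by (simp add: power_int_mult)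
  then have "(zeta r powi s) ^ q = 1 \<longleftrightarrow> int r dvd s * int q"
    using zeta_powi_eq_1_iff[OF assms(1)] by simp
  also have "\<dots> \<longleftrightarrow> int p dvd s" using q \<open>0 < q\<close> by simp
  finally show ?thesis using \<open>r div p = q\<close> by simp
qed

text \<open>The product of the non-zero entries is \<open>zeta r\<close> to the sum of the
  exponents. Its power \<open>r div p\<close> is 1 exactly when \<open>r\<close> divides that sum
  times \<open>r div p\<close>, that is, when \<open>p\<close> divides the sum.\<close>

lemma mk_mat_in_Grpn_iff:
  assumes "0 < r" "p dvd r" and w: "w permutes {..<n}"
  shows "mk_mat r n w k \<in> Grpn r p n \<longleftrightarrow> int p dvd (\<Sum>j<n. k j)"
proof -
  have "monomial_mat n (mk_mat r n w k)"
    unfolding monomial_mat_def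
  proof (intro conjI allI impI)
    fix i assume i: "i < n"
    have "pinv w i < n" "w (pinv w i) = i" using i permutes_less[OF permutes_inv[OF w]] permutes_inverses[OF w] by auto
    have 1: "j = pinv w i" if "j < n" "mk_mat r n w k $$ (i, j) \<noteq> 0" for j
      using that i permutes_inverses(2)[OF w, of j] by (cases "i = w j") auto
    show "\<exists>!j. j < n \<and> mk_mat r n w k $$ (i, j) \<noteq> 0"
    proof (rule ex1I[of _ "pinv w i"])
      show "pinv w i < n \<and> mk_mat r n w k $$ (i, pinv w i) \<noteq> 0"
        using i \<open>pinv w i < n\<close> \<open>w (pinv w i) = i\<close> by simp
    qed (use 1 in blast)
  next
    fix j assume "j < n"
    then have "w j < n" using permutes_less[OF w] by simp
    have 1: "i = w j" if "i < n" "mk_mat r n w k $$ (i, j) \<noteq> 0" for i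
      using that \<open>j < n\<close> by (cases "i = w j") auto
    show "\<exists>!i. i < n \<and> mk_mat r n w k $$ (i, j) \<noteq> 0"
    proof (rule ex1I[of _ "w j"])
      show "w j < n \<and> mk_mat r n w k $$ (w j, j) \<noteq> 0"
        using \<open>j < n\<close> \<open>w j < n\<close> by simp
    qed (use 1 in blast)
  qed simp
  moreover have "(mk_mat r n w k $$ ij) ^ r = 1" if ij: "ij \<in> nonzero_pos n (mk_mat r n w k)" for ij
  proof -
    obtain j where j: "ij = (w j, j)" "j < n" using ij unfolding nonzero_pos_mk_mat[OF w] by auto
    have "(mk_mat r n w k $$ ij) ^ r = (zeta r powi int r) powi k j"
      using j permutes_less[OF w] by (simp add: power_int_power' power_int_power flip: power_int_mult power_int_of_nat) (simp add: mult.commute)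
    also have "\<dots> = 1" using assms(1) by simp
    finally show ?thesis .
  qed
  ultimately show ?thesis
    using zeta_powi_div_eq_1_iff[OF assms(1,2)] by (simp add: Grpn_def prod_nonzero_pos_mk_mat[OF w])
qed

lemma Grpn_cases:
  assumes A: "A \<in> Grpn r p n" and r: "0 < r" "p dvd r"
  obtains w k where "w permutes {..<n}" "A = mk_mat r n w (\<lambda>j. int (k j))" "\<And>j. k j < r"
    "int p dvd (\<Sum>j<n. int (k j))"
proof -
  have mm: "monomial_mat n A" and rt: "\<And>ij. ij \<in> nonzero_pos n A \<Longrightarrow> (A $$ ij) ^ r = 1"
    using A by (auto simp: Grpn_def)
  have cex: "\<exists>!i. i < n \<and> A $$ (i, j) \<noteq> 0" if "j < n" for j
    using mm that unfolding monomial_mat_def by simp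
  have rex: "\<exists>!j. j < n \<and> A $$ (i, j) \<noteq> 0" if "i < n" for i
    using mm that unfolding monomial_mat_def by simp
  define w where "w j = (if j < n then THE i. i < n \<and> A $$ (i, j) \<noteq> 0 else j)" for j
  have col: "w j < n \<and> A $$ (w j, j) \<noteq> 0" if "j < n" for j
    using theI'[OF cex[OF that]] that by (simp add: w_def)
  have colu: "i = w j" if "j < n" "i < n" "A $$ (i, j) \<noteq> 0" for i j
    using cex[OF that(1)] col[OF that(1)] that by auto
  have inj: "inj_on w {..<n}"
  proof (rule inj_onI)
    fix x y assume xy: "x \<in> {..<n}" "y \<in> {..<n}" "w x = w y"
    then have "w x < n" "A $$ (w x, x) \<noteq> 0" "A $$ (w x, y) \<noteq> 0" using col[of x] col[of y] by auto
    with rex[of "w x"] xy show "x = y" by auto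
  qed
  have "w ` {..<n} = {..<n}" using inj col by (intro endo_inj_surj) auto
  with inj have "bij_betw w {..<n} {..<n}" by (simp add: bij_betw_def)
  then have w: "w permutes {..<n}" by (rule bij_imp_permutes) (simp add: w_def)
  have "\<exists>k<r. j < n \<longrightarrow> A $$ (w j, j) = zeta r ^ k" for j
  proof (cases "j < n")
    case True
    have "(w j, j) \<in> nonzero_pos n A" using True col by (auto simp: nonzero_pos_def)
    from roots_of_unity_zeta[OF r(1) rt[OF this]] show ?thesis by auto
  qed (use r in auto)
  then have "\<forall>j. \<exists>k. k < r \<and> (j < n \<longrightarrow> A $$ (w j, j) = zeta r ^ k)" by simp
  from choice[OF this] obtain k where k: "\<And>j. k j < r" "\<And>j. j < n \<Longrightarrow> A $$ (w j, j) = zeta r ^ k j" by auto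
  have Ac: "A \<in> carrier_mat n n" using mm by (simp add: monomial_mat_def)
  have eq: "A = mk_mat r n w (\<lambda>j. int (k j))"
  proof (rule eq_matI)
    fix a b assume "a < dim_row (mk_mat r n w (\<lambda>j. int (k j)))" "b < dim_col (mk_mat r n w (\<lambda>j. int (k j)))"
    then have ab: "a < n" "b < n" by simp_all
    have "A $$ (a, b) = (if a = w b then zeta r ^ k b else 0)"
      using k(2)[OF ab(2)] colu[OF ab(2,1)] by metis
    then show "A $$ (a, b) = mk_mat r n w (\<lambda>j. int (k j)) $$ (a, b)"
      by (simp only: mk_mat_entry[OF ab] power_int_of_nat)
  qed (use Ac in auto)
  have "int p dvd (\<Sum>j<n. int (k j))" using A mk_mat_in_Grpn_iff[OF r w] eq by simp
  then show ?thesis using that[OF w eq k(1)] by blast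
qed

lemma zeta_mat_mk: "zeta_mat r n i l = mk_mat r n id (\<lambda>a. if a = i then l else 0)"
  by (rule eq_matI) (auto simp: zeta_mat_def)

lemma swap_mat_mk: "swap_mat n i j = mk_mat r n (Transposition.transpose i j) (\<lambda>a. 0)"
  by (rule eq_matI) (auto simp: swap_mat_def)

text \<open>Exponents of the reflection in the normal form. They sum to zero, so these reflections
  belong to \<open>Grpn r p n\<close> for every divisor \<open>p\<close> of
  \<open>r\<close>.\<close>

definition refl_exp :: "nat \<Rightarrow> nat \<Rightarrow> int \<Rightarrow> nat \<Rightarrow> int" where
  "refl_exp i j l a = (if a = i then - l else if a = j then l else 0)"

lemma transpose_permutes_less: "i < n \<Longrightarrow> j < n \<Longrightarrow> Transposition.transpose i j permutes {..<n::nat}"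
  by (rule permutes_swap_id) auto

lemma refl_mat_mk:
  assumes "i < n" "j < n" "i \<noteq> j"
  shows "refl_mat r n i j l = mk_mat r n (Transposition.transpose i j) (refl_exp i j (int l))"
proof -
  have "refl_mat r n i j l = mk_mat r n (Transposition.transpose i j)
     (\<lambda>a. (if Transposition.transpose i j a = i then int l else 0) + (if a = i then - int l else 0))"
    unfolding refl_mat_def zeta_mat_mk swap_mat_mk[of n i j r]
    by (subst mk_mat_mult[OF transpose_permutes_less[OF assms(1,2)]],
        subst mk_mat_mult[OF permutes_id]) (simp add: o_def)
  also have "(\<lambda>a. (if Transposition.transpose i j a = i then int l else 0) + (if a = i then - int l else 0))
     = refl_exp i j (int l)"
    using assms(3) by (auto simp: refl_exp_def fun_eq_iff Transposition.transpose_def)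
  finally show ?thesis .
qed

section \<open>The group action on polynomials\<close>

definition exp_perm :: "(nat \<Rightarrow> nat) \<Rightarrow> (nat \<Rightarrow>\<^sub>0 nat) \<Rightarrow> (nat \<Rightarrow>\<^sub>0 nat)" where
  "exp_perm w m = Poly_Mapping.map_key (pinv w) m"

lemma coef_exp_perm: "w permutes A \<Longrightarrow> coef (exp_perm w m) i = coef m (pinv w i)"
  unfolding exp_perm_def by (subst map_key.rep_eq[OF permutes_inj[OF permutes_inv]]) auto

lemma exp_perm_add: "w permutes A \<Longrightarrow> exp_perm w (m + m') = exp_perm w m + exp_perm w m'"
  by (rule poly_mapping_eqI) (simp add: coef_exp_perm lookup_add)

lemma exp_perm_unit: "w permutes A \<Longrightarrow> exp_perm w (unit_exp i) = unit_exp (w i)"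
  by (rule poly_mapping_eqI) (auto simp: coef_exp_perm permutes_inverses)

lemma exp_perm_0 [simp]: "w permutes A \<Longrightarrow> exp_perm w 0 = 0"
  by (rule poly_mapping_eqI) (auto simp: coef_exp_perm)

lemma exp_perm_in_vars [simp]: "w permutes {..<n} \<Longrightarrow> exp_perm w m \<in> in_vars n \<longleftrightarrow> m \<in> in_vars n"
proof -
  assume w: "w permutes {..<n}"
  have "pinv w i = i" if "i \<ge> n" for i
    using permutes_not_in[OF permutes_inv[OF w]] that by simp
  then show ?thesis by (simp add: in_vars_iff coef_exp_perm[OF w])
qed

lemma exp_perm_inv:
  assumes "w permutes A"
  shows "exp_perm (pinv w) (exp_perm w m) = m" "exp_perm w (exp_perm (pinv w) m) = m"
  using assms
  by (auto intro!: poly_mapping_eqI simp: coef_exp_perm[OF assms] coef_exp_perm[OF permutes_inv[OF assms]]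
      permutes_inv_inv permutes_inverses)

lemma exp_perm_inject: "w permutes A \<Longrightarrow> exp_perm w m = exp_perm w m' \<longleftrightarrow> m = m'"
  by (metis exp_perm_inv(1))

lemma exp_perm_comp: "w permutes A \<Longrightarrow> w' permutes A \<Longrightarrow> exp_perm w (exp_perm w' m) = exp_perm (w \<circ> w') m"
  by (rule poly_mapping_eqI)
     (simp add: coef_exp_perm[of w] coef_exp_perm[of w'] coef_exp_perm[OF permutes_compose[of w' A w]]
        o_inv_distrib permutes_bij)

lemma mdeg_exp_perm:
  assumes "w permutes {..<n}" "m \<in> in_vars n" shows "mdeg (exp_perm w m) = mdeg m"
proof -
  have "mdeg (exp_perm w m) = (\<Sum>i<n. coef m (pinv w i))"
    using mdeg_in_vars[of "exp_perm w m" n] assms by (simp add: coef_exp_perm[OF assms(1)])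
  also have "\<dots> = (\<Sum>i<n. coef m i)"
    by (rule sum.permute[OF permutes_inv[OF assms(1)], unfolded o_def, symmetric])
  finally show ?thesis using mdeg_in_vars[OF assms(2)] by simp
qed

text \<open>\<kappa> stays arbitrary because the theory is instantiated twice: with \<kappa> = 0
  over the ground field and with an indeterminate \<kappa> over its extension K(\<kappa>).
  \<open>\<iota>\<close> is only assumed to be a ring homomorphism; on the complex numbers it is
  automatically injective.\<close>

locale cher = cherednik r p n \<iota> \<kappa> c
  for r p n :: nat and \<iota> :: "complex \<Rightarrow> 'k::field" and \<kappa> :: 'k and c :: "nat \<Rightarrow> 'k" +
  assumes r_pos: "0 < r" and n_pos: "0 < n" and p_dvd: "p dvd r"
    and hom_add: "\<iota> (x + y) = \<iota> x + \<iota> y"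
    and hom_mult: "\<iota> (x * y) = \<iota> x * \<iota> y"
    and hom_one: "\<iota> 1 = 1"
    and c_zero: "\<And>l. l < r \<Longrightarrow> \<not> p dvd l \<Longrightarrow> c l = 0"
begin

lemma hom_zero [simp]: "\<iota> 0 = 0"
  by (metis add_cancel_right_left add_0 hom_add)

lemma hom_eq_0_iff [simp]: "\<iota> x = 0 \<longleftrightarrow> x = 0"
proof
  assume h: "\<iota> x = 0"
  show "x = 0"
  proof (rule ccontr)
    assume "x \<noteq> 0"
    then have "\<iota> x * \<iota> (inverse x) = 1" by (metis hom_mult hom_one right_inverse)
    with h show False by simp
  qed
qed simp

lemma hom_of_nat: "\<iota> (of_nat k) = of_nat k"
  by (induction k) (auto simp: hom_add hom_one)

lemma hom_uminus: "\<iota> (- x) = - \<iota> x"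
  using hom_add[of x "- x"] by (simp add: eq_neg_iff_add_eq_0 add.commute)

text \<open>Characteristic zero is inherited from the complex numbers through
  \<open>\<iota>\<close>.\<close>

lemma of_nat_neq_0: "0 < k \<Longrightarrow> (of_nat k :: 'k) \<noteq> 0"
  using hom_eq_0_iff[of "of_nat k"] by (simp add: hom_of_nat)

lemma of_int_eq_0: "(of_int k :: 'k) = 0 \<longleftrightarrow> k = 0"
proof (cases k rule: int_cases2)
  case (nonneg m)
  then show ?thesis using of_nat_neq_0[of m] by (cases "m = 0") auto
next
  case (nonpos m)
  then show ?thesis using of_nat_neq_0[of m] by (cases "m = 0") auto
qed

lemma zpow_0 [simp]: "zpow 0 = 1" by (simp add: zpow_def hom_one)

lemma zpow_add: "zpow (a + b) = zpow a * zpow b"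
  by (simp add: zpow_def power_int_add hom_mult)

lemma zpow_neq_0 [simp]: "zpow a \<noteq> 0" by (simp add: zpow_def)

lemma zpow_eq_1_iff: "zpow a = 1 \<longleftrightarrow> int r dvd a"
proof -
  have "zpow a = 1 \<longleftrightarrow> \<iota> (zeta r powi a - 1) = 0"
    using hom_add[of "zeta r powi a" "- 1"] by (simp add: zpow_def hom_uminus hom_one)
  then show ?thesis using zeta_powi_eq_1_iff[OF r_pos] by simp
qed

lemma zpow_cong: "a mod int r = b mod int r \<Longrightarrow> zpow a = zpow b"
  using zeta_powi_eq_iff[OF r_pos, of a b] by (simp add: zpow_def)

lemma zpow_eq_iff: "zpow a = zpow b \<longleftrightarrow> a mod int r = b mod int r"
proof
  assume "zpow a = zpow b"
  then have "zpow (a - b) * zpow b = 1 * zpow b" by (simp flip: zpow_add)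
  then have "int r dvd a - b" using zpow_eq_1_iff by (metis mult_cancel_right zpow_neq_0)
  then show "a mod int r = b mod int r" by (simp add: mod_eq_dvd_iff)
qed (rule zpow_cong)

lemma zpow_minus_mult [simp]: "zpow (- a) * zpow a = 1" "zpow a * zpow (- a) = 1"
  by (simp_all flip: zpow_add)

lemma zpow_of_nat_mult: "zpow (int l * a) = zpow a ^ l"
  by (induction l) (simp_all add: distrib_right zpow_add)

text \<open>A geometric sum over a root of unity: orthogonality of the characters of the cyclic
  group of order \<open>r\<close>.\<close>

lemma sum_zpow: "(\<Sum>l<r. zpow (int l * a)) = (if int r dvd a then of_nat r else 0)"
proof (cases "int r dvd a")
  case True
  then have "zpow (int l * a) = 1" for l using zpow_eq_1_iff by simp
  then show ?thesis using True by simp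
next
  case False
  then have "zpow a \<noteq> 1" using zpow_eq_1_iff by simp
  moreover have "zpow a ^ r = 1" using zpow_eq_1_iff[of "int r * a"] by (simp add: zpow_of_nat_mult)
  ultimately show ?thesis using False geometric_sum[of "zpow a" r] by (simp add: zpow_of_nat_mult)
qed

text \<open>The map l \<mapsto> e l + s permutes the residues modulo \<open>r\<close> when e is 1 or
  -1. The two signs serve the shift of \<open>l\<close> produced by conjugation and the inversion of
  \<open>l\<close> that comes from exchanging the two indices of a reflection.\<close>

lemma sum_periodic:
  assumes per: "\<And>a b. a mod int r = b mod int r \<Longrightarrow> F a = F b" and e: "e = 1 \<or> e = - 1"
  shows "(\<Sum>l<r. F (e * int l + s)) = (\<Sum>l<r. F (int l) :: 'b::comm_monoid_add)"
proof (rule sum.reindex_bij_witness[where i = "\<lambda>l. nat (e * (int l - s) mod int r)"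
      and j = "\<lambda>l. nat ((e * int l + s) mod int r)"])
  fix l assume l: "l \<in> {..<r}"
  show "nat ((e * int l + s) mod int r) \<in> {..<r}" "nat (e * (int l - s) mod int r) \<in> {..<r}"
    using r_pos by (simp_all add: nat_less_iff)
  have "e * ((e * int l + s) mod int r - s) mod int r = e * (e * int l + s - s) mod int r"
    by (metis mod_diff_left_eq mod_mult_right_eq)
  also have "\<dots> = int l" using e l by auto
  finally show "nat (e * (int (nat ((e * int l + s) mod int r)) - s) mod int r) = l"
    using r_pos by simp
  have "(e * (e * (int l - s) mod int r) + s) mod int r = (e * (e * (int l - s)) + s) mod int r"
    by (metis mod_add_left_eq mod_mult_right_eq)
  also have "\<dots> = int l" using e l by auto
  finally show "nat ((e * int (nat (e * (int l - s) mod int r)) + s) mod int r) = l"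
    using r_pos by simp
  show "F (int (nat ((e * int l + s) mod int r))) = F (e * int l + s)"
    using r_pos by (intro per) simp
qed

text \<open>\<open>mk_mat r n w k\<close> maps y_j to zeta^(k j) y_(w j), hence x_j to zeta^(- k j)
  x_(w j). Parametrizing by \<open>w\<close> and \<open>k\<close> instead of matrices turns products
  into \<open>ract_comp\<close> and also covers elements outside \<open>Grpn r p n\<close>, such as
  the powers zeta_i^l with \<open>p\<close> not dividing l.\<close>

definition ract :: "(nat \<Rightarrow> nat) \<Rightarrow> (nat \<Rightarrow> int) \<Rightarrow> 'k mpol \<Rightarrow> 'k mpol" where
  "ract w k = psubst (\<lambda>j. pscale (zpow (- k j)) (xvar (w j)))"

lemma ract_simps [simp]:
  "ract w k (f + g) = ract w k f + ract w k g"
  "ract w k (f - g) = ract w k f - ract w k g"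
  "ract w k (pscale a f) = pscale a (ract w k f)"
  "ract w k (f * g) = ract w k f * ract w k g"
  "ract w k 0 = 0" "ract w k 1 = 1"
  "ract w k (xvar j) = pscale (zpow (- k j)) (xvar (w j))"
  by (simp_all add: ract_def psubst_add psubst_diff psubst_pscale psubst_mult)

lemma ract_uminus [simp]: "ract w k (- f) = - ract w k f"
  using ract_simps(2)[of w k 0 f] by simp

lemma ract_sum: "ract w k (sum f A) = (\<Sum>x\<in>A. ract w k (f x))"
  by (induction A rule: infinite_finite_induct) auto

lemma ract_polys [simp, intro]:
  assumes w: "w permutes {..<n}" and "f \<in> polys n" shows "ract w k f \<in> polys n"
  using assms(2) by (induction rule: polys_induct) (auto simp: permutes_less[OF w])

lemma ract_cong:
  assumes "f \<in> polys n" and "\<And>j. j < n \<Longrightarrow> w j = w' j"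
    and "\<And>j. j < n \<Longrightarrow> k j mod int r = k' j mod int r"
  shows "ract w k f = ract w' k' f"
proof -
  have "zpow (- k j) = zpow (- k' j)" if "j < n" for j
    using assms(3)[OF that] by (intro zpow_cong) (metis mod_minus_cong)
  with assms(1) show ?thesis by (induction rule: polys_induct) (auto simp: assms(2))
qed

lemma ract_comp:
  assumes "f \<in> polys n"
  shows "ract w k (ract w' k' f) = ract (w \<circ> w') (\<lambda>j. k (w' j) + k' j) f"
  using assms by (induction rule: polys_induct) (auto simp: algebra_simps simp flip: zpow_add)

lemma ract_id: "f \<in> polys n \<Longrightarrow> ract id (\<lambda>j. 0) f = f"
  by (induction rule: polys_induct) auto

lemma group_act_mk_mat:
  assumes w: "w permutes {..<n}" and f: "f \<in> polys n"
  shows "group_act (mk_mat r n w k) f = ract w k f"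
proof -
  have var: "(\<Sum>i<n. pscale (\<iota> (inv_mat n (mk_mat r n w k) $$ (j, i))) (xvar i)) =
      pscale (zpow (- k j)) (xvar (w j))" if j: "j < n" for j
  proof -
    have "(\<Sum>i<n. pscale (\<iota> (inv_mat n (mk_mat r n w k) $$ (j, i))) (xvar i)) =
        (\<Sum>i<n. if i = w j then pscale (zpow (- k j)) (xvar (w j)) else (0::'k mpol))"
      unfolding inv_mat_mk_mat[OF w] using j
      by (intro sum.cong) (auto simp: zpow_def permutes_inverses[OF w])
    also have "\<dots> = pscale (zpow (- k j)) (xvar (w j))"
      using j permutes_less[OF w, of j] by (simp add: sum.delta)
    finally show ?thesis .
  qed
  show ?thesis unfolding group_act_def using f
    by (induction rule: polys_induct) (auto simp: psubst_add psubst_pscale psubst_mult var)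
qed

lemma ract_mon:
  assumes w: "w permutes {..<n}" and "m \<in> in_vars n"
  shows "ract w k (mon m) = pscale (zpow (- (\<Sum>j<n. k j * int (coef m j)))) (mon (exp_perm w m))"
  using assms(2)
proof (induction rule: mon_induct)
  case zero then show ?case using w by simp
next
  case (step i m)
  have "(\<Sum>j<n. k j * int (coef (unit_exp i + m) j)) =
      (\<Sum>j<n. (if j = i then k j else 0) + k j * int (coef m j))"
    by (intro sum.cong) (auto simp: lookup_add distrib_left)
  also have "\<dots> = k i + (\<Sum>j<n. k j * int (coef m j))"
    using step.hyps by (simp add: sum.distrib sum.delta)
  finally have e: "(\<Sum>j<n. k j * int (coef (unit_exp i + m) j)) = k i + (\<Sum>j<n. k j * int (coef m j))" .
  have "ract w k (mon (unit_exp i + m)) = ract w k (xvar i) * ract w k (mon m)"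
    by (simp only: xvar_mult_mon[symmetric] ract_simps)
  also have "\<dots> = pscale (zpow (- k i) * zpow (- (\<Sum>j<n. k j * int (coef m j))))
      (xvar (w i) * mon (exp_perm w m))"
    by (simp add: step.IH pscale_mult_left pscale_mult_right)
  also have "\<dots> = pscale (zpow (- (\<Sum>j<n. k j * int (coef (unit_exp i + m) j))))
      (mon (exp_perm w (unit_exp i + m)))"
    unfolding e by (simp add: xvar_mult_mon exp_perm_add[OF w] exp_perm_unit[OF w] flip: zpow_add)
  finally show ?case .
qed

lemma coef_ract:
  assumes w: "w permutes {..<n}" and f: "f \<in> polys n" and m: "m \<in> in_vars n"
  shows "coef (ract w k f) (exp_perm w m) = zpow (- (\<Sum>j<n. k j * int (coef m j))) * coef f m"
proof -
  have "ract w k f = (\<Sum>m'\<in>supp f. ract w k (pscale (coef f m') (mon m')))"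
    by (subst (1) poly_mapping_sum_single[of f]) (simp add: ract_sum pscale_single flip: ract_simps(3))
  also have "\<dots> = (\<Sum>m'\<in>supp f. pscale (coef f m' * zpow (- (\<Sum>j<n. k j * int (coef m' j)))) (mon (exp_perm w m')))"
    using f by (intro sum.cong refl) (auto simp: ract_mon[OF w] polys_def subset_iff)
  finally have "coef (ract w k f) (exp_perm w m) =
     (\<Sum>m'\<in>supp f. coef f m' * zpow (- (\<Sum>j<n. k j * int (coef m' j))) * coef (mon (exp_perm w m')) (exp_perm w m))"
    by (simp add: lookup_sum)
  also have "\<dots> = (\<Sum>m'\<in>supp f. if m' = m then coef f m * zpow (- (\<Sum>j<n. k j * int (coef m j))) else 0)"
    by (intro sum.cong refl) (auto simp: lookup_single when_def exp_perm_inject[OF w])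
  also have "\<dots> = zpow (- (\<Sum>j<n. k j * int (coef m j))) * coef f m"
    by (auto simp: sum.delta in_keys_iff)
  finally show ?thesis .
qed

lemma supp_ract:
  assumes w: "w permutes {..<n}" and f: "f \<in> polys n"
  shows "supp (ract w k f) = exp_perm w ` supp f"
proof -
  have "m \<in> supp (ract w k f) \<longleftrightarrow> m \<in> exp_perm w ` supp f" for m
  proof (cases "m \<in> in_vars n")
    case True
    let ?m = "exp_perm (pinv w) m"
    have m: "?m \<in> in_vars n" "exp_perm w ?m = m"
      using True by (simp_all add: permutes_inv[OF w] exp_perm_inv[OF w])
    have "m \<in> supp (ract w k f) \<longleftrightarrow> ?m \<in> supp f"
      using coef_ract[OF w f m(1), of k] m(2) by (simp add: in_keys_iff)
    also have "\<dots> \<longleftrightarrow> m \<in> exp_perm w ` supp f" using m(2) exp_perm_inv(1)[OF w] by (metis imageE imageI)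
    finally show ?thesis .
  next
    case False
    then show ?thesis using ract_polys[OF w f, of k] f w by (auto simp: polys_def subset_iff)
  qed
  then show ?thesis by blast
qed

lemma ract_homog: "w permutes {..<n} \<Longrightarrow> f \<in> polys n \<Longrightarrow> homog d f \<Longrightarrow> homog d (ract w k f)"
  by (auto simp: homog_def supp_ract mdeg_exp_perm polys_def subset_iff)

text \<open>The index \<open>l\<close> is an integer because conjugation by \<open>ract w k\<close>
  shifts it by \<open>k i - k j\<close>.\<close>

definition refl :: "nat \<Rightarrow> nat \<Rightarrow> int \<Rightarrow> 'k mpol \<Rightarrow> 'k mpol" where
  "refl i j l = ract (Transposition.transpose i j) (refl_exp i j l)"

definition zact :: "nat \<Rightarrow> int \<Rightarrow> 'k mpol \<Rightarrow> 'k mpol" where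
  "zact i l = ract id (\<lambda>a. if a = i then l else 0)"

lemma refl_simps [simp]:
  "refl i j l (f + g) = refl i j l f + refl i j l g"
  "refl i j l (f - g) = refl i j l f - refl i j l g"
  "refl i j l (pscale a f) = pscale a (refl i j l f)"
  "refl i j l (f * g) = refl i j l f * refl i j l g"
  "refl i j l 0 = 0" "refl i j l 1 = 1" "refl i j l (- f) = - refl i j l f"
  by (simp_all add: refl_def)

lemma zact_simps [simp]:
  "zact i l (f + g) = zact i l f + zact i l g"
  "zact i l (f - g) = zact i l f - zact i l g"
  "zact i l (pscale a f) = pscale a (zact i l f)"
  "zact i l (f * g) = zact i l f * zact i l g"
  "zact i l 0 = 0" "zact i l 1 = 1" "zact i l (- f) = - zact i l f"
  by (simp_all add: zact_def)

lemma refl_xvar: "i \<noteq> j \<Longrightarrow> refl i j l (xvar a) =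
    (if a = i then pscale (zpow l) (xvar j) else if a = j then pscale (zpow (- l)) (xvar i) else xvar a)"
  by (auto simp: refl_def refl_exp_def)

lemma zact_xvar: "zact i l (xvar a) = (if a = i then pscale (zpow (- l)) (xvar i) else xvar a)"
  by (auto simp: zact_def)

lemma refl_polys [simp, intro]: "i < n \<Longrightarrow> j < n \<Longrightarrow> f \<in> polys n \<Longrightarrow> refl i j l f \<in> polys n"
  by (simp add: refl_def transpose_permutes_less)

lemma zact_polys [simp, intro]: "f \<in> polys n \<Longrightarrow> zact i l f \<in> polys n"
  by (simp add: zact_def permutes_id)

lemma group_act_refl_mat:
  "i < n \<Longrightarrow> j < n \<Longrightarrow> i \<noteq> j \<Longrightarrow> f \<in> polys n \<Longrightarrow> group_act (refl_mat r n i j l) f = refl i j (int l) f"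
  by (simp add: refl_mat_mk refl_def group_act_mk_mat transpose_permutes_less)

lemma group_act_zeta_mat: "f \<in> polys n \<Longrightarrow> group_act (zeta_mat r n i l) f = zact i l f"
  by (simp add: zeta_mat_mk zact_def group_act_mk_mat permutes_id)

lemma refl_cong: "f \<in> polys n \<Longrightarrow> a mod int r = b mod int r \<Longrightarrow> refl i j a f = refl i j b f"
  unfolding refl_def by (rule ract_cong) (auto simp: refl_exp_def intro: mod_minus_cong)

lemma refl_sym: "f \<in> polys n \<Longrightarrow> i \<noteq> j \<Longrightarrow> refl j i l f = refl i j (- l) f"
  unfolding refl_def by (rule ract_cong) (auto simp: refl_exp_def transpose_commute)

lemma ract_refl:
  assumes "w permutes {..<n}" "f \<in> polys n" "i \<noteq> j"
  shows "ract w k (refl i j l f) = refl (w i) (w j) (l + k i - k j) (ract w k f)"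
proof -
  have inj: "w a = w b \<longleftrightarrow> a = b" for a b using permutes_inj[OF assms(1)] by (auto dest: injD)
  show ?thesis
    unfolding refl_def ract_comp[OF assms(2)]
    by (rule ract_cong[OF assms(2)]) (use assms(3) in \<open>auto simp: refl_exp_def Transposition.transpose_def inj add.commute\<close>)
qed

lemma ract_zact:
  assumes "w permutes {..<n}" "f \<in> polys n"
  shows "ract w k (zact i l f) = zact (w i) l (ract w k f)"
proof -
  have inj: "w a = w b \<longleftrightarrow> a = b" for a b using permutes_inj[OF assms(1)] by (auto dest: injD)
  show ?thesis
    unfolding zact_def ract_comp[OF assms(2)]
    by (rule ract_cong[OF assms(2)]) (auto simp: inj add.commute)
qed

end

section \<open>Divided differences and Dunkl operators\<close>

lemma exact_quot_eq: "g \<noteq> 0 \<Longrightarrow> g * q = f \<Longrightarrow> exact_quot f g = q"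
  unfolding exact_quot_def by (rule the_equality) auto

lemma pderivative_linext:
  "pderivative i = linext (\<lambda>m. pscale (of_nat (coef m i)) (mon (m - unit_exp i)))"
  by (rule ext) (simp add: pderivative_def linext_def pscale_single unit_exp_def mult.commute)

lemma pderivative_add: "pderivative i (f + g) = pderivative i f + pderivative i g"
  by (simp add: pderivative_linext linext_add)

lemma pderivative_pscale: "pderivative i (pscale a f) = pscale a (pderivative i f)"
  by (simp add: pderivative_linext linext_pscale)

lemma linext_one: "linext \<phi> 1 = \<phi> 0"
  using linext_single[of \<phi> 0 1] by simp

lemma pderivative_0 [simp]: "pderivative i 0 = 0"
  by (simp add: pderivative_linext)

lemma pderivative_1 [simp]: "pderivative i 1 = 0"
  by (simp add: pderivative_linext linext_one)

lemma pderivative_xvar_mon: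
  "pderivative i (xvar a * mon m) = xvar a * pderivative i (mon m) + (if a = i then mon m else 0)"
proof (cases "coef m i = 0")
  case True
  show ?thesis
  proof (cases "a = i")
    case True
    have "unit_exp i + m - unit_exp i = m" by (rule poly_mapping_eqI) (simp add: lookup_add lookup_minus)
    then show ?thesis using True \<open>coef m i = 0\<close>
      by (simp add: xvar_mult_mon pderivative_linext lookup_add pscale_single)
  next
    case False
    then show ?thesis using True by (simp add: xvar_mult_mon pderivative_linext lookup_add)
  qed
next
  case False
  have e: "unit_exp a + m - unit_exp i = unit_exp a + (m - unit_exp i)"
    using False by (intro poly_mapping_eqI) (auto simp: lookup_add lookup_minus)
  have "mon (unit_exp i + (m - unit_exp i)) = mon m"
    using unit_exp_add_diff[OF False] by simp
  then show ?thesis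
    by (auto simp: xvar_mult_mon pderivative_linext lookup_add pscale_add_left pscale_mult_right e)
qed

lemma pderivative_xvar:
  "pderivative i (xvar a * f) = xvar a * pderivative i f + (if a = i then f else 0)"
proof -
  let ?L = "\<lambda>f. pderivative i (xvar a * f) - xvar a * pderivative i f - (if a = i then f else 0)"
  have add: "?L (f + g) = ?L f + ?L g" for f g by (simp add: pderivative_add algebra_simps)
  have sc: "?L (pscale b f) = pscale b (?L f)" for b f
    by (simp add: pderivative_pscale pscale_mult_right pscale_diff_right)
  have zero: "?L 0 = 0" by (simp add: pderivative_linext)
  have sum: "?L (sum g A) = (\<Sum>x\<in>A. ?L (g x))" for g and A :: "(nat \<Rightarrow>\<^sub>0 nat) set"
    by (induction A rule: infinite_finite_induct) (simp_all only: sum.infinite sum.empty sum.insert add zero not_False_eq_True)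
  have "?L (Poly_Mapping.single m b) = 0" for m b
    using sc[of b "mon m"] by (simp add: pderivative_xvar_mon pscale_single)
  then have "?L (\<Sum>m\<in>supp f. Poly_Mapping.single m (coef f m)) = 0"
    unfolding sum by (intro sum.neutral ballI)
  then have "?L f = 0" by (simp only: poly_mapping_sum_single[symmetric])
  then show ?thesis by (simp add: algebra_simps)
qed

context cher begin

abbreviation D :: "nat \<Rightarrow> 'k mpol \<Rightarrow> 'k mpol" where "D \<equiv> dunkl"

text \<open>A linear form that \<open>refl i j l\<close> negates; its zero set is the reflecting
  hyperplane.\<close>

definition dfac :: "nat \<Rightarrow> nat \<Rightarrow> int \<Rightarrow> 'k mpol" where
  "dfac i j l = xvar i - pscale (zpow l) (xvar j)"

lemma dfac_neq_0: "i \<noteq> j \<Longrightarrow> dfac i j l \<noteq> 0"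
proof
  assume "i \<noteq> j" "dfac i j l = 0"
  then have "coef (dfac i j l) (unit_exp i) = 0" by simp
  moreover have "unit_exp i \<noteq> unit_exp j"
    using \<open>i \<noteq> j\<close> by (metis coef_unit_exp zero_neq_one)
  ultimately show False
    by (simp add: dfac_def xvar_eq_mon lookup_minus lookup_single)
qed

lemma dfac_homog: "homog 1 (dfac i j l)"
  unfolding dfac_def by (intro homog_diff homog_pscale homog_xvar)

definition dd :: "nat \<Rightarrow> nat \<Rightarrow> int \<Rightarrow> 'k mpol \<Rightarrow> 'k mpol" where
  "dd i j l f = exact_quot (f - refl i j l f) (dfac i j l)"

definition zdd :: "nat \<Rightarrow> int \<Rightarrow> 'k mpol \<Rightarrow> 'k mpol" where
  "zdd i l f = exact_quot (f - zact i l f) (xvar i)"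

lemma dd_eqI: "i \<noteq> j \<Longrightarrow> dfac i j l * q = f - refl i j l f \<Longrightarrow> dd i j l f = q"
  unfolding dd_def by (rule exact_quot_eq[OF dfac_neq_0])

lemma zdd_eqI: "xvar i * q = f - zact i l f \<Longrightarrow> zdd i l f = q"
  unfolding zdd_def by (rule exact_quot_eq[OF xvar_neq_0])

text \<open>Twisted Leibniz rule for a reflection s: x_a f - s(x_a f) = x_a (f - s f) + (x_a - s
  x_a) s f, and x_a - s x_a is 1, - zeta^(-l) or 0 times \<open>dfac i j l\<close> according to a =
  i, a = j or any other a.\<close>

lemma dd_step:
  assumes "i \<noteq> j" and q: "dfac i j l * q = f - refl i j l f"
  shows "dfac i j l * (xvar a * q + (if a = i then refl i j l f
      else if a = j then - pscale (zpow (- l)) (refl i j l f) else 0)) =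
    xvar a * f - refl i j l (xvar a * f)"
proof -
  let ?s = "refl i j l f"
  have "dfac i j l * (xvar a * q) = xvar a * f - xvar a * ?s"
    using q by (metis mult.left_commute right_diff_distrib)
  moreover have "xvar j - pscale (zpow (- l)) (xvar i) = - pscale (zpow (- l)) (dfac i j l)"
    by (simp add: dfac_def pscale_diff_right)
  then have "- (dfac i j l * pscale (zpow (- l)) ?s) = (xvar j - pscale (zpow (- l)) (xvar i)) * ?s"
    by (simp add: pscale_mult_left pscale_mult_right)
  ultimately show ?thesis
    using assms(1) by (auto simp: refl_xvar distrib_left algebra_simps dfac_def)
qed

lemma zdd_step:
  assumes q: "xvar i * q = f - zact i l f"
  shows "xvar i * (xvar a * q + (if a = i then pscale (1 - zpow (- l)) (zact i l f) else 0)) =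
    xvar a * f - zact i l (xvar a * f)"
proof -
  have "xvar i * (xvar a * q) = xvar a * f - xvar a * zact i l f"
    using q by (metis mult.left_commute right_diff_distrib)
  then show ?thesis
    by (auto simp: zact_xvar distrib_left right_diff_distrib pscale_mult_right pscale_mult_left pscale_diff_left)
qed

text \<open>Divisibility is obtained by induction over multiplication by variables;
  \<open>dd_step\<close> writes down the quotient for \<open>xvar a * f\<close>.\<close>

lemma dd_exists:
  assumes "i \<noteq> j" "i < n" "j < n" "f \<in> polys n"
  shows "\<exists>q\<in>polys n. dfac i j l * q = f - refl i j l f"
  using assms(4)
proof (induction rule: polys_induct)
  case (var a f)
  then obtain q where q: "q \<in> polys n" "dfac i j l * q = f - refl i j l f" by blast
  show ?case
    using dd_step[OF assms(1) q(2), of a] q(1) var assms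
    by (intro bexI[of _ "xvar a * q + (if a = i then refl i j l f
      else if a = j then - pscale (zpow (- l)) (refl i j l f) else 0)"]) auto
next
  case (scale b f)
  then obtain q where q: "q \<in> polys n" "dfac i j l * q = f - refl i j l f" by blast
  then show ?case by (intro bexI[of _ "pscale b q"]) (auto simp: pscale_mult_right pscale_diff_right)
next
  case (add f g)
  then obtain q q' where "q \<in> polys n" "dfac i j l * q = f - refl i j l f"
    "q' \<in> polys n" "dfac i j l * q' = g - refl i j l g" by blast
  then show ?case by (intro bexI[of _ "q + q'"]) (auto simp: distrib_left)
qed (auto intro!: bexI[of _ 0])

lemma zdd_exists:
  assumes "i < n" "f \<in> polys n"
  shows "\<exists>q\<in>polys n. xvar i * q = f - zact i l f"
  using assms(2)
proof (induction rule: polys_induct)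
  case (var a f)
  then obtain q where q: "q \<in> polys n" "xvar i * q = f - zact i l f" by blast
  show ?case
    using zdd_step[OF q(2), of a] q(1) var assms
    by (intro bexI[of _ "xvar a * q + (if a = i then pscale (1 - zpow (- l)) (zact i l f) else 0)"]) auto
next
  case (scale b f)
  then obtain q where q: "q \<in> polys n" "xvar i * q = f - zact i l f" by blast
  then show ?case by (intro bexI[of _ "pscale b q"]) (auto simp: pscale_mult_right pscale_diff_right)
next
  case (add f g)
  then obtain q q' where "q \<in> polys n" "xvar i * q = f - zact i l f"
    "q' \<in> polys n" "xvar i * q' = g - zact i l g" by blast
  then show ?case by (intro bexI[of _ "q + q'"]) (auto simp: distrib_left)
qed (auto intro!: bexI[of _ 0])

context
  fixes i j :: nat assumes ij: "i \<noteq> j" "i < n" "j < n"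
begin

lemma dd_spec:
  assumes "f \<in> polys n"
  shows "dfac i j l * dd i j l f = f - refl i j l f" "dd i j l f \<in> polys n"
proof -
  obtain q where "q \<in> polys n" "dfac i j l * q = f - refl i j l f"
    using dd_exists[OF ij assms] by blast
  then show "dfac i j l * dd i j l f = f - refl i j l f" "dd i j l f \<in> polys n"
    using dd_eqI[OF ij(1)] by auto
qed

lemma dd_add: "f \<in> polys n \<Longrightarrow> g \<in> polys n \<Longrightarrow> dd i j l (f + g) = dd i j l f + dd i j l g"
  by (rule dd_eqI[OF ij(1)]) (simp add: distrib_left dd_spec)

lemma dd_pscale: "f \<in> polys n \<Longrightarrow> dd i j l (pscale a f) = pscale a (dd i j l f)"
  by (rule dd_eqI[OF ij(1)]) (simp add: pscale_mult_right dd_spec pscale_diff_right)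

lemma dd_xvar: "f \<in> polys n \<Longrightarrow> dd i j l (xvar a * f) = xvar a * dd i j l f +
    (if a = i then refl i j l f else if a = j then - pscale (zpow (- l)) (refl i j l f) else 0)"
  by (rule dd_eqI[OF ij(1)]) (rule dd_step[OF ij(1) dd_spec(1)])

lemma dd_invariant: "f \<in> polys n \<Longrightarrow> refl i j l a = a \<Longrightarrow> dd i j l (f * a) = dd i j l f * a"
  by (rule dd_eqI[OF ij(1)]) (simp add: dd_spec mult.assoc[symmetric] left_diff_distrib)

lemma dd_1: "dd i j l 1 = 0"
  by (rule dd_eqI[OF ij(1)]) simp

text \<open>In degree 0 the quotient vanishes, because \<open>homog_factor\<close> forces d \<ge> 1
  for a non-zero one; the truncated subtraction is therefore harmless.\<close>

lemma dd_homog: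
  assumes "f \<in> polys n" "homog d f" shows "homog (d - 1) (dd i j l f)"
proof (cases "dd i j l f = 0")
  case False
  have "homog d (refl i j l f)"
    unfolding refl_def by (rule ract_homog) (use assms ij transpose_permutes_less in auto)
  then have "homog d (dd i j l f * dfac i j l)"
    using homog_diff[OF assms(2)] dd_spec(1)[OF assms(1)] by (simp add: mult.commute)
  from homog_factor[OF this dfac_homog dfac_neq_0[OF ij(1)] False] show ?thesis by simp
qed simp

end

lemma zdd_spec:
  assumes "i < n" "f \<in> polys n"
  shows "xvar i * zdd i l f = f - zact i l f" "zdd i l f \<in> polys n"
proof -
  obtain q where "q \<in> polys n" "xvar i * q = f - zact i l f"
    using zdd_exists[OF assms] by blast
  then show "xvar i * zdd i l f = f - zact i l f" "zdd i l f \<in> polys n"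
    using zdd_eqI by auto
qed

lemma zdd_add: "i < n \<Longrightarrow> f \<in> polys n \<Longrightarrow> g \<in> polys n \<Longrightarrow> zdd i l (f + g) = zdd i l f + zdd i l g"
  by (rule zdd_eqI) (simp add: distrib_left zdd_spec)

lemma zdd_pscale: "i < n \<Longrightarrow> f \<in> polys n \<Longrightarrow> zdd i l (pscale a f) = pscale a (zdd i l f)"
  by (rule zdd_eqI) (simp add: pscale_mult_right zdd_spec pscale_diff_right)

lemma zdd_xvar: "i < n \<Longrightarrow> f \<in> polys n \<Longrightarrow> zdd i l (xvar a * f) = xvar a * zdd i l f +
    (if a = i then pscale (1 - zpow (- l)) (zact i l f) else 0)"
  by (rule zdd_eqI) (rule zdd_step[OF zdd_spec(1)])

lemma zdd_invariant: "i < n \<Longrightarrow> f \<in> polys n \<Longrightarrow> zact i l a = a \<Longrightarrow> zdd i l (f * a) = zdd i l f * a"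
  by (rule zdd_eqI) (simp add: zdd_spec mult.assoc[symmetric] left_diff_distrib)

lemma zdd_1: "zdd i l 1 = 0"
  by (rule zdd_eqI) simp

lemma zact_homog: "f \<in> polys n \<Longrightarrow> homog d f \<Longrightarrow> homog d (zact i l f)"
  unfolding zact_def by (rule ract_homog[OF permutes_id])

lemma refl_homog: "i < n \<Longrightarrow> j < n \<Longrightarrow> f \<in> polys n \<Longrightarrow> homog d f \<Longrightarrow> homog d (refl i j l f)"
  unfolding refl_def by (rule ract_homog[OF transpose_permutes_less])

lemma zdd_homog:
  assumes "i < n" "f \<in> polys n" "homog d f" shows "homog (d - 1) (zdd i l f)"
proof (cases "zdd i l f = 0")
  case False
  have "homog d (zdd i l f * xvar i)"
    using homog_diff[OF assms(3) zact_homog[OF assms(2,3)]] zdd_spec(1)[OF assms(1,2)]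
    by (simp add: mult.commute)
  from homog_factor[OF this homog_xvar xvar_neq_0 False] show ?thesis by simp
qed simp

lemma pderivative_polys: "f \<in> polys n \<Longrightarrow> pderivative i f \<in> polys n"
  by (induction rule: polys_induct)
     (auto simp: pderivative_xvar pderivative_add pderivative_pscale)

lemma pderivative_homog:
  assumes "homog d f" shows "homog (d - 1) (pderivative i f)"
proof -
  have "homog (d - 1) (pscale b (pscale (of_nat (coef m i)) (mon (m - unit_exp i))))"
    if "m \<in> supp f" for b m
  proof (cases "coef m i = 0")
    case False
    have "mdeg (unit_exp i + (m - unit_exp i)) = d"
      using assms that unit_exp_add_diff[OF False] by (simp add: homog_def)
    then have "mdeg (m - unit_exp i) = d - 1" by simp
    then show ?thesis by (intro homog_pscale) (simp add: homog_def)
  qed simp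
  then show ?thesis unfolding pderivative_linext linext_def by (intro homog_sum)
qed

section \<open>Dunkl operators and their commutation relations\<close>

lemma dunkl_alt:
  assumes "i < n" "f \<in> polys n"
  shows "D i f = pscale \<kappa> (pderivative i f) - (\<Sum>l = 1..<r. pscale (c l) (zdd i (int l) f))
     - pscale (c 0) (\<Sum>j\<in>{..<n} - {i}. \<Sum>l<r. dd i j (int l) f)"
proof -
  have "(\<Sum>l = 1..<r. pscale (c l) (exact_quot (f - group_act (zeta_mat r n i (int l)) f) (xvar i)))
      = (\<Sum>l = 1..<r. pscale (c l) (zdd i (int l) f))"
    using assms by (simp add: zdd_def group_act_zeta_mat)
  moreover have "(\<Sum>j\<in>{..<n} - {i}. \<Sum>l<r.
      exact_quot (f - group_act (refl_mat r n i j l) f) (xvar i - pscale (zpow (int l)) (xvar j)))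
      = (\<Sum>j\<in>{..<n} - {i}. \<Sum>l<r. dd i j (int l) f)"
    using assms by (intro sum.cong refl) (auto simp: dd_def group_act_refl_mat dfac_def)
  ultimately show ?thesis by (simp add: dunkl_def)
qed

lemma D_polys [simp, intro]: "i < n \<Longrightarrow> f \<in> polys n \<Longrightarrow> D i f \<in> polys n"
  by (auto simp: dunkl_alt pderivative_polys intro!: polys_diff polys_pscale polys_sum zdd_spec(2) dd_spec(2))

lemma D_add: "i < n \<Longrightarrow> f \<in> polys n \<Longrightarrow> g \<in> polys n \<Longrightarrow> D i (f + g) = D i f + D i g"
  by (simp add: dunkl_alt pderivative_add zdd_add dd_add sum.distrib pscale_add_right cong: sum.cong_simp)

lemma D_pscale: "i < n \<Longrightarrow> f \<in> polys n \<Longrightarrow> D i (pscale a f) = pscale a (D i f)"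
  by (simp add: dunkl_alt pderivative_pscale zdd_pscale dd_pscale pscale_diff_right pscale_sum_right mult.commute
      cong: sum.cong_simp)

lemma D_1: "i < n \<Longrightarrow> D i 1 = 0"
  by (simp add: dunkl_alt zdd_1 dd_1 cong: sum.cong_simp)

lemma D_0: "i < n \<Longrightarrow> D i 0 = 0"
  using D_pscale[of i 0 0] by simp

lemma D_uminus: "i < n \<Longrightarrow> f \<in> polys n \<Longrightarrow> D i (- f) = - D i f"
  using D_pscale[of i f "- 1"] by (simp add: pscale_minus_left)

lemma D_diff: "i < n \<Longrightarrow> f \<in> polys n \<Longrightarrow> g \<in> polys n \<Longrightarrow> D i (f - g) = D i f - D i g"
  using D_add[of i f "- g"] by (simp add: D_uminus)

lemma D_sum: "i < n \<Longrightarrow> (\<And>x. x \<in> A \<Longrightarrow> f x \<in> polys n) \<Longrightarrow> D i (sum f A) = (\<Sum>x\<in>A. D i (f x))"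
  by (induction A rule: infinite_finite_induct) (auto simp: D_0 D_add polys_sum)

lemma D_homog: "i < n \<Longrightarrow> f \<in> polys n \<Longrightarrow> homog d f \<Longrightarrow> homog (d - 1) (D i f)"
  unfolding dunkl_alt
  by (intro homog_diff homog_pscale homog_sum pderivative_homog zdd_homog dd_homog) auto

text \<open>\<open>Rop\<close>, \<open>Rtw\<close> and \<open>Cop\<close> are the actions of the
  group algebra elements in the commutation relations of y_i with the variables. The rules
  \<open>D_1\<close>, \<open>D_xvar_neq\<close> and \<open>D_xvar_eq\<close> determine the Dunkl
  operators on \<open>polys n\<close> by linearity, which is what the later inductions use.\<close>

definition Rop :: "nat \<Rightarrow> nat \<Rightarrow> 'k mpol \<Rightarrow> 'k mpol" where
  "Rop i j f = (\<Sum>l<r. refl i j (int l) f)"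

definition Rtw :: "nat \<Rightarrow> nat \<Rightarrow> 'k mpol \<Rightarrow> 'k mpol" where
  "Rtw i j f = (\<Sum>l<r. pscale (zpow (- int l)) (refl i j (int l) f))"

definition Cop :: "nat \<Rightarrow> 'k mpol \<Rightarrow> 'k mpol" where
  "Cop i f = (\<Sum>l = 1..<r. pscale (c l * (1 - zpow (- int l))) (zact i (int l) f))"

lemma Rop_polys [simp, intro]: "i < n \<Longrightarrow> j < n \<Longrightarrow> f \<in> polys n \<Longrightarrow> Rop i j f \<in> polys n"
  by (auto simp: Rop_def intro!: polys_sum)

lemma Rtw_polys [simp, intro]: "i < n \<Longrightarrow> j < n \<Longrightarrow> f \<in> polys n \<Longrightarrow> Rtw i j f \<in> polys n"
  by (auto simp: Rtw_def intro!: polys_sum)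

lemma Cop_polys [simp, intro]: "f \<in> polys n \<Longrightarrow> Cop i f \<in> polys n"
  by (auto simp: Cop_def intro!: polys_sum)

lemma Rop_linear:
  "Rop i j (f + g) = Rop i j f + Rop i j g" "Rop i j (pscale a f) = pscale a (Rop i j f)"
  by (simp_all add: Rop_def sum.distrib pscale_sum_right)

lemma D_xvar_neq:
  assumes "i < n" "a < n" "i \<noteq> a" "f \<in> polys n"
  shows "D i (xvar a * f) = xvar a * D i f + pscale (c 0) (Rtw i a f)"
proof -
  have "(\<Sum>j\<in>{..<n} - {i}. \<Sum>l<r. dd i j (int l) (xvar a * f)) =
      (\<Sum>j\<in>{..<n} - {i}. xvar a * (\<Sum>l<r. dd i j (int l) f) - (if j = a then Rtw i a f else 0))"
    using assms by (intro sum.cong refl)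
      (auto simp: dd_xvar sum.distrib sum_distrib_left Rtw_def sum_negf)
  also have "\<dots> = xvar a * (\<Sum>j\<in>{..<n} - {i}. \<Sum>l<r. dd i j (int l) f) - Rtw i a f"
    using assms by (simp add: sum_subtractf sum_distrib_left sum.delta)
  finally show ?thesis using assms
    by (simp add: dunkl_alt pderivative_xvar zdd_xvar right_diff_distrib pscale_mult_right sum_distrib_left
        pscale_diff_right)
qed

lemma D_xvar_eq:
  assumes "i < n" "f \<in> polys n"
  shows "D i (xvar i * f) = xvar i * D i f + pscale \<kappa> f - Cop i f
    - pscale (c 0) (\<Sum>j\<in>{..<n} - {i}. Rop i j f)"
proof -
  have "(\<Sum>j\<in>{..<n} - {i}. \<Sum>l<r. dd i j (int l) (xvar i * f)) =
      (\<Sum>j\<in>{..<n} - {i}. xvar i * (\<Sum>l<r. dd i j (int l) f) + Rop i j f)"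
    using assms by (intro sum.cong refl) (auto simp: dd_xvar sum.distrib sum_distrib_left Rop_def)
  then show ?thesis using assms
    by (simp add: dunkl_alt pderivative_xvar zdd_xvar right_diff_distrib pscale_mult_right sum_distrib_left
        pscale_diff_right pscale_add_right sum.distrib Cop_def)
qed

lemma ract_Rop:
  assumes w: "w permutes {..<n}" and "f \<in> polys n" "i \<noteq> j" "i < n" "j < n"
  shows "ract w k (Rop i j f) = Rop (w i) (w j) (ract w k f)"
proof -
  have less: "w i < n" "w j < n" using assms permutes_less[OF w] by auto
  have "ract w k (Rop i j f) = (\<Sum>l<r. refl (w i) (w j) (1 * int l + (k i - k j)) (ract w k f))"
    using assms by (simp add: Rop_def ract_sum ract_refl add_diff_eq)
  also have "\<dots> = Rop (w i) (w j) (ract w k f)"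
    unfolding Rop_def by (rule sum_periodic) (use assms less in \<open>auto intro!: refl_cong\<close>)
  finally show ?thesis .
qed

text \<open>Conjugation shifts the summation index \<open>l\<close> by \<open>k i - k j\<close>; the
  coefficients zeta^(-l) absorb the shift up to the scalar in front.\<close>

lemma ract_Rtw:
  assumes w: "w permutes {..<n}" and "f \<in> polys n" "i \<noteq> j" "i < n" "j < n"
  shows "ract w k (Rtw i j f) = pscale (zpow (k i - k j)) (Rtw (w i) (w j) (ract w k f))"
proof -
  have less: "w i < n" "w j < n" using assms permutes_less[OF w] by auto
  let ?F = "\<lambda>a. pscale (zpow (- a)) (refl (w i) (w j) a (ract w k f))"
  have F: "?F a = ?F b" if "a mod int r = b mod int r" for a b
  proof -
    have "zpow (- a) = zpow (- b)" by (rule zpow_cong) (metis mod_minus_cong that)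
    moreover have "refl (w i) (w j) a (ract w k f) = refl (w i) (w j) b (ract w k f)"
      using assms that by (intro refl_cong ract_polys) auto
    ultimately show ?thesis by simp
  qed
  have z: "zpow (- int l) = zpow (k i - k j) * zpow (- (1 * int l + (k i - k j)))" for l
    by (subst zpow_add[symmetric]) simp
  have "ract w k (Rtw i j f) = (\<Sum>l<r. pscale (zpow (- int l)) (refl (w i) (w j) (1 * int l + (k i - k j)) (ract w k f)))"
    using assms by (simp add: Rtw_def ract_sum ract_refl add_diff_eq)
  also have "\<dots> = (\<Sum>l<r. pscale (zpow (k i - k j)) (?F (1 * int l + (k i - k j))))"
    by (intro sum.cong refl) (simp only: z pscale_pscale)
  also have "\<dots> = pscale (zpow (k i - k j)) (\<Sum>l<r. ?F (1 * int l + (k i - k j)))"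
    by (simp only: pscale_sum_right)
  also have "(\<Sum>l<r. ?F (1 * int l + (k i - k j))) = (\<Sum>l<r. ?F (int l))"
    by (rule sum_periodic, rule F) simp_all
  finally show ?thesis by (simp add: Rtw_def)
qed

lemma ract_Cop:
  assumes w: "w permutes {..<n}" and "f \<in> polys n"
  shows "ract w k (Cop i f) = Cop (w i) (ract w k f)"
  using assms by (simp add: Cop_def ract_sum ract_zact)

lemma sum_permute_remove:
  assumes w: "w permutes {..<n}" and "i < n"
  shows "(\<Sum>j\<in>{..<n} - {i}. F (w j)) = (\<Sum>j\<in>{..<n} - {w i}. F j :: 'b::comm_monoid_add)"
proof -
  have inj: "w x = w y \<longleftrightarrow> x = y" for x y using permutes_inj[OF w] by (auto dest: injD)
  have "w ` ({..<n} - {i}) = {..<n} - {w i}"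
    using permutes_image[OF w] by (auto simp: inj image_set_diff[OF permutes_inj[OF w]])
  moreover have "inj_on w ({..<n} - {i})" using inj by (auto simp: inj_on_def)
  ultimately show ?thesis by (metis (no_types, lifting) sum.reindex_cong)
qed

text \<open>Both sides vanish on 1 and satisfy the same commutation relation with every
  \<open>xvar a\<close>. The scalar is the one by which the group element sends y_i to a multiple of
  y_(w i).\<close>

lemma ract_D:
  assumes w: "w permutes {..<n}" and i: "i < n" and f: "f \<in> polys n"
  shows "ract w k (D i f) = pscale (zpow (k i)) (D (w i) (ract w k f))"
  using f
proof (induction rule: polys_induct)
  case zero then show ?case using i permutes_less[OF w] by (simp add: D_0)
next
  case one then show ?case using i permutes_less[OF w] by (simp add: D_1)
next
  case (var a f)
  have inj: "w x = w y \<longleftrightarrow> x = y" for x y using permutes_inj[OF w] by (auto dest: injD)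
  have wi: "w i < n" "w a < n" using i var permutes_less[OF w] by auto
  have Tf: "ract w k f \<in> polys n" using var w by simp
  have z: "zpow (- k a) * zpow (k i) = zpow (k i - k a)" "zpow (k i) * zpow (- k a) = zpow (k i - k a)"
    by (simp_all flip: zpow_add)
  show ?case
  proof (cases "a = i")
    case True
    have "ract w k (D i (xvar i * f)) = pscale (zpow (- k i)) (xvar (w i)) * pscale (zpow (k i)) (D (w i) (ract w k f))
       + pscale \<kappa> (ract w k f) - Cop (w i) (ract w k f) - pscale (c 0) (\<Sum>j\<in>{..<n} - {i}. Rop (w i) (w j) (ract w k f))"
      using i var w by (simp add: D_xvar_eq ract_Cop ract_sum ract_Rop)
    also have "\<dots> = D (w i) (xvar (w i) * ract w k f)"
      using wi Tf by (simp add: D_xvar_eq pscale_mult_left pscale_mult_right sum_permute_remove[OF w i, of "\<lambda>j. Rop (w i) j (ract w k f)"])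
    also have "\<dots> = pscale (zpow (k i)) (D (w i) (ract w k (xvar i * f)))"
      using wi Tf by (simp add: pscale_mult_left D_pscale)
    finally show ?thesis using True by simp
  next
    case False
    have "ract w k (D i (xvar a * f)) =
        pscale (zpow (k i - k a)) (xvar (w a) * D (w i) (ract w k f) + pscale (c 0) (Rtw (w i) (w a) (ract w k f)))"
      using i False var w by (simp add: D_xvar_neq ract_Rtw pscale_mult_left pscale_mult_right pscale_add_right z mult.commute[of "c 0"])
    also have "\<dots> = pscale (zpow (k i - k a)) (D (w i) (xvar (w a) * ract w k f))"
      using wi False Tf by (simp add: D_xvar_neq inj)
    also have "\<dots> = pscale (zpow (k i)) (D (w i) (ract w k (xvar a * f)))"
      using wi Tf by (simp add: pscale_mult_left D_pscale z)
    finally show ?thesis .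
  qed
next
  case (scale a f) then show ?case using i permutes_less[OF w] w by (simp add: D_pscale mult.commute)
next
  case (add f g) then show ?case using i permutes_less[OF w] w by (simp add: D_add pscale_add_right)
qed

lemma refl_D:
  assumes "i \<noteq> j" "i < n" "j < n" "a < n" "f \<in> polys n"
  shows "refl i j l (D a f) = (if a = i then pscale (zpow (- l)) (D j (refl i j l f))
     else if a = j then pscale (zpow l) (D i (refl i j l f)) else D a (refl i j l f))"
  using assms ract_D[OF transpose_permutes_less[of i n j] assms(4,5), of "refl_exp i j l"]
  by (auto simp: refl_def refl_exp_def)

lemma zact_D: "a < n \<Longrightarrow> f \<in> polys n \<Longrightarrow> i \<noteq> a \<Longrightarrow> zact i l (D a f) = D a (zact i l f)"
  using ract_D[OF permutes_id, of a f] by (simp add: zact_def)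

text \<open>The terms that do not commute termwise come from the reflections exchanging i and j.
  Fact \<open>A\<close> turns the correction from moving x_i past D_j into the summand m = j of the
  reflection sum and removes it on one side; fact \<open>B\<close> does the same on the other
  side.\<close>

lemma D_commute_step:
  assumes ij: "i \<noteq> j" "i < n" "j < n" and f: "f \<in> polys n" and IH: "D i (D j f) = D j (D i f)"
  shows "D i (D j (xvar i * f)) = D j (D i (xvar i * f))"
proof -
  let ?M = "{..<n} - {i} - {j}"
  have split: "(\<Sum>m\<in>{..<n} - {i}. F m) = F j + (\<Sum>m\<in>?M. F m)" for F :: "nat \<Rightarrow> 'k mpol"
    using ij by (subst sum.remove[of _ j]) auto
  have A: "D i (Rtw j i f) = Rop i j (D j f)"
  proof -
    have "Rop i j (D j f) = (\<Sum>l<r. pscale (zpow (int l)) (D i (refl i j (int l) f)))"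
      using ij f by (simp add: Rop_def refl_D)
    also have "\<dots> = (\<Sum>l<r. pscale (zpow (- 1 * int l + 0)) (D i (refl i j (- 1 * int l + 0) f)))"
      by (rule sum_periodic[symmetric]) (use f ij zpow_cong refl_cong in metis, simp)
    also have "\<dots> = D i (Rtw j i f)"
      using ij f by (simp add: Rtw_def D_sum D_pscale refl_sym[of f i j])
    finally show ?thesis by simp
  qed
  have B: "Rtw j i (D i f) = D j (Rop i j f)"
  proof -
    have "Rtw j i (D i f) = (\<Sum>l<r. D j (refl j i (int l) f))"
      unfolding Rtw_def using ij f by (intro sum.cong refl) (simp add: refl_D)
    also have "\<dots> = (\<Sum>l<r. D j (refl i j (- 1 * int l + 0) f))"
      using ij f by (simp add: refl_sym[of f i j])
    also have "\<dots> = (\<Sum>l<r. D j (refl i j (int l) f))"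
      by (rule sum_periodic) (use f refl_cong in metis, simp)
    also have "\<dots> = D j (Rop i j f)" using ij f by (simp add: Rop_def D_sum)
    finally show ?thesis .
  qed
  have C: "D j (Cop i f) = Cop i (D j f)"
    using ij f by (simp add: Cop_def D_sum D_pscale zact_D)
  have E: "D j (Rop i m f) = Rop i m (D j f)" if "m \<in> ?M" for m
    using ij f that by (simp add: Rop_def D_sum refl_D)
  have "D i (D j (xvar i * f)) = xvar i * D i (D j f) + pscale \<kappa> (D j f) - Cop i (D j f)
     - pscale (c 0) (\<Sum>m\<in>{..<n} - {i}. Rop i m (D j f)) + pscale (c 0) (Rop i j (D j f))"
    using ij f by (simp add: D_xvar_neq D_add D_pscale D_xvar_eq A)
  also have "\<dots> = xvar i * D j (D i f) + pscale \<kappa> (D j f) - D j (Cop i f)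
     - pscale (c 0) (\<Sum>m\<in>?M. D j (Rop i m f))"
    by (simp add: split IH C E pscale_add_right)
  also have "\<dots> = D j (xvar i * D i f + pscale \<kappa> f - Cop i f
     - (pscale (c 0) (Rop i j f) + pscale (c 0) (\<Sum>m\<in>?M. Rop i m f)))"
  proof -
    have S: "(\<Sum>m\<in>?M. Rop i m f) \<in> polys n" using ij f by (intro polys_sum) auto
    have "D j (\<Sum>m\<in>?M. Rop i m f) = (\<Sum>m\<in>?M. D j (Rop i m f))"
      using ij f by (intro D_sum) auto
    then show ?thesis using ij f S by (simp add: D_diff D_add D_xvar_neq D_pscale B)
  qed
  also have "\<dots> = D j (D i (xvar i * f))"
    using ij f by (simp add: D_xvar_eq split pscale_add_right)
  finally show ?thesis .
qed

lemma D_commute: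
  assumes "i < n" "j < n" "f \<in> polys n" shows "D i (D j f) = D j (D i f)"
proof (cases "i = j")
  case False
  show ?thesis using assms(3)
  proof (induction rule: polys_induct)
    case (var a f)
    consider "a = i" | "a = j" | "a \<noteq> i" "a \<noteq> j" by blast
    then show ?case
    proof cases
      case 1
      then show ?thesis using D_commute_step[OF False assms(1,2) var(2,3)] by simp
    next
      case 2
      then show ?thesis using D_commute_step[OF False[symmetric] assms(2,1) var(2) var(3)[symmetric]] by simp
    next
      case 3
      \<comment> \<open>Reflections in the indices y and a leave x alone, so the two correction
        terms are exchanged when i and j are.\<close>
      have R: "D x (Rtw y a f) = Rtw y a (D x f)" if "x < n" "y < n" "x \<noteq> y" "x \<noteq> a" "y \<noteq> a" for x y
        using that var by (simp add: Rtw_def D_sum D_pscale refl_D)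
      show ?thesis
        using 3 var assms False by (simp add: D_xvar_neq D_add D_pscale R add_ac)
    qed
  qed (use assms in \<open>simp_all add: D_0 D_1 D_add D_pscale\<close>)
qed simp

end

declare One_nat_def [simp del]

section \<open>The polynomial representation of the rational Cherednik algebra\<close>

lemma mem_coset_iff:
  assumes "ideal I R" "a \<in> carrier R"
  shows "b \<in> I +>\<^bsub>R\<^esub> a \<longleftrightarrow> (\<exists>h\<in>I. b = h \<oplus>\<^bsub>R\<^esub> a)"
  unfolding a_r_coset_def' by auto

lemma free_algebra_simps [simp]:
  "mult (free_algebra A) = (*)" "one (free_algebra A) = 1" "zero (free_algebra A) = 0"
  "add (free_algebra A) = (+)"
  by (simp_all add: free_algebra_def)

lemma free_algebra_carrier:
  "a \<in> carrier (free_algebra A) \<longleftrightarrow> (\<forall>w\<in>supp a. set (letters w) \<subseteq> A)"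
  by (simp add: free_algebra_def)

lemma free_algebra_add: "a \<in> carrier (free_algebra A) \<Longrightarrow> b \<in> carrier (free_algebra A) \<Longrightarrow>
    a + b \<in> carrier (free_algebra A)"
  using keys_add[of a b] by (auto simp: free_algebra_carrier)

lemma free_algebra_uminus: "a \<in> carrier (free_algebra A) \<Longrightarrow> - a \<in> carrier (free_algebra A)"
  by (auto simp: free_algebra_carrier in_keys_iff)

lemma free_algebra_diff: "a \<in> carrier (free_algebra A) \<Longrightarrow> b \<in> carrier (free_algebra A) \<Longrightarrow>
    a - b \<in> carrier (free_algebra A)"
  using free_algebra_add[of a A "- b"] free_algebra_uminus[of b A] by simp

lemma free_algebra_mult:
  assumes "a \<in> carrier (free_algebra A)" "b \<in> carrier (free_algebra A)"
  shows "a * b \<in> carrier (free_algebra A)"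
proof -
  have "set (letters w) \<subseteq> A" if w: "w \<in> supp (a * b)" for w
  proof -
    obtain u v where "u \<in> supp a" "v \<in> supp b" "w = u + v"
      using keys_mult[of a b] w by blast
    then show ?thesis using assms by (auto simp: free_algebra_carrier plus_free_word_def)
  qed
  then show ?thesis by (simp add: free_algebra_carrier)
qed

lemma free_algebra_1 [simp]: "1 \<in> carrier (free_algebra A)"
  by (simp add: free_algebra_carrier zero_free_word_def)

lemma free_algebra_0 [simp]: "0 \<in> carrier (free_algebra A)"
  by (simp add: free_algebra_carrier)

lemma free_algebra_fgen: "g \<in> A \<Longrightarrow> fgen g \<in> carrier (free_algebra A)"
  by (simp add: free_algebra_carrier fgen_def)

lemma free_algebra_fscalar [simp]: "fscalar a \<in> carrier (free_algebra A)"
  by (simp add: free_algebra_carrier fscalar_def zero_free_word_def)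

lemma free_algebra_sum: "(\<And>x. x \<in> X \<Longrightarrow> F x \<in> carrier (free_algebra A)) \<Longrightarrow> sum F X \<in> carrier (free_algebra A)"
  by (induction X rule: infinite_finite_induct) (auto simp: free_algebra_add)

lemma ring_free_algebra: "ring (free_algebra A :: ('a, 'k::field) free_alg ring)"
proof (rule ringI)
  show "abelian_group (free_algebra A :: ('a, 'k) free_alg ring)"
  proof (rule abelian_groupI)
    fix x :: "('a, 'k) free_alg" assume "x \<in> carrier (free_algebra A)"
    then show "\<exists>y\<in>carrier (free_algebra A). y \<oplus>\<^bsub>free_algebra A\<^esub> x = \<zero>\<^bsub>free_algebra A\<^esub>"
      by (intro bexI[of _ "- x"]) (auto simp: free_algebra_uminus)
  qed (auto simp: free_algebra_add add_ac)
  show "Group.monoid (free_algebra A :: ('a, 'k) free_alg ring)"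
    by (rule monoidI) (auto simp: free_algebra_mult mult.assoc)
qed (auto simp: distrib_left distrib_right)

lemma a_inv_free_algebra:
  assumes "a \<in> carrier (free_algebra A)"
  shows "\<ominus>\<^bsub>free_algebra A\<^esub> a = - (a :: ('a, 'k::field) free_alg)"
proof -
  interpret ring "free_algebra A :: ('a, 'k) free_alg ring" by (rule ring_free_algebra)
  show ?thesis using assms free_algebra_uminus[OF assms] minus_equality[of "- a" a] by simp
qed

lemma free_act_linext: "free_act \<rho> a f = linext (\<lambda>w. foldr \<rho> (letters w) f) a"
  by (simp add: free_act_def linext_def)

lemma free_act_add: "free_act \<rho> (a + b) f = free_act \<rho> a f + free_act \<rho> b f"
  by (simp add: free_act_linext linext_add)

lemma free_act_diff: "free_act \<rho> (a - b) f = free_act \<rho> a f - free_act \<rho> b f"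
  by (simp add: free_act_linext linext_diff)

lemma free_act_uminus: "free_act \<rho> (- a) f = - free_act \<rho> a f"
  by (simp add: free_act_linext linext_uminus)

lemma free_act_sum: "free_act \<rho> (sum F X) f = (\<Sum>x\<in>X. free_act \<rho> (F x) f)"
  by (simp add: free_act_linext linext_sum)

lemma free_act_fgen: "free_act \<rho> (fgen g) f = \<rho> g f"
  by (simp add: free_act_linext fgen_def)

lemma free_act_fscalar: "free_act \<rho> (fscalar a) f = pscale a f"
  by (simp add: free_act_linext fscalar_def zero_free_word_def)

lemma free_act_1: "free_act \<rho> 1 f = f"
  by (simp add: free_act_linext linext_one zero_free_word_def)

lemma free_act_0: "free_act \<rho> 0 f = 0"
  by (simp add: free_act_linext)

section \<open>Action of the free algebra, its relations and its subalgebras\<close>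

context cher begin

abbreviation "FA \<equiv> (free_algebra cherednik_gens :: (cgen, 'k) free_alg ring)"
abbreviation "FC \<equiv> carrier (free_algebra cherednik_gens :: (cgen, 'k) free_alg ring)"
abbreviation "J \<equiv> genideal FA cherednik_rels"

lemma Grpn_1_cases:
  assumes "A \<in> Grpn r 1 n"
  obtains w k where "w permutes {..<n}" "A = mk_mat r n w k"
  by (rule Grpn_cases[OF assms r_pos one_dvd]) (rule that)

text \<open>Statements on the generators are confined to \<open>polys n\<close>, where the exact
  quotients in \<open>dunkl\<close> are known to exist; the restriction persists through everything
  said about the action.\<close>

lemma gen_act_polys: "g \<in> cherednik_gens \<Longrightarrow> f \<in> polys n \<Longrightarrow> gen_act g f \<in> polys n"
  unfolding cherednik_gens_def
  by (auto elim!: Grpn_1_cases simp: group_act_mk_mat)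

lemma gen_act_add: "g \<in> cherednik_gens \<Longrightarrow> f \<in> polys n \<Longrightarrow> h \<in> polys n \<Longrightarrow>
    gen_act g (f + h) = gen_act g f + gen_act g h"
  unfolding cherednik_gens_def
  by (auto elim!: Grpn_1_cases simp: group_act_mk_mat D_add distrib_left)

lemma gen_act_pscale: "g \<in> cherednik_gens \<Longrightarrow> f \<in> polys n \<Longrightarrow> gen_act g (pscale a f) = pscale a (gen_act g f)"
  unfolding cherednik_gens_def
  by (auto elim!: Grpn_1_cases simp: group_act_mk_mat D_pscale pscale_mult_right)

lemma foldr_gen_act:
  assumes "set xs \<subseteq> cherednik_gens"
  shows "f \<in> polys n \<Longrightarrow> foldr gen_act xs f \<in> polys n"
    and "f \<in> polys n \<Longrightarrow> h \<in> polys n \<Longrightarrow> foldr gen_act xs (f + h) = foldr gen_act xs f + foldr gen_act xs h"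
    and "f \<in> polys n \<Longrightarrow> foldr gen_act xs (pscale a f) = pscale a (foldr gen_act xs f)"
proof -
  show P: "f \<in> polys n \<Longrightarrow> foldr gen_act xs f \<in> polys n" for f
    using assms by (induction xs) (auto simp: gen_act_polys)
  have Q: "set ys \<subseteq> set xs \<Longrightarrow> f \<in> polys n \<Longrightarrow> foldr gen_act ys f \<in> polys n" for ys f
    using assms by (induction ys) (auto intro!: gen_act_polys)
  have "set ys \<subseteq> set xs \<Longrightarrow> f \<in> polys n \<Longrightarrow> h \<in> polys n \<Longrightarrow>
     foldr gen_act ys (f + h) = foldr gen_act ys f + foldr gen_act ys h" for ys
    using assms by (induction ys) (auto simp: gen_act_add Q subset_iff)
  then show "f \<in> polys n \<Longrightarrow> h \<in> polys n \<Longrightarrow> foldr gen_act xs (f + h) = foldr gen_act xs f + foldr gen_act xs h" by simp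
  have "set ys \<subseteq> set xs \<Longrightarrow> f \<in> polys n \<Longrightarrow>
     foldr gen_act ys (pscale a f) = pscale a (foldr gen_act ys f)" for ys
    using assms by (induction ys) (auto simp: gen_act_pscale Q subset_iff)
  then show "f \<in> polys n \<Longrightarrow> foldr gen_act xs (pscale a f) = pscale a (foldr gen_act xs f)" by simp
qed

lemma foldr_gen_act_0: "set xs \<subseteq> cherednik_gens \<Longrightarrow> foldr gen_act xs 0 = 0"
  using foldr_gen_act(3)[of xs 0 0] by simp

lemma foldr_gen_act_sum:
  assumes "set xs \<subseteq> cherednik_gens" "\<And>x. x \<in> X \<Longrightarrow> F x \<in> polys n"
  shows "foldr gen_act xs (sum F X) = (\<Sum>x\<in>X. foldr gen_act xs (F x))"
  using assms(2)
  by (induction X rule: infinite_finite_induct) (auto simp: foldr_gen_act_0 foldr_gen_act(2) polys_sum assms(1))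

lemma free_act_polys [intro]: "a \<in> FC \<Longrightarrow> f \<in> polys n \<Longrightarrow> free_act gen_act a f \<in> polys n"
  unfolding free_act_def by (intro polys_sum polys_pscale foldr_gen_act(1)) (auto simp: free_algebra_carrier)

lemma free_act_add_right: "a \<in> FC \<Longrightarrow> f \<in> polys n \<Longrightarrow> g \<in> polys n \<Longrightarrow>
    free_act gen_act a (f + g) = free_act gen_act a f + free_act gen_act a g"
  unfolding free_act_def by (simp add: free_algebra_carrier foldr_gen_act(2) pscale_add_right sum.distrib)

lemma free_act_pscale_right: "a \<in> FC \<Longrightarrow> f \<in> polys n \<Longrightarrow>
    free_act gen_act a (pscale b f) = pscale b (free_act gen_act a f)"
  unfolding free_act_def by (simp add: free_algebra_carrier foldr_gen_act(3) pscale_sum_right mult.commute)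

text \<open>Concatenation of words is composition of operators, and linearity on
  \<open>polys n\<close> moves the coefficients of \<open>b\<close> through the words of
  \<open>a\<close>.\<close>

lemma free_act_mult:
  assumes "a \<in> FC" "b \<in> FC" "f \<in> polys n"
  shows "free_act gen_act (a * b) f = free_act gen_act a (free_act gen_act b f)"
proof -
  let ?W = "\<lambda>w f. foldr gen_act (letters w) f"
  have "a * b = (\<Sum>u\<in>supp a. \<Sum>v\<in>supp b. Poly_Mapping.single (u + v) (coef a u * coef b v))"
    using arg_cong2[OF poly_mapping_sum_single[of a] poly_mapping_sum_single[of b], of "(*)"]
    by (simp add: sum_product mult_single)
  then have "free_act gen_act (a * b) f =
      (\<Sum>u\<in>supp a. \<Sum>v\<in>supp b. pscale (coef a u * coef b v) (?W u (?W v f)))"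
    by (simp add: free_act_linext linext_sum plus_free_word_def)
  also have "\<dots> = (\<Sum>u\<in>supp a. pscale (coef a u) (\<Sum>v\<in>supp b. pscale (coef b v) (?W u (?W v f))))"
    by (simp add: pscale_sum_right)
  also have "\<dots> = (\<Sum>u\<in>supp a. pscale (coef a u) (?W u (\<Sum>v\<in>supp b. pscale (coef b v) (?W v f))))"
  proof (intro sum.cong refl arg_cong[where f = "pscale _"])
    fix u assume u: "u \<in> supp a"
    then have su: "set (letters u) \<subseteq> cherednik_gens" using assms by (simp add: free_algebra_carrier)
    have sv: "?W v f \<in> polys n" if "v \<in> supp b" for v
      using that assms by (intro foldr_gen_act(1)) (auto simp: free_algebra_carrier)
    show "(\<Sum>v\<in>supp b. pscale (coef b v) (?W u (?W v f))) = ?W u (\<Sum>v\<in>supp b. pscale (coef b v) (?W v f))"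
      using su sv by (simp add: foldr_gen_act_sum foldr_gen_act(3))
  qed
  finally show ?thesis by (simp add: free_act_def)
qed

lemma fgen_FC: "i < n \<Longrightarrow> FX i \<in> FC" "i < n \<Longrightarrow> FY i \<in> FC" "g \<in> Grpn r 1 n \<Longrightarrow> FT g \<in> FC"
  by (auto intro!: free_algebra_fgen simp: cherednik_gens_def)

lemma mk_mat_Grpn_1: "w permutes {..<n} \<Longrightarrow> mk_mat r n w k \<in> Grpn r 1 n"
  using mk_mat_in_Grpn_iff[OF r_pos, of 1] by simp

lemma refl_mat_Grpn_1: "i < n \<Longrightarrow> j < n \<Longrightarrow> i \<noteq> j \<Longrightarrow> refl_mat r n i j l \<in> Grpn r 1 n"
  by (simp add: refl_mat_mk mk_mat_Grpn_1 transpose_permutes_less)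

lemma zeta_mat_Grpn_1: "zeta_mat r n i l \<in> Grpn r 1 n"
  by (simp add: zeta_mat_mk mk_mat_Grpn_1 permutes_id)

lemma Grpn_1_mult:
  assumes "g \<in> Grpn r 1 n" "h \<in> Grpn r 1 n" shows "g * h \<in> Grpn r 1 n"
proof -
  obtain w k w' k' where "w permutes {..<n}" "g = mk_mat r n w k" "w' permutes {..<n}" "h = mk_mat r n w' k'"
    using assms by (meson Grpn_1_cases)
  then show ?thesis by (simp add: mk_mat_mult mk_mat_Grpn_1 permutes_compose)
qed

lemma group_act_mult:
  assumes "g \<in> Grpn r 1 n" "h \<in> Grpn r 1 n" "f \<in> polys n"
  shows "group_act g (group_act h f) = group_act (g * h) f"
proof -
  obtain w k w' k' where "w permutes {..<n}" "g = mk_mat r n w k" "w' permutes {..<n}" "h = mk_mat r n w' k'"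
    using assms by (meson Grpn_1_cases)
  then show ?thesis using assms(3)
    by (simp add: mk_mat_mult group_act_mk_mat permutes_compose ract_comp)
qed

lemma group_act_polys [intro]: "g \<in> Grpn r 1 n \<Longrightarrow> f \<in> polys n \<Longrightarrow> group_act g f \<in> polys n"
  by (erule Grpn_1_cases) (simp add: group_act_mk_mat)

lemma group_act_D:
  assumes g: "g \<in> Grpn r 1 n" and j: "j < n" and f: "f \<in> polys n"
  shows "group_act g (D j f) = (\<Sum>i<n. pscale (\<iota> (g $$ (i, j))) (D i (group_act g f)))"
proof -
  obtain w k where w: "w permutes {..<n}" and g: "g = mk_mat r n w k" using g by (rule Grpn_1_cases)
  have "(\<Sum>i<n. pscale (\<iota> (g $$ (i, j))) (D i (group_act g f))) =
     (\<Sum>i<n. if i = w j then pscale (zpow (k j)) (D (w j) (group_act g f)) else 0)"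
    using j by (intro sum.cong refl) (auto simp: g zpow_def)
  also have "\<dots> = pscale (zpow (k j)) (D (w j) (group_act g f))"
    using j permutes_less[OF w, of j] by (simp add: sum.delta)
  finally show ?thesis using ract_D[OF w j f] f j by (simp add: g group_act_mk_mat[OF w])
qed

lemma group_act_xvar: "group_act g (xvar j * f) = (\<Sum>i<n. pscale (\<iota> (inv_mat n g $$ (j, i))) (xvar i)) * group_act g f"
  by (simp add: group_act_def psubst_mult)

text \<open>This makes the polynomial representation well defined. The relations among the y_i are
  \<open>D_commute\<close>, conjugation of y_j by group elements is the equivariance
  \<open>group_act_D\<close>, and the mixed relations are \<open>D_xvar_neq\<close> and
  \<open>D_xvar_eq\<close>.\<close>

lemma rels_act:
  assumes "a \<in> cherednik_rels"
  shows "a \<in> FC" and "f \<in> polys n \<Longrightarrow> free_act gen_act a f = 0"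
proof -
  note FC = free_algebra_add free_algebra_diff free_algebra_mult free_algebra_sum fgen_FC
    refl_mat_Grpn_1 zeta_mat_Grpn_1 Grpn_1_mult
  note act = free_act_add free_act_diff free_act_sum free_act_mult free_act_fgen free_act_fscalar FC free_act_1
  from assms consider
    (x) i j where "a = FX i * FX j - FX j * FX i" "i < n" "j < n"
  | (y) i j where "a = FY i * FY j - FY j * FY i" "i < n" "j < n"
  | (one) "a = FT (1\<^sub>m n) - 1"
  | (gh) g h where "a = FT g * FT h - FT (g * h)" "g \<in> Grpn r 1 n" "h \<in> Grpn r 1 n"
  | (gx) g j where "a = FT g * FX j - (\<Sum>i<n. fscalar (\<iota> (inv_mat n g $$ (j, i))) * FX i) * FT g"
      "g \<in> Grpn r 1 n" "j < n"
  | (gy) g j where "a = FT g * FY j - (\<Sum>i<n. fscalar (\<iota> (g $$ (i, j))) * FY i) * FT g"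
      "g \<in> Grpn r 1 n" "j < n"
  | (yx) i j where "a = FY i * FX j - (FX j * FY i
        + fscalar (c 0) * (\<Sum>l<r. fscalar (zpow (- int l)) * FT (refl_mat r n i j l)))" "i < n" "j < n" "i \<noteq> j"
  | (yxi) i where "a = FY i * FX i - (FX i * FY i + fscalar \<kappa>
        - (\<Sum>l = 1..<r. fscalar (c l * (1 - zpow (- int l))) * FT (zeta_mat r n i (int l)))
        - fscalar (c 0) * (\<Sum>j\<in>{..<n} - {i}. \<Sum>l<r. FT (refl_mat r n i j l)))" "i < n"
    unfolding cherednik_rels_def by blast
  note cases = this
  have id: "1\<^sub>m n \<in> Grpn r 1 n" using mk_mat_Grpn_1[OF permutes_id, of "\<lambda>_. 0"] by (simp add: mk_mat_id)
  have refl_eq: "f \<in> polys n \<Longrightarrow> i < n \<Longrightarrow> (\<Sum>j\<in>{..<n} - {i}. \<Sum>l<r. group_act (refl_mat r n i j l) f)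
      = (\<Sum>j\<in>{..<n} - {i}. Rop i j f)" for f i
    unfolding Rop_def by (intro sum.cong refl) (auto simp: group_act_refl_mat)
  show "a \<in> FC"
    using cases
  proof cases
    case one then show ?thesis using id by (auto intro!: FC)
  next
    case (yxi i) then show ?thesis by (auto intro!: FC)
  qed (auto intro!: FC)
  show "free_act gen_act a f = 0" if f: "f \<in> polys n"
    using cases
  proof cases
    case (x i j) then show ?thesis using f by (simp add: act mult.left_commute)
  next
    case (y i j) then show ?thesis using f by (simp add: act D_commute)
  next
    case one
    have "group_act (1\<^sub>m n) f = f"
      using f group_act_mk_mat[OF permutes_id f, of "\<lambda>_. 0"] by (simp add: mk_mat_id ract_id)
    then show ?thesis using one f id by (simp add: act)
  next
    case (gh g h) then show ?thesis using f by (simp add: act group_act_mult)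
  next
    case (gx g j)
    have gf: "group_act g f \<in> polys n" using gx f by auto
    show ?thesis using gx f gf
      by (simp add: act group_act_xvar sum_distrib_right pscale_mult_left)
  next
    case (gy g j)
    have gf: "group_act g f \<in> polys n" using gy f by auto
    have "(\<Sum>i<n. fscalar (\<iota> (g $$ (i, j))) * FY i) \<in> FC"
      using gy by (intro free_algebra_sum) (auto intro!: FC)
    then show ?thesis using gy f gf by (simp add: act group_act_D)
  next
    case (yx i j)
    then show ?thesis using f by (simp add: act D_xvar_neq Rtw_def group_act_refl_mat)
  next
    case (yxi i)
    have FC': "(\<Sum>j\<in>{..<n} - {i}. \<Sum>l<r. FT (refl_mat r n i j l)) \<in> FC"
      using yxi by (intro free_algebra_sum) (auto intro!: FC)
    show ?thesis using yxi f FC'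
      by (simp add: act D_xvar_eq Cop_def group_act_zeta_mat refl_eq)
  qed
qed

lemma ring_FA: "ring FA" by (rule ring_free_algebra)

lemma rels_subset: "cherednik_rels \<subseteq> FC" using rels_act(1) by blast

lemma ideal_J: "ideal J FA" by (rule ring.genideal_ideal[OF ring_FA rels_subset])

text \<open>The elements of the free algebra acting by zero on \<open>polys n\<close> form a
  two-sided ideal; it contains the relations and therefore \<open>J\<close>.\<close>

lemma J_act:
  assumes "a \<in> J" shows "a \<in> FC" and "f \<in> polys n \<Longrightarrow> free_act gen_act a f = 0"
proof -
  let ?N = "{a \<in> FC. \<forall>f\<in>polys n. free_act gen_act a f = 0}"
  have "ideal ?N FA"
  proof (rule idealI[OF ring_FA])
    have "subgroup ?N (add_monoid FA)"
    proof (rule group.subgroupI)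
      show "Group.group (add_monoid FA)" by (rule abelian_group.a_group[OF ring.is_abelian_group[OF ring_FA]])
      fix a assume a: "a \<in> ?N"
      then have "inv\<^bsub>add_monoid FA\<^esub> a = - a" using a_inv_free_algebra[of a cherednik_gens] by (simp add: a_inv_def)
      then show "inv\<^bsub>add_monoid FA\<^esub> a \<in> ?N" using a by (simp add: free_algebra_uminus free_act_uminus)
    next
      show "?N \<noteq> {}" using free_act_0 by (auto intro!: exI[of _ 0])
    qed (auto simp: free_algebra_add free_act_add)
    then show "subgroup ?N (add_monoid FA)" .
  qed (auto simp: free_algebra_mult free_act_mult free_act_polys free_act_pscale_right[where b = 0, simplified])
  then have "J \<subseteq> ?N" using rels_act by (intro ring.genideal_minimal[OF ring_FA]) auto
  then show "a \<in> FC" "f \<in> polys n \<Longrightarrow> free_act gen_act a f = 0" using assms by auto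
qed

text \<open>The representative picked by \<open>SOME\<close> differs from \<open>a\<close> by an
  element of \<open>J\<close>, which acts by zero.\<close>

lemma poly_act_cclass:
  assumes "a \<in> FC" "f \<in> polys n"
  shows "poly_act (cclass a) f = free_act gen_act a f"
proof -
  have cc: "cclass a = J +>\<^bsub>FA\<^esub> a" by (simp add: cclass_def Let_def)
  have "a \<in> cclass a"
    unfolding cc mem_coset_iff[OF ideal_J assms(1)]
    using additive_subgroup.zero_closed[OF ideal.axioms(1)[OF ideal_J]] by force
  then have "(SOME b. b \<in> cclass a) \<in> cclass a" by (rule someI)
  then obtain h where "h \<in> J" "(SOME b. b \<in> cclass a) = h + a"
    unfolding cc mem_coset_iff[OF ideal_J assms(1)] by auto
  then show ?thesis using J_act(2) assms by (simp add: poly_act_def free_act_add)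
qed

lemma cclass_hom:
  "\<one>\<^bsub>cherednik_full\<^esub> = cclass 1"
  "a \<in> FC \<Longrightarrow> b \<in> FC \<Longrightarrow> cclass a \<oplus>\<^bsub>cherednik_full\<^esub> cclass b = cclass (a + b)"
  "a \<in> FC \<Longrightarrow> b \<in> FC \<Longrightarrow> cclass a \<otimes>\<^bsub>cherednik_full\<^esub> cclass b = cclass (a * b)"
  "a \<in> FC \<Longrightarrow> \<ominus>\<^bsub>cherednik_full\<^esub> cclass a = cclass (- a)"
proof -
  have h: "(+>\<^bsub>FA\<^esub>) J \<in> Ring.ring_hom FA (FA Quot J)" by (rule ideal.rcos_ring_hom[OF ideal_J])
  have full: "cherednik_full = FA Quot J" by (simp add: cherednik_full_def Let_def)
  have cc: "cclass = (+>\<^bsub>FA\<^esub>) J" by (rule ext) (simp add: cclass_def Let_def)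
  have ringQ: "ring (FA Quot J)" by (rule ideal.quotient_is_ring[OF ideal_J])
  show "\<one>\<^bsub>cherednik_full\<^esub> = cclass 1" unfolding full cc using ring_hom_one[OF h] by simp
  show "a \<in> FC \<Longrightarrow> b \<in> FC \<Longrightarrow> cclass a \<oplus>\<^bsub>cherednik_full\<^esub> cclass b = cclass (a + b)"
    unfolding full cc using ring_hom_add[OF h] by simp
  show "a \<in> FC \<Longrightarrow> b \<in> FC \<Longrightarrow> cclass a \<otimes>\<^bsub>cherednik_full\<^esub> cclass b = cclass (a * b)"
    unfolding full cc using ring_hom_mult[OF h] by simp
  show "a \<in> FC \<Longrightarrow> \<ominus>\<^bsub>cherednik_full\<^esub> cclass a = cclass (- a)"
  proof -
    assume a: "a \<in> FC"
    have cl: "cclass x \<in> carrier (FA Quot J)" if "x \<in> FC" for x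
      unfolding cc using ring_hom_closed[OF h that] .
    have "cclass (- a) \<oplus>\<^bsub>FA Quot J\<^esub> cclass a = \<zero>\<^bsub>FA Quot J\<^esub>"
      unfolding cc using ring_hom_add[OF h free_algebra_uminus[OF a] a] ring_hom_zero[OF h ring_FA ringQ] by simp
    then show "\<ominus>\<^bsub>cherednik_full\<^esub> cclass a = cclass (- a)"
      unfolding full
      by (intro abelian_group.minus_equality ring.is_abelian_group[OF ringQ] cl a free_algebra_uminus)
  qed
qed

lemma subalgebra_gen_subset:
  assumes "B \<subseteq> cclass ` FC" "h \<in> subalgebra_gen B" shows "h \<in> cclass ` FC"
  using assms(2) unfolding subalgebra_gen_def
proof (induction rule: generate_ring.induct)
  case one then show ?case by (simp add: cclass_hom)
next
  case (incl h) then show ?case using assms(1) by auto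
next
  case (a_inv h) then show ?case using free_algebra_uminus by (force simp: cclass_hom)
next
  case (eng_add h1 h2) then show ?case using free_algebra_add by (force simp: cclass_hom)
next
  case (eng_mult h1 h2) then show ?case using free_algebra_mult by (force simp: cclass_hom)
qed

text \<open>Reduces stability to the generators. The induction also carries that every element is
  the class of some element of \<open>FC\<close>, since only for such classes
  \<open>poly_act\<close> is computable.\<close>

lemma subalgebra_gen_stable:
  assumes B: "B \<subseteq> cclass ` FC"
    and U: "U \<subseteq> polys n" "\<And>u v. u \<in> U \<Longrightarrow> v \<in> U \<Longrightarrow> u + v \<in> U" "\<And>a u. u \<in> U \<Longrightarrow> pscale a u \<in> U"
    and act: "\<And>b u. b \<in> B \<Longrightarrow> u \<in> U \<Longrightarrow> poly_act b u \<in> U"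
    and h: "h \<in> subalgebra_gen B"
  shows "u \<in> U \<Longrightarrow> poly_act h u \<in> U"
proof -
  have "h \<in> cclass ` FC \<and> (\<forall>u\<in>U. poly_act h u \<in> U)"
    using h unfolding subalgebra_gen_def
  proof (induction rule: generate_ring.induct)
    case one
    then show ?case using U(1) by (auto simp: cclass_hom poly_act_cclass free_act_1 subset_iff)
  next
    case (incl h)
    then show ?case using B U(1,3) act by (auto simp: poly_act_cclass free_act_fscalar subset_iff)
  next
    case (a_inv h)
    then obtain a where a: "a \<in> FC" "h = cclass a" by auto
    have "poly_act (cclass (- a)) u \<in> U" if "u \<in> U" for u
    proof -
      have "poly_act (cclass (- a)) u = pscale (- 1) (poly_act h u)"
        using that U(1) a free_algebra_uminus[OF a(1)]
        by (auto simp: poly_act_cclass free_act_uminus pscale_minus_left subset_iff)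
      then show ?thesis using a_inv.IH that U(3) by metis
    qed
    then show ?case using a free_algebra_uminus by (auto simp: cclass_hom)
  next
    case (eng_add h1 h2)
    then obtain a b where a: "a \<in> FC" "h1 = cclass a" "b \<in> FC" "h2 = cclass b" by auto
    have "poly_act (cclass (a + b)) u = poly_act h1 u + poly_act h2 u" if "u \<in> U" for u
      using that U(1) a free_algebra_add[OF a(1,3)] by (auto simp: poly_act_cclass free_act_add subset_iff)
    then show ?case using a free_algebra_add[OF a(1,3)] eng_add.IH U(2) by (auto simp: cclass_hom)
  next
    case (eng_mult h1 h2)
    then obtain a b where a: "a \<in> FC" "h1 = cclass a" "b \<in> FC" "h2 = cclass b" by auto
    have "poly_act (cclass (a * b)) u = poly_act h1 (poly_act h2 u)" if "u \<in> U" for u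
    proof -
      have "u \<in> polys n" "free_act gen_act b u \<in> polys n" using that U(1) a by auto
      then show ?thesis using a free_algebra_mult[OF a(1,3)] by (simp add: poly_act_cclass free_act_mult)
    qed
    then show ?case using a free_algebra_mult[OF a(1,3)] eng_mult.IH by (auto simp: cclass_hom)
  qed
  then show "u \<in> U \<Longrightarrow> poly_act h u \<in> U" by blast
qed

lemma subalgebra_gen_incl: "b \<in> B \<Longrightarrow> b \<in> subalgebra_gen B" "cclass (fscalar a) \<in> subalgebra_gen B"
  unfolding subalgebra_gen_def by (auto intro: generate_ring.incl)

definition Z :: "nat \<Rightarrow> 'k mpol \<Rightarrow> 'k mpol" where
  "Z i f = D i (xvar i * f) + pscale (c 0) (\<Sum>j<i. Rop i j f)"

lemma z_elt_FC: "i < n \<Longrightarrow> FY i * FX i + fscalar (c 0) * (\<Sum>j<i. \<Sum>l<r. FT (refl_mat r n i j l)) \<in> FC"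
  by (intro free_algebra_add free_algebra_mult free_algebra_sum fgen_FC free_algebra_fscalar refl_mat_Grpn_1) auto

lemma poly_act_z: assumes "i < n" "f \<in> polys n" shows "poly_act (z_elt i) f = Z i f"
proof -
  have S: "(\<Sum>j<i. \<Sum>l<r. FT (refl_mat r n i j l)) \<in> FC"
    using assms by (intro free_algebra_sum fgen_FC refl_mat_Grpn_1) auto
  have "(\<Sum>j<i. \<Sum>l<r. group_act (refl_mat r n i j l) f) = (\<Sum>j<i. Rop i j f)"
    unfolding Rop_def using assms by (intro sum.cong refl) (auto simp: group_act_refl_mat)
  then show ?thesis using assms S
    by (simp add: z_elt_def poly_act_cclass z_elt_FC free_act_add free_act_mult free_act_sum free_act_fgen
      free_act_fscalar fgen_FC Z_def)
qed

lemma poly_act_T: "g \<in> Grpn r 1 n \<Longrightarrow> f \<in> polys n \<Longrightarrow> poly_act (cclass (FT g)) f = group_act g f"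
  by (simp add: poly_act_cclass fgen_FC free_act_fgen)

lemma poly_act_X: "i < n \<Longrightarrow> f \<in> polys n \<Longrightarrow> poly_act (cclass (FX i)) f = xvar i * f"
  by (simp add: poly_act_cclass fgen_FC free_act_fgen)

lemma poly_act_Y: "i < n \<Longrightarrow> f \<in> polys n \<Longrightarrow> poly_act (cclass (FY i)) f = D i f"
  by (simp add: poly_act_cclass fgen_FC free_act_fgen)

lemma poly_act_fscalar: "f \<in> polys n \<Longrightarrow> poly_act (cclass (fscalar a)) f = pscale a f"
  by (simp add: poly_act_cclass free_act_fscalar)

lemma poly_act_linear:
  assumes "h \<in> cclass ` FC" "f \<in> polys n" "g \<in> polys n"
  shows "poly_act h f \<in> polys n" "poly_act h (f + g) = poly_act h f + poly_act h g"
    "poly_act h (pscale a f) = pscale a (poly_act h f)"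
  using assms by (auto simp: poly_act_cclass free_act_add_right free_act_pscale_right)

lemma Z_polys [simp, intro]: "i < n \<Longrightarrow> f \<in> polys n \<Longrightarrow> Z i f \<in> polys n"
  unfolding Z_def by (intro polys_add polys_pscale polys_sum D_polys Rop_polys polys_mult polys_xvar) auto

lemma Z_add: "i < n \<Longrightarrow> f \<in> polys n \<Longrightarrow> g \<in> polys n \<Longrightarrow> Z i (f + g) = Z i f + Z i g"
  by (simp add: Z_def distrib_left D_add Rop_linear sum.distrib pscale_add_right)

lemma Z_pscale: "i < n \<Longrightarrow> f \<in> polys n \<Longrightarrow> Z i (pscale a f) = pscale a (Z i f)"
  by (simp add: Z_def pscale_mult_right D_pscale Rop_linear pscale_add_right pscale_sum_right mult.commute)

lemma Z_homog:
  assumes "i < n" "f \<in> polys n" "homog d f" shows "homog d (Z i f)"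
proof -
  have "homog (1 + d - 1) (D i (xvar i * f))"
    using assms by (intro D_homog homog_mult homog_xvar polys_mult polys_xvar) auto
  moreover have "homog d (\<Sum>j<i. Rop i j f)"
    unfolding Rop_def using assms by (intro homog_sum refl_homog) auto
  ultimately show ?thesis unfolding Z_def by (intro homog_add homog_pscale) auto
qed

end

section \<open>Spectrum and triangularity of the operators \<open>z\<^sub>i\<close>\<close>

text \<open>\<open>behind m i j\<close> says that the stable sort of \<open>m\<close> to a partition places position \<open>j\<close> to the right of
  \<open>i\<close>; hence \<open>behind_num n m i\<close> is the 0-based \<open>v_of n m i\<close>.\<close>

definition behind :: "(nat \<Rightarrow>\<^sub>0 nat) \<Rightarrow> nat \<Rightarrow> nat \<Rightarrow> bool" where
  "behind m i j \<longleftrightarrow> i < j \<and> coef m j \<le> coef m i \<or> j < i \<and> coef m j < coef m i"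

definition behind_num :: "nat \<Rightarrow> (nat \<Rightarrow>\<^sub>0 nat) \<Rightarrow> nat \<Rightarrow> nat" where
  "behind_num n m i = card {j. j < n \<and> behind m i j}"

text \<open>\<open>behind m\<close> is transitive and irreflexive, so everything behind j is behind
  i, and j itself is an additional element.\<close>

lemma behind_num_less:
  assumes "behind m i j" "j < n" shows "behind_num n m j < behind_num n m i"
proof -
  have "behind m i k" if "behind m j k" for k
    using assms that by (cases "k = i") (auto simp: behind_def)
  moreover have "\<not> behind m j j" by (simp add: behind_def)
  ultimately have "{k. k < n \<and> behind m j k} \<subset> {k. k < n \<and> behind m i k}"
    using assms by auto
  then show ?thesis unfolding behind_num_def by (intro psubset_card_mono) auto
qed

lemma behind_total: "i \<noteq> j \<Longrightarrow> behind m i j \<or> behind m j i"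
  by (auto simp: behind_def)

lemma behind_num_inj: "i \<noteq> j \<Longrightarrow> i < n \<Longrightarrow> j < n \<Longrightarrow> behind_num n m i \<noteq> behind_num n m j"
  using behind_total[of i j m] behind_num_less[of m i j n] behind_num_less[of m j i n] by auto

lemma behind_num_permute:
  assumes w: "w permutes {..<n}"
    and "\<And>j. j < n \<Longrightarrow> j \<noteq> i \<Longrightarrow> behind m' (w i) (w j) \<longleftrightarrow> behind m i j"
  shows "behind_num n m' (w i) = behind_num n m i"
proof -
  have inj: "w x = w y \<longleftrightarrow> x = y" for x y using permutes_inj[OF w] by (auto dest: injD)
  have irr: "\<not> behind m i i" "\<not> behind m' (w i) (w i)" by (auto simp: behind_def)
  have "{k. k < n \<and> behind m' (w i) k} = w ` {j. j < n \<and> behind m i j}"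
  proof (rule Set.set_eqI, rule iffI)
    fix k assume k: "k \<in> {k. k < n \<and> behind m' (w i) k}"
    have "w (pinv w k) = k" "pinv w k < n"
      using k permutes_inverses(1)[OF w] permutes_less[OF permutes_inv[OF w]] by auto
    then show "k \<in> w ` {j. j < n \<and> behind m i j}"
      using k assms(2)[of "pinv w k"] irr(2) by (metis (mono_tags, lifting) imageI mem_Collect_eq)
  next
    fix k assume "k \<in> w ` {j. j < n \<and> behind m i j}"
    then obtain j where "k = w j" "j < n" "behind m i j" by auto
    then show "k \<in> {k. k < n \<and> behind m' (w i) k}"
      using assms(2)[of j] irr(1) permutes_less[OF w, of j] by (cases "j = i") auto
  qed
  then show ?thesis unfolding behind_num_def by (simp add: card_image inj_on_def inj)
qed

section \<open>An order on exponents that isolates leading terms\<close>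

definition exp_norm :: "nat \<Rightarrow> (nat \<Rightarrow>\<^sub>0 nat) \<Rightarrow> nat" where
  "exp_norm n m = (\<Sum>i<n. coef m i ^ 2)"

definition exp_moment :: "nat \<Rightarrow> (nat \<Rightarrow>\<^sub>0 nat) \<Rightarrow> nat" where
  "exp_moment n m = (\<Sum>i<n. i * coef m i)"

text \<open>Stands in for the partial order on exponents. The sum of squares drops when two entries
  move closer together; between exponents of equal norm, such as rearrangements of each other, the
  one with the larger moment, whose big entries sit further right, is lower.\<close>

definition exp_lower :: "nat \<Rightarrow> (nat \<Rightarrow>\<^sub>0 nat) \<Rightarrow> (nat \<Rightarrow>\<^sub>0 nat) \<Rightarrow> bool" where
  "exp_lower n m' m \<longleftrightarrow> exp_norm n m' < exp_norm n m \<or>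
     exp_norm n m' = exp_norm n m \<and> exp_moment n m < exp_moment n m'"

definition upd2 :: "(nat \<Rightarrow>\<^sub>0 nat) \<Rightarrow> nat \<Rightarrow> nat \<Rightarrow> nat \<Rightarrow> nat \<Rightarrow> (nat \<Rightarrow>\<^sub>0 nat)" where
  "upd2 m i j a b = Poly_Mapping.update i a (Poly_Mapping.update j b m)"

lemma coef_upd2: "i \<noteq> j \<Longrightarrow> coef (upd2 m i j a b) k = (if k = i then a else if k = j then b else coef m k)"
  by (simp add: upd2_def lookup_update)

lemma sum_upd2:
  assumes "i \<noteq> j" "i < n" "j < n"
  shows "(\<Sum>k<n. F k (coef (upd2 m i j a b) k)) + F i (coef m i) + F j (coef m j) =
    (\<Sum>k<n. F k (coef m k)) + F i a + (F j b :: nat)"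
proof -
  have "(\<Sum>k<n. G k) = G i + (G j + (\<Sum>k\<in>{..<n} - {i} - {j}. G k))" for G :: "nat \<Rightarrow> nat"
    using assms by (subst sum.remove[of _ i], simp_all, subst sum.remove[of _ j]) auto
  from this[of "\<lambda>k. F k (coef (upd2 m i j a b) k)"] this[of "\<lambda>k. F k (coef m k)"]
  show ?thesis using assms(1) by (simp add: coef_upd2 cong: sum.cong_simp)
qed

text \<open>If the new entries exceed the smaller old one by u and v, the sum of squares drops by 2
  u v, because the sum of the two entries is kept.\<close>

lemma upd2_norm_less:
  assumes "i \<noteq> j" "i < n" "j < n" and "a + b = coef m i + coef m j"
    and "min (coef m i) (coef m j) < a" "min (coef m i) (coef m j) < b"
  shows "exp_lower n (upd2 m i j a b) m"
proof -
  have "a\<^sup>2 + b\<^sup>2 < (coef m i)\<^sup>2 + (coef m j)\<^sup>2"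
  proof -
    define x y where "x = coef m i" and "y = coef m j"
    have "int a * int a + int b * int b < int x * int x + int y * int y"
    proof (cases "x \<le> y")
      case True
      define u v where "u = int a - int x" and "v = int b - int x"
      have uv: "u > 0" "v > 0" "int y = int x + u + v" using assms(4-6) True by (auto simp: u_def v_def x_def y_def)
      have "int a = int x + u" "int b = int x + v" by (auto simp: u_def v_def)
      then show ?thesis using mult_pos_pos[OF uv(1,2)] uv(3) by (simp add: algebra_simps)
    next
      case False
      define u v where "u = int a - int y" and "v = int b - int y"
      have uv: "u > 0" "v > 0" "int x = int y + u + v" using assms(4-6) False by (auto simp: u_def v_def x_def y_def)
      have "int a = int y + u" "int b = int y + v" by (auto simp: u_def v_def)
      then show ?thesis using mult_pos_pos[OF uv(1,2)] uv(3) by (simp add: algebra_simps)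
    qed
    then have "int (a * a + b * b) < int (x * x + y * y)" by simp
    then show ?thesis by (simp only: of_nat_less_iff power2_eq_square x_def y_def)
  qed
  then have "exp_norm n (upd2 m i j a b) < exp_norm n m"
    using sum_upd2[OF assms(1-3), of "\<lambda>_ x. x ^ 2" m a b] by (simp add: exp_norm_def)
  then show ?thesis by (simp add: exp_lower_def)
qed

lemma upd2_swap_lower:
  assumes "i < j" "j < n" "coef m j < coef m i"
  shows "exp_lower n (upd2 m i j (coef m j) (coef m i)) m" "exp_lower n (upd2 m j i (coef m i) (coef m j)) m"
proof -
  have norm: "exp_norm n (upd2 m i j (coef m j) (coef m i)) = exp_norm n m"
    using sum_upd2[of i j n "\<lambda>_ x. x ^ 2" m "coef m j" "coef m i"] assms by (simp add: exp_norm_def)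
  define d where "d = coef m i - coef m j"
  have d: "coef m i = coef m j + d" "d > 0" using assms(3) by (auto simp: d_def)
  have "d * i < d * j" using assms(1) d(2) by simp
  moreover have "d * i + exp_moment n (upd2 m i j (coef m j) (coef m i)) = d * j + exp_moment n m"
    using sum_upd2[of i j n "\<lambda>k x. k * x" m "coef m j" "coef m i"] assms(1,2) d
    by (simp add: exp_moment_def algebra_simps)
  ultimately have "exp_moment n m < exp_moment n (upd2 m i j (coef m j) (coef m i))" by linarith
  then show "exp_lower n (upd2 m i j (coef m j) (coef m i)) m" using norm by (simp add: exp_lower_def)
  moreover have "upd2 m j i (coef m i) (coef m j) = upd2 m i j (coef m j) (coef m i)"
    using assms(1) by (intro poly_mapping_eqI) (auto simp: coef_upd2)
  ultimately show "exp_lower n (upd2 m j i (coef m i) (coef m j)) m" by simp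
qed

lemma mon_power: "xvar i ^ a = mon (Poly_Mapping.single i a)"
proof (induction a)
  case (Suc a)
  have "unit_exp i + Poly_Mapping.single i a = Poly_Mapping.single i (Suc a)"
    by (rule poly_mapping_eqI) (auto simp: lookup_add lookup_single when_def)
  then show ?case using Suc by (simp add: xvar_mult_mon)
qed simp

text \<open>The part of the monomial free of x_i and x_j. Reflections in these two indices fix it,
  which reduces the computation to two variables.\<close>

definition upd_base :: "(nat \<Rightarrow>\<^sub>0 nat) \<Rightarrow> nat \<Rightarrow> nat \<Rightarrow> 'k::field mpol" where
  "upd_base m i j = mon (upd2 m i j 0 0)"

lemma mon_upd2:
  assumes "i \<noteq> j"
  shows "mon (upd2 m i j a b) = (upd_base m i j * xvar i ^ a * xvar j ^ b :: 'k::field mpol)"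
proof -
  have "upd2 m i j 0 0 + Poly_Mapping.single i a + Poly_Mapping.single j b = upd2 m i j a b"
    using assms by (intro poly_mapping_eqI) (auto simp: lookup_add coef_upd2 lookup_single when_def)
  then show ?thesis by (simp add: mon_power mult_single upd_base_def)
qed

lemma pscale_power: "pscale a f ^ e = pscale (a ^ e) (f ^ e)"
  by (induction e) (auto simp: pscale_mult_left pscale_mult_right)

lemma upd2_same: "i \<noteq> j \<Longrightarrow> upd2 m i j (coef m i) (coef m j) = m"
  by (rule poly_mapping_eqI) (auto simp: coef_upd2)

lemma upd2_in_vars: "i \<noteq> j \<Longrightarrow> i < n \<Longrightarrow> j < n \<Longrightarrow> m \<in> in_vars n \<Longrightarrow> upd2 m i j a b \<in> in_vars n"
  by (auto simp: in_vars_iff coef_upd2)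

context cher begin

text \<open>The parameters d_j with the sum extended over all \<open>l\<close>; the added terms
  vanish by \<open>c_zero\<close>, so this is \<open>d_param\<close> without the division by
  \<open>p\<close>.\<close>

definition dz :: "int \<Rightarrow> 'k" where
  "dz j = (\<Sum>l = 1..<r. c l * zpow (int l * j))"

lemma d_param_dz: "d_param j = dz j"
proof -
  obtain q where q: "r = p * q" using p_dvd by blast
  have p: "0 < p" "r div p = q" using r_pos q by auto
  have "dz j = (\<Sum>l\<in>{l. 1 \<le> l \<and> l < r \<and> p dvd l}. c l * zpow (int l * j))"
    unfolding dz_def by (rule sum.mono_neutral_right) (auto simp: c_zero)
  also have "\<dots> = (\<Sum>l = 1..<q. c (l * p) * zpow (int (l * p) * j))"
    by (rule sum.reindex_bij_witness[where i = "\<lambda>l. l * p" and j = "\<lambda>l. l div p"])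
       (use p q in \<open>auto simp: mult.commute Suc_le_eq One_nat_def elim!: dvdE\<close>)
  finally show ?thesis by (simp add: d_param_def p)
qed

text \<open>The eigenvalue prescribed in \<open>jack\<close>, with the explicit count
  \<open>behind_num\<close> in place of \<open>v_of\<close>; the two are identified in
  \<open>v_of_eq\<close>.\<close>

definition ev :: "nat \<Rightarrow> (nat \<Rightarrow>\<^sub>0 nat) \<Rightarrow> 'k" where
  "ev i m = of_int (int (coef m i) + 1) * \<kappa> - (dz 0 - dz (- int (coef m i) - 1))
     - of_nat (r * behind_num n m i) * c 0"

definition low :: "(nat \<Rightarrow>\<^sub>0 nat) \<Rightarrow> 'k mpol set" where
  "low m = {f. \<forall>m'\<in>supp f. exp_lower n m' m}"

lemma low_0 [simp]: "0 \<in> low m" by (simp add: low_def)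

lemma low_add: "f \<in> low m \<Longrightarrow> g \<in> low m \<Longrightarrow> f + g \<in> low m"
  using keys_add[of f g] by (auto simp: low_def)

lemma low_pscale: "f \<in> low m \<Longrightarrow> pscale a f \<in> low m"
  using supp_pscale_subset[of a f] by (auto simp: low_def)

lemma low_uminus: "f \<in> low m \<Longrightarrow> - f \<in> low m"
  using low_pscale[of f m "- 1"] by (simp add: pscale_minus_left)

lemma low_sum: "(\<And>x. x \<in> A \<Longrightarrow> F x \<in> low m) \<Longrightarrow> sum F A \<in> low m"
  by (induction A rule: infinite_finite_induct) (auto simp: low_add)

lemma low_mon: "exp_lower n m' m \<Longrightarrow> mon m' \<in> low m"
  by (simp add: low_def)

definition zsum :: "int \<Rightarrow> 'k" where
  "zsum t = (\<Sum>l<r. zpow (int l * t))"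

lemma zsum_0 [simp]: "zsum 0 = of_nat r"
  by (simp add: zsum_def)

context
  fixes i j :: nat and m :: "nat \<Rightarrow>\<^sub>0 nat"
  assumes ij: "i \<noteq> j" "i < n" "j < n" and m: "m \<in> in_vars n"
begin

lemma refl_base: "refl i j l (upd_base m i j) = upd_base m i j"
proof -
  let ?b = "upd2 m i j 0 0"
  have b: "?b \<in> in_vars n" using upd2_in_vars ij m by simp
  have "exp_perm (Transposition.transpose i j) ?b = ?b"
    by (rule poly_mapping_eqI)
       (use ij in \<open>auto simp: coef_exp_perm[OF transpose_permutes_less[OF ij(2,3)]] coef_upd2 Transposition.transpose_def\<close>)
  moreover have "(\<Sum>k<n. refl_exp i j l k * int (coef ?b k)) = 0"
    by (rule sum.neutral) (use ij in \<open>auto simp: refl_exp_def coef_upd2\<close>)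
  ultimately show ?thesis
    unfolding refl_def upd_base_def by (subst ract_mon[OF transpose_permutes_less[OF ij(2,3)] b]) simp
qed

lemma refl_power: "refl i j l (f ^ e) = refl i j l f ^ e"
  by (induction e) auto

lemma zpow_power: "zpow a ^ e = zpow (int e * a)"
  by (simp add: zpow_of_nat_mult)

lemma refl_upd2:
  "refl i j l (mon (upd2 m i j a b)) = pscale (zpow (l * (int a - int b))) (mon (upd2 m i j b a))"
proof -
  have "refl i j l (mon (upd2 m i j a b)) =
     upd_base m i j * pscale (zpow l) (xvar j) ^ a * pscale (zpow (- l)) (xvar i) ^ b"
    using ij by (simp add: mon_upd2[OF ij(1)] refl_base refl_power refl_xvar)
  also have "\<dots> = pscale (zpow (int b * (- l)) * zpow (int a * l)) (upd_base m i j * xvar j ^ a * xvar i ^ b)"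
    by (simp only: pscale_power pscale_mult_left pscale_mult_right zpow_power pscale_pscale)
  also have "zpow (int b * (- l)) * zpow (int a * l) = zpow (l * (int a - int b))"
    by (subst zpow_add[symmetric]) (rule arg_cong[where f = zpow], simp add: algebra_simps)
  also have "upd_base m i j * xvar j ^ a * xvar i ^ b = mon (upd2 m i j b a)"
    by (simp add: mon_upd2[OF ij(1)] mult_ac)
  finally show ?thesis .
qed

lemma Rop_mon: "Rop i j (mon m) = pscale (zsum (int (coef m i) - int (coef m j))) (mon (upd2 m i j (coef m j) (coef m i)))"
  using refl_upd2[of _ "coef m i" "coef m j"] unfolding Rop_def upd2_same[OF ij(1)] by (simp add: pscale_sum_left zsum_def)

lemma xvar_mon_upd2: "xvar i * mon m = (mon (upd2 m i j (Suc (coef m i)) (coef m j)) :: 'k mpol)"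
proof -
  have "xvar i * mon (upd2 m i j (coef m i) (coef m j)) = (mon (upd2 m i j (Suc (coef m i)) (coef m j)) :: 'k mpol)"
    by (simp add: mon_upd2[OF ij(1)] mult_ac)
  then show ?thesis by (simp add: upd2_same[OF ij(1)])
qed

text \<open>Let Y = zeta^l x_j and N = m_i + 1 - m_j. The difference of the polynomial and its
  reflection is a common factor times x_i^N - Y^N, while \<open>dfac i j l\<close> is x_i - Y, so
  the quotient is a geometric sum.\<close>

lemma dd_xvar_mon_ge:
  assumes "coef m j \<le> Suc (coef m i)"
  shows "dd i j l (xvar i * mon m) = (\<Sum>t<Suc (coef m i) - coef m j. pscale (zpow (l * int t)) (mon (upd2 m i j (coef m i - t) (coef m j + t))))"
proof (rule dd_eqI[OF ij(1)])
  define N where "N = Suc (coef m i) - coef m j"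
  define B where "B = upd_base m i j * xvar i ^ coef m j * (xvar j ^ coef m j :: 'k mpol)"
  define Y where "Y = pscale (zpow l) (xvar j)"
  have trm: "pscale (zpow (l * int t)) (mon (upd2 m i j (coef m i - t) (coef m j + t))) = B * (xvar i ^ (N - Suc t) * Y ^ t)"
    if t: "t < N" for t
  proof -
    have "coef m i - t = coef m j + (N - Suc t)" using t assms by (auto simp: N_def)
    then have "mon (upd2 m i j (coef m i - t) (coef m j + t)) = B * (xvar i ^ (N - Suc t) * xvar j ^ t)"
      unfolding mon_upd2[OF ij(1)] B_def by (simp add: power_add mult_ac)
    then show ?thesis by (simp add: Y_def pscale_power zpow_power pscale_mult_right mult.commute)
  qed
  have "dfac i j l * (\<Sum>t<N. xvar i ^ (N - Suc t) * Y ^ t) = - ((Y - xvar i) * (\<Sum>t<N. xvar i ^ (N - Suc t) * Y ^ t))"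
    by (simp add: dfac_def Y_def left_diff_distrib)
  also have "\<dots> = xvar i ^ N - Y ^ N" by (simp add: power_diff_sumr2[symmetric])
  finally have "dfac i j l * (\<Sum>t<N. B * (xvar i ^ (N - Suc t) * Y ^ t)) = B * (xvar i ^ N - Y ^ N)"
    by (simp flip: sum_distrib_left add: mult.left_commute)
  also have "\<dots> = mon (upd2 m i j (Suc (coef m i)) (coef m j)) - pscale (zpow (l * int N)) (mon (upd2 m i j (coef m j) (Suc (coef m i))))"
  proof -
    have e: "Suc (coef m i) = coef m j + N" using assms by (simp add: N_def)
    show ?thesis unfolding mon_upd2[OF ij(1)] B_def e
      by (simp add: Y_def pscale_power zpow_power pscale_mult_right power_add right_diff_distrib mult_ac)
  qed
  also have "\<dots> = xvar i * mon m - refl i j l (xvar i * mon m)"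
    using assms unfolding xvar_mon_upd2 refl_upd2 by (simp add: N_def of_nat_diff)
  finally show "dfac i j l * (\<Sum>t<Suc (coef m i) - coef m j. pscale (zpow (l * int t)) (mon (upd2 m i j (coef m i - t) (coef m j + t)))) =
     xvar i * mon m - refl i j l (xvar i * mon m)"
    using trm by (simp add: N_def)
qed

text \<open>The same geometric sum up to a non-zero scalar, now with N = m_j - m_i - 1. In each of
  its terms the exponents of x_i and x_j exceed m_i and still add up to m_i + m_j, so
  \<open>upd2_norm_less\<close> applies.\<close>

lemma dd_xvar_mon_less:
  assumes "coef m i < coef m j"
  shows "dd i j l (xvar i * mon m) \<in> low m"
proof -
  define N where "N = coef m j - Suc (coef m i)"
  define B where "B = upd_base m i j * xvar i ^ Suc (coef m i) * (xvar j ^ Suc (coef m i) :: 'k mpol)"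
  define Y where "Y = pscale (zpow l) (xvar j)"
  define Q where "Q = pscale (zpow (- l * int N)) (\<Sum>t<N. B * (xvar i ^ (N - Suc t) * Y ^ t))"
  have "dd i j l (xvar i * mon m) = - Q"
  proof (rule dd_eqI[OF ij(1)])
    have "dfac i j l * (\<Sum>t<N. xvar i ^ (N - Suc t) * Y ^ t) = - ((Y - xvar i) * (\<Sum>t<N. xvar i ^ (N - Suc t) * Y ^ t))"
      by (simp add: dfac_def Y_def left_diff_distrib)
    also have "\<dots> = xvar i ^ N - Y ^ N" by (simp add: power_diff_sumr2[symmetric])
    finally have "dfac i j l * (\<Sum>t<N. B * (xvar i ^ (N - Suc t) * Y ^ t)) = B * (xvar i ^ N - Y ^ N)"
      by (simp flip: sum_distrib_left add: mult.left_commute)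
    then have "dfac i j l * - Q = pscale (zpow (- l * int N)) (B * Y ^ N) - pscale (zpow (- l * int N)) (B * xvar i ^ N)"
      by (simp add: Q_def pscale_mult_right right_diff_distrib pscale_diff_right)
    also have "pscale (zpow (- l * int N)) (B * Y ^ N) = B * xvar j ^ N"
      by (simp add: Y_def pscale_power zpow_power pscale_mult_right mult.commute)
    also have "B * xvar j ^ N - pscale (zpow (- l * int N)) (B * xvar i ^ N) =
       mon (upd2 m i j (Suc (coef m i)) (coef m j)) - pscale (zpow (- l * int N)) (mon (upd2 m i j (coef m j) (Suc (coef m i))))"
    proof -
      have e: "coef m j = Suc (coef m i) + N" using assms by (simp add: N_def)
      show ?thesis unfolding mon_upd2[OF ij(1)] B_def e
        by (simp only: power_add mult_ac)
    qed
    also have "\<dots> = xvar i * mon m - refl i j l (xvar i * mon m)"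
      using assms unfolding xvar_mon_upd2 refl_upd2 by (simp add: N_def of_nat_diff algebra_simps)
    finally show "dfac i j l * - Q = xvar i * mon m - refl i j l (xvar i * mon m)" .
  qed
  moreover have "B * (xvar i ^ (N - Suc t) * Y ^ t) \<in> low m" if t: "t < N" for t
  proof -
    have "B * (xvar i ^ (N - Suc t) * Y ^ t) =
        pscale (zpow (int t * l)) (mon (upd2 m i j (Suc (coef m i) + (N - Suc t)) (Suc (coef m i) + t)))"
      unfolding mon_upd2[OF ij(1)] B_def
      by (simp only: Y_def pscale_power zpow_power pscale_mult_right power_add mult_ac)
    moreover have "exp_lower n (upd2 m i j (Suc (coef m i) + (N - Suc t)) (Suc (coef m i) + t)) m"
      using t assms by (intro upd2_norm_less[OF ij]) (auto simp: N_def)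
    ultimately show ?thesis by (simp add: low_pscale low_mon)
  qed
  ultimately show ?thesis unfolding Q_def by (intro low_uminus low_pscale low_sum | simp add: low_uminus low_pscale low_sum)+
qed

text \<open>Contribution of the pair i, j to z_i, without the factor \<open>c 0\<close>. For m_i >
  m_j the geometric sum begins with r times the monomial itself, ends with \<open>Rop i j\<close> of
  it, and is lower in between. The end term is cancelled by the summand of z_i if j < i and is lower
  if i < j. For m_i = m_j both ends coincide and the position decides.\<close>

lemma pair_triangular:
  "- (\<Sum>l<r. dd i j (int l) (xvar i * mon m)) + (if j < i then Rop i j (mon m) else 0)
   + pscale (if behind m i j then of_nat r else 0) (mon m) \<in> low m"
proof (cases "coef m i < coef m j")
  case True
  have "(if j < i then Rop i j (mon m) else 0) \<in> low m"
  proof (cases "j < i")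
    case True
    then show ?thesis using \<open>coef m i < coef m j\<close> upd2_swap_lower(2)[of j i n m] ij
      by (simp add: Rop_mon low_pscale low_mon)
  qed simp
  moreover have "- (\<Sum>l<r. dd i j (int l) (xvar i * mon m)) \<in> low m"
    by (intro low_uminus low_sum dd_xvar_mon_less True)
  moreover have "\<not> behind m i j" using True by (auto simp: behind_def)
  ultimately show ?thesis by (simp only: if_False pscale_zero_left add_0_right low_add)
next
  case False
  then have ge: "coef m j \<le> coef m i" by simp
  have "(\<Sum>l<r. dd i j (int l) (xvar i * mon m)) =
      (\<Sum>l<r. \<Sum>t<Suc (coef m i) - coef m j. pscale (zpow (int l * int t)) (mon (upd2 m i j (coef m i - t) (coef m j + t))))"
    using ge by (intro sum.cong refl dd_xvar_mon_ge) simp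
  also have "\<dots> = (\<Sum>t<Suc (coef m i - coef m j). pscale (zsum (int t)) (mon (upd2 m i j (coef m i - t) (coef m j + t))))"
    using ge by (subst sum.swap) (simp add: pscale_sum_left Suc_diff_le zsum_def)
  finally have S: "(\<Sum>l<r. dd i j (int l) (xvar i * mon m)) = \<dots>" .
  show ?thesis
  proof (cases "coef m i = coef m j")
    case True
    have u: "upd2 m i j (coef m j) (coef m j) = m"
      using upd2_same[OF ij(1), of m] unfolding True .
    have "(\<Sum>l<r. dd i j (int l) (xvar i * mon m)) = pscale (of_nat r) (mon m)"
      unfolding S unfolding True by (simp add: u)
    moreover have "Rop i j (mon m) = pscale (of_nat r) (mon m)"
      unfolding Rop_mon unfolding True by (simp add: u)
    ultimately show ?thesis using True ij(1) by (auto simp: behind_def)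
  next
    case False
    then have gt: "coef m j < coef m i" using ge by simp
    let ?M = "\<lambda>t. pscale (zsum (int t)) (mon (upd2 m i j (coef m i - t) (coef m j + t)) :: 'k mpol)"
    obtain d where d: "coef m i - coef m j = Suc d" using gt by (metis Suc_diff_Suc)
    have "(\<Sum>t<Suc (coef m i - coef m j). ?M t) = ?M 0 + (\<Sum>t<d. ?M (Suc t)) + ?M (Suc d)"
      unfolding d by (subst sum.lessThan_Suc, subst sum.lessThan_Suc_shift) simp
    moreover have "?M 0 = pscale (of_nat r) (mon m)" by (simp add: upd2_same[OF ij(1)])
    moreover have "?M (Suc d) = Rop i j (mon m)"
      using gt by (simp add: Rop_mon of_nat_diff flip: d)
    ultimately have S2: "(\<Sum>l<r. dd i j (int l) (xvar i * mon m)) =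
        pscale (of_nat r) (mon m) + (\<Sum>t<d. ?M (Suc t)) + Rop i j (mon m)"
      unfolding S by simp
    have L: "(\<Sum>t<d. ?M (Suc t)) \<in> low m"
    proof (intro low_sum low_pscale low_mon upd2_norm_less[OF ij])
      fix t assume "t \<in> {..<d}"
      then show "coef m i - Suc t + (coef m j + Suc t) = coef m i + coef m j" "min (coef m i) (coef m j) < coef m i - Suc t" "min (coef m i) (coef m j) < coef m j + Suc t"
        using d by auto
    qed
    show ?thesis
    proof (cases "j < i")
      case True
      then show ?thesis using gt low_uminus[OF L] by (simp add: S2 behind_def)
    next
      case False
      then have "i < j" using ij(1) by simp
      then have "Rop i j (mon m) \<in> low m"
        using gt upd2_swap_lower(1)[of i j n m] ij by (simp add: Rop_mon low_pscale low_mon)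
      then show ?thesis using gt False \<open>i < j\<close> low_add[OF low_uminus[OF L] low_uminus]
        by (simp add: S2 behind_def)
    qed
  qed
qed

end

lemma zdd_xvar_mon:
  assumes "i < n" "m \<in> in_vars n"
  shows "zdd i l (xvar i * mon m) = pscale (1 - zpow (l * (- int (coef m i) - 1))) (mon m)"
proof (rule zdd_eqI)
  have "zact i l (mon m) = pscale (zpow (- (\<Sum>j<n. (if j = i then l else 0) * int (coef m j)))) (mon (exp_perm id m))"
    unfolding zact_def by (rule ract_mon[OF permutes_id assms(2)])
  also have "(\<Sum>j<n. (if j = i then l else 0) * int (coef m j)) = (\<Sum>j<n. if j = i then l * int (coef m i) else 0)"
    by (intro sum.cong refl) auto
  also have "exp_perm id m = m" by (rule poly_mapping_eqI) (simp add: coef_exp_perm[OF permutes_id])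
  finally have z: "zact i l (mon m) = pscale (zpow (- (l * int (coef m i)))) (mon m)"
    using assms by (simp add: sum.delta)
  have "zpow (- l) * zpow (- (l * int (coef m i))) = zpow (l * (- int (coef m i) - 1))"
    by (subst zpow_add[symmetric]) (rule arg_cong[where f = zpow], simp add: algebra_simps)
  then show "xvar i * pscale (1 - zpow (l * (- int (coef m i) - 1))) (mon m) =
      xvar i * mon m - zact i l (xvar i * mon m)"
    by (simp add: right_diff_distrib zact_xvar z mult.commute[of "zpow (- (l * int (coef m i)))"] pscale_mult_left pscale_mult_right pscale_diff_left)
qed

text \<open>The derivative gives (m_i + 1) \<kappa>, the cyclic reflections give - (d_0 - d_(- m_i -
  1)), and each position behind i gives - r * c 0 by \<open>pair_triangular\<close>.\<close>

lemma Z_triangular: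
  assumes i: "i < n" and m: "m \<in> in_vars n"
  shows "Z i (mon m) - pscale (ev i m) (mon m) \<in> low m"
proof -
  let ?T = "\<lambda>j. - (\<Sum>l<r. dd i j (int l) (xvar i * mon m)) + (if j < i then Rop i j (mon m) else 0)"
  have T: "?T j + pscale (if behind m i j then of_nat r else 0) (mon m) \<in> low m" if "j \<in> {..<n} - {i}" for j
    using pair_triangular[of i j m] that i m by auto
  have mp: "mon m \<in> polys n" using m by simp
  have pd: "pderivative i (xvar i * mon m) = pscale (of_nat (coef m i) + 1) (mon m :: 'k mpol)"
  proof -
    have "xvar i * pderivative i (mon m) = pscale (of_nat (coef m i)) (mon m :: 'k mpol)"
    proof (cases "coef m i = 0")
      case False
      have "xvar i * mon (m - unit_exp i) = (mon m :: 'k mpol)" using unit_exp_add_diff[OF False] by (simp add: xvar_mult_mon)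
      then show ?thesis by (simp add: pderivative_linext pscale_mult_right)
    qed (simp add: pderivative_linext)
    then show ?thesis by (simp add: pderivative_xvar pscale_add_left)
  qed
  have zz: "(\<Sum>l = 1..<r. pscale (c l) (zdd i (int l) (xvar i * mon m))) =
      pscale (dz 0 - dz (- int (coef m i) - 1)) (mon m)"
    by (simp add: zdd_xvar_mon[OF i m] dz_def pscale_sum_left[symmetric] sum_subtractf[symmetric] right_diff_distrib)
  have "(\<Sum>j<i. Rop i j (mon m)) = (\<Sum>j\<in>{..<n} - {i}. if j < i then Rop i j (mon m) else 0)"
    using i by (intro sum.mono_neutral_cong_left) auto
  then have sT: "(\<Sum>j\<in>{..<n} - {i}. ?T j) =
      - (\<Sum>j\<in>{..<n} - {i}. \<Sum>l<r. dd i j (int l) (xvar i * mon m)) + (\<Sum>j<i. Rop i j (mon m))"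
    by (simp add: sum_subtractf)
  have "(\<Sum>j\<in>{..<n} - {i}. if behind m i j then of_nat r else 0) = (of_nat (r * behind_num n m i) :: 'k)"
  proof -
    have "(\<Sum>j\<in>{..<n} - {i}. if behind m i j then of_nat r else 0) = (\<Sum>j\<in>{j. j < n \<and> behind m i j}. of_nat r :: 'k)"
      by (rule sum.mono_neutral_cong_right) (auto simp: behind_def)
    then show ?thesis by (simp add: behind_num_def mult.commute)
  qed
  then have bn: "(\<Sum>j\<in>{..<n} - {i}. pscale (if behind m i j then of_nat r else 0) (mon m :: 'k mpol)) =
      pscale (of_nat (r * behind_num n m i)) (mon m)"
    by (simp only: pscale_sum_left[symmetric])
  have "Z i (mon m) = pscale (\<kappa> * (of_nat (coef m i) + 1)) (mon m) - pscale (dz 0 - dz (- int (coef m i) - 1)) (mon m)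
     + pscale (c 0) (\<Sum>j\<in>{..<n} - {i}. ?T j)"
    unfolding sT Z_def dunkl_alt[OF i polys_mult[OF polys_xvar[OF i] mp]] pd zz
    by (simp add: pscale_add_right pscale_diff_right mult.commute)
  then have "Z i (mon m) - pscale (ev i m) (mon m) = pscale (c 0)
      (\<Sum>j\<in>{..<n} - {i}. ?T j + pscale (if behind m i j then of_nat r else 0) (mon m))"
    unfolding sum.distrib bn by (simp add: ev_def pscale_diff_left pscale_add_left pscale_add_right algebra_simps)
  then show ?thesis using T by (simp only:) (intro low_pscale low_sum, blast)
qed

lemma Z_sum: "i < n \<Longrightarrow> (\<And>x. x \<in> A \<Longrightarrow> F x \<in> polys n) \<Longrightarrow> Z i (sum F A) = (\<Sum>x\<in>A. Z i (F x))"
  using Z_pscale[of i 0 0]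
  by (induction A rule: infinite_finite_induct) (auto simp: Z_add polys_sum)

text \<open>Take an exponent of the support with maximal norm and, among these, minimal moment. By
  triangularity no other monomial of the support contributes to its coefficient, which is thus
  multiplied by \<open>ev i m\<close>.\<close>

lemma eigenvector_top:
  assumes f: "f \<in> polys n" "f \<noteq> 0" and E: "\<And>i. i < n \<Longrightarrow> Z i f = pscale (E i) f"
  obtains m where "m \<in> supp f" "\<And>i. i < n \<Longrightarrow> E i = ev i m" "\<And>m'. m' \<in> supp f \<Longrightarrow> \<not> exp_lower n m m'"
proof -
  have fin: "finite (supp f)" "supp f \<noteq> {}" using f by auto
  let ?N = "Max (exp_norm n ` supp f)"
  let ?A = "{m \<in> supp f. exp_norm n m = ?N}"
  have "?N \<in> exp_norm n ` supp f" using fin by (intro Max_in) auto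
  then have A: "finite ?A" "?A \<noteq> {}" by auto
  from ex_min_if_finite[of "exp_moment n ` ?A"] A
  obtain m where m: "m \<in> ?A" "\<And>m'. m' \<in> ?A \<Longrightarrow> \<not> exp_moment n m' < exp_moment n m" by (auto simp: image_iff)
  have top: "\<not> exp_lower n m m'" if "m' \<in> supp f" for m'
    using Max_ge[of "exp_norm n ` supp f" "exp_norm n m'"] fin m that by (auto simp: exp_lower_def)
  have "E i = ev i m" if i: "i < n" for i
  proof -
    have iv: "m' \<in> in_vars n" if "m' \<in> supp f" for m' using f(1) that by (auto simp: polys_def)
    have "Z i f = (\<Sum>m'\<in>supp f. pscale (coef f m') (Z i (mon m')))"
    proof -
      have "Z i (\<Sum>m'\<in>supp f. pscale (coef f m') (mon m')) = (\<Sum>m'\<in>supp f. pscale (coef f m') (Z i (mon m')))"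
        using iv i by (subst Z_sum) (auto simp: Z_pscale)
      then show ?thesis by (simp add: pscale_single flip: poly_mapping_sum_single)
    qed
    then have "coef (Z i f) m = (\<Sum>m'\<in>supp f. coef f m' * coef (Z i (mon m')) m)"
      by (simp add: lookup_sum)
    also have "\<dots> = (\<Sum>m'\<in>supp f. if m' = m then coef f m * ev i m else 0)"
    proof (intro sum.cong refl)
      fix m' assume m': "m' \<in> supp f"
      have "coef (Z i (mon m') - pscale (ev i m') (mon m')) m = 0"
        using Z_triangular[OF i iv[OF m']] top[OF m'] by (auto simp: low_def in_keys_iff)
      then show "coef f m' * coef (Z i (mon m')) m = (if m' = m then coef f m * ev i m else 0)"
        by (simp add: lookup_minus lookup_single when_def split: if_splits)
    qed
    also have "\<dots> = coef f m * ev i m" using m by (simp add: sum.delta)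
    finally have "E i * coef f m = coef f m * ev i m" using E[OF i] by simp
    then show ?thesis using m(1) by (simp add: in_keys_iff mult.commute)
  qed
  then show ?thesis using that[of m] m top by blast
qed

section \<open>Intertwining operators\<close>

abbreviation sw :: "nat \<Rightarrow> 'k mpol \<Rightarrow> 'k mpol" where "sw i \<equiv> refl i (Suc i) 0"

lemma Rop_sym: "i \<noteq> j \<Longrightarrow> f \<in> polys n \<Longrightarrow> Rop j i f = Rop i j f"
proof -
  assume "i \<noteq> j" and f: "f \<in> polys n"
  have "(\<Sum>l<r. refl i j (- 1 * int l + 0) f) = (\<Sum>l<r. refl i j (int l) f)"
    by (rule sum_periodic, rule refl_cong[OF f]) simp_all
  then show ?thesis using \<open>i \<noteq> j\<close> f by (simp add: Rop_def refl_sym[of f i j])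
qed

lemma refl_0_Rop:
  assumes "i \<noteq> j" "i < n" "j < n" "a \<noteq> b" "a < n" "b < n" "f \<in> polys n"
  shows "refl i j 0 (Rop a b f) = Rop (Transposition.transpose i j a) (Transposition.transpose i j b) (refl i j 0 f)"
  unfolding refl_def by (rule ract_Rop[OF transpose_permutes_less]) (use assms in auto)

lemma sw_sw: "Suc i < n \<Longrightarrow> f \<in> polys n \<Longrightarrow> sw i (sw i f) = f"
proof -
  assume f: "f \<in> polys n"
  have "sw i (sw i f) = ract id (\<lambda>j. 0) f"
    unfolding refl_def ract_comp[OF f] by (rule ract_cong[OF f]) (auto simp: refl_exp_def Transposition.transpose_def)
  then show ?thesis using f by (simp add: ract_id)
qed

context
  fixes i :: nat assumes i: "Suc i < n"
begin

lemma sw_D_xvar: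
  assumes "a < n" "f \<in> polys n"
  shows "sw i (D a (xvar a * f)) = D (Transposition.transpose i (Suc i) a)
     (xvar (Transposition.transpose i (Suc i) a) * sw i f)"
  using ract_D[OF transpose_permutes_less[of i n "Suc i"] assms(1), of "xvar a * f" "refl_exp i (Suc i) 0"] assms i
  by (simp add: refl_def refl_exp_def)

lemma sw_Z_other:
  assumes "a < n" "a \<noteq> i" "a \<noteq> Suc i" "f \<in> polys n"
  shows "Z a (sw i f) = sw i (Z a f)"
proof -
  let ?t = "Transposition.transpose i (Suc i)"
  have "sw i (\<Sum>j<a. Rop a j f) = (\<Sum>j<a. sw i (Rop a j f))" by (simp add: ract_sum refl_def)
  also have "\<dots> = (\<Sum>j<a. Rop a (?t j) (sw i f))"
    using assms i by (intro sum.cong refl) (subst refl_0_Rop, auto)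
  also have "\<dots> = (\<Sum>j<a. Rop a j (sw i f))"
  proof (cases "a < i")
    case True
    then show ?thesis by (intro sum.cong refl) (auto simp: Transposition.transpose_def)
  next
    case False
    then have "?t permutes {..<a}" using assms by (intro transpose_permutes_less) auto
    from sum.permute[OF this, of "\<lambda>j. Rop a j (sw i f)"] show ?thesis by (simp add: o_def)
  qed
  finally show ?thesis using assms i sw_D_xvar[OF assms(1,4)] by (simp add: Z_def)
qed

text \<open>z_(i+1) has one reflection summand more than the conjugate of z_i, the one with index i.
  This is the cross relation of a graded Hecke algebra.\<close>

lemma sw_Z_Suc:
  assumes f: "f \<in> polys n"
  shows "Z (Suc i) (sw i f) = sw i (Z i f) + pscale (c 0) (Rop i (Suc i) (sw i f))"
proof -
  have "sw i (\<Sum>j<i. Rop i j f) = (\<Sum>j<i. sw i (Rop i j f))" by (simp add: ract_sum refl_def)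
  also have "\<dots> = (\<Sum>j<i. Rop (Suc i) j (sw i f))"
    using f i by (intro sum.cong refl) (auto simp: refl_0_Rop)
  finally have "sw i (\<Sum>j<i. Rop i j f) = (\<Sum>j<i. Rop (Suc i) j (sw i f))" .
  then show ?thesis using f i sw_D_xvar[of i f] Rop_sym[of i "Suc i" "sw i f"]
    by (simp add: Z_def pscale_add_right)
qed

lemma sw_Z:
  assumes f: "f \<in> polys n"
  shows "Z i (sw i f) = sw i (Z (Suc i) f) - pscale (c 0) (Rop i (Suc i) (sw i f))"
proof -
  have "Z (Suc i) (sw i (sw i f)) = sw i (Z i (sw i f)) + pscale (c 0) (Rop i (Suc i) f)"
    using sw_Z_Suc[of "sw i f"] f i by (simp add: sw_sw)
  then have "sw i (Z (Suc i) f) = sw i (sw i (Z i (sw i f))) + pscale (c 0) (sw i (Rop i (Suc i) f))"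
    using f i by (simp add: sw_sw)
  moreover have "sw i (Rop i (Suc i) f) = Rop i (Suc i) (sw i f)"
    using f i by (simp add: refl_0_Rop Rop_sym[of i "Suc i"])
  ultimately show ?thesis using f i by (simp add: sw_sw)
qed

text \<open>Applying Z_i to s_i f leaves the extra term - c 0 \<pi> f; the multiple x f compensates
  it precisely when x (\<alpha> - \<beta>) = c 0 \<pi>. The condition is kept free of division so
  that x = 0 covers \<pi> = 0.\<close>

lemma tau_eigen:
  assumes f: "f \<in> polys n" and E: "Z i f = pscale \<alpha> f" "Z (Suc i) f = pscale \<beta> f"
    and P: "Rop i (Suc i) (sw i f) = pscale \<pi> f" and x: "x * (\<alpha> - \<beta>) = c 0 * \<pi>"
  shows "Z i (sw i f + pscale x f) = pscale \<beta> (sw i f + pscale x f)"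
    "Z (Suc i) (sw i f + pscale x f) = pscale \<alpha> (sw i f + pscale x f)"
proof -
  have "c 0 * \<pi> = x * \<alpha> - x * \<beta>" using x by (simp add: right_diff_distrib)
  then show "Z i (sw i f + pscale x f) = pscale \<beta> (sw i f + pscale x f)"
    "Z (Suc i) (sw i f + pscale x f) = pscale \<alpha> (sw i f + pscale x f)"
    using f i by (simp_all add: Z_add Z_pscale sw_Z sw_Z_Suc E P pscale_add_right pscale_diff_left mult.commute)
qed

lemma tau_eigen_other:
  assumes f: "f \<in> polys n" and a: "a < n" "a \<noteq> i" "a \<noteq> Suc i" and E: "Z a f = pscale \<alpha> f"
  shows "Z a (sw i f + pscale x f) = pscale \<alpha> (sw i f + pscale x f)"
  using assms i by (simp add: Z_add Z_pscale sw_Z_other E pscale_add_right mult.commute)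

text \<open>A reflection \<open>refl i (Suc i) l\<close> composed with \<open>sw i\<close> is
  diagonal and acts on \<open>f\<close> by zeta^(- l \<delta>), so the sum over \<open>l\<close> is
  \<open>r\<close> or 0. In the applications \<delta> is the difference of the exponents at i and i
  + 1, taken modulo \<open>r\<close>.\<close>

lemma Rop_sw:
  assumes f: "f \<in> polys n"
    and "\<And>l. ract id (\<lambda>b. if b = i then - l else if b = Suc i then l else 0) f = pscale (zpow (l * \<delta>)) f"
  shows "Rop i (Suc i) (sw i f) = pscale (if int r dvd \<delta> then of_nat r else 0) f"
proof -
  have "refl i (Suc i) l (sw i f) = ract id (\<lambda>b. if b = i then l else if b = Suc i then - l else 0) f" for l
    unfolding refl_def ract_comp[OF f]
    by (rule ract_cong[OF f]) (auto simp: refl_exp_def Transposition.transpose_def)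
  then have "refl i (Suc i) l (sw i f) = pscale (zpow (l * - \<delta>)) f" for l
    using assms(2)[of "- l"] by (simp add: minus_mult_commute cong: if_cong)
  then show ?thesis using sum_zpow[of "- \<delta>"] by (simp add: Rop_def flip: pscale_sum_left)
qed

end

section \<open>The affine intertwiner\<close>

definition cyc :: "nat \<Rightarrow> nat" where
  "cyc j = (if j = 0 then n - 1 else if j < n then j - 1 else j)"

lemma cyc_permutes: "cyc permutes {..<n}"
proof (rule bij_imp_permutes)
  show "bij_betw cyc {..<n} {..<n}"
    by (rule bij_betw_byWitness[where f' = "\<lambda>j. if j = n - 1 then 0 else Suc j"])
       (use n_pos in \<open>auto simp: cyc_def\<close>)
qed (use n_pos in \<open>auto simp: cyc_def\<close>)

text \<open>The affine intertwiner of Knop and Sahi.  Together with the operators \<open>sw i + x\<close> it produces every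
  Jack polynomial from \<open>1\<close> without introducing a pole at \<open>\<kappa> = 0\<close>.\<close>

definition Phi :: "'k mpol \<Rightarrow> 'k mpol" where
  "Phi f = xvar (n - 1) * ract cyc (\<lambda>j. 0) f"

definition exp_phi :: "(nat \<Rightarrow>\<^sub>0 nat) \<Rightarrow> (nat \<Rightarrow>\<^sub>0 nat)" where
  "exp_phi m = unit_exp (n - 1) + exp_perm cyc m"

lemma cyc_ract_D:
  assumes "a < n" "f \<in> polys n"
  shows "ract cyc (\<lambda>j. 0) (D a (xvar a * f)) = D (cyc a) (xvar (cyc a) * ract cyc (\<lambda>j. 0) f)"
  using ract_D[OF cyc_permutes assms(1), of "xvar a * f" "\<lambda>j. 0"] assms by simp

lemma Phi_polys [simp, intro]: "f \<in> polys n \<Longrightarrow> Phi f \<in> polys n"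
  using n_pos by (simp add: Phi_def cyc_permutes)

text \<open>Moving x_(n-1) past D_i creates the reflections between i and n - 1. Under the cyclic
  shift they come from those between i + 1 and 0, exactly the summand of z_(i+1) that the shifted
  sum of z_i lacks.\<close>

lemma Z_Phi:
  assumes f: "f \<in> polys n" and i: "Suc i < n"
  shows "Z i (Phi f) = Phi (Z (Suc i) f)"
proof -
  let ?N = "n - 1" and ?h = "ract cyc (\<lambda>j. 0) f"
  have h: "?h \<in> polys n" using f by (simp add: cyc_permutes)
  have N: "?N < n" "i < ?N" using i by auto
  have R: "Rtw i ?N (xvar i * ?h) = xvar ?N * Rop i ?N ?h"
    using N by (simp add: Rtw_def Rop_def refl_xvar sum_distrib_left pscale_mult_left)
  have R2: "Rop i j (xvar ?N * ?h) = xvar ?N * Rop i j ?h" if "j < i" for j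
    using N that by (simp add: Rop_def refl_xvar sum_distrib_left)
  have "Z i (Phi f) = xvar ?N * (D i (xvar i * ?h) + pscale (c 0) (Rop i ?N ?h) + pscale (c 0) (\<Sum>j<i. Rop i j ?h))"
    using h N by (simp add: Z_def Phi_def mult.left_commute[of "xvar i"] D_xvar_neq R R2 distrib_left
      pscale_mult_right sum_distrib_left)
  also have "D i (xvar i * ?h) = ract cyc (\<lambda>j. 0) (D (Suc i) (xvar (Suc i) * f))"
    using cyc_ract_D[of "Suc i" f] f i by (simp add: cyc_def)
  also have "(\<Sum>j<i. Rop i j ?h) = (\<Sum>j<i. ract cyc (\<lambda>j. 0) (Rop (Suc i) (Suc j) f))"
    using f i by (intro sum.cong refl) (simp add: ract_Rop[OF cyc_permutes], simp add: cyc_def)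
  also have "Rop i ?N ?h = ract cyc (\<lambda>j. 0) (Rop (Suc i) 0 f)"
    using f i by (simp add: ract_Rop[OF cyc_permutes]) (simp add: cyc_def)
  finally show ?thesis
    by (simp only: Z_def Phi_def sum.lessThan_Suc_shift ract_simps ract_sum pscale_add_right add.assoc)
qed

text \<open>The reflection sum in z_(n-1) runs over all other indices and cancels the one in the
  commutation relation of y_(n-1) and x_(n-1); only \<kappa> and the cyclic reflections
  survive.\<close>

lemma Z_Phi_last:
  assumes f: "f \<in> polys n"
  shows "Z (n - 1) (Phi f) = Phi (Z 0 f) + pscale \<kappa> (Phi f) - Cop (n - 1) (Phi f)"
proof -
  let ?N = "n - 1" and ?h = "ract cyc (\<lambda>j. 0) f"
  have h: "?h \<in> polys n" using f by (simp add: cyc_permutes)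
  have N: "?N < n" using n_pos by auto
  have set: "{..<n} - {?N} = {..<?N}" using n_pos by auto
  have "Z ?N (Phi f) = xvar ?N * D ?N (xvar ?N * ?h) + pscale \<kappa> (Phi f) - Cop ?N (Phi f)"
    using h N by (simp add: Z_def Phi_def D_xvar_eq set)
  also have "D ?N (xvar ?N * ?h) = ract cyc (\<lambda>j. 0) (D 0 (xvar 0 * f))"
    using cyc_ract_D[of 0 f] f n_pos by (simp add: cyc_def)
  finally show ?thesis by (simp add: Z_def Phi_def)
qed

lemma Cop_eigen:
  assumes "\<And>l. zact i l f = pscale (zpow (- l * \<delta>)) f"
  shows "Cop i f = pscale (dz (- \<delta>) - dz (- \<delta> - 1)) f"
proof -
  have "c l * (1 - zpow (- int l)) * zpow (- int l * \<delta>) = c l * zpow (int l * - \<delta>) - c l * zpow (int l * (- \<delta> - 1))" for l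
  proof -
    have "zpow (- int l) * zpow (- int l * \<delta>) = zpow (int l * (- \<delta> - 1))"
      by (subst zpow_add[symmetric]) (rule arg_cong[where f = zpow], simp add: algebra_simps)
    then show ?thesis by (simp add: algebra_simps)
  qed
  then show ?thesis by (simp add: Cop_def assms dz_def flip: pscale_sum_left sum_subtractf)
qed

lemma ract_id_weight:
  assumes f: "f \<in> polys n" and "\<And>m. m \<in> supp f \<Longrightarrow> (\<Sum>j<n. k j * int (coef m j)) mod int r = N mod int r"
  shows "ract id k f = pscale (zpow (- N)) f"
proof -
  have id: "exp_perm id m = m" for m by (rule poly_mapping_eqI) (simp add: coef_exp_perm[OF permutes_id])
  have "ract id k f = (\<Sum>m\<in>supp f. ract id k (pscale (coef f m) (mon m)))"
    by (subst (1) poly_mapping_sum_single[of f]) (simp add: ract_sum pscale_single flip: ract_simps(3))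
  also have "\<dots> = (\<Sum>m\<in>supp f. pscale (zpow (- N)) (pscale (coef f m) (mon m)))"
  proof (intro sum.cong refl)
    fix m assume m: "m \<in> supp f"
    then have "m \<in> in_vars n" using f by (auto simp: polys_def)
    moreover have "zpow (- (\<Sum>j<n. k j * int (coef m j))) = zpow (- N)"
      using assms(2)[OF m] by (intro zpow_cong) (metis mod_minus_cong)
    ultimately show "ract id k (pscale (coef f m) (mon m)) = pscale (zpow (- N)) (pscale (coef f m) (mon m))"
      by (simp only: ract_simps ract_mon[OF permutes_id] id pscale_pscale mult.commute)
  qed
  also have "\<dots> = pscale (zpow (- N)) (\<Sum>m\<in>supp f. Poly_Mapping.single m (coef f m))"
    by (simp add: pscale_sum_right pscale_single)
  finally show ?thesis by (simp flip: poly_mapping_sum_single)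
qed

end

section \<open>Eigenvectors with prescribed leading exponent\<close>

lemma coef_xvar_mult: "coef (xvar i * f) (unit_exp i + m) = coef f m"
proof -
  have "xvar i * f = (\<Sum>m'\<in>supp f. Poly_Mapping.single (unit_exp i + m') (coef f m'))"
    by (subst (1) poly_mapping_sum_single[of f]) (simp add: xvar_eq_mon sum_distrib_left mult_single)
  then have "coef (xvar i * f) (unit_exp i + m) = (\<Sum>m'\<in>supp f. if m' = m then coef f m else 0)"
    by (simp add: lookup_sum lookup_single when_def cong: if_cong)
  then show ?thesis by (auto simp: sum.delta in_keys_iff)
qed

lemma supp_xvar_mult:
  assumes "m \<in> supp (xvar i * f)" obtains m' where "m' \<in> supp f" "m = unit_exp i + m'"
  using keys_mult[of "xvar i" f] assms by (auto simp: xvar_eq_mon)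

lemma coef_xvar_mult_0: "coef m i = 0 \<Longrightarrow> coef (xvar i * f) m = 0"
  by (rule ccontr) (auto simp: in_keys_iff lookup_add elim!: supp_xvar_mult[unfolded in_keys_iff])

context cher begin

text \<open>The properties of a Jack polynomial that make sense for every \<kappa>. The congruence
  of all exponents modulo \<open>r\<close> encodes the weight under all diagonal matrices at once.
  Uniqueness is not built in; \<open>good_unique\<close> adds it where the eigenvalues separate
  exponents.\<close>

definition good :: "(nat \<Rightarrow>\<^sub>0 nat) \<Rightarrow> 'k mpol \<Rightarrow> bool" where
  "good \<mu> g \<longleftrightarrow> g \<in> polys n \<and> homog (mdeg \<mu>) g \<and>
     (\<forall>m\<in>supp g. \<forall>i<n. int (coef m i) mod int r = int (coef \<mu> i) mod int r) \<and>
     (\<forall>i<n. Z i g = pscale (ev i \<mu>) g) \<and> coef g \<mu> = 1"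

lemma good_0: "good 0 1"
proof -
  have "Z i 1 = pscale (ev i 0) 1" if i: "i < n" for i
  proof -
    let ?d = "Z i 1 - pscale (ev i 0) (1 :: 'k mpol)"
    have "?d \<in> low 0" using Z_triangular[OF i, of 0] by (simp add: in_vars_def)
    moreover have "homog 0 ?d"
      by (intro homog_diff homog_pscale Z_homog i) auto
    ultimately have *: "exp_lower n m 0 \<and> m = 0" if "m \<in> supp ?d" for m
      using that by (simp add: low_def homog_def)
    have False if "m \<in> supp ?d" for m
      using *[OF that] by (auto simp: exp_lower_def)
    then have "supp ?d = {}" by blast
    then show ?thesis by simp
  qed
  then show ?thesis by (auto simp: good_def)
qed

lemma cyc_pinv: "j < n \<Longrightarrow> cyc (if j = n - 1 then 0 else Suc j) = j"
  using n_pos by (auto simp: cyc_def)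

lemma coef_exp_phi:
  assumes "j < n" shows "coef (exp_phi m) (cyc j) = coef m j + (if j = 0 then 1 else 0)"
proof -
  have "cyc j = n - 1 \<longleftrightarrow> j = 0" using assms by (auto simp: cyc_def)
  then show ?thesis
    by (auto simp: exp_phi_def lookup_add coef_exp_perm[OF cyc_permutes] permutes_inverses[OF cyc_permutes])
qed

lemma exp_phi_less: "Suc i < n \<Longrightarrow> coef (exp_phi m) i = coef m (Suc i)"
  using coef_exp_phi[of "Suc i" m] by (simp add: cyc_def)

lemma exp_phi_last: "coef (exp_phi m) (n - 1) = coef m 0 + 1"
  using coef_exp_phi[of 0 m] n_pos by (simp add: cyc_def)

text \<open>Position 0 wins every tie, while the last position loses every tie; the increment by one
  of the entry that moves from the first to the last place compensates this.\<close>

lemma behind_num_phi: "i < n \<Longrightarrow> behind_num n (exp_phi m) (cyc i) = behind_num n m i"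
proof (rule behind_num_permute[OF cyc_permutes])
  fix j assume "i < n" "j < n" "j \<noteq> i"
  then show "behind (exp_phi m) (cyc i) (cyc j) \<longleftrightarrow> behind m i j"
    by (auto simp: behind_def coef_exp_phi) (auto simp: cyc_def split: if_splits)
qed

lemma ev_phi: "Suc i < n \<Longrightarrow> ev i (exp_phi m) = ev (Suc i) m"
  using behind_num_phi[of "Suc i" m] by (simp add: ev_def exp_phi_less cyc_def)

lemma ev_phi_last: "ev (n - 1) (exp_phi m) = ev 0 m + \<kappa> -
    (dz (- (int (coef m 0) + 1)) - dz (- (int (coef m 0) + 1) - 1))"
proof -
  have "behind_num n (exp_phi m) (n - 1) = behind_num n m 0"
    using behind_num_phi[of 0 m] n_pos by (simp add: cyc_def)
  moreover define X Y where "X = dz (- (int (coef m 0) + 1))" and "Y = dz (- (int (coef m 0) + 1) - 1)"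
  moreover have "- int (coef m 0) - 1 = - (int (coef m 0) + 1)"
    "- int (coef m 0 + 1) - 1 = - (int (coef m 0) + 1) - 1" by simp_all
  ultimately have E: "ev (n - 1) (exp_phi m) = of_int (int (coef m 0 + 1) + 1) * \<kappa> - (dz 0 - Y) - of_nat (r * behind_num n m 0) * c 0"
    "ev 0 m = of_int (int (coef m 0) + 1) * \<kappa> - (dz 0 - X) - of_nat (r * behind_num n m 0) * c 0"
    unfolding ev_def exp_phi_last by (simp_all only:)
  have "ev (n - 1) (exp_phi m) = ev 0 m + \<kappa> - (X - Y)" unfolding E by (simp add: algebra_simps)
  then show ?thesis by (simp only: X_def Y_def)
qed

lemma Phi_pscale: "Phi (pscale a f) = pscale a (Phi f)"
  by (simp add: Phi_def pscale_mult_right)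

lemma good_Phi:
  assumes g: "good \<mu> g" and \<mu>: "\<mu> \<in> in_vars n" shows "good (exp_phi \<mu>) (Phi g)"
proof -
  let ?h = "ract cyc (\<lambda>j. 0) g"
  have gp: "g \<in> polys n" and hom: "homog (mdeg \<mu>) g"
    and cg: "\<And>m i. m \<in> supp g \<Longrightarrow> i < n \<Longrightarrow> int (coef m i) mod int r = int (coef \<mu> i) mod int r"
    and Z: "\<And>i. i < n \<Longrightarrow> Z i g = pscale (ev i \<mu>) g" and c1: "coef g \<mu> = 1"
    using g by (auto simp: good_def)
  have sup: "\<exists>m'\<in>supp g. m = exp_phi m'" if "m \<in> supp (Phi g)" for m
    using that unfolding Phi_def exp_phi_def
    by (elim supp_xvar_mult) (auto simp: supp_ract[OF cyc_permutes gp])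
  have cong: "int (coef m i) mod int r = int (coef (exp_phi \<mu>) i) mod int r"
    if m: "m \<in> supp (Phi g)" and i: "i < n" for m i
  proof -
    obtain m' where m': "m' \<in> supp g" "m = exp_phi m'" using sup[OF m] by blast
    define j where "j = (if i = n - 1 then 0 else Suc i)"
    have j: "j < n" "i = cyc j" using cyc_pinv[OF i] i n_pos by (auto simp: j_def)
    have "(int (coef m' j) + (if j = 0 then 1 else 0)) mod int r = (int (coef \<mu> j) + (if j = 0 then 1 else 0)) mod int r"
      using cg[OF m'(1) j(1)] by (intro mod_add_cong) auto
    then show ?thesis using m'(2) j by (simp add: coef_exp_phi split: if_splits)
  qed
  have deg: "homog (mdeg (exp_phi \<mu>)) (Phi g)"
    using homog_mult[OF homog_xvar ract_homog[OF cyc_permutes gp hom]] \<mu>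
    by (simp add: Phi_def exp_phi_def mdeg_exp_perm[OF cyc_permutes])
  have Zl: "Z i (Phi g) = pscale (ev i (exp_phi \<mu>)) (Phi g)" if i: "i < n" for i
  proof (cases "Suc i < n")
    case True
    then show ?thesis using Z[of "Suc i"] gp by (simp add: Z_Phi ev_phi Phi_pscale)
  next
    case False
    then have i: "i = n - 1" using i by simp
    let ?\<delta> = "int (coef \<mu> 0) + 1"
    have "zact (n - 1) l (Phi g) = pscale (zpow (- l * ?\<delta>)) (Phi g)" for l
    proof -
      have "ract id (\<lambda>a. if a = n - 1 then l else 0) (Phi g) = pscale (zpow (- (l * ?\<delta>))) (Phi g)"
      proof (rule ract_id_weight)
        fix m assume m: "m \<in> supp (Phi g)"
        have "(\<Sum>j<n. (if j = n - 1 then l else 0) * int (coef m j)) = (\<Sum>j<n. if j = n - 1 then l * int (coef m (n - 1)) else 0)"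
          by (intro sum.cong refl) auto
        also have "\<dots> = l * int (coef m (n - 1))" using n_pos by (simp add: sum.delta)
        finally show "(\<Sum>j<n. (if j = n - 1 then l else 0) * int (coef m j)) mod int r = l * ?\<delta> mod int r"
          using cong[OF m, of "n - 1"] n_pos by (simp add: exp_phi_last) (metis mod_mult_right_eq)
      qed (use gp in auto)
      then show ?thesis by (simp add: zact_def)
    qed
    from Cop_eigen[OF this] show ?thesis
      using Z[of 0] gp n_pos unfolding i
      by (simp only: Z_Phi_last ev_phi_last pscale_diff_left pscale_add_left Phi_pscale)
  qed
  have "coef (Phi g) (exp_phi \<mu>) = 1"
    using coef_ract[OF cyc_permutes gp \<mu>, of "\<lambda>j. 0"] c1 by (simp add: Phi_def exp_phi_def coef_xvar_mult)
  then show ?thesis using gp cong deg Zl by (auto simp: good_def)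
qed

abbreviation tr :: "nat \<Rightarrow> nat \<Rightarrow> nat" where "tr i \<equiv> Transposition.transpose i (Suc i)"

lemma tr_permutes: "Suc i < n \<Longrightarrow> tr i permutes {..<n}"
  by (rule transpose_permutes_less) auto

lemma coef_exp_tr: "Suc i < n \<Longrightarrow> coef (exp_perm (tr i) m) j = coef m (tr i j)"
  by (simp add: coef_exp_perm[OF tr_permutes])

lemma behind_num_tr:
  assumes "Suc i < n" "coef m i \<noteq> coef m (Suc i)" "a < n"
  shows "behind_num n (exp_perm (tr i) m) (tr i a) = behind_num n m a"
proof (rule behind_num_permute[OF tr_permutes[OF assms(1)]])
  fix j assume "j < n" "j \<noteq> a"
  then show "behind (exp_perm (tr i) m) (tr i a) (tr i j) \<longleftrightarrow> behind m a j"
    using assms by (auto simp: behind_def coef_exp_tr Transposition.transpose_def)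
qed

lemma ev_tr:
  assumes "Suc i < n" "coef m i \<noteq> coef m (Suc i)" "a < n"
  shows "ev (tr i a) (exp_perm (tr i) m) = ev a m"
  by (simp add: ev_def behind_num_tr[OF assms] coef_exp_tr[OF assms(1)])

text \<open>The hypothesis \<open>top\<close> keeps the coefficient at the exchanged exponent equal
  to 1. A non-zero \<open>x\<close> occurs only if the exponents at i and i + 1 are congruent modulo
  \<open>r\<close>, so the summand \<open>pscale x g\<close> has the residues of the exchanged
  exponent as well.\<close>

lemma good_sw:
  assumes g: "good \<nu> g" and \<nu>: "\<nu> \<in> in_vars n" and i: "Suc i < n" and ne: "coef \<nu> i \<noteq> coef \<nu> (Suc i)"
    and top: "coef g (exp_perm (tr i) \<nu>) = 0"
    and x: "if int r dvd int (coef \<nu> i) - int (coef \<nu> (Suc i))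
       then x * (ev i \<nu> - ev (Suc i) \<nu>) = c 0 * of_nat r else x = 0"
  shows "good (exp_perm (tr i) \<nu>) (sw i g + pscale x g)"
proof -
  let ?\<mu> = "exp_perm (tr i) \<nu>" and ?g = "sw i g + pscale x g"
  let ?\<delta> = "int (coef \<nu> i) - int (coef \<nu> (Suc i))"
  have gp: "g \<in> polys n" and hom: "homog (mdeg \<nu>) g"
    and cg: "\<And>m i. m \<in> supp g \<Longrightarrow> i < n \<Longrightarrow> int (coef m i) mod int r = int (coef \<nu> i) mod int r"
    and Z: "\<And>i. i < n \<Longrightarrow> Z i g = pscale (ev i \<nu>) g" and c1: "coef g \<nu> = 1"
    using g by (auto simp: good_def)
  note tp = tr_permutes[OF i]
  have "ract id (\<lambda>b. if b = i then - l else if b = Suc i then l else 0) g = pscale (zpow (l * ?\<delta>)) g" for l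
  proof -
    have "ract id (\<lambda>b. if b = i then - l else if b = Suc i then l else 0) g = pscale (zpow (- (- l * ?\<delta>))) g"
    proof (rule ract_id_weight[OF gp])
      fix m assume m: "m \<in> supp g"
      let ?k = "\<lambda>b. if b = i then - l else if b = Suc i then l else 0"
      have "(\<Sum>j<n. ?k j * int (coef m j)) = (\<Sum>j\<in>{i, Suc i}. ?k j * int (coef m j))"
        using i by (intro sum.mono_neutral_right) auto
      also have "\<dots> = - l * (int (coef m i) - int (coef m (Suc i)))" by (simp add: algebra_simps)
      finally show "(\<Sum>j<n. ?k j * int (coef m j)) mod int r = - l * ?\<delta> mod int r"
        using mod_mult_cong[OF refl mod_diff_cong[OF cg[OF m, of i] cg[OF m, of "Suc i"]], of "- l"] i by simp
    qed
    then show ?thesis by simp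
  qed
  note P = Rop_sw[OF i gp this]
  have x': "x * (ev i \<nu> - ev (Suc i) \<nu>) = c 0 * (if int r dvd ?\<delta> then of_nat r else 0)"
    using x by (auto split: if_splits)
  have i': "i < n" using i by simp
  note tau = tau_eigen[OF i gp Z[OF i'] Z[OF i] P x']
  have Zg: "Z a ?g = pscale (ev a ?\<mu>) ?g" if a: "a < n" for a
  proof -
    consider "a = i" | "a = Suc i" | "a \<noteq> i" "a \<noteq> Suc i" by blast
    then show ?thesis
    proof cases
      case 1 then show ?thesis using tau(1) ev_tr[OF i ne i] by simp
    next
      case 2 then show ?thesis using tau(2) ev_tr[OF i ne i'] by simp
    next
      case 3 then show ?thesis using tau_eigen_other[OF i gp a 3 Z[OF a]] ev_tr[OF i ne a] by simp
    qed
  qed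
  have hg: "homog (mdeg ?\<mu>) ?g"
    unfolding mdeg_exp_perm[OF tp \<nu>] using i' i gp hom by (intro homog_add homog_pscale refl_homog)
  have cong: "int (coef m j) mod int r = int (coef ?\<mu> j) mod int r" if m: "m \<in> supp ?g" and j: "j < n" for m j
  proof -
    have tj: "tr i j < n" using permutes_less[OF tp] j by simp
    from m consider m' where "m' \<in> supp g" "m = exp_perm (tr i) m'" | "m \<in> supp g" "x \<noteq> 0"
      using keys_add[of "sw i g" "pscale x g"] supp_pscale_subset[of x g]
      by (cases "x = 0") (auto simp: refl_def supp_ract[OF tp gp])
    then show ?thesis
    proof cases
      case 1 then show ?thesis using cg[OF _ tj] by (simp add: coef_exp_tr[OF i])
    next
      case 2
      then have "int (coef \<nu> i) mod int r = int (coef \<nu> (Suc i)) mod int r"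
        using x by (auto simp: mod_eq_dvd_iff split: if_splits)
      then show ?thesis using cg[OF 2(1) j] by (auto simp: coef_exp_tr[OF i] Transposition.transpose_def)
    qed
  qed
  have "refl_exp i (Suc i) 0 = (\<lambda>_. 0)" by (auto simp: refl_exp_def fun_eq_iff)
  then have "coef (sw i g) ?\<mu> = 1"
    using coef_ract[OF tp gp \<nu>, of "refl_exp i (Suc i) 0"] c1 by (simp add: refl_def)
  then have "coef ?g ?\<mu> = 1" using top by (simp add: lookup_add)
  then show ?thesis using Zg hg cong gp i unfolding good_def by auto
qed

lemma swap_exp_lower:
  assumes "Suc i < n" "coef \<nu> i < coef \<nu> (Suc i)"
  shows "exp_lower n \<nu> (exp_perm (tr i) \<nu>)"
proof -
  let ?M = "exp_perm (tr i) \<nu>"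
  have M: "coef ?M i = coef \<nu> (Suc i)" "coef ?M (Suc i) = coef \<nu> i"
    by (simp_all add: coef_exp_tr[OF assms(1)])
  have "upd2 ?M i (Suc i) (coef ?M (Suc i)) (coef ?M i) = \<nu>"
    by (rule poly_mapping_eqI) (auto simp: coef_upd2 coef_exp_tr[OF assms(1)] Transposition.transpose_def)
  then show ?thesis using upd2_swap_lower(1)[of i "Suc i" n ?M] M assms by simp
qed

text \<open>A non-zero difference would be an eigenvector whose top exponent has the eigenvalues of
  \<mu>, so it is \<mu> by separation; but the two coefficients at \<mu> cancel.\<close>

lemma good_unique:
  assumes sep: "\<And>m. m \<in> in_vars n \<Longrightarrow> (\<And>i. i < n \<Longrightarrow> ev i m = ev i \<mu>) \<Longrightarrow> m = \<mu>"
    and g: "good \<mu> g" and f: "f \<in> polys n" "\<And>i. i < n \<Longrightarrow> Z i f = pscale (ev i \<mu>) f" "coef f \<mu> = 1"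
  shows "f = g"
proof (rule ccontr)
  assume "f \<noteq> g"
  have gp: "g \<in> polys n" and Z: "\<And>i. i < n \<Longrightarrow> Z i g = pscale (ev i \<mu>) g" and c1: "coef g \<mu> = 1"
    using g by (auto simp: good_def)
  have Zd: "Z i (f - g) = pscale (ev i \<mu>) (f - g)" if "i < n" for i
  proof -
    have "Z i (f + pscale (- 1) g) = Z i f + pscale (- 1) (Z i g)"
      using that f(1) gp by (simp only: Z_add Z_pscale polys_pscale)
    then show ?thesis using f(2)[OF that] Z[OF that] by (simp add: pscale_minus_left pscale_diff_right)
  qed
  obtain m where m: "m \<in> supp (f - g)" "\<And>i. i < n \<Longrightarrow> ev i \<mu> = ev i m"
    by (rule eigenvector_top[of "f - g" "\<lambda>i. ev i \<mu>"]) (use f(1) gp \<open>f \<noteq> g\<close> Zd in auto)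
  moreover have "m \<in> in_vars n" using m(1) polys_diff[OF f(1) gp] by (auto simp: polys_def)
  ultimately have "m = \<mu>" using sep[of m] m(2) by simp
  then show False using m(1) f(3) c1 by (simp add: in_keys_iff lookup_minus)
qed

text \<open>By separation the top exponent of \<open>g\<close> is \<nu>, and \<nu> is lower than its
  exchange, which therefore cannot occur in \<open>g\<close>.\<close>

lemma good_swap_coef:
  assumes sep: "\<And>m. m \<in> in_vars n \<Longrightarrow> (\<And>i. i < n \<Longrightarrow> ev i m = ev i \<nu>) \<Longrightarrow> m = \<nu>"
    and g: "good \<nu> g" and "Suc i < n" "coef \<nu> i < coef \<nu> (Suc i)"
  shows "coef g (exp_perm (tr i) \<nu>) = 0"
proof -
  have gp: "g \<in> polys n" and Z: "\<And>i. i < n \<Longrightarrow> Z i g = pscale (ev i \<nu>) g" and "g \<noteq> 0"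
    using g by (auto simp: good_def)
  then obtain m where m: "m \<in> supp g" "\<And>i. i < n \<Longrightarrow> ev i \<nu> = ev i m" "\<And>m'. m' \<in> supp g \<Longrightarrow> \<not> exp_lower n m m'"
    using eigenvector_top[of g "\<lambda>i. ev i \<nu>"] by metis
  then have "m = \<nu>" using sep[of m] gp by (auto simp: polys_def)
  then show ?thesis using m(3) swap_exp_lower[OF assms(3,4)] by (auto simp: in_keys_iff)
qed

end

section \<open>The shortest sorting permutation\<close>

lemma permutes_rank: "w permutes {..<n} \<Longrightarrow> a < n \<Longrightarrow> w a = card {b. b < n \<and> w b < w a}"
proof -
  assume w: "w permutes {..<n}" and a: "a < n"
  have "w ` {b. b < n \<and> w b < w a} = {..<w a}"
  proof (rule Set.set_eqI, rule iffI)
    fix x assume x: "x \<in> {..<w a}"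
    then have "x < n" using permutes_less[OF w, of a] a by simp
    then have "pinv w x < n" "w (pinv w x) = x"
      using permutes_less[OF permutes_inv[OF w]] permutes_inverses(1)[OF w] by auto
    then show "x \<in> w ` {b. b < n \<and> w b < w a}" using x by (metis (mono_tags, lifting) imageI lessThan_iff mem_Collect_eq)
  qed auto
  then have "card (w ` {b. b < n \<and> w b < w a}) = w a" by simp
  then show ?thesis using permutes_inj[OF w] by (simp add: card_image inj_on_subset)
qed

text \<open>The position that the stable decreasing sort assigns to \<open>i\<close>, hence the
  expected inverse of \<open>w_of\<close>.\<close>

definition sort_pos :: "nat \<Rightarrow> (nat \<Rightarrow>\<^sub>0 nat) \<Rightarrow> nat \<Rightarrow> nat" where
  "sort_pos n m i = (if i < n then n - 1 - behind_num n m i else i)"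

lemma behind_num_le: "i < n \<Longrightarrow> behind_num n m i \<le> n - 1"
proof -
  assume "i < n"
  then have "{j. j < n \<and> behind m i j} \<subseteq> {..<n} - {i}" by (auto simp: behind_def)
  then have "card {j. j < n \<and> behind m i j} \<le> card ({..<n} - {i})" by (intro card_mono) auto
  then show ?thesis using \<open>i < n\<close> by (simp add: behind_num_def)
qed

lemma sort_pos_permutes: "sort_pos n m permutes {..<n}"
proof (rule bij_imp_permutes)
  have inj: "inj_on (sort_pos n m) {..<n}"
  proof (rule inj_onI)
    fix x y assume "x \<in> {..<n}" "y \<in> {..<n}" "sort_pos n m x = sort_pos n m y"
    then have xy: "x < n" "y < n" "n - 1 - behind_num n m x = n - 1 - behind_num n m y" by (auto simp: sort_pos_def)
    then have "behind_num n m x = behind_num n m y" using behind_num_le[OF xy(1)] behind_num_le[OF xy(2)] by (metis diff_diff_cancel)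
    then show "x = y" using behind_num_inj[of x y n m] xy by auto
  qed
  moreover have "sort_pos n m ` {..<n} \<subseteq> {..<n}" by (auto simp: sort_pos_def)
  ultimately show "bij_betw (sort_pos n m) {..<n} {..<n}" by (simp add: bij_betw_def endo_inj_surj)
qed (simp add: sort_pos_def)

lemma sort_pos_less: "a < n \<Longrightarrow> b < n \<Longrightarrow> a \<noteq> b \<Longrightarrow> sort_pos n m a < sort_pos n m b \<longleftrightarrow> behind m a b"
  using behind_num_less[of m a b n] behind_num_less[of m b a n] behind_total[of a b m] behind_num_le[of a n m] behind_num_le[of b n m]
  by (auto simp: sort_pos_def)

lemma inversions_alt:
  assumes w: "w permutes {..<n}"
  shows "inversions n w = card {(a, b). a < b \<and> b < n \<and> pinv w b < pinv w a}"
proof -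
  let ?S = "{(i, j). i < j \<and> j < n \<and> w j < w i}" and ?f = "\<lambda>(i, j). (w j, w i)"
  have inj: "w x = w y \<longleftrightarrow> x = y" for x y using permutes_inj[OF w] by (auto dest: injD)
  have "{(a, b). a < b \<and> b < n \<and> pinv w b < pinv w a} = ?f ` ?S"
  proof (rule Set.set_eqI, rule iffI)
    fix x assume "x \<in> {(a, b). a < b \<and> b < n \<and> pinv w b < pinv w a}"
    then obtain a b where x: "x = (a, b)" "a < b" "b < n" "pinv w b < pinv w a" by blast
    then have "pinv w a < n" using permutes_less[OF permutes_inv[OF w], of a] by simp
    then have "(pinv w b, pinv w a) \<in> ?S" using x by (simp add: permutes_inverses(1)[OF w])
    moreover have "x = ?f (pinv w b, pinv w a)" using x by (simp add: permutes_inverses(1)[OF w])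
    ultimately show "x \<in> ?f ` ?S" by (rule rev_image_eqI)
  next
    fix x assume "x \<in> ?f ` ?S"
    then obtain i j where x: "x = (w j, w i)" "i < j" "j < n" "w j < w i" by auto
    then show "x \<in> {(a, b). a < b \<and> b < n \<and> pinv w b < pinv w a}"
      using permutes_less[OF w, of i] by (simp add: permutes_inverses(2)[OF w])
  qed
  moreover have "inj_on ?f ?S" by (auto simp: inj_on_def inj)
  ultimately show ?thesis by (simp add: inversions_def card_image)
qed

text \<open>Every sorting permutation must invert the pairs a < b with a smaller entry at a, and the
  stable sort inverts no others. A shortest one therefore has the same set of inversions, and this
  set determines the relative order of all values of the inverse.\<close>

lemma pinv_w_of:
  assumes i: "i < n" shows "pinv (w_of n m) i = sort_pos n m i"
proof -
  let ?P = "\<lambda>w. w permutes {..<n} \<and> (\<forall>i j. i \<le> j \<and> j < n \<longrightarrow> coef m (w j) \<le> coef m (w i))"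
  let ?A = "{(a, b). a < b \<and> b < n \<and> coef m a < coef m b}"
  let ?B = "\<lambda>w. {(a, b). a < b \<and> b < n \<and> pinv w b < pinv w a}"
  define W where "W = pinv (sort_pos n m)"
  note sp = sort_pos_permutes[of n m]
  have W: "W permutes {..<n}" unfolding W_def by (rule permutes_inv[OF sp])
  have Winv: "pinv W = sort_pos n m" unfolding W_def by (rule permutes_inv_inv[OF sp])
  have PW: "?P W"
  proof (intro conjI allI impI)
    fix i j assume ij: "i \<le> j \<and> j < n"
    show "coef m (W j) \<le> coef m (W i)"
    proof (rule ccontr)
      assume lt: "\<not> coef m (W j) \<le> coef m (W i)"
      then have "W j \<noteq> W i" by auto
      then have "behind m (W j) (W i)" using lt by (auto simp: behind_def linorder_neq_iff)
      then have "sort_pos n m (W j) < sort_pos n m (W i)"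
        using ij \<open>W j \<noteq> W i\<close> permutes_less[OF W] sort_pos_less[of "W j" n "W i" m] by auto
      then show False using ij permutes_inverses(1)[OF sp] by (simp add: W_def)
    qed
  qed (rule W)
  have BW: "?B W = ?A"
  proof -
    have "pinv W b < pinv W a \<longleftrightarrow> coef m a < coef m b" if "a < b" "b < n" for a b
      using sort_pos_less[of b n a m] that by (auto simp: Winv behind_def)
    then show ?thesis by blast
  qed
  have fin: "finite {(a, b). a < b \<and> b < n \<and> Q a b}" for Q
    by (rule finite_subset[of _ "{..<n} \<times> {..<n}"]) auto
  have arg: "?P (w_of n m)" "inversions n (w_of n m) \<le> inversions n W"
  proof -
    have e: "w_of n m = arg_min (inversions n) ?P" by (simp only: w_of_def)
    have a: "?P (arg_min (inversions n) ?P) \<and>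
        (\<forall>y. ?P y \<longrightarrow> inversions n (arg_min (inversions n) ?P) \<le> inversions n y)"
      by (rule arg_min_nat_lemma[of ?P W, OF PW])
    show "?P (w_of n m)" unfolding e by (rule conjunct1[OF a])
    show "inversions n (w_of n m) \<le> inversions n W"
      unfolding e by (rule mp[OF spec[OF conjunct2[OF a], of W] PW])
  qed
  let ?w = "w_of n m"
  have w: "?w permutes {..<n}" using arg(1) by blast
  have sub: "?A \<subseteq> ?B ?w"
  proof clarify
    fix a b assume ab: "a < b" "b < n" "coef m a < coef m b"
    show "pinv ?w b < pinv ?w a"
    proof (rule ccontr)
      assume "\<not> pinv ?w b < pinv ?w a"
      then have "pinv ?w a \<le> pinv ?w b" "pinv ?w b < n" using permutes_less[OF permutes_inv[OF w]] ab by auto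
      then have "coef m (?w (pinv ?w b)) \<le> coef m (?w (pinv ?w a))" using arg(1) by blast
      then show False using ab by (simp add: permutes_inverses[OF w])
    qed
  qed
  have "card (?B ?w) \<le> card ?A" using arg(2) by (simp add: inversions_alt[OF w] inversions_alt[OF W] BW)
  with sub have BA: "?B ?w = ?A" by (intro card_seteq[symmetric] fin)
  have order: "pinv ?w a < pinv ?w b \<longleftrightarrow> sort_pos n m a < sort_pos n m b" if "a < n" "b < n" for a b
  proof -
    have inj: "pinv ?w a = pinv ?w b \<longleftrightarrow> a = b" using permutes_inj[OF permutes_inv[OF w]] by (auto dest: injD)
    have "(a, b) \<in> ?B ?w \<longleftrightarrow> (a, b) \<in> ?B W" "(b, a) \<in> ?B ?w \<longleftrightarrow> (b, a) \<in> ?B W" using BA BW by auto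
    moreover have inj': "sort_pos n m a = sort_pos n m b \<longleftrightarrow> a = b" using permutes_inj[OF sp] by (auto dest: injD)
    ultimately show ?thesis using that inj unfolding Winv by (cases a b rule: linorder_cases) auto
  qed
  have "pinv ?w i = card {b. b < n \<and> pinv ?w b < pinv ?w i}"
    by (rule permutes_rank[OF permutes_inv[OF w] i])
  also have "{b. b < n \<and> pinv ?w b < pinv ?w i} = {b. b < n \<and> sort_pos n m b < sort_pos n m i}"
    using order i by auto
  also have "card \<dots> = sort_pos n m i" by (rule permutes_rank[OF sp i, symmetric])
  finally show ?thesis .
qed

lemma v_of_eq: "i < n \<Longrightarrow> v_of n m i = behind_num n m i"
  using behind_num_le[of i n m] by (simp add: v_of_def pinv_w_of sort_pos_def)

section \<open>Specialization at \<open>\<kappa> = 0\<close>\<close>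

text \<open>The local ring of K(\<kappa>) at \<kappa> = 0; \<open>spec0\<close> is its residue
  map.\<close>

definition reg :: "'k::field poly fract \<Rightarrow> bool" where
  "reg q \<longleftrightarrow> (\<exists>u w. q = Fract u w \<and> poly w 0 \<noteq> 0)"

lemma spec0_Fract: "poly w 0 \<noteq> 0 \<Longrightarrow> spec0 (Fract u w) = poly u 0 / (poly w 0 :: 'k::field)"
  unfolding spec0_def
proof (rule the_equality)
  assume w: "poly w 0 \<noteq> 0"
  show "\<exists>u' w'. Fract u w = Fract u' w' \<and> poly w' 0 \<noteq> 0 \<and> poly u 0 / poly w 0 = poly u' 0 / poly w' 0"
    using w by blast
  fix a assume "\<exists>u' w'. Fract u w = Fract u' w' \<and> poly w' 0 \<noteq> 0 \<and> a = poly u' 0 / poly w' 0"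
  then obtain u' w' where *: "Fract u w = Fract u' w'" "poly w' 0 \<noteq> 0" "a = poly u' 0 / poly w' 0" by blast
  have "w \<noteq> 0" "w' \<noteq> 0" using w *(2) by auto
  then have "u * w' = u' * w" using *(1) by (simp add: eq_fract)
  then have "poly (u * w') 0 = poly (u' * w) 0" by simp
  then show "a = poly u 0 / poly w 0" unfolding *(3) using w *(2) by (simp add: frac_eq_eq mult.commute)
qed

lemma regE:
  assumes "reg q" obtains u w where "q = Fract u w" "poly w 0 \<noteq> 0" "w \<noteq> 0"
  using assms unfolding reg_def by force

lemma reg_Fract: "poly w 0 \<noteq> 0 \<Longrightarrow> reg (Fract u w)"
  unfolding reg_def by blast

lemma reg_add: assumes "reg a" "reg b" shows "reg (a + b)" "spec0 (a + b) = spec0 a + spec0 b"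
proof -
  obtain u w u' w' where *: "a = Fract u w" "poly w 0 \<noteq> 0" "w \<noteq> 0" "b = Fract u' w'" "poly w' 0 \<noteq> 0" "w' \<noteq> 0"
    using assms by (elim regE)
  have "a + b = Fract (u * w' + u' * w) (w * w')" using * by simp
  moreover have "poly (w * w') 0 \<noteq> 0" using * by simp
  ultimately show "reg (a + b)" "spec0 (a + b) = spec0 a + spec0 b"
    using * by (simp_all add: reg_Fract spec0_Fract add_frac_eq)
qed

lemma reg_mult: assumes "reg a" "reg b" shows "reg (a * b)" "spec0 (a * b) = spec0 a * spec0 b"
proof -
  obtain u w u' w' where *: "a = Fract u w" "poly w 0 \<noteq> 0" "w \<noteq> 0" "b = Fract u' w'" "poly w' 0 \<noteq> 0" "w' \<noteq> 0"
    using assms by (elim regE)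
  have "a * b = Fract (u * u') (w * w')" using * by simp
  moreover have "poly (w * w') 0 \<noteq> 0" using * by simp
  ultimately show "reg (a * b)" "spec0 (a * b) = spec0 a * spec0 b"
    using * by (simp_all add: reg_Fract spec0_Fract)
qed

lemma reg_kconst [simp]: "reg (kconst a)" "spec0 (kconst a) = a"
  by (simp_all add: kconst_def reg_Fract spec0_Fract)

lemma reg_kvar [simp]: "reg kvar" "spec0 kvar = (0 :: 'k::field)"
  by (simp_all add: kvar_def reg_Fract spec0_Fract)

lemma kconst_0 [simp]: "kconst 0 = 0" by (simp add: kconst_def Zero_fract_def)

lemma kconst_1 [simp]: "kconst 1 = 1" by (simp add: kconst_def One_fract_def one_pCons)

lemma kconst_add: "kconst (a + b) = kconst a + kconst b" by (simp add: kconst_def)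

lemma kconst_mult: "kconst (a * b) = kconst a * kconst b" by (simp add: kconst_def mult.commute)

lemma kconst_uminus: "kconst (- a) = - kconst a" by (simp add: kconst_def)

lemma kconst_diff: "kconst (a - b) = kconst a - kconst b"
  using kconst_add[of a "- b"] by (simp add: kconst_uminus)

lemma kconst_sum: "kconst (sum f A) = (\<Sum>x\<in>A. kconst (f x))"
  by (induction A rule: infinite_finite_induct) (auto simp: kconst_add)

lemma kconst_of_nat: "of_nat k = kconst (of_nat k)"
  by (induction k) (auto simp: kconst_add)

lemma kconst_of_int: "of_int k = kconst (of_int k)"
  by (cases k rule: int_cases2) (auto simp: kconst_of_nat kconst_uminus)

lemma reg_0 [simp]: "reg 0" "spec0 0 = 0" using reg_kconst[of 0] by simp_all

lemma reg_1 [simp]: "reg 1" "spec0 1 = 1" using reg_kconst[of 1] by simp_all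

lemma reg_of_nat [simp]: "reg (of_nat k)" "spec0 (of_nat k) = of_nat k"
  by (simp_all add: kconst_of_nat)

lemma reg_of_int [simp]: "reg (of_int k)" "spec0 (of_int k) = of_int k"
  by (simp_all add: kconst_of_int)

lemma reg_uminus: assumes "reg a" shows "reg (- a)" "spec0 (- a) = - spec0 a"
proof -
  have *: "- a = kconst (- 1) * a" by (simp add: kconst_uminus)
  show "reg (- a)" "spec0 (- a) = - spec0 a"
    unfolding * reg_mult(2)[OF reg_kconst(1) assms] reg_kconst(2)
    by (simp_all only: reg_mult(1)[OF reg_kconst(1) assms] mult_minus_left mult_1)
qed

lemma reg_diff: assumes "reg a" "reg b" shows "reg (a - b)" "spec0 (a - b) = spec0 a - spec0 b"
  using reg_add[OF assms(1) reg_uminus(1)[OF assms(2)]] reg_uminus(2)[OF assms(2)] by simp_all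

lemma reg_divide: assumes "reg a" "reg b" "spec0 b \<noteq> 0" shows "reg (a / b)"
proof -
  obtain u w where *: "b = Fract u w" "poly w 0 \<noteq> 0" "w \<noteq> 0" using assms(2) by (elim regE)
  then have "poly u 0 \<noteq> 0" using assms(3) by (simp add: spec0_Fract)
  then have "reg (inverse b)" using * by (simp add: reg_Fract)
  then show ?thesis using reg_mult[OF assms(1)] by (simp add: divide_inverse)
qed

section \<open>Specialization of polynomials and operators at \<kappa> = 0\<close>

definition regp :: "'k::field poly fract mpol \<Rightarrow> bool" where
  "regp f \<longleftrightarrow> (\<forall>m. reg (coef f m))"

abbreviation sp :: "'k::field poly fract mpol \<Rightarrow> 'k mpol" where
  "sp \<equiv> Poly_Mapping.map spec0"

lemma coef_sp [simp]: "coef (sp f) m = spec0 (coef f m)"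
  by (simp add: Poly_Mapping.map.rep_eq when_def)

lemma sp_polys: "f \<in> polys n \<Longrightarrow> sp f \<in> polys n"
proof -
  have "supp (sp f) \<subseteq> supp f" by (auto simp: in_keys_iff)
  then show "f \<in> polys n \<Longrightarrow> sp f \<in> polys n" by (auto simp: polys_def)
qed

lemma sp_0 [simp]: "sp 0 = 0" by (rule poly_mapping_eqI) simp

lemma sp_1 [simp]: "regp 1" "sp 1 = 1"
  by (auto simp: regp_def lookup_one when_def intro!: poly_mapping_eqI)

lemma regp_0 [simp]: "regp 0" by (simp add: regp_def)

lemma sp_add: assumes "regp f" "regp g" shows "regp (f + g)" "sp (f + g) = sp f + sp g"
  using assms by (auto simp: regp_def lookup_add reg_add intro!: poly_mapping_eqI)

lemma sp_pscale: assumes "reg a" "regp f" shows "regp (pscale a f)" "sp (pscale a f) = pscale (spec0 a) (sp f)"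
  using assms by (auto simp: regp_def reg_mult intro!: poly_mapping_eqI)

lemma sp_diff: assumes "regp f" "regp g" shows "regp (f - g)" "sp (f - g) = sp f - sp g"
  using assms by (auto simp: regp_def lookup_minus reg_diff intro!: poly_mapping_eqI)

lemma sp_sum: "(\<And>x. x \<in> A \<Longrightarrow> regp (F x)) \<Longrightarrow> regp (sum F A) \<and> sp (sum F A) = (\<Sum>x\<in>A. sp (F x))"
  by (induction A rule: infinite_finite_induct) (auto simp: sp_add)

lemma sp_xvar: assumes "regp f" shows "regp (xvar i * f)" "sp (xvar i * f) = xvar i * sp f"
proof -
  have "reg (coef (xvar i * f) m) \<and> spec0 (coef (xvar i * f) m) = coef (xvar i * sp f) m" for m
  proof (cases "coef m i = 0")
    case True
    then show ?thesis by (simp add: coef_xvar_mult_0)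
  next
    case False
    from unit_exp_add_diff[OF this] obtain m' where "m = unit_exp i + m'" by metis
    then show ?thesis using assms by (simp add: coef_xvar_mult regp_def)
  qed
  then show "regp (xvar i * f)" "sp (xvar i * f) = xvar i * sp f"
    by (auto simp: regp_def intro!: poly_mapping_eqI)
qed

lemma homog_sp: "homog d f \<Longrightarrow> homog d (sp f)"
  by (auto simp: homog_def in_keys_iff)

locale cher0 = cher r p n \<iota> 0 c
  for r p n :: nat and \<iota> :: "complex \<Rightarrow> 'k::field" and c :: "nat \<Rightarrow> 'k" +
  assumes c0: "c 0 \<noteq> 0"
begin

text \<open>The same theory over K(\<kappa>), with \<kappa> the indeterminate and the other
  parameters constant.\<close>

sublocale G: cher r p n "\<lambda>a. kconst (\<iota> a)" kvar "\<lambda>l. kconst (c l)"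
  by unfold_locales
     (simp_all add: r_pos n_pos p_dvd hom_add hom_mult hom_one kconst_add kconst_mult c_zero)

lemma G_zpow: "G.zpow a = kconst (zpow a)"
  by (simp add: G.zpow_def zpow_def)

lemma G_dz: "G.dz a = kconst (dz a)"
  by (simp add: G.dz_def dz_def kconst_sum kconst_mult G_zpow)

lemma G_ev: "reg (G.ev i m)" "spec0 (G.ev i m) = ev i m"
proof -
  have "G.ev i m = of_int (int (coef m i) + 1) * kvar + kconst (- (dz 0 - dz (- int (coef m i) - 1))
     - of_nat (r * behind_num n m i) * c 0)"
    by (simp only: G.ev_def G_dz kconst_diff kconst_uminus kconst_mult kconst_of_nat) simp
  then show "reg (G.ev i m)" "spec0 (G.ev i m) = ev i m"
    by (simp_all only: reg_add reg_mult reg_of_int reg_kvar reg_kconst) (simp add: ev_def)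
qed

text \<open>Compatibility with specialization at one polynomial: no pole arises, and the generic
  operator \<open>A\<close> specializes to \<open>B\<close>.\<close>

definition ok :: "('k poly fract mpol \<Rightarrow> 'k poly fract mpol) \<Rightarrow> ('k mpol \<Rightarrow> 'k mpol) \<Rightarrow> 'k poly fract mpol \<Rightarrow> bool" where
  "ok A B f \<longleftrightarrow> regp (A f) \<and> sp (A f) = B (sp f)"

lemma regp_induct [consumes 2, case_names zero one var scale add]:
  assumes "f \<in> polys n" and "regp f" and "P 0" and "P 1"
    and "\<And>i f. i < n \<Longrightarrow> f \<in> polys n \<Longrightarrow> regp f \<Longrightarrow> P f \<Longrightarrow> P (xvar i * f)"
    and "\<And>a f. reg a \<Longrightarrow> f \<in> polys n \<Longrightarrow> regp f \<Longrightarrow> P f \<Longrightarrow> P (pscale a f)"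
    and "\<And>f g. f \<in> polys n \<Longrightarrow> g \<in> polys n \<Longrightarrow> regp f \<Longrightarrow> regp g \<Longrightarrow> P f \<Longrightarrow> P g \<Longrightarrow> P (f + g)"
  shows "P f"
proof -
  have "coef f m \<in> {a. reg a}" for m using assms(2) by (simp add: regp_def)
  with assms(1) have "regp f \<and> P f"
  proof (induction rule: polys_induct_scalars)
  qed (use assms(3-) in \<open>auto simp: sp_xvar sp_pscale sp_add\<close>)
  then show ?thesis by blast
qed

lemma ok_ract:
  assumes "w permutes {..<n}" "f \<in> polys n" "regp f" shows "ok (G.ract w k) (ract w k) f"
  using assms(2,3)
proof (induction rule: regp_induct)
  case (var i f)
  then show ?case
    by (simp add: ok_def G_zpow pscale_mult_left sp_pscale sp_xvar)
qed (auto simp: ok_def sp_pscale sp_add)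

lemma ok_refl: "i < n \<Longrightarrow> j < n \<Longrightarrow> f \<in> polys n \<Longrightarrow> regp f \<Longrightarrow> ok (G.refl i j l) (refl i j l) f"
  using ok_ract[OF transpose_permutes_less] by (simp add: ok_def G.refl_def refl_def)

lemma ok_zact: "f \<in> polys n \<Longrightarrow> regp f \<Longrightarrow> ok (G.zact i l) (zact i l) f"
  using ok_ract[OF permutes_id] by (simp add: ok_def G.zact_def zact_def)

lemma sp_sum_ok:
  assumes "\<And>x. x \<in> A \<Longrightarrow> regp (F x) \<and> sp (F x) = H x"
  shows "regp (sum F A) \<and> sp (sum F A) = sum H A"
  using sp_sum[of A F] assms by simp

lemma ok_Rop: "i < n \<Longrightarrow> j < n \<Longrightarrow> f \<in> polys n \<Longrightarrow> regp f \<Longrightarrow> ok (G.Rop i j) (Rop i j) f"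
  using ok_refl unfolding ok_def G.Rop_def Rop_def by (intro sp_sum_ok) auto

lemma ok_Rtw: "i < n \<Longrightarrow> j < n \<Longrightarrow> f \<in> polys n \<Longrightarrow> regp f \<Longrightarrow> ok (G.Rtw i j) (Rtw i j) f"
  using ok_refl unfolding ok_def G.Rtw_def Rtw_def by (intro sp_sum_ok) (auto simp: sp_pscale G_zpow)

lemma ok_Cop: "f \<in> polys n \<Longrightarrow> regp f \<Longrightarrow> ok (G.Cop i) (Cop i) f"
  using ok_zact unfolding ok_def G.Cop_def Cop_def
  by (intro sp_sum_ok) (auto simp: sp_pscale G_zpow reg_mult reg_diff)

text \<open>Quotients of polynomials are awkward to specialize; induction with the commutation
  relations involves only sums and products.\<close>

lemma ok_D:
  assumes i: "i < n" and "f \<in> polys n" "regp f" shows "ok (G.D i) (D i) f"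
  using assms(2,3)
proof (induction rule: regp_induct)
  case zero then show ?case using i by (simp add: ok_def G.D_0 D_0)
next
  case one then show ?case using i by (simp add: ok_def G.D_1 D_1)
next
  case (var a f)
  have spf: "sp f \<in> polys n" using var by (simp add: sp_polys)
  show ?case
  proof (cases "a = i")
    case True
    have "regp (\<Sum>j\<in>{..<n} - {i}. G.Rop i j f) \<and> sp (\<Sum>j\<in>{..<n} - {i}. G.Rop i j f) = (\<Sum>j\<in>{..<n} - {i}. Rop i j (sp f))"
      using ok_Rop i var unfolding ok_def by (intro sp_sum_ok) auto
    then show ?thesis using True i var ok_Cop[of f i] spf
      by (simp add: ok_def sp_xvar G.D_xvar_eq D_xvar_eq sp_add sp_diff sp_pscale)
  next
    case False
    then show ?thesis using i var ok_Rtw[of i a f] spf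
      by (simp add: ok_def sp_xvar G.D_xvar_neq D_xvar_neq sp_add sp_pscale)
  qed
next
  case (scale a f) then show ?case using i by (simp add: ok_def G.D_pscale D_pscale sp_pscale sp_polys)
next
  case (add f g) then show ?case using i by (simp add: ok_def G.D_add D_add sp_add sp_polys)
qed

lemma ok_Z:
  assumes i: "i < n" and f: "f \<in> polys n" "regp f" shows "ok (G.Z i) (Z i) f"
proof -
  have "regp (\<Sum>j<i. G.Rop i j f) \<and> sp (\<Sum>j<i. G.Rop i j f) = (\<Sum>j<i. Rop i j (sp f))"
    using ok_Rop i f unfolding ok_def by (intro sp_sum_ok) auto
  moreover have "ok (G.D i) (D i) (xvar i * f)"
    using i f by (intro ok_D) (auto simp: sp_xvar)
  ultimately show ?thesis using f
    by (simp add: ok_def G.Z_def Z_def sp_add sp_pscale sp_xvar)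
qed

lemma good_sp:
  assumes g: "G.good \<mu> g" and reg: "regp g" shows "good \<mu> (sp g)"
proof -
  have gp: "g \<in> polys n" using g by (simp add: G.good_def)
  have "Z i (sp g) = pscale (ev i \<mu>) (sp g)" if i: "i < n" for i
    using ok_Z[OF i gp reg] g i reg by (simp add: ok_def G.good_def sp_pscale G_ev)
  moreover have "supp (sp g) \<subseteq> supp g" by (auto simp: in_keys_iff)
  ultimately show ?thesis using g unfolding good_def G.good_def
    by (auto simp: sp_polys homog_sp)
qed

lemma kvar_sep: "of_int k * kvar = kconst (a :: 'k) \<Longrightarrow> k = 0"
proof -
  assume "of_int k * kvar = kconst a"
  then have "Fract ([:of_int k:] * [:0, 1:]) 1 = Fract [:a:] 1"
    by (simp only: kconst_of_int kconst_def kvar_def mult_fract mult_1)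
  then have "[:of_int k:] * [:0, 1:] = [:a:]" by (simp add: eq_fract)
  then have "(of_int k :: 'k) = 0" by simp
  then show "k = 0" using of_int_eq_0[of k] by simp
qed

text \<open>\<kappa> enters the eigenvalue of z_i only through (m_i + 1) \<kappa>, so comparing
  coefficients of the indeterminate recovers every entry.\<close>

lemma G_sep:
  assumes "m \<in> in_vars n" "\<mu> \<in> in_vars n" and eq: "\<And>i. i < n \<Longrightarrow> G.ev i m = G.ev i \<mu>"
  shows "m = \<mu>"
proof (rule poly_mapping_eqI)
  fix i
  show "coef m i = coef \<mu> i"
  proof (cases "i < n")
    case True
    let ?C = "\<lambda>m. (dz 0 - dz (- int (coef m i) - 1)) + of_nat (r * behind_num n m i) * c 0"
    have E: "G.ev i m = of_int (int (coef m i) + 1) * kvar - kconst (?C m)" for m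
      by (simp only: G.ev_def G_dz kconst_diff kconst_add kconst_mult kconst_of_nat) simp
    have "of_int (int (coef m i) - int (coef \<mu> i)) * kvar = kconst (?C m - ?C \<mu>)"
      using eq[OF True] unfolding E kconst_diff by (simp add: algebra_simps)
    then have "int (coef m i) - int (coef \<mu> i) = 0" by (rule kvar_sep)
    then show ?thesis by simp
  next
    case False
    then show ?thesis using assms(1,2) by (simp add: in_vars_iff)
  qed
qed

text \<open>This keeps the intertwiners regular at \<kappa> = 0. Congruent exponents have the same
  contribution \<open>dz\<close>, so the eigenvalues differ by r * c 0 times the difference of two
  distinct values of \<open>behind_num\<close>.\<close>

lemma behind_ev_neq:
  assumes i: "Suc i < n" and eq: "int r dvd int (coef \<nu> i) - int (coef \<nu> (Suc i))"
  shows "ev i \<nu> - ev (Suc i) \<nu> \<noteq> 0"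
proof -
  have "dz (- int (coef \<nu> i) - 1) = dz (- int (coef \<nu> (Suc i)) - 1)"
    unfolding dz_def
  proof (intro sum.cong refl arg_cong2[where f = "(*)"] zpow_cong)
    fix l
    have "int r dvd int l * (- int (coef \<nu> i) - 1) - int l * (- int (coef \<nu> (Suc i)) - 1)"
      using dvd_mult[OF eq, of "- int l"] by (simp add: algebra_simps)
    then show "int l * (- int (coef \<nu> i) - 1) mod int r = int l * (- int (coef \<nu> (Suc i)) - 1) mod int r"
      by (simp add: mod_eq_dvd_iff)
  qed
  then have e: "ev i \<nu> - ev (Suc i) \<nu> =
      of_int (int (r * behind_num n \<nu> (Suc i)) - int (r * behind_num n \<nu> i)) * c 0"
    by (simp add: ev_def algebra_simps)
  define X where "X = int (r * behind_num n \<nu> (Suc i)) - int (r * behind_num n \<nu> i)"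
  have "ev i \<nu> - ev (Suc i) \<nu> = of_int X * c 0" unfolding X_def by (rule e)
  moreover have "behind_num n \<nu> (Suc i) \<noteq> behind_num n \<nu> i" using i by (intro behind_num_inj) auto
  then have "X \<noteq> 0" using r_pos by (simp add: X_def)
  ultimately show ?thesis using c0 of_int_eq_0[of X] by simp
qed

text \<open>An exponent with non-zero last entry is \<open>exp_phi\<close> of one of smaller degree,
  so \<open>Phi\<close> applies. Otherwise a non-zero entry is brought to the last place by
  exchanges with a zero to its right, and each exchange is undone by an intertwiner. There the
  larger entry stands to the right, so \<open>good_swap_coef\<close> gives the condition on the
  leading coefficient.\<close>

lemma G_good_exists:
  assumes "\<mu> \<in> in_vars n" shows "\<exists>g. G.good \<mu> g \<and> regp g"
  using assms
proof (induction "mdeg \<mu>" arbitrary: \<mu> rule: less_induct)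
  case less
  have phi: "\<exists>g. G.good \<mu>' g \<and> regp g"
    if \<mu>': "\<mu>' \<in> in_vars n" "mdeg \<mu>' = mdeg \<mu>" and last: "coef \<mu>' (n - 1) \<noteq> 0" for \<mu>'
  proof -
    let ?\<nu> = "exp_perm (pinv cyc) (\<mu>' - unit_exp (n - 1))"
    have d: "\<mu>' - unit_exp (n - 1) \<in> in_vars n" using \<mu>'(1) by (simp add: in_vars_iff lookup_minus)
    then have \<nu>: "?\<nu> \<in> in_vars n" by (simp add: permutes_inv[OF cyc_permutes])
    have e: "exp_phi ?\<nu> = \<mu>'"
      unfolding exp_phi_def exp_perm_inv(2)[OF cyc_permutes] by (rule unit_exp_add_diff[OF last])
    have "mdeg \<mu>' = 1 + mdeg ?\<nu>"
      using e \<nu> d by (metis exp_phi_def mdeg_add mdeg_exp_perm[OF cyc_permutes] mdeg_unit_exp)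
    then have "mdeg ?\<nu> < mdeg \<mu>" using \<mu>'(2) by simp
    from less.hyps[OF this \<nu>] obtain g where g: "G.good ?\<nu> g" "regp g" by blast
    have "G.exp_phi = exp_phi" by (simp add: fun_eq_iff G.exp_phi_def exp_phi_def G.cyc_def cyc_def cong: if_cong)
    then have "G.good \<mu>' (G.Phi g)" using G.good_Phi[OF g(1) \<nu>] e by simp
    moreover have "regp (G.Phi g)"
    proof -
      have "ok (G.ract G.cyc (\<lambda>j. 0)) (ract G.cyc (\<lambda>j. 0)) g"
        using ok_ract[OF G.cyc_permutes _ g(2)] g(1) by (simp add: G.good_def)
      then show ?thesis by (simp add: G.Phi_def ok_def sp_xvar)
    qed
    ultimately show ?thesis by blast
  qed
  show ?case
  proof (cases "\<mu> = 0")
    case True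
    then show ?thesis using G.good_0 sp_1 by blast
  next
    case False
    then obtain i where i: "coef \<mu> i \<noteq> 0" using exp_nonzero_coef by blast
    then have "i < n" using less.prems unfolding in_vars_iff by (meson not_le)
    \<comment> \<open>The inner induction is on the distance \<open>k\<close> of a non-zero entry
      from the last position.\<close>
    have "\<forall>\<mu>'. \<mu>' \<in> in_vars n \<longrightarrow> mdeg \<mu>' = mdeg \<mu> \<longrightarrow> k < n \<longrightarrow> coef \<mu>' (n - 1 - k) \<noteq> 0 \<longrightarrow>
        (\<exists>g. G.good \<mu>' g \<and> regp g)" for k
    proof (induction k)
      case 0
      show ?case
      proof (intro allI impI)
        fix \<mu>' assume h: "\<mu>' \<in> in_vars n" "mdeg \<mu>' = mdeg \<mu>" "0 < n" "coef \<mu>' (n - 1 - 0) \<noteq> 0"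
        show "\<exists>g. G.good \<mu>' g \<and> regp g" by (rule phi[OF h(1,2) h(4)[unfolded diff_zero]])
      qed
    next
      case (Suc k)
      show ?case
      proof (intro allI impI)
        fix \<mu>' assume h: "\<mu>' \<in> in_vars n" "mdeg \<mu>' = mdeg \<mu>" "Suc k < n" "coef \<mu>' (n - 1 - Suc k) \<noteq> 0"
        define i where "i = n - 1 - Suc k"
        have i: "Suc i < n" "Suc i = n - 1 - k" using h(3) by (auto simp: i_def)
        show "\<exists>g. G.good \<mu>' g \<and> regp g"
        proof (cases "coef \<mu>' (Suc i) = 0")
          case False
          then show ?thesis using Suc.IH h i by auto
        next
          case True
          define \<nu> where "\<nu> = exp_perm (tr i) \<mu>'"
          have tt: "exp_perm (tr i) \<nu> = \<mu>'"
            by (rule poly_mapping_eqI) (simp add: \<nu>_def coef_exp_tr[OF i(1)] transpose_involutory)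
          have \<nu>: "\<nu> \<in> in_vars n" "mdeg \<nu> = mdeg \<mu>" "coef \<nu> (Suc i) \<noteq> 0" "coef \<nu> i = 0"
          proof -
            have "coef \<mu>' i \<noteq> 0" using h(4) by (simp add: i_def)
            then show "coef \<nu> (Suc i) \<noteq> 0" by (simp add: \<nu>_def coef_exp_tr[OF i(1)])
            show "coef \<nu> i = 0" using True by (simp add: \<nu>_def coef_exp_tr[OF i(1)])
            show "\<nu> \<in> in_vars n" "mdeg \<nu> = mdeg \<mu>"
              using h tr_permutes[OF i(1)] by (simp_all add: \<nu>_def mdeg_exp_perm)
          qed
          then obtain g where g: "G.good \<nu> g" "regp g" using Suc.IH h(3) i(2) by auto
          let ?\<delta> = "int (coef \<nu> i) - int (coef \<nu> (Suc i))"
          let ?x = "if int r dvd ?\<delta> then kconst (c 0) * of_nat r / (G.ev i \<nu> - G.ev (Suc i) \<nu>) else 0"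
          have x: "reg ?x \<and> (if int r dvd ?\<delta> then ?x * (G.ev i \<nu> - G.ev (Suc i) \<nu>) = kconst (c 0) * of_nat r else ?x = 0)"
          proof (cases "int r dvd ?\<delta>")
            case True
            have R: "reg (G.ev i \<nu> - G.ev (Suc i) \<nu>)" "spec0 (G.ev i \<nu> - G.ev (Suc i) \<nu>) \<noteq> 0"
              using behind_ev_neq[OF i(1) True] by (simp_all add: reg_diff G_ev)
            then have "G.ev i \<nu> - G.ev (Suc i) \<nu> \<noteq> 0" by auto
            then show ?thesis using True reg_divide[OF reg_mult(1)[OF reg_kconst(1) reg_of_nat(1)] R] by simp
          qed simp
          have top: "coef g (exp_perm (tr i) \<nu>) = 0"
            using \<nu> by (intro G.good_swap_coef[OF _ g(1) i(1)] G_sep[OF _ \<nu>(1)]) auto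
          have "G.good (exp_perm (tr i) \<nu>) (G.sw i g + pscale ?x g)"
            using \<nu> x by (intro G.good_sw[OF g(1) \<nu>(1) i(1) _ top]) auto
          moreover have "regp (G.sw i g + pscale ?x g)"
          proof -
            have "g \<in> polys n" using g(1) by (simp add: G.good_def)
            then have "regp (G.sw i g)" using ok_refl[of i "Suc i" g 0] g(2) i(1) by (simp add: ok_def)
            then show ?thesis using x g(2) by (intro sp_add(1) sp_pscale(1)) auto
          qed
          ultimately show ?thesis unfolding tt by blast
        qed
      qed
    qed
    from this[of "n - 1 - i"] show ?thesis using less.prems i \<open>i < n\<close> by auto
  qed
qed

text \<open>Uniqueness over K(\<kappa>) identifies the polynomial denoted by \<open>G.jack\<close>
  with the regular one constructed from intertwiners; specialization then preserves all its
  properties.\<close>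

lemma jack0_good:
  assumes \<mu>: "\<mu> \<in> in_vars n" shows "good \<mu> (jack0 r p n \<iota> c \<mu>)"
proof -
  obtain g where g: "G.good \<mu> g" "regp g" using G_good_exists[OF \<mu>] by blast
  have gp: "g \<in> polys n" using g(1) by (simp add: G.good_def)
  let ?m = "\<lambda>i. int (coef \<mu> i)"
  have E: "of_int (?m i + 1) * kvar - (G.d_param 0 - G.d_param (- ?m i - 1))
            - of_nat (r * v_of n \<mu> i) * kconst (c 0) = G.ev i \<mu>" if "i < n" for i
    using that by (simp add: G.ev_def G.d_param_dz v_of_eq)
  have diag: "G.poly_act (G.cclass (fgen (GenT (mk_mat r n id k)))) g = pscale (G.zpow (- N)) g"
    if "\<And>m. m \<in> supp g \<Longrightarrow> (\<Sum>j<n. k j * int (coef m j)) mod int r = N mod int r" for k N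
    using that gp by (simp add: G.poly_act_T G.mk_mat_Grpn_1 permutes_id G.group_act_mk_mat G.ract_id_weight)
  have cg: "\<And>m i. m \<in> supp g \<Longrightarrow> i < n \<Longrightarrow> int (coef m i) mod int r = int (coef \<mu> i) mod int r"
    using g by (auto simp: G.good_def)
  have "G.jack \<mu> = g"
    unfolding G.jack_def Let_def
  proof (rule the_equality)
    have 1: "G.poly_act (G.z_elt i) g =
          pscale (of_int (?m i + 1) * kvar - (G.d_param 0 - G.d_param (- ?m i - 1))
            - of_nat (r * v_of n \<mu> i) * kconst (c 0)) g" if "i < n" for i
      using g(1) that gp unfolding E[OF that] by (simp add: G.poly_act_z G.good_def)
    have 2: "G.poly_act (G.cclass (fgen (GenT (zeta_mat r n i (int p))))) g = pscale (G.zpow (- int p * ?m i)) g"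
      if i: "i < n" for i
    proof -
      have "(\<Sum>j<n. (if j = i then int p else 0) * int (coef m j)) = int p * int (coef m i)" for m
      proof -
        have "(\<Sum>j<n. (if j = i then int p else 0) * int (coef m j)) = (\<Sum>j<n. if j = i then int p * int (coef m i) else 0)"
          by (intro sum.cong refl) auto
        then show ?thesis using i by (simp add: sum.delta)
      qed
      then have "(\<Sum>j<n. (if j = i then int p else 0) * int (coef m j)) mod int r = int p * ?m i mod int r"
        if "m \<in> supp g" for m
        using mod_mult_cong[OF refl cg[OF that i], of "int p"] by simp
      from diag[OF this] show ?thesis by (simp add: zeta_mat_mk)
    qed
    have 3: "G.poly_act (G.cclass (fgen (GenT (zeta_mat r n i 1 * zeta_mat r n (Suc i) (- 1))))) g =
            pscale (G.zpow (?m (Suc i) - ?m i)) g" if i: "Suc i < n" for i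
    proof -
      let ?k = "\<lambda>j. (if j = i then 1 else 0) + (if j = Suc i then - 1 else 0) :: int"
      have "zeta_mat r n i 1 * zeta_mat r n (Suc i) (- 1) = mk_mat r n id ?k"
        unfolding zeta_mat_mk mk_mat_mult[OF permutes_id] by simp
      moreover have "(\<Sum>j<n. ?k j * int (coef m j)) = int (coef m i) - int (coef m (Suc i))" for m
      proof -
        have "(\<Sum>j<n. ?k j * int (coef m j)) = (\<Sum>j\<in>{i, Suc i}. ?k j * int (coef m j))"
          using i by (intro sum.mono_neutral_right) auto
        then show ?thesis by simp
      qed
      ultimately show ?thesis
        using diag[of ?k "?m i - ?m (Suc i)"] mod_diff_cong[OF cg[of _ i] cg[of _ "Suc i"]] i by simp
    qed
    show "g \<in> carrier (poly_ring n) \<and> coef g \<mu> = 1 \<and>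
       (\<forall>i<n. G.poly_act (G.z_elt i) g =
          pscale (of_int (?m i + 1) * kvar - (G.d_param 0 - G.d_param (- ?m i - 1))
            - of_nat (r * v_of n \<mu> i) * kconst (c 0)) g) \<and>
       (\<forall>i<n. G.poly_act (G.cclass (fgen (GenT (zeta_mat r n i (int p))))) g = pscale (G.zpow (- int p * ?m i)) g) \<and>
       (\<forall>i. Suc i < n \<longrightarrow>
          G.poly_act (G.cclass (fgen (GenT (zeta_mat r n i 1 * zeta_mat r n (Suc i) (- 1))))) g =
            pscale (G.zpow (?m (Suc i) - ?m i)) g)"
      using 1 2 3 gp g(1) by (auto simp: G.good_def)
    fix f
    assume f: "f \<in> carrier (poly_ring n) \<and> coef f \<mu> = 1 \<and>
       (\<forall>i<n. G.poly_act (G.z_elt i) f =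
          pscale (of_int (?m i + 1) * kvar - (G.d_param 0 - G.d_param (- ?m i - 1))
            - of_nat (r * v_of n \<mu> i) * kconst (c 0)) f) \<and>
       (\<forall>i<n. G.poly_act (G.cclass (fgen (GenT (zeta_mat r n i (int p))))) f = pscale (G.zpow (- int p * ?m i)) f) \<and>
       (\<forall>i. Suc i < n \<longrightarrow>
          G.poly_act (G.cclass (fgen (GenT (zeta_mat r n i 1 * zeta_mat r n (Suc i) (- 1))))) f =
            pscale (G.zpow (?m (Suc i) - ?m i)) f)"
    then have fp: "f \<in> polys n" "coef f \<mu> = 1" by auto
    moreover have "G.Z i f = pscale (G.ev i \<mu>) f" if "i < n" for i
      using f that fp(1) E[OF that] G.poly_act_z[OF that fp(1)] by metis
    ultimately show "f = g"
      using G_sep[OF _ \<mu>] by (intro G.good_unique[OF _ g(1)]) auto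
  qed
  then show ?thesis using good_sp[OF g] by (simp add: jack0_def)
qed

end

section \<open>Colored permutations and Steinberg weights\<close>

text \<open>\<open>perm_of\<close> says nothing outside the range; the identity there gives a
  permutation in the sense of \<open>permutes\<close>.\<close>

definition pw :: "nat \<Rightarrow> complex mat \<Rightarrow> nat \<Rightarrow> nat" where
  "pw n v j = (if j < n then perm_of n v j else j)"

lemma perm_of_mk_mat:
  assumes w: "w permutes {..<n}" and j: "j < n" shows "perm_of n (mk_mat r n w k) j = w j"
  unfolding perm_of_def
proof (rule the_equality)
  show "w j < n \<and> mk_mat r n w k $$ (w j, j) \<noteq> 0" using j permutes_less[OF w, of j] by simp
  show "i = w j" if "i < n \<and> mk_mat r n w k $$ (i, j) \<noteq> 0" for i
    using that j mk_mat_entry[of i n j r w k] by (auto split: if_splits)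
qed

lemma pw_mk_mat: "w permutes {..<n} \<Longrightarrow> pw n (mk_mat r n w k) = w"
  by (rule ext) (auto simp: pw_def perm_of_mk_mat permutes_not_in)

lemma color_of_mk_mat:
  assumes w: "w permutes {..<n}" and j: "j < n" and k: "k j < r"
  shows "color_of r n (mk_mat r n w (\<lambda>j. int (k j))) j = k j"
proof -
  have e: "mk_mat r n w (\<lambda>j. int (k j)) $$ (perm_of n (mk_mat r n w (\<lambda>j. int (k j))) j, j) = zeta r ^ k j"
    using j permutes_less[OF w, of j] by (simp add: perm_of_mk_mat[OF w j])
  show ?thesis unfolding color_of_def e
    using zeta_power_inj[of r] k by (intro the_equality) (auto dest: inj_onD)
qed

definition des_below :: "nat \<Rightarrow> nat \<Rightarrow> complex mat \<Rightarrow> nat \<Rightarrow> nat" where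
  "des_below r n v j = card {j'. j \<le> j' \<and> j' \<in> descents r n v}"

lemma descents_less: "i \<in> descents r n v \<Longrightarrow> Suc i < n"
  by (simp add: descents_def)

lemma finite_descents [simp]: "finite (descents r n v)"
  by (rule finite_subset[of _ "{..<n}"]) (auto dest: descents_less)

lemma des_below_Suc: "des_below r n v j = des_below r n v (Suc j) + (if j \<in> descents r n v then 1 else 0)"
proof -
  have "{j'. j \<le> j' \<and> j' \<in> descents r n v} =
      {j'. Suc j \<le> j' \<and> j' \<in> descents r n v} \<union> (if j \<in> descents r n v then {j} else {})"
    by (auto simp: le_less Suc_le_eq)
  then show ?thesis by (auto simp: des_below_def)
qed

lemma des_below_last: "des_below r n v (n - 1) = 0"
  by (auto simp: des_below_def dest: descents_less)

context
  fixes r p n :: nat assumes r_pos: "0 < r" and p_dvd: "p dvd r" and n_pos: "0 < n"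
begin

lemma G1_sub_cases:
  assumes "v \<in> G1_sub r p n"
  shows "pw n v permutes {..<n}" "\<And>j. j < n \<Longrightarrow> color_of r n v j < r"
    "v = mk_mat r n (pw n v) (\<lambda>j. int (color_of r n v j))" "color_of r n v (n - 1) < r div p"
proof -
  have "v \<in> Grpn r 1 n" and c: "color_of r n v (n - 1) \<le> r div p - 1" using assms by (auto simp: G1_sub_def)
  from Grpn_cases[OF this(1) r_pos one_dvd] obtain w k
    where w: "w permutes {..<n}" and v: "v = mk_mat r n w (\<lambda>j. int (k j))" and k: "\<And>j. k j < r" by metis
  have pw: "pw n v = w" using pw_mk_mat[OF w] v by simp
  have col: "color_of r n v j = k j" if "j < n" for j using color_of_mk_mat[OF w that, of k r] k[of j] v by simp
  show "pw n v permutes {..<n}" using w pw by simp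
  show "color_of r n v j < r" if "j < n" for j using col[OF that] k by simp
  show "v = mk_mat r n (pw n v) (\<lambda>j. int (color_of r n v j))"
    unfolding pw by (subst v) (rule mk_mat_cong[OF r_pos], auto simp: col)
  have "0 < r div p" using p_dvd r_pos by (auto simp: dvd_def)
  then show "color_of r n v (n - 1) < r div p" using c by simp
qed

lemma pw_inj: "v \<in> G1_sub r p n \<Longrightarrow> pw n v x = pw n v y \<longleftrightarrow> x = y"
  by (rule inj_eq[OF permutes_inj[OF G1_sub_cases(1)]])

lemma mk_mat_G1_sub:
  assumes w: "w permutes {..<n}" and k: "\<And>j. j < n \<Longrightarrow> k j < r" and last: "k (n - 1) < r div p"
  shows "mk_mat r n w (\<lambda>j. int (k j)) \<in> G1_sub r p n"
    "pw n (mk_mat r n w (\<lambda>j. int (k j))) = w"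
    "\<And>j. j < n \<Longrightarrow> color_of r n (mk_mat r n w (\<lambda>j. int (k j))) j = k j"
proof -
  show "pw n (mk_mat r n w (\<lambda>j. int (k j))) = w" by (rule pw_mk_mat[OF w])
  show c: "color_of r n (mk_mat r n w (\<lambda>j. int (k j))) j = k j" if "j < n" for j
    using color_of_mk_mat[OF w that, of k r] k[OF that] by simp
  have "mk_mat r n w (\<lambda>j. int (k j)) \<in> Grpn r 1 n"
    using mk_mat_in_Grpn_iff[OF r_pos one_dvd w, of "\<lambda>j. int (k j)"] by simp
  then show "mk_mat r n w (\<lambda>j. int (k j)) \<in> G1_sub r p n"
    using c[of "n - 1"] n_pos last by (simp add: G1_sub_def)
qed

lemma finite_G1_sub: "finite (G1_sub r p n)"
proof -
  let ?f = "\<lambda>(w, ks). mk_mat r n w (\<lambda>j. int (ks ! j))"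
  let ?X = "{w. w permutes {..<n}} \<times> {ks. set ks \<subseteq> {..<r} \<and> length ks = n}"
  have "v \<in> ?f ` ?X" if v: "v \<in> G1_sub r p n" for v
  proof (rule image_eqI)
    let ?ks = "map (color_of r n v) [0..<n]"
    show "v = ?f (pw n v, ?ks)"
      unfolding prod.case
      by (subst G1_sub_cases(3)[OF v]) (rule mk_mat_cong[OF r_pos], auto)
    show "(pw n v, ?ks) \<in> ?X" using G1_sub_cases(1,2)[OF v] by auto
  qed
  moreover have "finite ?X" by (intro finite_cartesian_product finite_permutations finite_lists_length_eq) auto
  ultimately show ?thesis by (meson finite_imageI finite_subset subsetI)
qed

definition lam :: "complex mat \<Rightarrow> (nat \<Rightarrow>\<^sub>0 nat)" where
  "lam v = steinberg_weight r n v"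

lemma lam_in_vars [simp]: "lam v \<in> in_vars n"
  unfolding lam_def steinberg_weight_def in_vars_iff Let_def
  by (auto simp: lookup_sum lookup_single when_def)

lemma coef_lam:
  assumes v: "v \<in> G1_sub r p n" and j: "j < n"
  shows "coef (lam v) (pw n v j) = r * des_below r n v j + color_of r n v j"
proof -
  let ?w = "pw n v" and ?F = "\<lambda>i j. r * card {j'. j \<le> j' \<and> j' \<in> descents r n v} + color_of r n v j"
  note w = G1_sub_cases(1)[OF v]
  have inv: "the_inv_into {..<n} (perm_of n v) (?w j) = j"
  proof -
    have "inj_on (perm_of n v) {..<n}"
    proof (rule inj_onI)
      fix x y assume "x \<in> {..<n}" "y \<in> {..<n}" "perm_of n v x = perm_of n v y"
      then have "?w x = ?w y" by (simp add: pw_def)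
      then show "x = y" by (rule injD[OF permutes_inj[OF w]])
    qed
    then show ?thesis using the_inv_into_f_f[of "perm_of n v" "{..<n}" j] j by (simp add: pw_def)
  qed
  have "coef (lam v) (?w j) = (\<Sum>i<n. if i = ?w j then r * des_below r n v j + color_of r n v j else 0)"
    unfolding lam_def steinberg_weight_def lookup_sum Let_def
    by (intro sum.cong refl) (auto simp: lookup_single when_def inv des_below_def)
  then show ?thesis using permutes_less[OF w, of j] j by (simp add: sum.delta)
qed

text \<open>A descent adds a full \<open>r\<close>, which outweighs any difference of colors.
  Without a descent the color drops, or it stays the same and the values increase.\<close>

lemma lam_order_step:
  assumes v: "v \<in> G1_sub r p n" and j: "Suc j < n"
  shows "coef (lam v) (pw n v (Suc j)) < coef (lam v) (pw n v j) \<or>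
    coef (lam v) (pw n v (Suc j)) = coef (lam v) (pw n v j) \<and> pw n v j < pw n v (Suc j)"
proof -
  have j': "j < n" using j by simp
  have inj: "pw n v j \<noteq> pw n v (Suc j)" by (simp add: pw_inj[OF v])
  have pd: "perm_of n v j = pw n v j" "perm_of n v (Suc j) = pw n v (Suc j)" using j j' by (auto simp: pw_def)
  have k: "color_of r n v (Suc j) < r" "color_of r n v j < r" using G1_sub_cases(2)[OF v] j j' by auto
  show ?thesis
  proof (cases "j \<in> descents r n v")
    case True
    then have "des_below r n v j = des_below r n v (Suc j) + 1" using des_below_Suc[of r n v j] by simp
    then have "r * des_below r n v j = r * des_below r n v (Suc j) + r" by (simp add: distrib_left)
    then show ?thesis unfolding coef_lam[OF v j] coef_lam[OF v j'] using k by linarith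
  next
    case False
    then have "color_of r n v j > color_of r n v (Suc j) \<or>
        color_of r n v j = color_of r n v (Suc j) \<and> pw n v j < pw n v (Suc j)"
      using j inj by (auto simp: descents_def pd)
    moreover have "des_below r n v j = des_below r n v (Suc j)" using False des_below_Suc[of r n v j] by simp
    ultimately show ?thesis unfolding coef_lam[OF v j] coef_lam[OF v j'] by auto
  qed
qed

lemma lam_order:
  assumes v: "v \<in> G1_sub r p n" and "i < j" "j < n"
  shows "coef (lam v) (pw n v j) < coef (lam v) (pw n v i) \<or>
    coef (lam v) (pw n v j) = coef (lam v) (pw n v i) \<and> pw n v i < pw n v j"
  using assms(2,3)
proof (induction j)
  case (Suc j)
  show ?case
  proof (cases "i = j")
    case True
    then show ?thesis using lam_order_step[OF v] Suc.prems by simp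
  next
    case False
    then show ?thesis using lam_order_step[OF v, of j] Suc by force
  qed
qed simp

lemma behind_lam:
  assumes v: "v \<in> G1_sub r p n" and "i < n" "j < n" "i \<noteq> j"
  shows "behind (lam v) (pw n v i) (pw n v j) \<longleftrightarrow> i < j"
proof -
  have "pw n v i \<noteq> pw n v j" using assms(4) by (simp add: pw_inj[OF v])
  then show ?thesis
    using lam_order[OF v, of i j] lam_order[OF v, of j i] assms(2-4)
    by (cases "i < j") (auto simp: behind_def)
qed

text \<open>By \<open>lam_order\<close> the underlying permutation is the stable sort of the weight.
  Hence the \<open>c 0\<close> part of the eigenvalue at the coordinate w(j) depends on j alone and
  recovers w.\<close>

lemma behind_num_lam:
  assumes v: "v \<in> G1_sub r p n" and j: "j < n"
  shows "behind_num n (lam v) (pw n v j) = n - 1 - j"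
proof -
  note w = G1_sub_cases(1)[OF v]
  have inj: "pw n v x = pw n v y \<longleftrightarrow> x = y" for x y by (rule pw_inj[OF v])
  have "{a. a < n \<and> behind (lam v) (pw n v j) a} = pw n v ` {j<..<n}"
  proof (rule Set.set_eqI, rule iffI)
    fix a assume a: "a \<in> {a. a < n \<and> behind (lam v) (pw n v j) a}"
    define b where "b = pinv (pw n v) a"
    have b: "b < n" "a = pw n v b"
      using a permutes_less[OF permutes_inv[OF w], of a] permutes_inverses(1)[OF w] by (auto simp: b_def)
    then have "b \<noteq> j" using a by (auto simp: behind_def)
    then show "a \<in> pw n v ` {j<..<n}" using a b behind_lam[OF v j b(1)] by auto
  next
    fix a assume "a \<in> pw n v ` {j<..<n}"
    then show "a \<in> {a. a < n \<and> behind (lam v) (pw n v j) a}"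
      using behind_lam[OF v j] permutes_less[OF w] by auto
  qed
  then have "behind_num n (lam v) (pw n v j) = card {j<..<n}"
    by (simp add: behind_num_def card_image inj_on_def inj)
  then show ?thesis by simp
qed

lemma mdeg_lam:
  assumes v: "v \<in> G1_sub r p n"
  shows "mdeg (lam v) = (\<Sum>j<n. r * des_below r n v j + color_of r n v j)"
proof -
  note w = G1_sub_cases(1)[OF v]
  have "mdeg (lam v) = (\<Sum>i<n. coef (lam v) i)" by (rule mdeg_in_vars) simp
  also have "\<dots> = (\<Sum>j<n. coef (lam v) (pw n v j))" using sum.permute[OF w, of "coef (lam v)"] by (simp add: o_def)
  also have "\<dots> = (\<Sum>j<n. r * des_below r n v j + color_of r n v j)" by (intro sum.cong) (auto simp: coef_lam[OF v])
  finally show ?thesis .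
qed

section \<open>Left multiplication by adjacent transpositions and descent classes\<close>

definition move :: "nat \<Rightarrow> complex mat \<Rightarrow> complex mat" where
  "move i v = mk_mat r n (Transposition.transpose i (Suc i) \<circ> pw n v) (\<lambda>j. int (color_of r n v j))"

lemma move_props:
  assumes v: "v \<in> G1_sub r p n" and i: "Suc i < n"
  shows "move i v \<in> G1_sub r p n" "pw n (move i v) = Transposition.transpose i (Suc i) \<circ> pw n v"
    "\<And>j. j < n \<Longrightarrow> color_of r n (move i v) j = color_of r n v j"
proof -
  have w: "Transposition.transpose i (Suc i) \<circ> pw n v permutes {..<n}"
    using i by (intro permutes_compose G1_sub_cases(1)[OF v] transpose_permutes_less) auto
  note * = mk_mat_G1_sub[where k = "color_of r n v", OF w G1_sub_cases(2)[OF v] G1_sub_cases(4)[OF v]]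
  show "move i v \<in> G1_sub r p n" "pw n (move i v) = Transposition.transpose i (Suc i) \<circ> pw n v"
    "\<And>j. j < n \<Longrightarrow> color_of r n (move i v) j = color_of r n v j"
    unfolding move_def using * by blast+
qed

text \<open>Exchanging the values i and i + 1 reverses only the comparison of these two values,
  which matters for descents only if they stand in neighbouring positions of equal color. That case
  is excluded here.\<close>

definition allowed :: "nat \<Rightarrow> complex mat \<Rightarrow> bool" where
  "allowed i v \<longleftrightarrow> Suc i < n \<and>
     \<not> (color_of r n v (pinv (pw n v) i) = color_of r n v (pinv (pw n v) (Suc i)) \<and>
        (pinv (pw n v) i = Suc (pinv (pw n v) (Suc i)) \<or> pinv (pw n v) (Suc i) = Suc (pinv (pw n v) i)))"

lemma descents_pw:
  "i \<in> descents r n v \<longleftrightarrow> Suc i < n \<and> (color_of r n v i < color_of r n v (Suc i) \<or>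
      color_of r n v i = color_of r n v (Suc i) \<and> pw n v (Suc i) < pw n v i)"
  by (auto simp: descents_def pw_def)

lemma transpose_Suc_less:
  "x \<noteq> y \<Longrightarrow> {x, y} \<noteq> {i, Suc i} \<Longrightarrow>
    Transposition.transpose i (Suc i) x < Transposition.transpose i (Suc i) y \<longleftrightarrow> x < y"
  by (auto simp: Transposition.transpose_def doubleton_eq_iff)

lemma descents_move:
  assumes v: "v \<in> G1_sub r p n" and al: "allowed i v"
  shows "descents r n (move i v) = descents r n v"
proof -
  note w = G1_sub_cases(1)[OF v]
  have i: "Suc i < n" using al by (simp add: allowed_def)
  note mv = move_props[OF v i]
  have "j \<in> descents r n (move i v) \<longleftrightarrow> j \<in> descents r n v" for j
  proof (cases "Suc j < n \<and> color_of r n v j = color_of r n v (Suc j)")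
    case True
    have ne: "pw n v (Suc j) \<noteq> pw n v j" by (simp add: pw_inj[OF v])
    have "{pw n v (Suc j), pw n v j} \<noteq> {i, Suc i}"
    proof
      assume "{pw n v (Suc j), pw n v j} = {i, Suc i}"
      then consider "pw n v (Suc j) = i" "pw n v j = Suc i" | "pw n v (Suc j) = Suc i" "pw n v j = i"
        by (auto simp: doubleton_eq_iff)
      then show False
      proof cases
        case 1
        then have "pinv (pw n v) i = Suc j" "pinv (pw n v) (Suc i) = j"
          using permutes_inverses(2)[OF w, of "Suc j"] permutes_inverses(2)[OF w, of j] by simp_all
        then show False using al True by (simp add: allowed_def)
      next
        case 2
        then have "pinv (pw n v) (Suc i) = Suc j" "pinv (pw n v) i = j"
          using permutes_inverses(2)[OF w, of "Suc j"] permutes_inverses(2)[OF w, of j] by simp_all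
        then show False using al True by (simp add: allowed_def)
      qed
    qed
    from transpose_Suc_less[OF ne this] True show ?thesis by (simp add: descents_pw mv)
  next
    case False
    then show ?thesis by (auto simp: descents_pw mv(3))
  qed
  then show ?thesis by blast
qed

lemma class_move:
  assumes v: "v \<in> G1_sub r p n" and al: "allowed i v"
  shows "colored_descent_class r n (move i v) = colored_descent_class r n v"
proof -
  have i: "Suc i < n" using al by (simp add: allowed_def)
  show ?thesis using descents_move[OF v al] move_props(3)[OF v i] by (simp add: colored_descent_class_def)
qed

lemma class_eq_iff:
  "colored_descent_class r n v = colored_descent_class r n v' \<longleftrightarrow>
     descents r n v = descents r n v' \<and> (\<forall>j<n. color_of r n v j = color_of r n v' j)"
  by (auto simp: colored_descent_class_def)

lemma mdeg_class:
  assumes "v \<in> G1_sub r p n" "v' \<in> G1_sub r p n" "colored_descent_class r n v = colored_descent_class r n v'"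
  shows "mdeg (lam v) = mdeg (lam v')"
  using assms(3) unfolding mdeg_lam[OF assms(1)] mdeg_lam[OF assms(2)] class_eq_iff
  by (intro sum.cong) (auto simp: des_below_def)

text \<open>The exchange toggles exactly one descent j, and a descent at j adds \<open>r\<close> to
  the weight at every position up to j.\<close>

lemma mdeg_move_neq:
  assumes v: "v \<in> G1_sub r p n" and i: "Suc i < n" and nal: "\<not> allowed i v"
  shows "mdeg (lam (move i v)) \<noteq> mdeg (lam v)"
proof -
  note w = G1_sub_cases(1)[OF v]
  note mv = move_props[OF v i]
  let ?w = "pw n v"
  define j where "j = min (pinv ?w i) (pinv ?w (Suc i))"
  have inv: "?w (pinv ?w x) = x" for x using permutes_inverses(1)[OF w] by simp
  have j: "Suc j < n" "color_of r n v j = color_of r n v (Suc j)" "{?w j, ?w (Suc j)} = {i, Suc i}"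
    using nal i permutes_less[OF permutes_inv[OF w], of i] permutes_less[OF permutes_inv[OF w], of "Suc i"]
    unfolding allowed_def j_def by (auto simp: min_def inv) (metis inv)+
  have other: "a \<in> descents r n (move i v) \<longleftrightarrow> a \<in> descents r n v" if "a \<noteq> j" for a
  proof (cases "Suc a < n \<and> color_of r n v a = color_of r n v (Suc a)")
    case True
    have inj: "?w x = ?w y \<longleftrightarrow> x = y" for x y by (rule pw_inj[OF v])
    have "{?w (Suc a), ?w a} \<noteq> {?w j, ?w (Suc j)}"
      using that by (auto simp: doubleton_eq_iff inj)
    then have "{?w (Suc a), ?w a} \<noteq> {i, Suc i}" using j(3) by simp
    from transpose_Suc_less[OF _ this] True show ?thesis by (simp add: descents_pw mv inj)
  next
    case False
    then show ?thesis by (auto simp: descents_pw mv(3))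
  qed
  have flip: "j \<in> descents r n (move i v) \<longleftrightarrow> j \<notin> descents r n v"
    using j by (auto simp: descents_pw mv doubleton_eq_iff)
  have cases: "descents r n (move i v) = insert j (descents r n v) \<and> j \<notin> descents r n v \<or>
     descents r n v = insert j (descents r n (move i v)) \<and> j \<notin> descents r n (move i v)"
  proof (cases "j \<in> descents r n v")
    case True
    then have "descents r n v = insert j (descents r n (move i v))"
      by (intro Set.set_eqI) (use other flip in \<open>metis insert_iff\<close>)
    then show ?thesis using flip True by simp
  next
    case False
    then have "descents r n (move i v) = insert j (descents r n v)"
      by (intro Set.set_eqI) (use other flip in \<open>metis insert_iff\<close>)
    then show ?thesis using False by simp
  qed
  have less: "mdeg (lam x) < mdeg (lam y)" if xy: "x \<in> G1_sub r p n" "y \<in> G1_sub r p n"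
    "descents r n y = insert j (descents r n x)" "j \<notin> descents r n x"
    "\<And>a. a < n \<Longrightarrow> color_of r n x a = color_of r n y a" for x y
  proof -
    have le: "des_below r n x a \<le> des_below r n y a" for a
      unfolding des_below_def by (rule card_mono) (use xy(3) in auto)
    have "des_below r n x j < des_below r n y j"
      unfolding des_below_def by (rule psubset_card_mono) (use xy(3,4) in auto)
    then have "(\<Sum>a<n. r * des_below r n x a + color_of r n x a) < (\<Sum>a<n. r * des_below r n y a + color_of r n y a)"
      using j(1) r_pos le xy(5) by (intro sum_strict_mono_ex1) (auto intro!: bexI[of _ j])
    then show ?thesis by (simp add: mdeg_lam xy)
  qed
  show ?thesis using cases less[OF v mv(1)] less[OF mv(1) v] mv(3) by force
qed

text \<open>Bubble sort: as long as some values i, i + 1 of v are ordered oppositely by v',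
  exchanging them reduces the number of pairs of positions on which v and v' disagree.\<close>

lemma class_connected:
  assumes "v \<in> G1_sub r p n" "v' \<in> G1_sub r p n" "colored_descent_class r n v = colored_descent_class r n v'"
    and "P v" and step: "\<And>i v. v \<in> G1_sub r p n \<Longrightarrow> P v \<Longrightarrow> allowed i v \<Longrightarrow> P (move i v)"
  shows "P v'"
proof -
  note w' = G1_sub_cases(1)[OF assms(2)]
  define cross where "cross v = {(x, y). x < n \<and> y < n \<and> pw n v x < pw n v y \<and> pw n v' y < pw n v' x}" for v
  have fin: "finite (cross v)" for v by (rule finite_subset[of _ "{..<n} \<times> {..<n}"]) (auto simp: cross_def)
  have "P v'" if "v \<in> G1_sub r p n" "colored_descent_class r n v = colored_descent_class r n v'" "P v" for v
    using that
  proof (induction "card (cross v)" arbitrary: v rule: less_induct)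
    case less
    note v = less.prems(1)
    note w = G1_sub_cases(1)[OF v]
    let ?w = "pw n v" and ?w' = "pw n v'"
    have inj: "?w x = ?w y \<longleftrightarrow> x = y" for x y by (rule pw_inj[OF v])
    have inv: "?w (pinv ?w x) = x" "pinv ?w (?w x) = x" for x using permutes_inverses[OF w] by simp_all
    have pl: "pinv ?w x < n \<longleftrightarrow> x < n" for x using permutes_less[OF permutes_inv[OF w]] by simp
    show ?case
    proof (cases "\<exists>i. Suc i < n \<and> ?w' (pinv ?w (Suc i)) < ?w' (pinv ?w i)")
      case True
      then obtain i where i: "Suc i < n" "?w' (pinv ?w (Suc i)) < ?w' (pinv ?w i)" by blast
      let ?a = "pinv ?w i" and ?b = "pinv ?w (Suc i)"
      have ab: "?a < n" "?b < n" using i by (auto simp: pl)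
      \<comment> \<open>The common class fixes the order of the values at neighbouring positions of
        equal color, whereas v and v' order these two positions oppositely.\<close>
      have al: "allowed i v"
      proof (rule ccontr)
        assume "\<not> allowed i v"
        then have c: "color_of r n v ?a = color_of r n v ?b" and or: "?a = Suc ?b \<or> ?b = Suc ?a"
          using i by (auto simp: allowed_def)
        have cl: "descents r n v = descents r n v'" "\<And>j. j < n \<Longrightarrow> color_of r n v j = color_of r n v' j"
          using less.prems(2) by (auto simp: class_eq_iff)
        from or show False
        proof
          assume e: "?a = Suc ?b"
          then have "?w (Suc ?b) = i" using inv(1)[of i] by simp
          then have "?b \<in> descents r n v" using e c ab inv(1)[of "Suc i"] by (simp add: descents_pw)
          then have "?b \<in> descents r n v'" using cl by simp
          then show False using e c cl(2) ab i by (auto simp: descents_pw)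
        next
          assume e: "?b = Suc ?a"
          have "?a \<in> descents r n v'" using e c ab i cl(2) by (simp add: descents_pw)
          then have "?a \<in> descents r n v" using cl by simp
          moreover have "?w (Suc ?a) = Suc i" using e inv(1)[of "Suc i"] by simp
          ultimately show False using e c ab inv(1)[of i] by (simp add: descents_pw)
        qed
      qed
      note mv = move_props[OF v i(1)]
      have "cross (move i v) \<subset> cross v"
      proof
        show "cross (move i v) \<subseteq> cross v"
        proof clarify
          fix x y assume xy: "(x, y) \<in> cross (move i v)"
          then have h: "x < n" "y < n" "tr' (?w x) < tr' (?w y)" "?w' y < ?w' x" if "tr' = Transposition.transpose i (Suc i)" for tr'
            using that by (auto simp: cross_def mv)
          have "?w x < ?w y"
          proof (cases "{?w x, ?w y} = {i, Suc i}")
            case True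
            then have "(x = ?a \<and> y = ?b) \<or> (x = ?b \<and> y = ?a)" using inv(2) by (auto simp: doubleton_eq_iff) metis+
            then show ?thesis
            proof
              assume "x = ?a \<and> y = ?b" then show ?thesis using inv(1) by simp
            next
              assume "x = ?b \<and> y = ?a" then show ?thesis using h(4)[OF refl] i(2) by simp
            qed
          next
            case False
            have "?w x \<noteq> ?w y" using h(3)[OF refl] by auto
            then show ?thesis using transpose_Suc_less[OF _ False] h(3)[OF refl] by simp
          qed
          then show "(x, y) \<in> cross v" using h[OF refl] by (simp add: cross_def)
        qed
        have "(?a, ?b) \<in> cross v" using ab i by (simp add: cross_def inv(1))
        moreover have "(?a, ?b) \<notin> cross (move i v)" by (simp add: cross_def mv inv(1))
        ultimately show "cross (move i v) \<noteq> cross v" by blast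
      qed
      then have "card (cross (move i v)) < card (cross v)" by (intro psubset_card_mono fin)
      from less.hyps[OF this mv(1)] show ?thesis
        using class_move[OF v al] less.prems step[OF v less.prems(3) al] by simp
    next
      case False
      \<comment> \<open>With no adjacent values left to exchange, w' composed with the inverse of w
        is increasing, hence the identity.\<close>
      have mono: "?w' (pinv ?w i) < ?w' (pinv ?w (Suc i))" if "Suc i < n" for i
      proof -
        have "pinv ?w i \<noteq> pinv ?w (Suc i)" using inv(1) by (metis n_not_Suc_n)
        then have "?w' (pinv ?w i) \<noteq> ?w' (pinv ?w (Suc i))" using permutes_inj[OF w'] by (auto dest: injD)
        then show ?thesis using False that by (meson linorder_neqE_nat)
      qed
      have mono': "?w' (pinv ?w i) < ?w' (pinv ?w j)" if "i < j" "j < n" for i j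
        using that
      proof (induction j)
        case (Suc j) then show ?case using mono[of j] by (cases "i = j") auto
      qed simp
      have u: "?w' \<circ> pinv ?w permutes {..<n}" by (rule permutes_compose[OF permutes_inv[OF w] w'])
      have "(?w' \<circ> pinv ?w) x = x" if x: "x < n" for x
      proof -
        have "{b. b < n \<and> (?w' \<circ> pinv ?w) b < (?w' \<circ> pinv ?w) x} = {..<x}"
        proof (rule Set.set_eqI)
          fix b show "b \<in> {b. b < n \<and> (?w' \<circ> pinv ?w) b < (?w' \<circ> pinv ?w) x} \<longleftrightarrow> b \<in> {..<x}"
            using mono'[of b x] mono'[of x b] x by (cases b x rule: linorder_cases) auto
        qed
        then show ?thesis using permutes_rank[OF u x] by simp
      qed
      then have "?w' j = ?w j" if "j < n" for j
        using that permutes_less[OF w, of j] inv(2) by (metis comp_apply)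
      moreover have "color_of r n v j = color_of r n v' j" if "j < n" for j
        using less.prems(2) that by (auto simp: class_eq_iff)
      ultimately have "v = v'"
        by (subst G1_sub_cases(3)[OF v], subst G1_sub_cases(3)[OF assms(2)], intro mk_mat_cong[OF r_pos]) auto
      then show ?thesis using less.prems by simp
    qed
  qed
  then show ?thesis using assms by blast
qed

text \<open>Positions form a zigzag poset determined by the class; its linear extensions are the
  permutations in the class.  A maximal position other than the last one can be moved to carry
  the largest value.\<close>

lemma trivial_class:
  assumes "v \<in> G1_sub r p n" "Q v"
    and step: "\<And>i v. v \<in> G1_sub r p n \<Longrightarrow> Q v \<Longrightarrow> allowed i v \<Longrightarrow> Q (move i v)"
    and last: "\<And>v. v \<in> G1_sub r p n \<Longrightarrow> Q v \<Longrightarrow> pw n v (n - 1) = n - 1 \<and> color_of r n v (n - 1) = 0"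
  shows "lam v = 0"
proof -
  \<comment> \<open>No neighbour of equal color is forced by the class to carry a larger value. The
    last position is never counted as free.\<close>
  define free where "free v a \<longleftrightarrow> a < n - 1 \<and> \<not> (color_of r n v a = color_of r n v (Suc a) \<and> a \<notin> descents r n v)
     \<and> \<not> (a \<ge> 1 \<and> color_of r n v (a - 1) = color_of r n v a \<and> a - 1 \<in> descents r n v)" for v a
  \<comment> \<open>Allowed moves can raise the value at a free position step by step up to n - 1,
    which is reserved for the last position by the hypothesis \<open>last\<close>.\<close>
  have no_free: "\<not> free v a" if "v \<in> G1_sub r p n" "Q v" for v a
    using that
  proof (induction "n - pw n v a" arbitrary: v rule: less_induct)
    case less
    note v = less.prems(1)
    note w = G1_sub_cases(1)[OF v]
    let ?w = "pw n v"
    have inv: "?w (pinv ?w x) = x" "pinv ?w (?w x) = x" for x using permutes_inverses[OF w] by simp_all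
    show ?case
    proof
      assume fr: "free v a"
      then have a: "a < n - 1" "a < n" by (auto simp: free_def)
      have "?w a \<noteq> n - 1"
      proof
        assume "?w a = n - 1"
        then have "?w a = ?w (n - 1)" using last[OF v less.prems(2)] by simp
        then show False using a inv(2) by (metis less_irrefl)
      qed
      moreover have "?w a < n" using permutes_less[OF w, of a] a by simp
      ultimately have i: "Suc (?w a) < n" by linarith
      let ?b = "pinv ?w (Suc (?w a))"
      have b: "?b < n" "?w ?b = Suc (?w a)" using permutes_less[OF permutes_inv[OF w], of "Suc (?w a)"] i inv by auto
      have al: "allowed (?w a) v"
      proof (rule ccontr)
        assume "\<not> allowed (?w a) v"
        then have c: "color_of r n v a = color_of r n v ?b" and or: "a = Suc ?b \<or> ?b = Suc a"
          using i by (auto simp: allowed_def inv)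
        from or show False
        proof
          assume e: "a = Suc ?b"
          then have "?b \<in> descents r n v" using c a b by (simp add: descents_pw)
          moreover have "a - 1 = ?b" "a \<ge> 1" using e by linarith+
          ultimately show False using fr c by (simp add: free_def)
        next
          assume e: "?b = Suc a"
          then have "a \<notin> descents r n v" using c a b by (auto simp: descents_pw)
          then show False using fr c e by (simp add: free_def)
        qed
      qed
      note mv = move_props[OF v i]
      have "free (move (?w a) v) a"
        using fr a mv(3) descents_move[OF v al] by (auto simp: free_def)
      moreover have "n - pw n (move (?w a) v) a < n - ?w a"
        using i by (simp add: mv(2))
      ultimately show False
        using less.hyps[OF _ mv(1) step[OF v less.prems(2) al]] by blast
    qed
  qed
  note v = assms(1)
  have nf: "\<not> free v a" for a using no_free[OF v assms(2)] .
  \<comment> \<open>Working from the left: position a is not smaller than its left neighbour's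
    constraint would require, because that neighbour is no descent; not being free it must lie below
    its right neighbour. So all colors agree and there are no descents.\<close>
  have chain: "color_of r n v a = color_of r n v (Suc a) \<and> a \<notin> descents r n v" if "a < n - 1" for a
    using that
  proof (induction a)
    case 0
    then show ?case using nf[of 0] by (simp add: free_def)
  next
    case (Suc a)
    then show ?case using nf[of "Suc a"] by (auto simp: free_def)
  qed
  have des: "descents r n v = {}" using chain descents_less[of _ r n v] by (metis Suc_lessE diff_Suc_1 ex_in_conv)
  have "a < n \<longrightarrow> color_of r n v (n - 1 - a) = 0" for a
  proof (induction a)
    case 0 then show ?case using last[OF v assms(2)] by simp
  next
    case (Suc a)
    show ?case
    proof
      assume a: "Suc a < n"
      then have "Suc (n - 1 - Suc a) = n - 1 - a" by simp
      then show "color_of r n v (n - 1 - Suc a) = 0" using chain[of "n - 1 - Suc a"] Suc a by simp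
    qed
  qed
  then have col: "color_of r n v a = 0" if "a < n" for a
    using that by (metis diff_diff_cancel diff_less_mono2 less_Suc_eq_le Suc_pred' n_pos diff_less_Suc One_nat_def)
  have "mdeg (lam v) = 0"
    unfolding mdeg_lam[OF v] by (intro sum.neutral) (auto simp: des_below_def des col)
  then show ?thesis by simp
qed

end

section \<open>Decomposition of the polynomial ring at \<open>\<kappa> = 0\<close>\<close>

text \<open>The constant term is the value of the substitution of 0 for all variables, which is
  multiplicative.\<close>

lemma coef_mult_0: "coef (f * g) 0 = coef f 0 * coef (g :: 'k::field mpol) 0"
proof -
  have m: "mon_subst (\<lambda>_. 0) m = (if m = 0 then 1 else (0 :: 'k mpol))" for m
    using exp_nonzero_coef[of m] by (auto simp: mon_subst_def in_keys_iff prod_zero_iff power_0_left)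
  have e: "psubst (\<lambda>_. 0) f = Poly_Mapping.single 0 (coef f 0)" for f :: "'k mpol"
  proof -
    have "psubst (\<lambda>_. 0) f = (\<Sum>x\<in>supp f. if x = 0 then Poly_Mapping.single 0 (coef f 0) else 0)"
      unfolding psubst_linext linext_def
      by (intro sum.cong refl) (auto simp: m pscale_def)
    then show ?thesis by (auto simp: sum.delta in_keys_iff)
  qed
  have "Poly_Mapping.single (0 :: nat \<Rightarrow>\<^sub>0 nat) (coef (f * g) 0) = Poly_Mapping.single 0 (coef f 0 * coef g 0)"
    using psubst_mult[of "\<lambda>_. 0" f g] by (simp add: e mult_single)
  then show ?thesis by (metis lookup_single_eq)
qed

lemma sum_mod_cong:
  fixes f g :: "'a \<Rightarrow> int"
  assumes "\<And>j. j \<in> A \<Longrightarrow> f j mod r = g j mod r" shows "sum f A mod r = sum g A mod r"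
proof -
  have "sum f A mod r = (\<Sum>j\<in>A. f j mod r) mod r" by (rule mod_sum_eq[symmetric])
  also have "(\<Sum>j\<in>A. f j mod r) = (\<Sum>j\<in>A. g j mod r)" by (rule sum.cong) (simp_all add: assms)
  also have "\<dots> mod r = sum g A mod r" by (rule mod_sum_eq)
  finally show ?thesis .
qed

lemma homog_0_const: "homog 0 f \<Longrightarrow> f = pscale (coef f 0) 1"
  by (rule poly_mapping_eqI) (auto simp: homog_def in_keys_iff lookup_one when_def)

lemma finite_exps: "finite {m \<in> in_vars n. mdeg m = d}"
proof (rule inj_on_finite[of "\<lambda>m. map (coef m) [0..<n]"])
  show "inj_on (\<lambda>m. map (coef m) [0..<n]) {m \<in> in_vars n. mdeg m = d}"
  proof (rule inj_onI, rule poly_mapping_eqI)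
    fix x y i assume h: "x \<in> {m \<in> in_vars n. mdeg m = d}" "y \<in> {m \<in> in_vars n. mdeg m = d}"
      "map (coef x) [0..<n] = map (coef y) [0..<n]"
    show "coef x i = coef y i"
      using h by (cases "i < n") (auto simp: in_vars_iff)
  qed
  show "(\<lambda>m. map (coef m) [0..<n]) ` {m \<in> in_vars n. mdeg m = d} \<subseteq> {xs. set xs \<subseteq> {..d} \<and> length xs = n}"
  proof -
    have "coef m x \<le> sum (coef m) {..<n}" if "x < n" for m :: "nat \<Rightarrow>\<^sub>0 nat" and x
      using that by (intro member_le_sum) auto
    then show ?thesis by (auto simp: mdeg_in_vars)
  qed
  show "finite {xs. set xs \<subseteq> {..d} \<and> length xs = n}" by (rule finite_lists_length_eq) simp
qed

definition sorted_exp :: "nat \<Rightarrow> (nat \<Rightarrow>\<^sub>0 nat) \<Rightarrow> bool" where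
  "sorted_exp n \<nu> \<longleftrightarrow> (\<forall>i j. i \<le> j \<longrightarrow> j < n \<longrightarrow> coef \<nu> j \<le> coef \<nu> i)"

lemma sorted_exp_unique:
  assumes s: "\<sigma> permutes {..<n}" and "sorted_exp n \<nu>" "sorted_exp n (exp_perm \<sigma> \<nu>)" "\<nu> \<in> in_vars n"
  shows "exp_perm \<sigma> \<nu> = \<nu>"
proof -
  let ?l = "\<lambda>\<nu>. map (coef \<nu>) (rev [0..<n])"
  have srt: "sorted (?l \<nu>)" if "sorted_exp n \<nu>" for \<nu>
    using that by (simp add: sorted_exp_def rev_map[symmetric] sorted_wrt_rev sorted_wrt_map)
      (auto simp: sorted_wrt_iff_nth_less)
  have "coef (exp_perm \<sigma> \<nu>) = coef \<nu> \<circ> pinv \<sigma>" by (rule ext) (simp add: coef_exp_perm[OF s])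
  then have "mset (?l (exp_perm \<sigma> \<nu>)) = image_mset (coef \<nu>) (image_mset (pinv \<sigma>) (mset_set {..<n}))"
    by (simp add: multiset.map_comp lessThan_atLeast0 mset_upt)
  also have "image_mset (pinv \<sigma>) (mset_set {..<n}) = mset_set {..<n}"
    using image_mset_mset_set[of "pinv \<sigma>" "{..<n}"] permutes_inj[OF permutes_inv[OF s]] permutes_image[OF permutes_inv[OF s]]
    by (simp add: inj_on_subset)
  also have "image_mset (coef \<nu>) (mset_set {..<n}) = mset (?l \<nu>)"
    by (simp add: lessThan_atLeast0 mset_upt)
  finally have "?l (exp_perm \<sigma> \<nu>) = ?l \<nu>"
    using srt assms(2,3) by (metis properties_for_sort)
  then have "coef (exp_perm \<sigma> \<nu>) i = coef \<nu> i" if "i < n" for i using that by auto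
  moreover have "exp_perm \<sigma> \<nu> \<in> in_vars n" using assms by simp
  ultimately show ?thesis using assms(4) by (intro poly_mapping_eqI) (metis in_vars_iff not_le)
qed

section \<open>Invariants, monomial symmetric invariants and weight spaces\<close>

context cher begin

lemma ract_hom_part:
  assumes w: "w permutes {..<n}" and f: "f \<in> polys n"
  shows "ract w k (hom_part d f) = hom_part d (ract w k f)"
proof -
  obtain N where N: "\<And>M. M \<ge> N \<Longrightarrow> (\<Sum>d<M. hom_part d f) = f" using sum_hom_part by blast
  let ?M = "max N (Suc d)"
  have "hom_part d (ract w k (\<Sum>e<?M. hom_part e f)) = (\<Sum>e<?M. hom_part d (ract w k (hom_part e f)))"
    by (simp add: ract_sum hom_part_sum)
  also have "\<dots> = (\<Sum>e<?M. if e = d then ract w k (hom_part d f) else 0)"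
    by (intro sum.cong refl) (subst hom_part_homog[OF ract_homog[OF w polys_hom_part[OF f] homog_hom_part]], auto)
  also have "\<dots> = ract w k (hom_part d f)" by (simp add: sum.delta)
  finally show ?thesis using N[of ?M] by simp
qed

definition Inv :: "'k mpol set" where
  "Inv = {a \<in> polys n. \<forall>w k. w permutes {..<n} \<longrightarrow> int p dvd (\<Sum>j<n. k j) \<longrightarrow> ract w k a = a}"

lemma Inv_polys: "a \<in> Inv \<Longrightarrow> a \<in> polys n" by (simp add: Inv_def)

lemma Inv_ract: "a \<in> Inv \<Longrightarrow> w permutes {..<n} \<Longrightarrow> int p dvd (\<Sum>j<n. k j) \<Longrightarrow> ract w k a = a"
  by (simp add: Inv_def)

lemma Inv_closed:
  "0 \<in> Inv" "1 \<in> Inv" "a \<in> Inv \<Longrightarrow> b \<in> Inv \<Longrightarrow> a + b \<in> Inv" "a \<in> Inv \<Longrightarrow> b \<in> Inv \<Longrightarrow> a - b \<in> Inv"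
  "a \<in> Inv \<Longrightarrow> b \<in> Inv \<Longrightarrow> a * b \<in> Inv" "a \<in> Inv \<Longrightarrow> pscale x a \<in> Inv" "a \<in> Inv \<Longrightarrow> hom_part d a \<in> Inv"
  by (auto simp: Inv_def ract_hom_part)

lemma Inv_sum: "(\<And>x. x \<in> X \<Longrightarrow> g x \<in> Inv) \<Longrightarrow> sum g X \<in> Inv"
  by (induction X rule: infinite_finite_induct) (auto simp: Inv_closed)

lemma Inv_refl: "a \<in> Inv \<Longrightarrow> i < n \<Longrightarrow> j < n \<Longrightarrow> i \<noteq> j \<Longrightarrow> refl i j l a = a"
proof -
  assume a: "a \<in> Inv" "i < n" "j < n" "i \<noteq> j"
  have "(\<Sum>x<n. refl_exp i j l x) = (\<Sum>x\<in>{i, j}. refl_exp i j l x)"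
    using a by (intro sum.mono_neutral_right) (auto simp: refl_exp_def)
  then have "int p dvd (\<Sum>x<n. refl_exp i j l x)" using a(4) by (simp add: refl_exp_def)
  then show ?thesis unfolding refl_def using a by (intro Inv_ract transpose_permutes_less)
qed

lemma Inv_zact: "a \<in> Inv \<Longrightarrow> i < n \<Longrightarrow> int p dvd l \<Longrightarrow> zact i l a = a"
  unfolding zact_def by (intro Inv_ract permutes_id) (auto simp: sum.delta)

lemma Rop_Inv: "a \<in> Inv \<Longrightarrow> i < n \<Longrightarrow> j < n \<Longrightarrow> i \<noteq> j \<Longrightarrow> Rop i j (f * a) = Rop i j f * a"
  by (simp add: Rop_def Inv_refl sum_distrib_right)

text \<open>Exponents of the monomial symmetric invariants of W: partitions whose parts are all
  congruent modulo \<open>r\<close> to one multiple e of r/p. A diagonal matrix of W has exponent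
  sum divisible by p, so it acts on such a monomial by a power of zeta divisible by p * (r/p) = r in
  the exponent, that is, trivially.\<close>

definition adm :: "(nat \<Rightarrow>\<^sub>0 nat) \<Rightarrow> bool" where
  "adm \<nu> \<longleftrightarrow> \<nu> \<in> in_vars n \<and> sorted_exp n \<nu> \<and>
     (\<exists>e. r div p dvd e \<and> (\<forall>j<n. coef \<nu> j mod r = e mod r))"

text \<open>The sum runs over all permutations, so each monomial appears with the order of a
  stabilizer as coefficient, non-zero in characteristic zero.\<close>

definition msym :: "(nat \<Rightarrow>\<^sub>0 nat) \<Rightarrow> 'k mpol" where
  "msym \<nu> = (\<Sum>\<sigma>\<in>{\<sigma>. \<sigma> permutes {..<n}}. mon (exp_perm \<sigma> \<nu>))"

lemma msym_homog: "\<nu> \<in> in_vars n \<Longrightarrow> homog (mdeg \<nu>) (msym \<nu>)"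
  unfolding msym_def by (intro homog_sum) (simp add: homog_def mdeg_exp_perm)

lemma msym_Inv:
  assumes "adm \<nu>" shows "msym \<nu> \<in> Inv"
proof -
  have \<nu>: "\<nu> \<in> in_vars n" using assms by (simp add: adm_def)
  obtain e where e: "r div p dvd e" "\<And>j. j < n \<Longrightarrow> coef \<nu> j mod r = e mod r" using assms by (auto simp: adm_def)
  have "ract w k (msym \<nu>) = msym \<nu>" if w: "w permutes {..<n}" and k: "int p dvd (\<Sum>j<n. k j)" for w k
  proof -
    have z: "zpow (- (\<Sum>j<n. k j * int (coef (exp_perm \<sigma> \<nu>) j))) = 1" if s: "\<sigma> permutes {..<n}" for \<sigma>
    proof -
      have "(\<Sum>j<n. k j * int (coef (exp_perm \<sigma> \<nu>) j)) mod int r = (\<Sum>j<n. k j * int e) mod int r"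
      proof (rule sum_mod_cong)
        fix j assume "j \<in> {..<n}"
        then have "coef (exp_perm \<sigma> \<nu>) j mod r = e mod r"
          using e(2)[of "pinv \<sigma> j"] permutes_less[OF permutes_inv[OF s]] by (simp add: coef_exp_perm[OF s])
        then have "int (coef (exp_perm \<sigma> \<nu>) j) mod int r = int e mod int r" by (metis zmod_int)
        then show "k j * int (coef (exp_perm \<sigma> \<nu>) j) mod int r = k j * int e mod int r"
          by (rule mod_mult_cong[OF refl])
      qed
      also have "(\<Sum>j<n. k j * int e) = (\<Sum>j<n. k j) * int e" by (simp add: sum_distrib_right)
      also have "\<dots> mod int r = 0"
      proof -
        have "int p * int (r div p) dvd (\<Sum>j<n. k j) * int e" using k e(1) by (intro mult_dvd_mono) auto
        then show ?thesis using p_dvd by (simp flip: of_nat_mult)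
      qed
      finally have "int r dvd (\<Sum>j<n. k j * int (coef (exp_perm \<sigma> \<nu>) j))" by (simp add: dvd_eq_mod_eq_0)
      then show ?thesis by (simp add: zpow_eq_1_iff)
    qed
    have "ract w k (msym \<nu>) = (\<Sum>\<sigma>\<in>{\<sigma>. \<sigma> permutes {..<n}}. mon (exp_perm (w \<circ> \<sigma>) \<nu>))"
      unfolding msym_def ract_sum
    proof (intro sum.cong refl)
      fix \<sigma> assume "\<sigma> \<in> {\<sigma>. \<sigma> permutes {..<n}}"
      then have s: "\<sigma> permutes {..<n}" by simp
      have "exp_perm \<sigma> \<nu> \<in> in_vars n" using s \<nu> by simp
      from ract_mon[OF w this, of k] show "ract w k (mon (exp_perm \<sigma> \<nu>)) = mon (exp_perm (w \<circ> \<sigma>) \<nu>)"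
        unfolding z[OF s] exp_perm_comp[OF w s] by simp
    qed
    also have "\<dots> = msym \<nu>"
      unfolding msym_def
      by (rule sum.reindex_bij_witness[where i = "\<lambda>\<sigma>. pinv w \<circ> \<sigma>" and j = "\<lambda>\<sigma>. w \<circ> \<sigma>"])
         (auto simp: permutes_compose w permutes_inv[OF w] o_assoc permutes_inv_o[OF w])
    finally show ?thesis .
  qed
  moreover have "msym \<nu> \<in> polys n" unfolding msym_def using \<nu> by (intro polys_sum) auto
  ultimately show ?thesis by (simp add: Inv_def)
qed

lemma coef_msym:
  assumes "adm \<nu>" "adm \<nu>'" shows "coef (msym \<nu>') \<nu> \<noteq> 0 \<longleftrightarrow> \<nu> = \<nu>'"
proof -
  have c: "coef (msym \<nu>') \<nu> = of_nat (card {\<sigma>. \<sigma> permutes {..<n} \<and> exp_perm \<sigma> \<nu>' = \<nu>})"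
  proof -
    have "coef (msym \<nu>') \<nu> = (\<Sum>\<sigma>\<in>{\<sigma>. \<sigma> permutes {..<n}}. if exp_perm \<sigma> \<nu>' = \<nu> then 1 else 0)"
      by (simp add: msym_def lookup_sum lookup_single when_def)
    also have "\<dots> = (\<Sum>\<sigma>\<in>{\<sigma>. \<sigma> permutes {..<n} \<and> exp_perm \<sigma> \<nu>' = \<nu>}. 1)"
      by (rule sum.mono_neutral_cong_right) (auto simp: finite_permutations)
    finally show ?thesis by simp
  qed
  show ?thesis
  proof (cases "\<nu> = \<nu>'")
    case True
    have "exp_perm id \<nu>' = \<nu>'" by (rule poly_mapping_eqI) (simp add: coef_exp_perm[OF permutes_id])
    then have "id \<in> {\<sigma>. \<sigma> permutes {..<n} \<and> exp_perm \<sigma> \<nu>' = \<nu>}" using True permutes_id by auto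
    moreover have "finite {\<sigma>. \<sigma> permutes {..<n} \<and> exp_perm \<sigma> \<nu>' = \<nu>}"
      by (rule finite_subset[OF _ finite_permutations[of "{..<n}"]]) auto
    ultimately have "0 < card {\<sigma>. \<sigma> permutes {..<n} \<and> exp_perm \<sigma> \<nu>' = \<nu>}" unfolding card_gt_0_iff by blast
    then show ?thesis using c of_nat_neq_0 True by simp
  next
    case False
    have e: "{\<sigma>. \<sigma> permutes {..<n} \<and> exp_perm \<sigma> \<nu>' = \<nu>} = {}"
      using sorted_exp_unique[of _ n \<nu>'] assms False by (auto simp: adm_def)
    show ?thesis unfolding c e using False by simp
  qed
qed

text \<open>The operators that act diagonally on the polynomials \<open>F v\<close>, each paired
  with its eigenvalue as a function of the exponent. The diagonal part consists of all diagonal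
  matrices of W.\<close>

definition wops :: "(('k mpol \<Rightarrow> 'k mpol) \<times> ((nat \<Rightarrow>\<^sub>0 nat) \<Rightarrow> 'k)) set" where
  "wops = {(Z i, ev i) | i. i < n} \<union>
     {(ract id a, \<lambda>\<mu>. zpow (- (\<Sum>j<n. a j * int (coef \<mu> j)))) | a. int p dvd (\<Sum>j<n. a j)}"

definition Wt :: "(nat \<Rightarrow>\<^sub>0 nat) \<Rightarrow> 'k mpol set" where
  "Wt \<mu> = {f \<in> polys n. \<forall>(A, \<alpha>)\<in>wops. A f = pscale (\<alpha> \<mu>) f}"

lemma WtI:
  assumes "f \<in> polys n" "\<And>i. i < n \<Longrightarrow> Z i f = pscale (ev i \<mu>) f"
    "\<And>a. int p dvd (\<Sum>j<n. a j) \<Longrightarrow> ract id a f = pscale (zpow (- (\<Sum>j<n. a j * int (coef \<mu> j)))) f"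
  shows "f \<in> Wt \<mu>"
  using assms by (auto simp: Wt_def wops_def)

lemma WtD:
  assumes "f \<in> Wt \<mu>"
  shows "f \<in> polys n" "\<And>i. i < n \<Longrightarrow> Z i f = pscale (ev i \<mu>) f"
    "\<And>a. int p dvd (\<Sum>j<n. a j) \<Longrightarrow> ract id a f = pscale (zpow (- (\<Sum>j<n. a j * int (coef \<mu> j)))) f"
  using assms by (fastforce simp: Wt_def wops_def)+

lemma wops_linear:
  assumes "(A, \<alpha>) \<in> wops" "f \<in> polys n" "g \<in> polys n"
  shows "A (f + g) = A f + A g" "A (pscale x f) = pscale x (A f)"
  using assms by (auto simp: wops_def Z_add Z_pscale)

lemma wops_sum:
  assumes A: "(A, \<alpha>) \<in> wops" and "\<And>x. x \<in> X \<Longrightarrow> g x \<in> polys n"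
  shows "A (sum g X) = (\<Sum>x\<in>X. A (g x))"
proof -
  have "A 0 = 0" using wops_linear(2)[OF A, of 0 0 0] by simp
  then show ?thesis using assms(2)
    by (induction X rule: infinite_finite_induct) (auto simp: wops_linear(1)[OF A] polys_sum)
qed

lemma Wt_pscale: "f \<in> Wt \<mu> \<Longrightarrow> pscale x f \<in> Wt \<mu>"
  unfolding Wt_def by (auto simp: wops_linear(2) mult.commute)

text \<open>Applying \<open>A - \<alpha>(wt x)\<close> for a separating pair \<open>(A, \<alpha>)\<close> removes the summand with index \<open>x\<close>.\<close>

lemma weight_extract:
  assumes "finite X" and N: "N \<subseteq> polys n" "\<And>f g. f \<in> N \<Longrightarrow> g \<in> N \<Longrightarrow> f + g \<in> N" "\<And>a f. f \<in> N \<Longrightarrow> pscale a f \<in> N"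
    and stable: "\<And>A \<alpha> f. (A, \<alpha>) \<in> wops \<Longrightarrow> f \<in> N \<Longrightarrow> A f \<in> N"
    and "g0 \<in> Wt \<mu>" "\<And>x. x \<in> X \<Longrightarrow> g x \<in> Wt (wt x)"
    and "\<And>x. x \<in> X \<Longrightarrow> \<exists>(A, \<alpha>)\<in>wops. \<alpha> \<mu> \<noteq> \<alpha> (wt x)"
    and "g0 + (\<Sum>x\<in>X. g x) \<in> N"
  shows "g0 \<in> N"
  using assms(1,6-)
proof (induction X arbitrary: g0 g)
  case empty
  then show ?case by simp
next
  case (insert y X)
  from insert.prems(3)[of y] obtain A \<alpha> where A: "(A, \<alpha>) \<in> wops" and ne: "\<alpha> \<mu> \<noteq> \<alpha> (wt y)" by auto
  let ?s = "g0 + (\<Sum>x\<in>insert y X. g x)"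
  have gp: "g x \<in> polys n" "A (g x) = pscale (\<alpha> (wt x)) (g x)" if "x \<in> insert y X" for x
    using insert.prems(2)[OF that] A by (auto simp: Wt_def)
  have g0: "g0 \<in> polys n" "A g0 = pscale (\<alpha> \<mu>) g0" using insert.prems(1) A by (auto simp: Wt_def)
  have Sp: "(\<Sum>x\<in>insert y X. g x) \<in> polys n" using gp by (intro polys_sum) auto
  have "A ?s = A g0 + A (\<Sum>x\<in>insert y X. g x)" by (rule wops_linear(1)[OF A g0(1) Sp])
  also have "A (\<Sum>x\<in>insert y X. g x) = (\<Sum>x\<in>insert y X. A (g x))" using gp by (intro wops_sum[OF A]) auto
  finally have As: "A ?s = pscale (\<alpha> \<mu>) g0 + (\<Sum>x\<in>insert y X. pscale (\<alpha> (wt x)) (g x))"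
    using gp g0 by (simp cong: sum.cong_simp)
  have "A ?s + pscale (- \<alpha> (wt y)) ?s = pscale (\<alpha> \<mu> - \<alpha> (wt y)) g0 + (\<Sum>x\<in>insert y X. pscale (\<alpha> (wt x) - \<alpha> (wt y)) (g x))"
    unfolding As by (simp only: pscale_diff_left pscale_add_right pscale_minus_left sum_subtractf pscale_sum_right)
       (simp add: algebra_simps sum_negf)
  also have "\<dots> = pscale (\<alpha> \<mu> - \<alpha> (wt y)) g0 + (\<Sum>x\<in>X. pscale (\<alpha> (wt x) - \<alpha> (wt y)) (g x))"
    using insert.hyps by simp
  finally have "pscale (\<alpha> \<mu> - \<alpha> (wt y)) g0 + (\<Sum>x\<in>X. pscale (\<alpha> (wt x) - \<alpha> (wt y)) (g x)) \<in> N"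
    using N(2)[OF stable[OF A insert.prems(4)] N(3)[OF insert.prems(4), of "- \<alpha> (wt y)"]] by simp
  moreover have "pscale (\<alpha> (wt x) - \<alpha> (wt y)) (g x) \<in> Wt (wt x)" if "x \<in> X" for x
    using insert.prems(2)[of x] that by (intro Wt_pscale) auto
  moreover have "\<exists>(A, \<alpha>)\<in>wops. \<alpha> \<mu> \<noteq> \<alpha> (wt x)" if "x \<in> X" for x
    using insert.prems(3)[of x] that by simp
  ultimately have "pscale (\<alpha> \<mu> - \<alpha> (wt y)) g0 \<in> N"
    by (rule insert.IH[OF Wt_pscale[OF insert.prems(1)], rotated 2])
  from N(3)[OF this, of "inverse (\<alpha> \<mu> - \<alpha> (wt y))"] show ?case using ne by simp
qed

end

section \<open>Freeness of the polynomial ring over the invariants\<close>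

context cher0 begin

text \<open>At \<kappa> = 0 only divided differences remain, and these are linear over polynomials
  fixed by the reflection. The elements zeta_i^l with \<open>p\<close> not dividing \<open>l\<close>
  are outside W, but their parameter vanishes.\<close>

lemma D_Inv:
  assumes "i < n" "f \<in> polys n" "a \<in> Inv" shows "D i (f * a) = D i f * a"
proof -
  have "pscale (c l) (zdd i (int l) (f * a)) = pscale (c l) (zdd i (int l) f) * a" if "l < r" for l
  proof (cases "p dvd l")
    case True
    then have "zact i (int l) a = a" using assms by (intro Inv_zact) auto
    then show ?thesis using assms by (simp add: zdd_invariant pscale_mult_left)
  next
    case False
    then show ?thesis using c_zero[OF that] by simp
  qed
  then have 1: "(\<Sum>l = 1..<r. pscale (c l) (zdd i (int l) (f * a))) = (\<Sum>l = 1..<r. pscale (c l) (zdd i (int l) f)) * a"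
    unfolding sum_distrib_right by (intro sum.cong) auto
  have "dd i j (int l) (f * a) = dd i j (int l) f * a" if "j \<in> {..<n} - {i}" for j l
    using that assms by (intro dd_invariant Inv_refl) auto
  then have 2: "(\<Sum>j\<in>{..<n} - {i}. \<Sum>l<r. dd i j (int l) (f * a)) = (\<Sum>j\<in>{..<n} - {i}. \<Sum>l<r. dd i j (int l) f) * a"
    unfolding sum_distrib_right by (intro sum.cong refl) auto
  show ?thesis using assms Inv_polys[OF assms(3)]
    by (simp add: dunkl_alt 1 2 left_diff_distrib pscale_mult_left)
qed

lemma Z_Inv: "i < n \<Longrightarrow> f \<in> polys n \<Longrightarrow> a \<in> Inv \<Longrightarrow> Z i (f * a) = Z i f * a"
  using D_Inv[of i "xvar i * f" a]
  by (simp add: Z_def Rop_Inv distrib_right sum_distrib_right pscale_mult_left mult.assoc cong: sum.cong_simp)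

lemma Wt_Inv: "f \<in> Wt \<mu> \<Longrightarrow> a \<in> Inv \<Longrightarrow> f * a \<in> Wt \<mu>"
  by (intro WtI) (auto simp: WtD Z_Inv Inv_polys pscale_mult_left Inv_ract permutes_id)

abbreviation E :: "complex mat set" where "E \<equiv> G1_sub r p n"
abbreviation lm :: "complex mat \<Rightarrow> nat \<Rightarrow>\<^sub>0 nat" where "lm v \<equiv> lam r n v"
abbreviation wv :: "complex mat \<Rightarrow> nat \<Rightarrow> nat" where "wv \<equiv> pw n"
abbreviation kv :: "complex mat \<Rightarrow> nat \<Rightarrow> nat" where "kv \<equiv> color_of r n"

definition F :: "complex mat \<Rightarrow> 'k mpol" where
  "F v = jack0 r p n \<iota> c (steinberg_weight r n v)"

lemma lm_vars [simp]: "lm v \<in> in_vars n" by (rule lam_in_vars[OF r_pos p_dvd n_pos])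

lemma F_good: "good (lm v) (F v)"
  using jack0_good[OF lm_vars] by (simp add: F_def lam_def[OF r_pos p_dvd n_pos])

lemma F_props: "F v \<in> polys n" "homog (mdeg (lm v)) (F v)" "F v \<noteq> 0"
  "\<And>m i. m \<in> supp (F v) \<Longrightarrow> i < n \<Longrightarrow> int (coef m i) mod int r = int (coef (lm v) i) mod int r"
  using F_good[of v] by (auto simp: good_def)

lemma sum_weight_cong:
  assumes "\<And>i. i < n \<Longrightarrow> int (coef m i) mod int r = int (coef \<mu> i) mod int r"
  shows "(\<Sum>j<n. a j * int (coef m j)) mod int r = (\<Sum>j<n. a j * int (coef \<mu> j)) mod int r"
proof -
  show ?thesis by (rule sum_mod_cong) (simp add: mod_mult_cong[OF refl assms])
qed

lemma F_ract_id: "ract id a (F v) = pscale (zpow (- (\<Sum>j<n. a j * int (coef (lm v) j)))) (F v)"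
  by (intro ract_id_weight sum_weight_cong) (use F_props in auto)

lemma F_Wt: "F v \<in> Wt (lm v)"
  by (rule WtI) (use F_good[of v] F_ract_id in \<open>auto simp: good_def\<close>)

lemma sum_delta_mult: "i < n \<Longrightarrow> (\<Sum>j<n. (if j = i then x else 0) * f j) = x * (f i :: int)"
proof -
  assume "i < n"
  moreover have "(\<Sum>j<n. (if j = i then x else 0) * f j) = (\<Sum>j<n. if j = i then x * f i else 0)"
    by (intro sum.cong) auto
  ultimately show ?thesis by (simp add: sum.delta)
qed

text \<open>The elements zeta_i^p fix p times each exponent modulo \<open>r\<close>, hence the terms
  \<open>dz\<close>; since \<open>c 0\<close> is non-zero the z_i then recover
  \<open>behind_num\<close>, and with it the permutation. The last color is below r/p, so it is
  determined by p times itself modulo \<open>r\<close>; quotients of two diagonal generators give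
  all other colors.\<close>

lemma weights_distinct:
  assumes v: "v \<in> E" "v' \<in> E" "v \<noteq> v'"
  shows "\<exists>(A, \<alpha>)\<in>wops. \<alpha> (lm v) \<noteq> \<alpha> (lm v')"
proof (rule ccontr)
  assume neg: "\<not> ?thesis"
  have evs: "ev i (lm v) = ev i (lm v')" if "i < n" for i
  proof -
    have "(Z i, ev i) \<in> wops" using that by (auto simp: wops_def)
    then show ?thesis using neg by auto
  qed
  have diag: "(\<Sum>j<n. a j * int (coef (lm v) j)) mod int r = (\<Sum>j<n. a j * int (coef (lm v') j)) mod int r"
    if "int p dvd (\<Sum>j<n. a j)" for a
  proof -
    have "(ract id a, \<lambda>\<mu>. zpow (- (\<Sum>j<n. a j * int (coef \<mu> j)))) \<in> wops" using that by (auto simp: wops_def)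
    then have "zpow (- (\<Sum>j<n. a j * int (coef (lm v) j))) = zpow (- (\<Sum>j<n. a j * int (coef (lm v') j)))"
      using neg by auto
    then show ?thesis unfolding zpow_eq_iff by (metis mod_minus_cong minus_minus)
  qed
  have pm: "int p * int (coef (lm v) i) mod int r = int p * int (coef (lm v') i) mod int r" if "i < n" for i
    using diag[of "\<lambda>j. if j = i then int p else 0"] that by (simp add: sum_delta_mult sum.delta)
  have dzs: "dz (- int (coef (lm v) i) - 1) = dz (- int (coef (lm v') i) - 1)" if i: "i < n" for i
    unfolding dz_def
  proof (intro sum.cong refl)
    fix l assume l: "l \<in> {1..<r}"
    show "c l * zpow (int l * (- int (coef (lm v) i) - 1)) = c l * zpow (int l * (- int (coef (lm v') i) - 1))"
    proof (cases "p dvd l")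
      case True
      then obtain q where q: "l = p * q" by blast
      have "int r dvd int p * int (coef (lm v) i) - int p * int (coef (lm v') i)"
        using pm[OF i] by (simp add: mod_eq_dvd_iff)
      from dvd_mult[OF this, of "- int q"]
      have "int r dvd int l * (- int (coef (lm v) i) - 1) - int l * (- int (coef (lm v') i) - 1)"
        by (simp add: q algebra_simps)
      then show ?thesis by (simp add: zpow_eq_iff mod_eq_dvd_iff)
    next
      case False then show ?thesis using c_zero l by simp
    qed
  qed
  have bn: "behind_num n (lm v) i = behind_num n (lm v') i" if i: "i < n" for i
  proof -
    have "(of_nat (r * behind_num n (lm v) i) :: 'k) = of_nat (r * behind_num n (lm v') i)"
      using evs[OF i] c0 unfolding ev_def dzs[OF i] by simp
    then have "(of_int (int (r * behind_num n (lm v) i) - int (r * behind_num n (lm v') i)) :: 'k) = 0"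
      by (simp only: of_int_diff of_int_of_nat_eq) simp
    then have "int (r * behind_num n (lm v) i) - int (r * behind_num n (lm v') i) = 0" by (simp only: of_int_eq_0)
    then have "r * behind_num n (lm v) i = r * behind_num n (lm v') i" by linarith
    then show ?thesis using r_pos by simp
  qed
  note w = G1_sub_cases(1)[OF r_pos p_dvd n_pos v(1)] and w' = G1_sub_cases(1)[OF r_pos p_dvd n_pos v(2)]
  have ww: "wv v' j = wv v j" if j: "j < n" for j
  proof -
    define j' where "j' = pinv (wv v') (wv v j)"
    have j': "j' < n" "wv v' j' = wv v j"
      using j permutes_less[OF permutes_inv[OF w']] permutes_less[OF w] permutes_inverses(1)[OF w'] by (auto simp: j'_def)
    have wj: "wv v j < n" using j permutes_less[OF w] by simp
    have "n - 1 - j = behind_num n (lm v) (wv v j)" using behind_num_lam[OF r_pos p_dvd n_pos v(1) j] by simp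
    also have "\<dots> = behind_num n (lm v') (wv v' j')" using bn[OF wj] j'(2) by simp
    also have "\<dots> = n - 1 - j'" using behind_num_lam[OF r_pos p_dvd n_pos v(2) j'(1)] by simp
    finally have "j = j'" using j j'(1) by linarith
    then show ?thesis using j'(2) by simp
  qed
  have cl: "int (coef (lm v) (wv v j)) mod int r = int (kv v j) mod int r"
    "int (coef (lm v') (wv v j)) mod int r = int (kv v' j) mod int r" if j: "j < n" for j
    using coef_lam[OF r_pos p_dvd n_pos v(1) j] coef_lam[OF r_pos p_dvd n_pos v(2) j] ww[OF j] by (simp_all)
  obtain q where q: "r = p * q" using p_dvd by blast
  then have pq: "0 < p" "r div p = q" using r_pos by auto
  have last: "kv v (n - 1) = kv v' (n - 1)"
  proof -
    have n1: "n - 1 < n" using n_pos by simp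
    have wn: "wv v (n - 1) < n" using n1 permutes_less[OF w] by simp
    have "int p * int (kv v (n - 1)) mod int r = int p * int (kv v' (n - 1)) mod int r"
      using pm[OF wn] mod_mult_cong[OF refl cl(1)[OF n1], of "int p"] mod_mult_cong[OF refl cl(2)[OF n1], of "int p"] by simp
    moreover have "p * kv v (n - 1) < r" "p * kv v' (n - 1) < r"
      using G1_sub_cases(4)[OF r_pos p_dvd n_pos v(1)] G1_sub_cases(4)[OF r_pos p_dvd n_pos v(2)] pq q by simp_all
    ultimately have "p * kv v (n - 1) = p * kv v' (n - 1)"
      by (metis mod_less of_nat_eq_iff of_nat_mod of_nat_mult)
    then show ?thesis using pq by simp
  qed
  have cols: "kv v j = kv v' j" if j: "j < n" for j
  proof (cases "j = n - 1")
    case False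
    have n1: "n - 1 < n" using n_pos by simp
    let ?x = "wv v j" and ?y = "wv v (n - 1)"
    have xy: "?x < n" "?y < n" using j n1 permutes_less[OF w] by auto
    let ?a = "\<lambda>i. (if i = ?x then 1 else 0) + (if i = ?y then - 1 else 0) :: int"
    have S: "(\<Sum>i<n. ?a i * g i) = g ?x - g ?y" for g
      using xy by (simp only: distrib_right sum.distrib sum_delta_mult)
    have "int p dvd (\<Sum>i<n. ?a i)" using S[of "\<lambda>_. 1"] by simp
    from diag[OF this] have "(int (coef (lm v) ?x) - int (coef (lm v) ?y)) mod int r =
        (int (coef (lm v') ?x) - int (coef (lm v') ?y)) mod int r" unfolding S .
    then have "(int (kv v j) - int (kv v (n - 1))) mod int r = (int (kv v' j) - int (kv v' (n - 1))) mod int r"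
      using mod_diff_cong[OF cl(1)[OF j] cl(1)[OF n1]] mod_diff_cong[OF cl(2)[OF j] cl(2)[OF n1]] by simp
    then have "(int (kv v j) - int (kv v (n - 1)) + int (kv v (n - 1))) mod int r = (int (kv v' j) - int (kv v' (n - 1)) + int (kv v (n - 1))) mod int r"
      by (rule mod_add_cong) simp
    then have "int (kv v j) mod int r = int (kv v' j) mod int r" using last by simp
    then show ?thesis using G1_sub_cases(2)[OF r_pos p_dvd n_pos v(1) j] G1_sub_cases(2)[OF r_pos p_dvd n_pos v(2) j] by simp
  qed (use last in simp)
  have "v = mk_mat r n (wv v) (\<lambda>j. int (kv v j))" by (rule G1_sub_cases(3)[OF r_pos p_dvd n_pos v(1)])
  also have "\<dots> = mk_mat r n (wv v') (\<lambda>j. int (kv v' j))"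
    by (rule mk_mat_cong[OF r_pos]) (simp_all add: ww cols)
  also have "\<dots> = v'" by (rule G1_sub_cases(3)[OF r_pos p_dvd n_pos v(2), symmetric])
  finally have "v = v'" .
  then show False using v(3) by simp
qed

lemma finite_E: "finite E" by (rule finite_G1_sub[OF r_pos p_dvd n_pos])

lemma weight_sep:
  assumes N: "N \<subseteq> polys n" "\<And>f g. f \<in> N \<Longrightarrow> g \<in> N \<Longrightarrow> f + g \<in> N" "\<And>a f. f \<in> N \<Longrightarrow> pscale a f \<in> N"
    and stable: "\<And>A \<alpha> f. (A, \<alpha>) \<in> wops \<Longrightarrow> f \<in> N \<Longrightarrow> A f \<in> N"
    and g: "\<And>v. v \<in> E \<Longrightarrow> g v \<in> Wt (lm v)" and sum: "(\<Sum>v\<in>E. g v) \<in> N" and v: "v \<in> E"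
  shows "g v \<in> N"
proof (rule weight_extract[where X = "E - {v}" and N = N and g = g and wt = lm and \<mu> = "lm v"])
  show "\<exists>(A, \<alpha>)\<in>wops. \<alpha> (lm v) \<noteq> \<alpha> (lm x)" if "x \<in> E - {v}" for x
    using weights_distinct[OF v, of x] that by auto
  show "g v + sum g (E - {v}) \<in> N" using sum finite_E v by (simp add: sum.remove)
qed (use finite_E g v N stable in blast)+

lemma Inv_independent:
  assumes "\<And>v. v \<in> E \<Longrightarrow> b v \<in> Inv" "(\<Sum>v\<in>E. F v * b v) = 0" "v \<in> E"
  shows "b v = 0"
proof -
  have "F v * b v \<in> {0}"
  proof (rule weight_sep[where g = "\<lambda>v. F v * b v"])
    show "A f \<in> {0}" if "(A, \<alpha>) \<in> wops" "f \<in> {0}" for A \<alpha> f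
      using wops_linear(2)[OF that(1), of 0 0 0] that(2) by simp
  qed (use assms in \<open>auto intro!: Wt_Inv F_Wt\<close>)
  then show ?thesis using F_props(3) by simp
qed

text \<open>Let w sort m stably. After subtracting a constant e from the parts and dividing by
  \<open>r\<close>, the remainders are the colors of v, and the quotients exceed the descent counts
  of v by a weakly decreasing sequence. This sequence times \<open>r\<close>, shifted by e, is
  \<nu>.\<close>

lemma exp_decompose:
  assumes m: "m \<in> in_vars n"
  shows "\<exists>v \<nu>. v \<in> E \<and> adm \<nu> \<and> m = lm v + exp_perm (wv v) \<nu>"
proof -
  define w where "w = pinv (sort_pos n m)"
  note sp = sort_pos_permutes[of n m]
  have w: "w permutes {..<n}" unfolding w_def by (rule permutes_inv[OF sp])
  have srt: "coef m (w j) < coef m (w i) \<or> coef m (w j) = coef m (w i) \<and> w i < w j" if "i < j" "j < n" for i j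
  proof -
    have "sort_pos n m (w i) < sort_pos n m (w j)" using that permutes_inverses(1)[OF sp] by (simp add: w_def)
    moreover have "w i < n" "w j < n" using that permutes_less[OF w] by simp_all
    moreover have "w i \<noteq> w j" using calculation(1) by (metis less_irrefl)
    ultimately have "behind m (w i) (w j)" using sort_pos_less by blast
    then show ?thesis by (auto simp: behind_def)
  qed
  define R where "R = r div p"
  have R: "0 < R" "R dvd r" "R \<le> r" using p_dvd r_pos by (auto simp: R_def dvd_def)
  define \<kappa>' where "\<kappa>' j = coef m (w j)" for j
  have \<kappa>mono: "\<kappa>' j \<le> \<kappa>' i" if "i \<le> j" "j < n" for i j
    using srt[of i j] that by (cases "i = j") (auto simp: \<kappa>'_def)
  define q where "q = \<kappa>' (n - 1)"
  \<comment> \<open>The smallest part \<open>q\<close> is rounded down to a multiple of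
    \<open>R\<close>. The last color becomes q mod R, below R as membership in \<open>E\<close>
    demands, and the last quotient is 0, in line with the absence of descents from there on.\<close>
  define e where "e = q - q mod R"
  have e: "R dvd e" "e \<le> q" unfolding e_def by (auto simp: minus_mod_eq_mult_div)
  have eq: "e \<le> \<kappa>' j" if "j < n" for j
  proof -
    have "j \<le> n - 1" "n - 1 < n" using that by linarith+
    from \<kappa>mono[OF this] show ?thesis using e(2) by (simp add: q_def)
  qed
  define k where "k j = (\<kappa>' j - e) mod r" for j
  define u where "u j = (\<kappa>' j - e) div r" for j
  have \<kappa>: "\<kappa>' j = e + (r * u j + k j)" if "j < n" for j
    using eq[OF that] by (simp add: k_def u_def)
  have qe: "q - e = q mod R" by (simp add: e_def)
  have qR: "q mod R < R" using R by simp
  have last: "k (n - 1) = q mod R" "u (n - 1) = 0"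
    using qR R(3) unfolding k_def u_def q_def[symmetric] qe by auto
  define v where "v = mk_mat r n w (\<lambda>j. int (k j))"
  have k: "k j < r" for j using r_pos by (simp add: k_def)
  have vE: "v \<in> E" "wv v = w" "\<And>j. j < n \<Longrightarrow> kv v j = k j"
    unfolding v_def using mk_mat_G1_sub[OF r_pos p_dvd n_pos w, of k] k last(1) qR R_def by auto
  let ?D = "des_below r n v"
  \<comment> \<open>At a descent the color rises, or it is constant while the value falls. Since the
    parts are sorted stably, both require the quotient to drop by at least one.\<close>
  have ustep: "u (Suc j) + (if j \<in> descents r n v then 1 else 0) \<le> u j" if j: "Suc j < n" for j
  proof -
    have j': "j < n" using j by simp
    have le: "r * u (Suc j) + k (Suc j) \<le> r * u j + k j" using \<kappa>mono[of j "Suc j"] \<kappa>[OF j] \<kappa>[OF j'] j by simp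
    have base: "u (Suc j) \<le> u j" unfolding u_def using \<kappa>mono[of j "Suc j"] j by (intro div_le_mono diff_le_mono) auto
    show ?thesis
    proof (cases "j \<in> descents r n v")
      case True
      have "u (Suc j) \<noteq> u j"
      proof
        assume ueq: "u (Suc j) = u j"
        then have "k (Suc j) \<le> k j" using le by simp
        moreover have "k j < k (Suc j) \<or> k j = k (Suc j) \<and> w (Suc j) < w j"
          using True unfolding descents_pw[OF r_pos p_dvd n_pos] vE(2) vE(3)[OF j] vE(3)[OF j'] by blast
        ultimately have "k (Suc j) = k j" "w (Suc j) < w j" by auto
        then have "\<kappa>' (Suc j) = \<kappa>' j" using \<kappa>[OF j] \<kappa>[OF j'] ueq by simp
        then show False using srt[of j "Suc j"] j \<open>w (Suc j) < w j\<close> by (simp add: \<kappa>'_def)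
      qed
      then show ?thesis using True base by simp
    qed (use base in simp)
  qed
  have step: "u (Suc j) - ?D (Suc j) \<le> u j - ?D j \<and> (?D (Suc j) \<le> u (Suc j) \<longrightarrow> ?D j \<le> u j)" if "Suc j < n" for j
    using ustep[OF that] des_below_Suc[of r n v j] by (auto split: if_splits)
  have Du: "i < n \<longrightarrow> ?D (n - 1 - i) \<le> u (n - 1 - i)" for i
  proof (induction i)
    case 0 then show ?case by (simp add: des_below_last)
  next
    case (Suc i)
    show ?case
    proof
      assume i: "Suc i < n"
      then have "Suc (n - 1 - Suc i) = n - 1 - i" by simp
      then show "?D (n - 1 - Suc i) \<le> u (n - 1 - Suc i)" using step[of "n - 1 - Suc i"] Suc i by simp
    qed
  qed
  have Dle: "?D j \<le> u j" if "j < n" for j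
    using Du[of "n - 1 - j"] that by simp
  have mono: "u j - ?D j \<le> u i - ?D i" if "i \<le> j" "j < n" for i j
    using that
  proof (induction j)
    case (Suc j)
    then show ?case using step[of j] by (cases "i = Suc j") (auto intro: order_trans)
  qed simp
  define N where "N j = (if j < n then e + r * (u j - ?D j) else 0)" for j
  define \<nu> where "\<nu> = Abs_poly_mapping N"
  have \<nu>: "coef \<nu> = N"
    unfolding \<nu>_def by (rule lookup_Abs_poly_mapping) (auto simp: N_def intro: finite_subset[of _ "{..<n}"])
  have "adm \<nu>"
    unfolding adm_def sorted_exp_def
  proof (intro conjI allI impI exI)
    show "\<nu> \<in> in_vars n" by (simp add: in_vars_iff \<nu> N_def)
    show "coef \<nu> j \<le> coef \<nu> i" if "i \<le> j" "j < n" for i j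
      using mono[OF that] that by (simp add: \<nu> N_def)
    show "r div p dvd e" using e R_def by simp
    show "coef \<nu> j mod r = e mod r" if "j < n" for j using that by (simp add: \<nu> N_def)
  qed
  moreover have "m = lm v + exp_perm (wv v) \<nu>"
  proof (rule poly_mapping_eqI)
    fix i
    show "coef m i = coef (lm v + exp_perm (wv v) \<nu>) i"
    proof (cases "i < n")
      case True
      define j where "j = pinv w i"
      have j: "j < n" "w j = i"
        using True permutes_less[OF permutes_inv[OF w]] permutes_inverses(1)[OF w] by (auto simp: j_def)
      have "coef (exp_perm w \<nu>) i = N j" by (simp add: coef_exp_perm[OF w] j_def \<nu>)
      moreover have "coef (lm v) i = r * ?D j + k j"
        using coef_lam[OF r_pos p_dvd n_pos vE(1) j(1)] j vE by simp
      moreover have "r * ?D j + r * (u j - ?D j) = r * u j"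
        using Dle[OF j(1)] by (simp flip: distrib_left)
      moreover have "coef m i = e + (r * u j + k j)" using \<kappa>[OF j(1)] j(2) by (simp add: \<kappa>'_def)
      ultimately show ?thesis using j(1) by (simp add: lookup_add vE(2) N_def)
    next
      case False
      have "exp_perm w \<nu> \<in> in_vars n" using w by (simp add: in_vars_iff[of \<nu>] \<nu> N_def)
      then show ?thesis using False m lm_vars[of v] by (simp add: in_vars_iff lookup_add vE(2))
    qed
  qed
  ultimately show ?thesis using vE(1) by blast
qed

text \<open>The products \<open>F v * msym \<nu>\<close> of degree \<open>d\<close> are as many as the monomials of degree \<open>d\<close>, so
  linear independence suffices for spanning.\<close>

lemma Inv_span:
  assumes "f \<in> polys n"
  shows "\<exists>b. (\<forall>v\<in>E. b v \<in> Inv) \<and> f = (\<Sum>v\<in>E. F v * b v)"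
proof -
  define Q where "Q = {f. \<exists>b. (\<forall>v\<in>E. b v \<in> Inv) \<and> f = (\<Sum>v\<in>E. F v * b v)}"
  have Q0: "0 \<in> Q" unfolding Q_def using Inv_closed(1) by (auto intro!: exI[of _ "\<lambda>_. 0"])
  have Qadd: "x + y \<in> Q" if xy: "x \<in> Q" "y \<in> Q" for x y
  proof -
    obtain b b' where b: "\<forall>v\<in>E. b v \<in> Inv" "x = (\<Sum>v\<in>E. F v * b v)" "\<forall>v\<in>E. b' v \<in> Inv" "y = (\<Sum>v\<in>E. F v * b' v)"
      using xy unfolding Q_def by blast
    have "x + y = (\<Sum>v\<in>E. F v * (b v + b' v))" by (simp add: b distrib_left sum.distrib)
    then show ?thesis unfolding Q_def using b Inv_closed(3) by (auto intro!: exI[of _ "\<lambda>v. b v + b' v"])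
  qed
  have Qsc: "pscale a x \<in> Q" if x: "x \<in> Q" for a x
  proof -
    obtain b where b: "\<forall>v\<in>E. b v \<in> Inv" "x = (\<Sum>v\<in>E. F v * b v)" using x unfolding Q_def by blast
    have "pscale a x = (\<Sum>v\<in>E. F v * pscale a (b v))" by (simp add: b pscale_sum_right pscale_mult_right)
    then show ?thesis unfolding Q_def using b Inv_closed(6) by (auto intro!: exI[of _ "\<lambda>v. pscale a (b v)"])
  qed
  have Qsub: "mpol.subspace Q" using Q0 Qadd Qsc by (auto simp: mpol.subspace_def)
  have Qsingle: "F v * a \<in> Q" if "v \<in> E" "a \<in> Inv" for v a
  proof -
    have "(\<Sum>v'\<in>E. F v' * (if v' = v then a else 0)) = (\<Sum>v'\<in>E. if v' = v then F v * a else 0)"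
      by (intro sum.cong) auto
    also have "\<dots> = F v * a" using that finite_E by (simp add: sum.delta)
    finally show ?thesis unfolding Q_def using that Inv_closed(1) by (auto intro!: exI[of _ "\<lambda>v'. if v' = v then a else 0"])
  qed
  have mon: "mon m \<in> Q" if "m \<in> in_vars n" for m
  proof -
    define d where "d = mdeg m"
    define M where "M = {m \<in> in_vars n. mdeg m = d}"
    have finM: "finite M" unfolding M_def by (rule finite_exps)
    have "\<forall>m\<in>M. \<exists>x. fst x \<in> E \<and> adm (snd x) \<and> m = lm (fst x) + exp_perm (wv (fst x)) (snd x)"
      using exp_decompose by (auto simp: M_def)
    from bchoice[OF this] obtain t where t: "\<And>m. m \<in> M \<Longrightarrow> fst (t m) \<in> E \<and> adm (snd (t m)) \<and>
        m = lm (fst (t m)) + exp_perm (wv (fst (t m))) (snd (t m))" by blast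
    define vt where "vt m = fst (t m)" for m
    define nt where "nt m = snd (t m)" for m
    have t1: "vt m \<in> E" and t2: "adm (nt m)" and t3: "m = lm (vt m) + exp_perm (wv (vt m)) (nt m)" if "m \<in> M" for m
      using t[OF that] by (auto simp: vt_def nt_def)
    define h where "h m = F (vt m) * msym (nt m)" for m
    \<comment> \<open>Products with the same \<open>v\<close> are collected into one invariant
      coefficient, which vanishes by \<open>Inv_independent\<close>; its coefficient at
      \<open>nt m0\<close> sees only the term of \<open>m0\<close>.\<close>
    have lin: "x m0 = 0" if S: "(\<Sum>m\<in>M. pscale (x m) (h m)) = 0" and m0: "m0 \<in> M" for x m0
    proof -
      define b where "b v = (\<Sum>m\<in>{m \<in> M. vt m = v}. pscale (x m) (msym (nt m)))" for v
      have "(\<Sum>v\<in>E. F v * b v) = (\<Sum>v\<in>E. \<Sum>m\<in>{m \<in> M. vt m = v}. pscale (x m) (h m))"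
        unfolding b_def sum_distrib_left by (intro sum.cong refl) (auto simp: h_def pscale_mult_right)
      also have "\<dots> = (\<Sum>m\<in>M. pscale (x m) (h m))"
        by (rule sum.group) (use finM finite_E t1 in auto)
      finally have "b (vt m0) = 0"
        using S t1[OF m0] t2
        by (intro Inv_independent[where b = b]) (auto simp: b_def intro!: Inv_sum Inv_closed(6) msym_Inv)
      then have "0 = coef (b (vt m0)) (nt m0)" by simp
      also have "\<dots> = (\<Sum>m\<in>{m \<in> M. vt m = vt m0}. x m * coef (msym (nt m)) (nt m0))"
        by (simp add: b_def lookup_sum)
      also have "\<dots> = (\<Sum>m\<in>{m \<in> M. vt m = vt m0}. if m = m0 then x m0 * coef (msym (nt m0)) (nt m0) else 0)"
      proof (intro sum.cong refl)
        fix m assume m: "m \<in> {m \<in> M. vt m = vt m0}"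
        have "nt m = nt m0 \<Longrightarrow> m = m0" using t3[of m] t3[OF m0] m by simp
        then show "x m * coef (msym (nt m)) (nt m0) = (if m = m0 then x m0 * coef (msym (nt m0)) (nt m0) else 0)"
          using coef_msym[OF t2[OF m0] t2, of m] m by auto
      qed
      also have "\<dots> = x m0 * coef (msym (nt m0)) (nt m0)" using m0 finM by (simp add: sum.delta)
      finally show ?thesis using coef_msym[OF t2[OF m0] t2[OF m0]] by simp
    qed
    have inj: "inj_on h M"
    proof (rule inj_onI)
      fix m m' assume mm: "m \<in> M" "m' \<in> M" "h m = h m'"
      show "m = m'"
      proof (rule ccontr)
        assume ne: "m \<noteq> m'"
        let ?x = "\<lambda>a. if a = m then 1 else if a = m' then - 1 else 0"
        have "(\<Sum>a\<in>M. pscale (?x a) (h a)) = (\<Sum>a\<in>{m, m'}. pscale (?x a) (h a))"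
          using mm finM by (intro sum.mono_neutral_right) auto
        also have "\<dots> = 0" using ne mm(3) by (simp add: pscale_minus_left)
        finally show False using lin[of ?x m] mm(1) by simp
      qed
    qed
    have ind: "mpol.independent (h ` M)"
    proof (rule mpol.independent_if_scalars_zero)
      fix y x assume S: "(\<Sum>z\<in>h ` M. pscale (y z) z) = 0" and x: "x \<in> h ` M"
      then show "y x = 0" using lin[of "\<lambda>m. y (h m)"] inj by (auto simp: sum.reindex)
    qed (use finM in simp)
    have hspan: "h m' \<in> mpol.span (mon ` M)" if m': "m' \<in> M" for m'
    proof -
      have nv: "nt m' \<in> in_vars n" using t2[OF m'] by (simp add: adm_def)
      have "mdeg (lm (vt m')) + mdeg (nt m') = mdeg m'"
        using arg_cong[OF t3[OF m'], of mdeg] G1_sub_cases(1)[OF r_pos p_dvd n_pos t1[OF m']] nv by (simp add: mdeg_exp_perm)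
      then have hm: "homog d (h m')"
        using homog_mult[OF F_props(2)[of "vt m'"] msym_homog[OF nv]] m' by (simp add: h_def M_def)
      have hp: "h m' \<in> polys n" using Inv_polys[OF msym_Inv[OF t2[OF m']]] by (simp add: h_def F_props)
      have "h m' = (\<Sum>a\<in>supp (h m'). pscale (coef (h m') a) (mon a))"
        by (subst (1) poly_mapping_sum_single) (simp add: pscale_single)
      moreover have "supp (h m') \<subseteq> M" using hm hp by (auto simp: M_def homog_def polys_def)
      then have "(\<Sum>a\<in>supp (h m'). pscale (coef (h m') a) (mon a)) \<in> mpol.span (mon ` M)"
        by (intro mpol.span_sum mpol.span_scale mpol.span_base) auto
      ultimately show ?thesis by simp
    qed
    \<comment> \<open>Otherwise more independent vectors than there are monomials of degree
      \<open>d\<close> would lie in the span of these monomials.\<close>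
    have "mon m \<in> mpol.span (h ` M)"
    proof (rule ccontr)
      assume notin: "mon m \<notin> mpol.span (h ` M)"
      have mM: "m \<in> M" using that by (simp add: M_def d_def)
      have "mpol.independent (insert (mon m) (h ` M))" by (rule mpol.independent_insertI[OF notin ind])
      moreover have "insert (mon m) (h ` M) \<subseteq> mpol.span (mon ` M)" using hspan mM by (auto intro: mpol.span_base)
      ultimately have "card (insert (mon m) (h ` M)) \<le> card ((mon :: _ \<Rightarrow> 'k mpol) ` M)"
        using mpol.independent_span_bound[of "mon ` M"] finM by blast
      moreover have "card ((mon :: _ \<Rightarrow> 'k mpol) ` M) \<le> card M" using finM by (rule card_image_le)
      moreover have "mon m \<notin> h ` M" using notin mpol.span_base by blast
      ultimately show False using finM card_image[OF inj] by simp
    qed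
    moreover have "h ` M \<subseteq> Q" unfolding h_def using Qsingle t1 t2 msym_Inv by blast
    ultimately show ?thesis using mpol.span_minimal[OF _ Qsub] by blast
  qed
  have "f = (\<Sum>m\<in>supp f. pscale (coef f m) (mon m))"
    by (subst (1) poly_mapping_sum_single) (simp add: pscale_single)
  also have "\<dots> \<in> Q"
    using assms mon by (intro mpol.subspace_sum[OF Qsub] Qsc) (auto simp: polys_def)
  finally show ?thesis by (simp add: Q_def)
qed

end

section \<open>The coinvariant ideal\<close>

lemma homog_coef_0: assumes "homog d f" "d \<noteq> 0" shows "coef f 0 = 0"
proof (rule ccontr)
  assume "coef f 0 \<noteq> 0"
  then have "0 \<in> supp f" by (simp add: in_keys_iff)
  then have "mdeg 0 = d" using assms(1) unfolding homog_def by blast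
  then show False using assms(2) by simp
qed

lemma ideal_polysI:
  assumes "N \<subseteq> polys n" "0 \<in> N" "\<And>f g. f \<in> N \<Longrightarrow> g \<in> N \<Longrightarrow> f + g \<in> N"
    and "\<And>f g. f \<in> polys n \<Longrightarrow> g \<in> N \<Longrightarrow> f * g \<in> (N :: 'k::field mpol set)"
  shows "ideal N (poly_ring n)"
proof (rule idealI)
  interpret cring "poly_ring n :: 'k mpol ring" by (rule cring_poly_ring)
  show "ring (poly_ring n :: 'k mpol ring)" by (rule ring_axioms)
  show "subgroup N (add_monoid (poly_ring n))"
  proof (rule group.subgroupI)
    show "Group.group (add_monoid (poly_ring n :: 'k mpol ring))" by (rule a_group)
    fix a assume a: "a \<in> N"
    then have "inv\<^bsub>add_monoid (poly_ring n)\<^esub> a = - a"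
      using a_inv_poly_ring[of a n] assms(1) by (auto simp: a_inv_def)
    then show "inv\<^bsub>add_monoid (poly_ring n)\<^esub> a \<in> N" using assms(4)[of "- 1" a] a by simp
  qed (use assms in auto)
next
  fix a x :: "'k mpol" assume "a \<in> N" "x \<in> carrier (poly_ring n)"
  then show "x \<otimes>\<^bsub>poly_ring n\<^esub> a \<in> N" "a \<otimes>\<^bsub>poly_ring n\<^esub> x \<in> N"
    using assms(4)[of x a] by (simp_all add: mult.commute[of a x])
qed

lemma ideal_polysD:
  assumes "ideal N (poly_ring n :: 'k::field mpol ring)"
  shows "N \<subseteq> polys n" "0 \<in> N" "\<And>f g. f \<in> N \<Longrightarrow> g \<in> N \<Longrightarrow> f + g \<in> N"
    "\<And>f g. f \<in> polys n \<Longrightarrow> g \<in> N \<Longrightarrow> f * g \<in> N"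
proof -
  interpret ideal N "poly_ring n :: 'k mpol ring" by (rule assms)
  show "N \<subseteq> polys n" using a_subset by simp
  show "0 \<in> N" using additive_subgroup.zero_closed[OF ideal.axioms(1)[OF assms]] by simp
  show "f \<in> N \<Longrightarrow> g \<in> N \<Longrightarrow> f + g \<in> N" for f g using additive_subgroup.a_closed[OF ideal.axioms(1)[OF assms]] by simp
  show "f \<in> polys n \<Longrightarrow> g \<in> N \<Longrightarrow> f * g \<in> N" for f g using I_l_closed[of g f] by simp
qed

context cher0 begin

lemma group_invariant_iff:
  assumes "f \<in> polys n"
  shows "(\<forall>g\<in>Grpn r p n. group_act g f = f) \<longleftrightarrow> f \<in> Inv"
proof
  assume h: "\<forall>g\<in>Grpn r p n. group_act g f = f"
  show "f \<in> Inv" unfolding Inv_def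
  proof (intro CollectI conjI allI impI assms)
    fix w k assume w: "w permutes {..<n}" and "int p dvd (\<Sum>j<n. k j)"
    then have "mk_mat r n w k \<in> Grpn r p n" using mk_mat_in_Grpn_iff[OF r_pos p_dvd w] by simp
    then show "ract w k f = f" using h group_act_mk_mat[OF w assms] by metis
  qed
next
  assume f: "f \<in> Inv"
  show "\<forall>g\<in>Grpn r p n. group_act g f = f"
  proof
    fix g assume "g \<in> Grpn r p n"
    from Grpn_cases[OF this r_pos p_dvd] obtain w k where w: "w permutes {..<n}"
      and g: "g = mk_mat r n w (\<lambda>j. int (k j))" and k: "int p dvd (\<Sum>j<n. int (k j))" by metis
    show "group_act g f = f" unfolding g group_act_mk_mat[OF w assms] by (rule Inv_ract[OF f w k])
  qed
qed

lemma positive_invariants_alt: "positive_invariants = {f \<in> Inv. \<exists>d>0. homog d f}"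
  unfolding positive_invariants_def homog_iff
  using group_invariant_iff Inv_polys by auto

definition coinv :: "'k mpol set" where
  "coinv = genideal (poly_ring n) positive_invariants"

text \<open>The augmentation ideal of the ring of invariants, inhomogeneous elements
  included.\<close>

definition Inv0 :: "'k mpol set" where
  "Inv0 = {a \<in> Inv. coef a 0 = 0}"

lemma Inv0_Inv: "a \<in> Inv0 \<Longrightarrow> a \<in> Inv" by (simp add: Inv0_def)

lemma Inv0_mult: "a \<in> Inv \<Longrightarrow> b \<in> Inv0 \<Longrightarrow> a * b \<in> Inv0"
  by (simp add: Inv0_def Inv_closed coef_mult_0)

lemma Inv0_add: "a \<in> Inv0 \<Longrightarrow> b \<in> Inv0 \<Longrightarrow> a + b \<in> Inv0"
  by (simp add: Inv0_def Inv_closed lookup_add)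

lemma Inv0_0: "0 \<in> Inv0" by (simp add: Inv0_def Inv_closed)

lemma Inv0_hom_part: "a \<in> Inv0 \<Longrightarrow> hom_part d a \<in> Inv0"
  by (simp add: Inv0_def Inv_closed coef_hom_part)

lemma ring_polys: "ring (poly_ring n :: 'k mpol ring)"
  using cring_poly_ring by (rule cring.axioms)

lemma positive_invariants_subset: "positive_invariants \<subseteq> polys n"
  by (auto simp: positive_invariants_alt Inv_polys)

lemma ideal_coinv: "ideal coinv (poly_ring n)"
  unfolding coinv_def using positive_invariants_subset by (intro ring.genideal_ideal[OF ring_polys]) simp

lemma coinv_closed:
  "coinv \<subseteq> polys n" "0 \<in> coinv" "f \<in> coinv \<Longrightarrow> g \<in> coinv \<Longrightarrow> f + g \<in> coinv" "h \<in> polys n \<Longrightarrow> f \<in> coinv \<Longrightarrow> h * f \<in> coinv"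
  using ideal_polysD[OF ideal_coinv] by auto

lemma coinv_pscale: "f \<in> coinv \<Longrightarrow> pscale a f \<in> coinv"
  using coinv_closed(4)[of "pscale a 1" f] by (simp add: pscale_mult_left)

lemma coinv_uminus: "f \<in> coinv \<Longrightarrow> - f \<in> coinv"
  using coinv_pscale[of f "- 1"] by (simp add: pscale_minus_left)

lemma coinv_diff: "f \<in> coinv \<Longrightarrow> g \<in> coinv \<Longrightarrow> f - g \<in> coinv"
  using coinv_closed(3)[of f "- g"] by (simp add: coinv_uminus)

lemma coinv_sum: "(\<And>x. x \<in> X \<Longrightarrow> g x \<in> coinv) \<Longrightarrow> sum g X \<in> coinv"
  by (induction X rule: infinite_finite_induct) (auto simp: coinv_closed)

lemma Inv0_coinv: assumes "a \<in> Inv0" shows "a \<in> coinv"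
proof -
  obtain N where N: "\<And>M. M \<ge> N \<Longrightarrow> (\<Sum>d<M. hom_part d a) = a" using sum_hom_part by blast
  have "hom_part d a \<in> coinv" for d
  proof (cases "d = 0")
    case True
    have "hom_part 0 a = 0"
      using assms by (intro poly_mapping_eqI) (auto simp: coef_hom_part Inv0_def)
    then show ?thesis using True coinv_closed(2) by simp
  next
    case False
    then have "hom_part d a \<in> positive_invariants"
      using Inv_closed(7)[OF Inv0_Inv[OF assms]] by (auto simp: positive_invariants_alt intro!: exI[of _ d])
    then show ?thesis unfolding coinv_def
      using ring.genideal_self[OF ring_polys] positive_invariants_subset by (metis carrier_poly_ring subsetD)
  qed
  then have "(\<Sum>d<N. hom_part d a) \<in> coinv" by (intro coinv_sum)
  then show ?thesis using N[of N] by simp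
qed

text \<open>By \<open>Inv_span\<close> the combinations with coefficients in the augmentation ideal
  are closed under multiplication by arbitrary polynomials. They form an ideal that contains the
  positive invariants and lies in \<open>coinv\<close>.\<close>

lemma coinv_iff: "f \<in> coinv \<longleftrightarrow> (\<exists>b. (\<forall>v\<in>E. b v \<in> Inv0) \<and> f = (\<Sum>v\<in>E. F v * b v))"
proof
  assume "\<exists>b. (\<forall>v\<in>E. b v \<in> Inv0) \<and> f = (\<Sum>v\<in>E. F v * b v)"
  then show "f \<in> coinv" using Inv0_coinv F_props(1) by (auto intro!: coinv_sum coinv_closed(4))
next
  let ?Q = "{f. \<exists>b. (\<forall>v\<in>E. b v \<in> Inv0) \<and> f = (\<Sum>v\<in>E. F v * b v)}"
  have add: "x + y \<in> ?Q" if xy: "x \<in> ?Q" "y \<in> ?Q" for x y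
  proof -
    obtain b b' where b: "\<forall>v\<in>E. b v \<in> Inv0" "x = (\<Sum>v\<in>E. F v * b v)" "\<forall>v\<in>E. b' v \<in> Inv0" "y = (\<Sum>v\<in>E. F v * b' v)"
      using xy by blast
    have "x + y = (\<Sum>v\<in>E. F v * (b v + b' v))" by (simp add: b distrib_left sum.distrib)
    then show ?thesis using b Inv0_add by (auto intro!: exI[of _ "\<lambda>v. b v + b' v"])
  qed
  have zero: "0 \<in> ?Q" using Inv0_0 by (auto intro!: exI[of _ "\<lambda>_. 0"])
  have sum: "sum g X \<in> ?Q" if "\<And>x. x \<in> X \<Longrightarrow> g x \<in> ?Q" for g and X :: "complex mat set"
    using that zero add by (induction X rule: infinite_finite_induct) (simp_all only: sum.infinite sum.empty sum.insert insert_iff simp_thms)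
  have base: "h * a \<in> ?Q" if h: "h \<in> polys n" and a: "a \<in> Inv0" for h a
  proof -
    obtain b where b: "\<forall>v\<in>E. b v \<in> Inv" "h = (\<Sum>v\<in>E. F v * b v)" using Inv_span[OF h] by blast
    have "h * a = (\<Sum>v\<in>E. F v * (b v * a))" by (simp add: b sum_distrib_right mult.assoc)
    then show ?thesis using b Inv0_mult[OF _ a] by (auto intro!: exI[of _ "\<lambda>v. b v * a"])
  qed
  have mult: "h * x \<in> ?Q" if h: "h \<in> polys n" and x: "x \<in> ?Q" for h x
  proof -
    obtain b where b: "\<forall>v\<in>E. b v \<in> Inv0" "x = (\<Sum>v\<in>E. F v * b v)" using x by blast
    have "h * x = (\<Sum>v\<in>E. (h * F v) * b v)" by (simp add: b sum_distrib_left mult.assoc)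
    also have "\<dots> \<in> ?Q" using b h F_props(1) by (intro sum base) auto
    finally show ?thesis .
  qed
  have "?Q \<subseteq> polys n" using F_props(1) Inv_polys Inv0_Inv by (auto intro!: polys_sum polys_mult)
  then have "ideal ?Q (poly_ring n)" using zero add mult by (intro ideal_polysI) blast+
  moreover have "positive_invariants \<subseteq> ?Q"
  proof
    fix a assume "a \<in> positive_invariants"
    then obtain d where d: "a \<in> Inv" "d > 0" "homog d a" by (auto simp: positive_invariants_alt)
    have "coef a 0 = 0" using homog_coef_0[OF d(3)] d(2) by simp
    then have "1 * a \<in> ?Q" using d(1) by (intro base) (auto simp: Inv0_def)
    then show "a \<in> ?Q" by (simp only: mult_1)
  qed
  ultimately have "coinv \<subseteq> ?Q" unfolding coinv_def by (intro ring.genideal_minimal[OF ring_polys])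
  then show "f \<in> coinv \<Longrightarrow> \<exists>b. (\<forall>v\<in>E. b v \<in> Inv0) \<and> f = (\<Sum>v\<in>E. F v * b v)" by blast
qed

text \<open>An operator linear over the invariants acts on the basis elements only and leaves the
  coefficients in the augmentation ideal.\<close>

lemma coinv_operator:
  assumes f: "f \<in> coinv"
    and A: "\<And>f. f \<in> polys n \<Longrightarrow> A f \<in> polys n" "\<And>f g. f \<in> polys n \<Longrightarrow> g \<in> polys n \<Longrightarrow> A (f + g) = A f + A g"
      "A 0 = 0" "\<And>f a. f \<in> polys n \<Longrightarrow> a \<in> Inv \<Longrightarrow> A (f * a) = A f * a"
  shows "A f \<in> coinv"
proof -
  obtain b where b: "\<forall>v\<in>E. b v \<in> Inv0" "f = (\<Sum>v\<in>E. F v * b v)" using f coinv_iff by blast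
  have bp: "F v * b v \<in> polys n" if "v \<in> E" for v using that b Inv0_Inv Inv_polys F_props(1) by auto
  have "A (\<Sum>v\<in>X. F v * b v) = (\<Sum>v\<in>X. A (F v) * b v)" if "X \<subseteq> E" for X
    using finite_subset[OF that finite_E] that
  proof (induction X rule: finite_induct)
    case (insert x X)
    have "(\<Sum>v\<in>X. F v * b v) \<in> polys n" using insert bp by (intro polys_sum) auto
    then show ?case using insert bp A(2)[of "F x * b x"] A(4)[of "F x" "b x"] b Inv0_Inv F_props(1) by auto
  qed (simp add: A(3))
  then have "A f = (\<Sum>v\<in>E. A (F v) * b v)" by (simp add: b)
  also have "\<dots> \<in> coinv" using A(1) F_props(1) b Inv0_coinv by (intro coinv_sum coinv_closed(4)) auto
  finally show ?thesis .
qed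

lemma coinv_D: "i < n \<Longrightarrow> f \<in> coinv \<Longrightarrow> D i f \<in> coinv"
  by (rule coinv_operator) (auto simp: D_add D_0 D_Inv)

lemma coinv_Z: "i < n \<Longrightarrow> f \<in> coinv \<Longrightarrow> Z i f \<in> coinv"
  by (rule coinv_operator) (auto simp: Z_add Z_Inv Z_pscale[of i 0 0, simplified])

lemma coinv_ract: "w permutes {..<n} \<Longrightarrow> int p dvd (\<Sum>j<n. k j) \<Longrightarrow> f \<in> coinv \<Longrightarrow> ract w k f \<in> coinv"
  by (rule coinv_operator) (auto simp: Inv_ract)

lemma coinv_hom_part: assumes "f \<in> coinv" shows "hom_part d f \<in> coinv"
proof -
  obtain b where b: "\<forall>v\<in>E. b v \<in> Inv0" "f = (\<Sum>v\<in>E. F v * b v)" using assms coinv_iff by blast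
  have "hom_part d (F v * b v) \<in> coinv" if v: "v \<in> E" for v
  proof -
    have "hom_part d (F v * b v) = (if mdeg (lm v) \<le> d then F v * hom_part (d - mdeg (lm v)) (b v) else 0)"
      using hom_part_mult_homog[OF F_props(2), of d "b v" v] by (simp add: mult.commute[of _ "F v"])
    moreover have "F v * hom_part e (b v) \<in> coinv" for e
      using b v by (intro coinv_closed(4) F_props(1) Inv0_coinv Inv0_hom_part) auto
    ultimately show ?thesis using coinv_closed(2) by simp
  qed
  then show ?thesis by (simp add: b(2) hom_part_sum coinv_sum)
qed

lemma coinv_coef_0: assumes "f \<in> coinv" shows "coef f 0 = 0"
proof -
  obtain b where b: "\<forall>v\<in>E. b v \<in> Inv0" "f = (\<Sum>v\<in>E. F v * b v)" using assms coinv_iff by blast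
  then show ?thesis by (simp add: lookup_sum coef_mult_0 Inv0_def)
qed

lemma F_const: "F v * pscale x 1 = pscale x (F v)"
  by (simp add: pscale_mult_right)

text \<open>Modulo the ideal each invariant coefficient may be replaced by its constant
  term.\<close>

lemma coinv_decompose:
  assumes "f \<in> polys n" shows "\<exists>u. f - (\<Sum>v\<in>E. pscale (u v) (F v)) \<in> coinv"
proof -
  obtain b where b: "\<forall>v\<in>E. b v \<in> Inv" "f = (\<Sum>v\<in>E. F v * b v)" using Inv_span[OF assms] by blast
  have "f - (\<Sum>v\<in>E. pscale (coef (b v) 0) (F v)) = (\<Sum>v\<in>E. F v * (b v - pscale (coef (b v) 0) 1))"
    by (simp add: b(2) right_diff_distrib F_const sum_subtractf)
  moreover have "b v - pscale (coef (b v) 0) 1 \<in> Inv0" if "v \<in> E" for v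
    using b that by (auto simp: Inv0_def Inv_closed lookup_minus lookup_one)
  ultimately show ?thesis unfolding coinv_iff
    by (intro exI[of _ "\<lambda>v. coef (b v) 0"] exI[of _ "\<lambda>v. b v - pscale (coef (b v) 0) 1"]) simp
qed

lemma coinv_independent:
  assumes "(\<Sum>v\<in>E. pscale (u v) (F v)) \<in> coinv" "v \<in> E" shows "u v = 0"
proof -
  obtain b where b: "\<forall>v\<in>E. b v \<in> Inv0" "(\<Sum>v\<in>E. pscale (u v) (F v)) = (\<Sum>v\<in>E. F v * b v)"
    using assms(1) coinv_iff by blast
  have "pscale (u v) 1 - b v = 0"
  proof (rule Inv_independent[where b = "\<lambda>v. pscale (u v) 1 - b v"])
    show "(\<Sum>v\<in>E. F v * (pscale (u v) 1 - b v)) = 0"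
      using b(2) by (simp add: right_diff_distrib F_const sum_subtractf)
  qed (use b assms(2) in \<open>auto simp: Inv_closed Inv0_Inv\<close>)
  then have "coef (pscale (u v) 1 - b v) 0 = 0" by simp
  then show ?thesis using b(1) assms(2) by (simp add: lookup_minus Inv0_def)
qed

lemma F_notin_coinv: "v \<in> E \<Longrightarrow> F v \<notin> coinv"
proof
  assume v: "v \<in> E" "F v \<in> coinv"
  have "(\<Sum>x\<in>E. pscale (if x = v then 1 else 0) (F x)) = (\<Sum>x\<in>E. if x = v then F v else 0)"
    by (intro sum.cong) auto
  also have "\<dots> = F v" using v finite_E by (simp add: sum.delta)
  finally show False using coinv_independent[of "\<lambda>x. if x = v then 1 else 0" v] v by simp
qed

text \<open>Separating weights in the expansion over the invariants shows that \<open>g\<close> is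
  \<open>F v\<close> times an invariant. By homogeneity this invariant is a constant when the
  degrees agree and has no constant term otherwise.\<close>

lemma weight_space_homog:
  assumes g: "g \<in> Wt (lm v)" "homog d g" and v: "v \<in> E"
  shows "(d = mdeg (lm v) \<longrightarrow> (\<exists>y. g = pscale y (F v))) \<and> (d \<noteq> mdeg (lm v) \<longrightarrow> g \<in> coinv)"
proof (cases "g = 0")
  case True
  then show ?thesis using coinv_closed(2) by (auto intro: exI[of _ 0])
next
  case False
  obtain b where b: "\<forall>v\<in>E. b v \<in> Inv" "g = (\<Sum>v\<in>E. F v * b v)" using Inv_span[OF WtD(1)[OF g(1)]] by blast
  have "F v * b v - g \<in> {0}"
  proof -
    let ?h = "\<lambda>x. F x * b x - (if x = v then g else 0)"
    have "(\<Sum>x\<in>E. ?h x) = g - (\<Sum>x\<in>E. if x = v then g else 0)" by (simp add: sum_subtractf b(2))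
    also have "\<dots> = 0" using v finite_E by (simp add: sum.delta)
    finally have S: "(\<Sum>x\<in>E. ?h x) \<in> {0}" by simp
    have W: "?h x \<in> Wt (lm x)" if x: "x \<in> E" for x
    proof -
      have 1: "F x * b x \<in> Wt (lm x)" using x b by (intro Wt_Inv F_Wt) auto
      have "(if x = v then g else 0) \<in> Wt (lm x)" using g(1) Wt_pscale[OF 1, of 0] by auto
      then have 2: "pscale (- 1) (if x = v then g else 0) \<in> Wt (lm x)" by (rule Wt_pscale)
      show ?thesis
      proof (rule WtI)
        show "?h x \<in> polys n" using WtD(1)[OF 1] WtD(1)[OF 2] polys_add by (force simp: pscale_minus_left)
        have e: "?h x = F x * b x + pscale (- 1) (if x = v then g else 0)" by (simp add: pscale_minus_left)
        show "Z i (?h x) = pscale (ev i (lm x)) (?h x)" if "i < n" for i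
          unfolding e Z_add[OF that WtD(1)[OF 1] WtD(1)[OF 2]] WtD(2)[OF 1 that] WtD(2)[OF 2 that]
          by (rule pscale_add_right[symmetric])
        show "ract id a (?h x) = pscale (zpow (- (\<Sum>j<n. a j * int (coef (lm x) j)))) (?h x)"
          if "int p dvd (\<Sum>j<n. a j)" for a
          unfolding e ract_simps(1) WtD(3)[OF 1 that] WtD(3)[OF 2 that]
          by (rule pscale_add_right[symmetric])
      qed
    qed
    have "?h v \<in> {0}"
    proof (rule weight_sep[where N = "{0}" and g = ?h])
      show "A f \<in> {0}" if "(A, \<alpha>) \<in> wops" "f \<in> {0}" for A \<alpha> f
        using wops_linear(2)[OF that(1), of 0 0 0] that(2) by simp
    qed (use W S v in auto)
    then show ?thesis by simp
  qed
  then have gb: "g = b v * F v" by (simp add: mult.commute)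
  have bI: "b v \<in> Inv" using b v by blast
  have "b v \<noteq> 0" using False gb by auto
  from homog_factor[OF _ F_props(2)[of v] F_props(3) this, of d] g(2) gb
  have hb: "mdeg (lm v) \<le> d" "homog (d - mdeg (lm v)) (b v)" by auto
  show ?thesis
  proof (intro conjI impI)
    assume "d = mdeg (lm v)"
    then have "b v = pscale (coef (b v) 0) 1" using hb(2) homog_0_const by simp
    then show "\<exists>y. g = pscale y (F v)" unfolding gb by (metis mult.commute F_const)
  next
    assume "d \<noteq> mdeg (lm v)"
    have "coef (b v) 0 = 0"
      using homog_coef_0[OF hb(2)] \<open>d \<noteq> mdeg (lm v)\<close> hb(1) by simp
    then have "b v \<in> coinv" using bI by (intro Inv0_coinv) (simp add: Inv0_def)
    then show "g \<in> coinv" unfolding gb using coinv_closed(4)[OF F_props(1)] by (metis mult.commute)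
  qed
qed

section \<open>Adjacent transpositions and the basis\<close>

lemma dz_cong: "a mod int r = b mod int r \<Longrightarrow> dz a = dz b"
  unfolding dz_def by (intro sum.cong refl arg_cong2[where f = "(*)"] zpow_cong mod_mult_cong)

context
  fixes v :: "complex mat" and i :: nat assumes v: "v \<in> E" and i: "Suc i < n"
begin

lemma pw_perm: "wv v permutes {..<n}" by (rule G1_sub_cases(1)[OF r_pos p_dvd n_pos v])

lemma move_E: "move r n i v \<in> E" by (rule move_props(1)[OF r_pos p_dvd n_pos v i])

lemma lm_mod: "j < n \<Longrightarrow> int (coef (lm v) (wv v j)) mod int r = int (kv v j) mod int r"
  using coef_lam[OF r_pos p_dvd n_pos v] by simp

lemma move_lm:
  assumes x: "x < n"
  shows "int (coef (lm (move r n i v)) (tr i x)) mod int r = int (coef (lm v) x) mod int r"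
    "ev (tr i x) (lm (move r n i v)) = ev x (lm v)"
proof -
  note mv = move_props[OF r_pos p_dvd n_pos v i]
  define j where "j = pinv (wv v) x"
  have j: "j < n" "wv v j = x"
    using x permutes_less[OF permutes_inv[OF pw_perm]] permutes_inverses(1)[OF pw_perm] by (auto simp: j_def)
  have tx: "tr i x = wv (move r n i v) j" using j by (simp add: mv)
  show m: "int (coef (lm (move r n i v)) (tr i x)) mod int r = int (coef (lm v) x) mod int r"
    using coef_lam[OF r_pos p_dvd n_pos mv(1) j(1)] coef_lam[OF r_pos p_dvd n_pos v j(1)] j mv(3)[OF j(1)] tx by simp
  have "behind_num n (lm (move r n i v)) (tr i x) = behind_num n (lm v) x"
    using behind_num_lam[OF r_pos p_dvd n_pos mv(1) j(1)] behind_num_lam[OF r_pos p_dvd n_pos v j(1)] j tx by simp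
  moreover have "dz (- int (coef (lm (move r n i v)) (tr i x)) - 1) = dz (- int (coef (lm v) x) - 1)"
    using m by (intro dz_cong mod_diff_cong mod_minus_cong refl)
  ultimately show "ev (tr i x) (lm (move r n i v)) = ev x (lm v)" by (simp add: ev_def)
qed

text \<open>\<open>h\<close> is the intertwiner applied to \<open>F v\<close>. If the positions a
  and b of the values i and i + 1 have equal colors, the eigenvalues of z_i and z_(i+1) differ by r
  * c 0 * (a - b), so x = 1/(a - b); for different colors the reflection sum acts by 0 and x =
  0.\<close>

lemma move_eigenvector:
  obtains x h where "h \<in> Wt (lm (move r n i v))" "homog (mdeg (lm v)) h" "sw i (F v) = h - pscale x (F v)"
    "if kv v (pinv (wv v) i) = kv v (pinv (wv v) (Suc i))
     then x * of_int (int (pinv (wv v) i) - int (pinv (wv v) (Suc i))) = 1 else x = 0"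
proof -
  let ?l = "lm v" and ?\<mu> = "lm (move r n i v)"
  let ?a = "pinv (wv v) i" and ?b = "pinv (wv v) (Suc i)"
  have inv: "wv v (pinv (wv v) y) = y" for y using permutes_inverses(1)[OF pw_perm] by simp
  have i': "i < n" using i by simp
  have ab: "?a < n" "?b < n" using i permutes_less[OF permutes_inv[OF pw_perm]] by auto
  have mods: "int (coef ?l i) mod int r = int (kv v ?a) mod int r" "int (coef ?l (Suc i)) mod int r = int (kv v ?b) mod int r"
    using lm_mod[OF ab(1)] lm_mod[OF ab(2)] by (simp_all add: inv)
  let ?\<delta> = "int (coef ?l i) - int (coef ?l (Suc i))"
  have col: "int r dvd ?\<delta> \<longleftrightarrow> kv v ?a = kv v ?b"
    using mods G1_sub_cases(2)[OF r_pos p_dvd n_pos v ab(1)] G1_sub_cases(2)[OF r_pos p_dvd n_pos v ab(2)]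
    by (simp flip: mod_eq_dvd_iff)
  define x where "x = (if int r dvd ?\<delta> then c 0 * of_nat r / (ev i ?l - ev (Suc i) ?l) else 0)"
  have x: "x * (ev i ?l - ev (Suc i) ?l) = c 0 * (if int r dvd ?\<delta> then of_nat r else 0)"
    using behind_ev_neq[OF i, of ?l] by (simp add: x_def)
  have "ract id (\<lambda>b. if b = i then - l else if b = Suc i then l else 0) (F v) = pscale (zpow (l * ?\<delta>)) (F v)" for l
  proof -
    let ?k = "\<lambda>b. if b = i then - l else if b = Suc i then l else 0"
    have "(\<Sum>j<n. ?k j * int (coef ?l j)) = (\<Sum>j\<in>{i, Suc i}. ?k j * int (coef ?l j))"
      using i by (intro sum.mono_neutral_right) auto
    also have "\<dots> = - (l * ?\<delta>)" by (simp add: algebra_simps)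
    finally show ?thesis using F_ract_id[of ?k v] by simp
  qed
  note P = Rop_sw[OF i F_props(1) this]
  have ZF: "Z y (F v) = pscale (ev y ?l) (F v)" if "y < n" for y using F_good[of v] that by (simp add: good_def)
  note tau = tau_eigen[OF i F_props(1) ZF[OF i'] ZF[OF i] P x]
  let ?h = "sw i (F v) + pscale x (F v)"
  have hp: "?h \<in> polys n" using i F_props(1) by auto
  have Zh: "Z (tr i y) ?h = pscale (ev y ?l) ?h" if y: "y < n" for y
  proof -
    consider "y = i" | "y = Suc i" | "y \<noteq> i" "y \<noteq> Suc i" by blast
    then show ?thesis
    proof cases
      case 1 then show ?thesis using tau(2) by simp
    next
      case 2 then show ?thesis using tau(1) by simp
    next
      case 3 then show ?thesis using tau_eigen_other[OF i F_props(1) y 3 ZF[OF y]] by simp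
    qed
  qed
  have "?h \<in> Wt ?\<mu>"
  proof (rule WtI[OF hp])
    fix y assume y: "y < n"
    have ty: "tr i y < n" using y permutes_less[OF tr_permutes[OF i]] by simp
    show "Z y ?h = pscale (ev y ?\<mu>) ?h"
      using Zh[OF ty] move_lm(2)[OF ty] by simp
  next
    fix a :: "nat \<Rightarrow> int"
    assume "int p dvd (\<Sum>j<n. a j)"
    have swap: "(\<Sum>j<n. a (tr i j) * int (coef ?l j)) = (\<Sum>j<n. a j * int (coef ?l (tr i j)))"
      using sum.permute[OF tr_permutes[OF i], of "\<lambda>j. a (tr i j) * int (coef ?l j)"] by (simp add: o_def)
    have mu: "int (coef ?l (tr i j)) mod int r = int (coef ?\<mu> j) mod int r" if "j < n" for j
      using move_lm(1)[of "tr i j"] that permutes_less[OF tr_permutes[OF i], of j] by simp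
    have mm: "(\<Sum>j<n. a j * int (coef ?l (tr i j))) mod int r = (\<Sum>j<n. a j * int (coef ?\<mu> j)) mod int r"
      by (rule sum_mod_cong) (use mu in \<open>auto intro!: mod_mult_cong\<close>)
    have "ract id a (sw i (F v)) = sw i (ract id (\<lambda>j. a (tr i j)) (F v))"
      unfolding refl_def ract_comp[OF F_props(1)]
      by (rule ract_cong[OF F_props(1)]) (auto simp: refl_exp_def)
    also have "\<dots> = pscale (zpow (- (\<Sum>j<n. a j * int (coef ?\<mu> j)))) (sw i (F v))"
      unfolding F_ract_id swap refl_simps(3) zpow_cong[OF mod_minus_cong[OF mm]] by (rule refl)
    finally have 1: "ract id a (sw i (F v)) = pscale (zpow (- (\<Sum>j<n. a j * int (coef ?\<mu> j)))) (sw i (F v))" .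
    \<comment> \<open>A non-zero \<open>x\<close> means congruent exponents at i and i + 1, so the
      two weights agree on diagonal matrices.\<close>
    have 2: "ract id a (pscale x (F v)) = pscale (zpow (- (\<Sum>j<n. a j * int (coef ?\<mu> j)))) (pscale x (F v))"
    proof (cases "x = 0")
      case False
      then have "int (coef ?l i) mod int r = int (coef ?l (Suc i)) mod int r"
        by (simp add: x_def mod_eq_dvd_iff split: if_splits)
      then have t: "int (coef ?l j) mod int r = int (coef ?l (tr i j)) mod int r" for j
        by (auto simp: Transposition.transpose_def)
      have "(\<Sum>j<n. a j * int (coef ?l j)) mod int r = (\<Sum>j<n. a j * int (coef ?\<mu> j)) mod int r"
        by (rule sum_mod_cong) (use t mu in \<open>auto intro!: mod_mult_cong\<close>)
      then have "zpow (- (\<Sum>j<n. a j * int (coef ?l j))) = zpow (- (\<Sum>j<n. a j * int (coef ?\<mu> j)))"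
        by (intro zpow_cong mod_minus_cong)
      then show ?thesis by (simp add: F_ract_id mult.commute)
    qed simp
    show "ract id a ?h = pscale (zpow (- (\<Sum>j<n. a j * int (coef ?\<mu> j)))) ?h"
      unfolding ract_simps(1) 1 2 by (rule pscale_add_right[symmetric])
  qed
  moreover have "homog (mdeg ?l) ?h"
    using i i' F_props by (intro homog_add homog_pscale refl_homog) auto
  moreover have "sw i (F v) = ?h - pscale x (F v)" by simp
  moreover have "if kv v ?a = kv v ?b then x * of_int (int ?a - int ?b) = 1 else x = 0"
  proof (cases "kv v ?a = kv v ?b")
    case True
    have "dz (- int (coef ?l i) - 1) = dz (- int (coef ?l (Suc i)) - 1)"
      by (intro dz_cong mod_diff_cong mod_minus_cong refl) (simp only: mods True)
    moreover have bn: "behind_num n ?l i = n - 1 - ?a" "behind_num n ?l (Suc i) = n - 1 - ?b"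
      using behind_num_lam[OF r_pos p_dvd n_pos v ab(1)] behind_num_lam[OF r_pos p_dvd n_pos v ab(2)] by (simp_all add: inv)
    ultimately have "ev i ?l - ev (Suc i) ?l = (of_nat r * c 0) * (of_nat (n - 1 - ?b) - of_nat (n - 1 - ?a))"
      unfolding ev_def bn of_nat_mult by (simp add: right_diff_distrib mult_ac)
    also have "of_nat (n - 1 - ?b) - of_nat (n - 1 - ?a) = (of_int (int ?a - int ?b) :: 'k)"
      using ab by (simp add: of_nat_diff)
    finally have "x * ((of_nat r * c 0) * of_int (int ?a - int ?b)) = c 0 * of_nat r"
      using x True col by simp
    then have "(of_nat r * c 0) * (x * of_int (int ?a - int ?b)) = (of_nat r * c 0) * 1" by (simp add: mult_ac)
    moreover have "of_nat r * c 0 \<noteq> 0" using c0 of_nat_neq_0[OF r_pos] by simp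
    ultimately have "x * of_int (int ?a - int ?b) = 1" by (metis mult_left_cancel)
    then show ?thesis using True by simp
  next
    case False
    then show ?thesis using col by (simp add: x_def)
  qed
  ultimately show ?thesis by (rule that)
qed

text \<open>The new vector cannot vanish: otherwise s_i acts on \<open>F v\<close> by - x, so x^2 =
  1. With different colors x is 0; with equal colors it would follow that a - b is 1 or -1, which
  \<open>allowed\<close> excludes.\<close>

lemma sw_allowed:
  assumes al: "allowed r n i v"
  obtains x y where "y \<noteq> 0" "sw i (F v) = pscale y (F (move r n i v)) - pscale x (F v)"
proof -
  let ?a = "pinv (wv v) i" and ?b = "pinv (wv v) (Suc i)"
  obtain x h where h: "h \<in> Wt (lm (move r n i v))" "homog (mdeg (lm v)) h" "sw i (F v) = h - pscale x (F v)"
    and x: "if kv v ?a = kv v ?b then x * of_int (int ?a - int ?b) = 1 else x = 0"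
    by (rule move_eigenvector)
  have "mdeg (lm v) = mdeg (lm (move r n i v))"
    by (rule mdeg_class[OF r_pos p_dvd n_pos v move_E]) (rule class_move[OF r_pos p_dvd n_pos v al, symmetric])
  then obtain y where y: "h = pscale y (F (move r n i v))"
    using weight_space_homog[OF h(1,2) move_E] by auto
  have "h \<noteq> 0"
  proof
    assume "h = 0"
    then have s: "sw i (F v) = pscale (- x) (F v)" using h(3) by (simp add: pscale_minus_left)
    have "F v = sw i (sw i (F v))" using sw_sw[OF i F_props(1)] by simp
    also have "\<dots> = pscale (x * x) (F v)" by (simp add: s)
    finally have "pscale (x * x - 1) (F v) = 0" by (simp add: pscale_diff_left)
    then have xx: "x * x = 1" using F_props(3) by simp
    show False
    proof (cases "kv v ?a = kv v ?b")
      case True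
      let ?d = "int ?a - int ?b"
      have xd: "x * of_int ?d = 1" using x True by simp
      have "of_int (?d * ?d) = (x * of_int ?d) * (x * of_int ?d)" using xx by (simp add: mult_ac)
      then have "(of_int (?d * ?d - 1) :: 'k) = 0" unfolding xd by simp
      then have "?d * ?d = 1" unfolding of_int_eq_0 by simp
      then have "?d = 1 \<or> ?d = - 1" by (simp add: zmult_eq_1_iff)
      then have "?a = Suc ?b \<or> ?b = Suc ?a" by linarith
      then show False using al True by (auto simp: allowed_def[OF r_pos p_dvd n_pos])
    next
      case False
      then show False using x xx by simp
    qed
  qed
  then have "y \<noteq> 0" using y by auto
  then show ?thesis using that[of y x] h(3) y by simp
qed

lemma sw_not_allowed:
  assumes "\<not> allowed r n i v"
  obtains x where "sw i (F v) + pscale x (F v) \<in> coinv"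
proof -
  obtain x h where h: "h \<in> Wt (lm (move r n i v))" "homog (mdeg (lm v)) h" "sw i (F v) = h - pscale x (F v)"
    by (rule move_eigenvector)
  have "mdeg (lm v) \<noteq> mdeg (lm (move r n i v))"
    using mdeg_move_neq[OF r_pos p_dvd n_pos v i assms] by simp
  then have "h \<in> coinv" using weight_space_homog[OF h(1,2) move_E] by simp
  then show ?thesis using that[of x] h(3) by simp
qed

end

end

section \<open>Submodules\<close>

lemma permutes_adjacent_induct [consumes 1, case_names id comp swap]:
  assumes w: "w permutes {..<n::nat}"
    and "P id" and comp: "\<And>w w'. w permutes {..<n} \<Longrightarrow> w' permutes {..<n} \<Longrightarrow> P w \<Longrightarrow> P w' \<Longrightarrow> P (w \<circ> w')"
    and tr: "\<And>i. Suc i < n \<Longrightarrow> P (Transposition.transpose i (Suc i))"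
  shows "P w"
proof -
  have t: "b < n \<Longrightarrow> P (Transposition.transpose a b)" if "a < b" for a b
    using that
  proof (induction b rule: less_induct)
    case (less b)
    then obtain b' where b': "b = Suc b'" by (cases b) auto
    show ?case
    proof (cases "a = b'")
      case True
      then show ?thesis using tr[of b'] less.prems b' by simp
    next
      case False
      then have P: "P (Transposition.transpose a b')" using less b' by simp
      have e: "Transposition.transpose a b = Transposition.transpose b' (Suc b') \<circ> (Transposition.transpose a b' \<circ> Transposition.transpose b' (Suc b'))"
        using False less.prems b' by (auto simp: fun_eq_iff Transposition.transpose_def)
      have bn: "Suc b' < n" "a < n" "b' < n" using less.prems b' by auto
      show ?thesis unfolding e
        using bn transpose_permutes_less
        by (intro comp P tr permutes_compose) auto
    qed
  qed
  have t': "P (Transposition.transpose a b)" if "a < n" "b < n" "a \<noteq> b" for a b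
    using that t[of a b] t[of b a] by (cases "a < b") (auto simp: transpose_commute)
  have fin: "finite {..<n}" by simp
  from w fin show ?thesis
  proof (induction rule: permutes_induct)
    case id show ?case by (rule assms(2))
  next
    case (swap a b w)
    then show ?case by (intro comp t' transpose_permutes_less) auto
  qed
qed

lemma span_image_sum:
  assumes "finite A" "s \<in> mpol.span (g ` A)"
  shows "\<exists>x. s = (\<Sum>v\<in>A. pscale (x v) (g v))"
proof -
  let ?S = "{s. \<exists>x. s = (\<Sum>v\<in>A. pscale (x v) (g v))}"
  have sub: "mpol.subspace ?S"
    unfolding mpol.subspace_def
  proof (intro conjI ballI allI)
    show "0 \<in> ?S" by (auto intro!: exI[of _ "\<lambda>_. 0"])
    show "s + t \<in> ?S" if st: "s \<in> ?S" "t \<in> ?S" for s t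
    proof -
      obtain x y where "s = (\<Sum>v\<in>A. pscale (x v) (g v))" "t = (\<Sum>v\<in>A. pscale (y v) (g v))" using st by blast
      then have "s + t = (\<Sum>v\<in>A. pscale (x v + y v) (g v))" by (simp add: pscale_add_left sum.distrib)
      then show ?thesis by (intro CollectI exI[of _ "\<lambda>v. x v + y v"])
    qed
    show "pscale a s \<in> ?S" if s: "s \<in> ?S" for a s
    proof -
      obtain x where "s = (\<Sum>v\<in>A. pscale (x v) (g v))" using s by blast
      then have "pscale a s = (\<Sum>v\<in>A. pscale (a * x v) (g v))" by (simp add: pscale_sum_right)
      then show ?thesis by (intro CollectI exI[of _ "\<lambda>v. a * x v"])
    qed
  qed
  have "g ` A \<subseteq> ?S"
  proof
    fix y assume "y \<in> g ` A"
    then obtain v where v: "v \<in> A" "y = g v" by blast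
    have "(\<Sum>x\<in>A. pscale (if x = v then 1 else 0) (g x)) = (\<Sum>x\<in>A. if x = v then g v else 0)"
      by (intro sum.cong) auto
    also have "\<dots> = y" using v assms(1) by (simp add: sum.delta)
    finally have "y = (\<Sum>x\<in>A. pscale (if x = v then 1 else 0) (g x))" by (rule sym)
    then show "y \<in> ?S" by (intro CollectI exI[of _ "\<lambda>x. if x = v then 1 else 0"])
  qed
  then have "mpol.span (g ` A) \<subseteq> ?S" using sub by (rule mpol.span_minimal)
  then show ?thesis using assms(2) by auto
qed

context cher0 begin

text \<open>The preimages in \<open>S\<close> of the \<open>\<H>\<close>-submodules of \<open>S/I\<close>.\<close>

definition hstable :: "'k mpol set \<Rightarrow> bool" where
  "hstable X \<longleftrightarrow> coinv \<subseteq> X \<and> X \<subseteq> polys n \<and> (\<forall>f\<in>X. \<forall>g\<in>X. f + g \<in> X) \<and> (\<forall>a. \<forall>f\<in>X. pscale a f \<in> X) \<and>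
     (\<forall>i<n. \<forall>f\<in>X. Z i f \<in> X) \<and>
     (\<forall>w k. w permutes {..<n} \<longrightarrow> int p dvd (\<Sum>j<n. k j) \<longrightarrow> (\<forall>f\<in>X. ract w k f \<in> X))"

lemma hstableD:
  assumes "hstable X"
  shows "coinv \<subseteq> X" "X \<subseteq> polys n" "\<And>f g. f \<in> X \<Longrightarrow> g \<in> X \<Longrightarrow> f + g \<in> X" "\<And>a f. f \<in> X \<Longrightarrow> pscale a f \<in> X"
    "\<And>i f. i < n \<Longrightarrow> f \<in> X \<Longrightarrow> Z i f \<in> X"
    "\<And>w k f. w permutes {..<n} \<Longrightarrow> int p dvd (\<Sum>j<n. k j) \<Longrightarrow> f \<in> X \<Longrightarrow> ract w k f \<in> X"
    "\<And>f g. f \<in> X \<Longrightarrow> g \<in> X \<Longrightarrow> f - g \<in> X"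
proof -
  show 1: "coinv \<subseteq> X" "X \<subseteq> polys n" "\<And>f g. f \<in> X \<Longrightarrow> g \<in> X \<Longrightarrow> f + g \<in> X" "\<And>a f. f \<in> X \<Longrightarrow> pscale a f \<in> X"
    "\<And>i f. i < n \<Longrightarrow> f \<in> X \<Longrightarrow> Z i f \<in> X"
    "\<And>w k f. w permutes {..<n} \<Longrightarrow> int p dvd (\<Sum>j<n. k j) \<Longrightarrow> f \<in> X \<Longrightarrow> ract w k f \<in> X"
    using assms unfolding hstable_def by blast+
  show "\<And>f g. f \<in> X \<Longrightarrow> g \<in> X \<Longrightarrow> f - g \<in> X"
    using 1(3) 1(4)[of _ "- 1"] by (metis diff_conv_add_uminus pscale_minus_left pscale_one)
qed

lemma refl_exp_sum: "i < n \<Longrightarrow> j < n \<Longrightarrow> i \<noteq> j \<Longrightarrow> (\<Sum>a<n. refl_exp i j l a) = 0"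
proof -
  assume ij: "i < n" "j < n" "i \<noteq> j"
  have "(\<Sum>a<n. refl_exp i j l a) = (\<Sum>a\<in>{i, j}. refl_exp i j l a)"
    using ij by (intro sum.mono_neutral_right) (auto simp: refl_exp_def)
  then show ?thesis using ij by (simp add: refl_exp_def)
qed

lemma hstable_refl: "hstable X \<Longrightarrow> i < n \<Longrightarrow> j < n \<Longrightarrow> i \<noteq> j \<Longrightarrow> f \<in> X \<Longrightarrow> refl i j l f \<in> X"
  unfolding refl_def using refl_exp_sum[of i j l] by (intro hstableD(6) transpose_permutes_less) auto

lemma hstable_wops: "hstable X \<Longrightarrow> (A, \<alpha>) \<in> wops \<Longrightarrow> f \<in> X \<Longrightarrow> A f \<in> X"
  using hstableD(5,6)[of X] permutes_id by (auto simp: wops_def)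

lemma hstable_F:
  assumes X: "hstable X" and f: "f \<in> X" and u: "f - (\<Sum>v\<in>E. pscale (u v) (F v)) \<in> coinv"
    and v: "v \<in> E" "u v \<noteq> 0"
  shows "F v \<in> X"
proof -
  note XD = hstableD[OF X]
  have "f - (f - (\<Sum>v\<in>E. pscale (u v) (F v))) \<in> X" using f u XD(1) by (intro XD(7)[of f "f - (\<Sum>v\<in>E. pscale (u v) (F v))"]) auto
  then have S: "(\<Sum>v\<in>E. pscale (u v) (F v)) \<in> X" by (simp only: diff_diff_eq2 add_diff_cancel_left')
  have "pscale (u v) (F v) \<in> X"
    using XD(2-4) hstable_wops[OF X] _ S v(1)
    by (rule weight_sep[where g = "\<lambda>v. pscale (u v) (F v)"]) (auto intro: Wt_pscale F_Wt)
  then have "pscale (1 / u v) (pscale (u v) (F v)) \<in> X" by (rule XD(4))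
  then show ?thesis using v(2) by simp
qed

lemma hstable_move:
  assumes X: "hstable X" and v: "v \<in> E" "F v \<in> X" and al: "allowed r n i v"
  shows "F (move r n i v) \<in> X"
proof -
  note XD = hstableD[OF X]
  have i: "Suc i < n" using al by (simp add: allowed_def[OF r_pos p_dvd n_pos])
  obtain x y where y: "y \<noteq> 0" "sw i (F v) = pscale y (F (move r n i v)) - pscale x (F v)"
    using sw_allowed[OF v(1) i al] .
  have "sw i (F v) + pscale x (F v) \<in> X" using v(2) i by (intro XD(3) XD(4) hstable_refl[OF X]) auto
  then have "pscale (1 / y) (pscale y (F (move r n i v))) \<in> X" using y(2) by (intro XD(4)[of _ "1 / y"]) simp
  then show ?thesis using y(1) by simp
qed

lemma hstable_class:
  assumes "hstable X" "v \<in> E" "v' \<in> E" "colored_descent_class r n v = colored_descent_class r n v'" "F v \<in> X"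
  shows "F v' \<in> X"
  using class_connected[OF r_pos p_dvd n_pos assms(2-4), of "\<lambda>v. F v \<in> X"] assms(5) hstable_move[OF assms(1)] by blast

definition class_set :: "nat set \<times> nat list \<Rightarrow> complex mat set" where
  "class_set d = {v \<in> E. colored_descent_class r n v = d}"

lemma class_set_E: "v \<in> class_set d \<Longrightarrow> v \<in> E" "finite (class_set d)"
  using finite_E by (auto simp: class_set_def)

text \<open>The preimage in the polynomial ring of the span of a descent class; with preimages the
  operators act on polynomials rather than on cosets.\<close>

definition class_space :: "nat set \<times> nat list \<Rightarrow> 'k mpol set" where
  "class_space d = {f \<in> polys n. \<exists>s\<in>mpol.span (F ` class_set d). f - s \<in> coinv}"

lemma span_polys: "mpol.span (F ` A) \<subseteq> polys n"
  by (rule mpol.span_minimal) (auto simp: mpol.subspace_def F_props)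

lemma class_space_span: "mpol.span (F ` class_set d) \<subseteq> class_space d"
  using span_polys coinv_closed(2) by (force simp: class_space_def)

lemma class_space_closed:
  "coinv \<subseteq> class_space d" "class_space d \<subseteq> polys n" "f \<in> class_space d \<Longrightarrow> g \<in> class_space d \<Longrightarrow> f + g \<in> class_space d" "f \<in> class_space d \<Longrightarrow> pscale a f \<in> class_space d"
proof -
  show "coinv \<subseteq> class_space d" using coinv_closed(1) mpol.span_zero by (force simp: class_space_def)
  show "class_space d \<subseteq> polys n" by (auto simp: class_space_def)
  show "f + g \<in> class_space d" if "f \<in> class_space d" "g \<in> class_space d"
  proof -
    obtain s t where st: "s \<in> mpol.span (F ` class_set d)" "t \<in> mpol.span (F ` class_set d)" "f - s \<in> coinv" "g - t \<in> coinv" "f \<in> polys n" "g \<in> polys n"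
      using \<open>f \<in> class_space d\<close> \<open>g \<in> class_space d\<close> unfolding class_space_def by blast
    have "f + g - (s + t) \<in> coinv" using coinv_closed(3)[OF st(3,4)] by (simp add: algebra_simps)
    then show ?thesis using st mpol.span_add[OF st(1,2)] unfolding class_space_def by blast
  qed
  show "pscale a f \<in> class_space d" if "f \<in> class_space d"
  proof -
    obtain s where st: "s \<in> mpol.span (F ` class_set d)" "f - s \<in> coinv" "f \<in> polys n"
      using \<open>f \<in> class_space d\<close> unfolding class_space_def by blast
    have "pscale a f - pscale a s \<in> coinv" using coinv_pscale[OF st(2), of a] by (simp add: pscale_diff_right)
    then show ?thesis using st mpol.span_scale[OF st(1)] unfolding class_space_def by blast
  qed
qed

lemma class_space_operator:
  assumes add: "\<And>f g. f \<in> polys n \<Longrightarrow> g \<in> polys n \<Longrightarrow> A (f + g) = A f + A g"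
    and scale: "\<And>a f. f \<in> polys n \<Longrightarrow> A (pscale a f) = pscale a (A f)"
    and coinv: "\<And>f. f \<in> coinv \<Longrightarrow> A f \<in> coinv" and F: "\<And>v. v \<in> class_set d \<Longrightarrow> A (F v) \<in> class_space d" and f: "f \<in> class_space d"
  shows "A f \<in> class_space d"
proof -
  obtain s where s: "s \<in> mpol.span (F ` class_set d)" "f - s \<in> coinv" "f \<in> polys n" using f unfolding class_space_def by blast
  have A0: "A 0 = 0" using scale[of 0 0] by simp
  have "mpol.subspace {s \<in> polys n. A s \<in> class_space d}"
    using class_space_closed[where d = d] coinv_closed(2) by (auto simp: mpol.subspace_def A0 add scale)
  then have "mpol.span (F ` class_set d) \<subseteq> {s \<in> polys n. A s \<in> class_space d}"
    using F by (intro mpol.span_minimal) (auto simp: F_props)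
  then have sp: "s \<in> polys n" "A s \<in> class_space d" using s(1) by auto
  have "A (f - s) + A s = A f" using add[of "f - s" s] sp s(3) by simp
  then show ?thesis using class_space_closed(3)[of "A (f - s)" d "A s"] sp(2) coinv[OF s(2)] class_space_closed(1)[of d] by auto
qed

lemma class_space_F: "v \<in> class_set d \<Longrightarrow> F v \<in> class_space d"
  using class_space_span mpol.span_base by blast

text \<open>Each element of W is a permutation after a diagonal matrix of W, and permutations reduce
  to adjacent transpositions. An allowed exchange stays in the class; a forbidden one returns a
  multiple of \<open>F v\<close> modulo the ideal.\<close>

lemma hstable_class_space: "hstable (class_space d)"
proof -
  have Zs: "Z i f \<in> class_space d" if i: "i < n" and f: "f \<in> class_space d" for i f
  proof (rule class_space_operator[where A = "Z i", OF Z_add[OF i] Z_pscale[OF i] coinv_Z[OF i] _ f])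
    fix v assume v: "v \<in> class_set d"
    show "Z i (F v) \<in> class_space d" using WtD(2)[OF F_Wt i] class_space_closed(4)[OF class_space_F[OF v]] by simp
  qed
  have diag: "ract id k f \<in> class_space d" if k: "int p dvd (\<Sum>j<n. k j)" and f: "f \<in> class_space d" for k f
  proof (rule class_space_operator[where A = "ract id k", OF ract_simps(1) ract_simps(3) coinv_ract[OF permutes_id k] _ f])
    fix v assume v: "v \<in> class_set d"
    show "ract id k (F v) \<in> class_space d" unfolding F_ract_id using class_space_closed(4)[OF class_space_F[OF v]] .
  qed
  have perm: "\<forall>f\<in>class_space d. ract w (\<lambda>_. 0) f \<in> class_space d" if "w permutes {..<n}" for w
    using that
  proof (induction rule: permutes_adjacent_induct)
    case id
    show ?case
    proof
      fix f assume f: "f \<in> class_space d"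
      then have "f \<in> polys n" using class_space_closed(2)[of d] by blast
      then show "ract id (\<lambda>_. 0) f \<in> class_space d" using f ract_id by simp
    qed
  next
    case (comp w w')
    show ?case
    proof
      fix f assume f: "f \<in> class_space d"
      have "ract (w \<circ> w') (\<lambda>_. 0) f = ract w (\<lambda>_. 0) (ract w' (\<lambda>_. 0) f)"
        using ract_comp[of f w "\<lambda>_. 0" w' "\<lambda>_. 0"] class_space_closed(2)[of d] f by auto
      then show "ract (w \<circ> w') (\<lambda>_. 0) f \<in> class_space d" using comp f by simp
    qed
  next
    case (swap i)
    have r0: "ract (tr i) (\<lambda>_. 0) f = sw i f" if "f \<in> polys n" for f
      unfolding refl_def by (rule ract_cong[OF that]) (auto simp: refl_exp_def)
    have sz: "(\<Sum>j<n. (\<lambda>_. 0) j) = (0 :: int)" by simp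
    show ?case
    proof
      fix f assume f: "f \<in> class_space d"
      show "ract (tr i) (\<lambda>_. 0) f \<in> class_space d"
      proof (rule class_space_operator[where A = "ract (tr i) (\<lambda>_. 0)", OF ract_simps(1) ract_simps(3) _ _ f])
        show "ract (tr i) (\<lambda>_. 0) f \<in> coinv" if "f \<in> coinv" for f
          by (rule coinv_ract[OF tr_permutes[OF swap] _ that]) simp
      next
        fix v assume v: "v \<in> class_set d"
        have vE: "v \<in> E" using class_set_E(1)[OF v] .
        have "sw i (F v) \<in> class_space d"
        proof (cases "allowed r n i v")
          case True
          obtain x y where y: "sw i (F v) = pscale y (F (move r n i v)) - pscale x (F v)"
            using sw_allowed[OF vE swap True] by blast
          have m: "move r n i v \<in> class_set d"
            using class_move[OF r_pos p_dvd n_pos vE True] move_E[OF vE swap] v by (simp add: class_set_def)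
          have "pscale y (F (move r n i v)) + pscale (- x) (F v) \<in> class_space d"
            by (intro class_space_closed(3,4) class_space_F m v)
          then show ?thesis unfolding y by (simp add: pscale_minus_left)
        next
          case False
          obtain x where x: "sw i (F v) + pscale x (F v) \<in> coinv" using sw_not_allowed[OF vE swap False] .
          then have "sw i (F v) + pscale x (F v) \<in> class_space d" using class_space_closed(1)[of d] by blast
          from class_space_closed(3)[OF this class_space_closed(4)[OF class_space_F[OF v], of "- x"]]
          show ?thesis by (simp add: pscale_minus_left)
        qed
        then show "ract (tr i) (\<lambda>_. 0) (F v) \<in> class_space d" by (simp add: r0 F_props)
      qed
    qed
  qed
  have "ract w k f \<in> class_space d" if w: "w permutes {..<n}" and k: "int p dvd (\<Sum>j<n. k j)" and f: "f \<in> class_space d" for w k f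
  proof -
    have "f \<in> polys n" using f class_space_closed(2)[of d] by auto
    then have "ract w k f = ract w (\<lambda>_. 0) (ract id k f)" using ract_comp[of f w "\<lambda>_. 0" id k] by simp
    then show ?thesis using perm[OF w] diag[OF k f] by simp
  qed
  then show ?thesis unfolding hstable_def using class_space_closed[where d = d] Zs by blast
qed

lemma class_space_sum:
  assumes "f \<in> class_space d"
  obtains u where "f - (\<Sum>v\<in>E. pscale (u v) (F v)) \<in> coinv" "\<And>v. v \<notin> class_set d \<Longrightarrow> u v = 0"
proof -
  obtain s where s: "s \<in> mpol.span (F ` class_set d)" "f - s \<in> coinv" using assms unfolding class_space_def by blast
  obtain x where x: "s = (\<Sum>v\<in>class_set d. pscale (x v) (F v))" using span_image_sum[OF class_set_E(2) s(1)] by blast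
  let ?u = "\<lambda>v. if v \<in> class_set d then x v else 0"
  have "s = (\<Sum>v\<in>E. pscale (?u v) (F v))"
    unfolding x using finite_E class_set_E(1)[of _ d] by (intro sum.mono_neutral_cong_left) auto
  then show ?thesis using s(2) that[of ?u] by simp
qed

text \<open>Outside the ideal some coefficient of \<open>f\<close> is non-zero; separating weights
  puts the corresponding \<open>F v\<close> into \<open>X\<close>, and connectedness spreads it over
  the class.\<close>

lemma hstable_class_space_subset:
  assumes X: "hstable X" and f: "f \<in> X" "f \<in> class_space d" "f \<notin> coinv"
  shows "class_space d \<subseteq> X"
proof -
  note XD = hstableD[OF X]
  obtain u where u: "f - (\<Sum>v\<in>E. pscale (u v) (F v)) \<in> coinv" "\<And>v. v \<notin> class_set d \<Longrightarrow> u v = 0"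
    using class_space_sum[OF f(2)] by blast
  have "\<exists>v\<in>E. u v \<noteq> 0"
  proof (rule ccontr)
    assume "\<not> (\<exists>v\<in>E. u v \<noteq> 0)"
    then have "(\<Sum>v\<in>E. pscale (u v) (F v)) = 0" by (intro sum.neutral) auto
    then show False using u(1) f(3) by simp
  qed
  then obtain v where v: "v \<in> E" "u v \<noteq> 0" by blast
  have vd: "colored_descent_class r n v = d" using u(2)[of v] v by (auto simp: class_set_def)
  have "F v \<in> X" by (rule hstable_F[OF X f(1) u(1) v])
  then have FX: "F ` class_set d \<subseteq> X" using hstable_class[OF X v(1)] vd by (auto simp: class_set_def)
  have "mpol.subspace X" using XD(1,3,4) coinv_closed(2) by (auto simp: mpol.subspace_def)
  then have sp: "mpol.span (F ` class_set d) \<subseteq> X" using FX by (intro mpol.span_minimal)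
  show ?thesis
  proof
    fix g assume "g \<in> class_space d"
    then obtain s where s: "s \<in> mpol.span (F ` class_set d)" "g - s \<in> coinv" unfolding class_space_def by blast
    then have "(g - s) + s \<in> X" using sp XD(1) by (intro XD(3)) auto
    then show "g \<in> X" by simp
  qed
qed

end

section \<open>The maximal graded submodule\<close>

text \<open>Genericity is expressed as linear independence over the complex numbers of the
  parameters \<open>c l\<close> with \<open>p\<close> dividing \<open>l\<close>, where
  \<open>l = 0\<close> stands for the parameter of the reflections exchanging two
  coordinates.\<close>

locale cher_gen = cher0 r p n \<iota> c
  for r p n :: nat and \<iota> :: "complex \<Rightarrow> 'k::field" and c :: "nat \<Rightarrow> 'k" +
  assumes independent: "\<iota> (a 0) * c 0 + (\<Sum>l = 1..<r. \<iota> (a l) * c l) = 0 \<Longrightarrow>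
    l < r \<Longrightarrow> p dvd l \<Longrightarrow> a l = 0"
begin

lemma coinv_pscale_eq_0: assumes "pscale x f \<in> coinv" "f \<notin> coinv" shows "x = 0"
proof (rule ccontr)
  assume "x \<noteq> 0"
  then have "pscale (1 / x) (pscale x f) = f" by simp
  then show False using coinv_pscale[OF assms(1), of "1 / x"] assms(2) by simp
qed

text \<open>The reflection terms cancel in z_(n-1), which acts as x_(n-1) y_(n-1) minus the cyclic
  reflections. If y_(n-1) kills \<open>F v\<close> modulo the ideal, comparing scalars gives a
  complex linear relation among the parameters, and independence makes every coefficient vanish. The
  one of \<open>c 0\<close> fixes the last value, that of \<open>c p\<close> the last color.\<close>

lemma singular_last:
  assumes v: "v \<in> E" and D: "D (n - 1) (F v) \<in> coinv"
  shows "wv v (n - 1) = n - 1 \<and> kv v (n - 1) = 0"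
proof -
  have N: "n - 1 < n" using n_pos by simp
  let ?\<delta> = "int (coef (lm v) (n - 1))"
  have "zact (n - 1) l (F v) = pscale (zpow (- l * ?\<delta>)) (F v)" for l
  proof -
    have "(\<Sum>j<n. (if j = n - 1 then l else 0) * int (coef (lm v) j)) = l * ?\<delta>" by (rule sum_delta_mult[OF N])
    then show ?thesis unfolding zact_def F_ract_id by simp
  qed
  then have C: "Cop (n - 1) (F v) = pscale (dz (- ?\<delta>) - dz (- ?\<delta> - 1)) (F v)" by (rule Cop_eigen)
  have e: "{..<n} - {n - 1} = {..<n - 1}" using n_pos by auto
  have "Z (n - 1) (F v) = xvar (n - 1) * D (n - 1) (F v) - Cop (n - 1) (F v)"
    unfolding Z_def D_xvar_eq[OF N F_props(1)] e by simp
  then have "xvar (n - 1) * D (n - 1) (F v) = pscale (ev (n - 1) (lm v) + (dz (- ?\<delta>) - dz (- ?\<delta> - 1))) (F v)"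
    using WtD(2)[OF F_Wt N] C by (simp add: pscale_add_left)
  moreover have "xvar (n - 1) * D (n - 1) (F v) \<in> coinv" using D N by (intro coinv_closed(4)) auto
  ultimately have xF: "pscale (ev (n - 1) (lm v) + (dz (- ?\<delta>) - dz (- ?\<delta> - 1))) (F v) \<in> coinv" by simp
  have z: "ev (n - 1) (lm v) + (dz (- ?\<delta>) - dz (- ?\<delta> - 1)) = 0"
    by (rule coinv_pscale_eq_0[OF xF F_notin_coinv[OF v]])
  let ?b = "r * behind_num n (lm v) (n - 1)"
  \<comment> \<open>The coefficients of the relation: - r b for \<open>c 0\<close>, with b the value
    of \<open>behind_num\<close> at the last coordinate, and zeta^(- l \<delta>) - 1 for
    \<open>c l\<close>.\<close>
  define a where "a l = (if l = 0 then - of_nat ?b else zeta r powi (int l * - ?\<delta>) - 1)" for l :: nat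
  have "(\<Sum>l = 1..<r. \<iota> (a l) * c l) = (\<Sum>l = 1..<r. c l * zpow (int l * - ?\<delta>) - c l * zpow (int l * 0))"
  proof (intro sum.cong refl)
    fix l assume "l \<in> {1..<r}"
    then have l: "l \<noteq> 0" by auto
    have "\<iota> (a l) + 1 = zpow (int l * - ?\<delta>)"
      using hom_add[of "a l" 1] l by (simp add: a_def zpow_def hom_one)
    then have "\<iota> (a l) = zpow (int l * - ?\<delta>) - 1" by (simp add: eq_diff_eq)
    then show "\<iota> (a l) * c l = c l * zpow (int l * - ?\<delta>) - c l * zpow (int l * 0)"
      by (simp add: left_diff_distrib mult.commute[of "c l"])
  qed
  also have "\<dots> = dz (- ?\<delta>) - dz 0" unfolding dz_def by (simp only: sum_subtractf mult.left_neutral)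
  finally have S: "(\<Sum>l = 1..<r. \<iota> (a l) * c l) = dz (- ?\<delta>) - dz 0" .
  have "\<iota> (a 0) = - of_nat ?b" by (simp only: a_def hom_uminus hom_of_nat simp_thms if_True)
  then have rel: "\<iota> (a 0) * c 0 + (\<Sum>l = 1..<r. \<iota> (a l) * c l) = 0"
    unfolding S using z by (simp add: ev_def algebra_simps)
  have a: "a l = 0" if "l < r" "p dvd l" for l by (rule independent[where a = a, OF rel that])
  have b0: "behind_num n (lm v) (n - 1) = 0"
    using a[of 0] r_pos by (simp add: a_def)
  have w: "wv v permutes {..<n}" by (rule G1_sub_cases(1)[OF r_pos p_dvd n_pos v])
  define j where "j = pinv (wv v) (n - 1)"
  have j: "j < n" "wv v j = n - 1"
    using N permutes_less[OF permutes_inv[OF w]] permutes_inverses(1)[OF w] by (auto simp: j_def)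
  have "n - 1 - j = 0" using behind_num_lam[OF r_pos p_dvd n_pos v j(1)] b0 j(2) by simp
  then have wn: "wv v (n - 1) = n - 1" using j by (metis Suc_diff_1 diff_is_0_eq le_antisym less_Suc_eq_le n_pos)
  have \<delta>: "coef (lm v) (n - 1) = kv v (n - 1)"
    using coef_lam[OF r_pos p_dvd n_pos v N] by (simp add: wn des_below_last)
  have kr: "kv v (n - 1) \<le> r div p - 1" using G1_sub_cases(4)[OF r_pos p_dvd n_pos v] by simp
  \<comment> \<open>For p < r the coefficient of \<open>c p\<close> forces \<open>r\<close> to
    divide p times the color, a number below \<open>r\<close>. For p = r the bound r div p - 1 on
    the last color is already 0.\<close>
  have "kv v (n - 1) = 0"
  proof (cases "p < r")
    case True
    have p0: "0 < p" using p_dvd r_pos by (auto intro: Nat.gr0I)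
    have "a p = 0" by (rule a[OF True]) simp
    then have "zeta r powi (int p * - ?\<delta>) = 1" using p0 by (simp add: a_def)
    then have "int r dvd int p * ?\<delta>" using zeta_powi_eq_1_iff[OF r_pos, of "int p * - ?\<delta>"] by simp
    then have "int r dvd int (p * kv v (n - 1))" using \<delta> by simp
    then have d: "r dvd p * kv v (n - 1)" unfolding int_dvd_int_iff .
    have "p * kv v (n - 1) < p * (r div p)"
      using kr p0 True p_dvd by (intro mult_strict_left_mono) (auto simp: dvd_def)
    then have "p * kv v (n - 1) < r" using p_dvd by simp
    then have "p * kv v (n - 1) = 0" using d by (meson dvd_imp_le gr0I not_le)
    then show ?thesis using p0 by simp
  next
    case False
    then have "r div p = 1" using p_dvd r_pos by (metis div_self dvd_imp_le le_antisym not_less not_gr_zero)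
    then show ?thesis using kr by simp
  qed
  then show ?thesis using wn by simp
qed

text \<open>A stable \<open>N\<close> not contained in the coinvariant ideal contains, modulo the ideal, some \<open>F v\<close> of minimal
  degree; these are singular vectors, which leaves only the constants.\<close>

lemma one_in_submodule:
  assumes N: "N \<subseteq> polys n" "\<And>f g. f \<in> N \<Longrightarrow> g \<in> N \<Longrightarrow> f + g \<in> N" "\<And>a f. f \<in> N \<Longrightarrow> pscale a f \<in> N"
    and X: "\<And>i f. i < n \<Longrightarrow> f \<in> N \<Longrightarrow> xvar i * f \<in> N" and Y: "\<And>i f. i < n \<Longrightarrow> f \<in> N \<Longrightarrow> D i f \<in> N"
    and T: "\<And>w k f. w permutes {..<n} \<Longrightarrow> int p dvd (\<Sum>j<n. k j) \<Longrightarrow> f \<in> N \<Longrightarrow> ract w k f \<in> N"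
    and G: "\<And>d f. f \<in> N \<Longrightarrow> hom_part d f \<in> N" and f: "f \<in> N" "f \<notin> coinv"
  shows "1 \<in> N"
proof -
  \<comment> \<open>The sum of \<open>N\<close> and the ideal, on which weights can be separated
    modulo the ideal.\<close>
  define M where "M = {f \<in> polys n. \<exists>g\<in>N. f - g \<in> coinv}"
  have N0: "0 \<in> N" using N(3)[OF f(1), of 0] by simp
  have Nsum: "sum g A \<in> N" if "\<And>x. x \<in> A \<Longrightarrow> g x \<in> N" for g and A :: "nat set"
    using that by (induction A rule: infinite_finite_induct) (auto simp: N0 N(2))
  have NZ: "Z i g \<in> N" if i: "i < n" and g: "g \<in> N" for i g
  proof -
    have "Rop i j g \<in> N" if j: "j < i" for j
      unfolding Rop_def refl_def using i j g refl_exp_sum[of i j]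
      by (intro Nsum T transpose_permutes_less) auto
    then show ?thesis unfolding Z_def using i g by (intro N(2) N(3) X Y Nsum) auto
  qed
  have MA: "A f \<in> M" if f: "f \<in> M" and A: "\<And>f g. f \<in> polys n \<Longrightarrow> g \<in> polys n \<Longrightarrow> A (f - g) = A f - A g"
    "\<And>f. f \<in> polys n \<Longrightarrow> A f \<in> polys n" "\<And>f. f \<in> N \<Longrightarrow> A f \<in> N" "\<And>f. f \<in> coinv \<Longrightarrow> A f \<in> coinv" for A f
  proof -
    obtain g where g: "g \<in> N" "f - g \<in> coinv" "f \<in> polys n" using f unfolding M_def by blast
    have "A f - A g \<in> coinv" using A(1)[OF g(3), of g] A(4)[OF g(2)] g(1) N(1) by auto
    then show ?thesis unfolding M_def using A(2)[OF g(3)] A(3)[OF g(1)] by blast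
  qed
  have Zdiff: "Z i (f - g) = Z i f - Z i g" if "i < n" "f \<in> polys n" "g \<in> polys n" for i f g
    using Z_add[OF that(1), of "f - g" g] that by simp
  have M: "hstable M" unfolding hstable_def
  proof (intro conjI allI ballI impI)
    show "coinv \<subseteq> M" using coinv_closed(1) N0 by (force simp: M_def)
    show "M \<subseteq> polys n" by (auto simp: M_def)
    fix f assume f: "f \<in> M"
    show "f + g \<in> M" if "g \<in> M" for g
    proof -
      obtain f' g' where h: "f' \<in> N" "g' \<in> N" "f - f' \<in> coinv" "g - g' \<in> coinv" "f \<in> polys n" "g \<in> polys n"
        using f \<open>g \<in> M\<close> unfolding M_def by blast
      have "f + g - (f' + g') \<in> coinv" using coinv_closed(3)[OF h(3,4)] by (simp add: algebra_simps)
      then show ?thesis unfolding M_def using h(5,6) N(2)[OF h(1,2)] by blast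
    qed
    show "pscale a f \<in> M" for a by (rule MA[OF f]) (auto simp: pscale_diff_right N(3) coinv_pscale)
    show "Z i f \<in> M" if "i < n" for i by (rule MA[OF f]) (use that in \<open>auto simp: Zdiff NZ coinv_Z\<close>)
    show "ract w k f \<in> M" if "w permutes {..<n}" "int p dvd (\<Sum>j<n. k j)" for w k
      by (rule MA[OF f]) (use that in \<open>auto simp: T coinv_ract\<close>)
  qed
  have MD: "D i f \<in> M" if "i < n" "f \<in> M" for i f
    by (rule MA[OF that(2)]) (use that(1) in \<open>auto simp: D_diff Y coinv_D\<close>)
  have inM: "\<exists>v\<in>E. F v \<in> M \<and> u v \<noteq> 0"
    if f: "f \<in> M" "f \<notin> coinv" and u: "f - (\<Sum>v\<in>E. pscale (u v) (F v)) \<in> coinv" for f u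
  proof -
    have "\<exists>v\<in>E. u v \<noteq> 0"
    proof (rule ccontr)
      assume "\<not> (\<exists>v\<in>E. u v \<noteq> 0)"
      then have "(\<Sum>v\<in>E. pscale (u v) (F v)) = 0" by (intro sum.neutral) auto
      then show False using u f(2) by simp
    qed
    then show ?thesis using hstable_F[OF M f(1) u] by blast
  qed
  have fM: "f \<in> M" using f(1) N(1) coinv_closed(2) by (force simp: M_def)
  define Q where "Q d v \<longleftrightarrow> F v \<in> M \<and> mdeg (lm v) = d" for d v
  have "\<exists>d. \<exists>v\<in>E. Q d v"
    using coinv_decompose[of f] f N(1) inM[OF fM f(2)] unfolding Q_def by blast
  then obtain d where d: "\<exists>v\<in>E. Q d v" "\<And>d'. d' < d \<Longrightarrow> \<not> (\<exists>v\<in>E. Q d' v)"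
    using exists_least_iff[of "\<lambda>d. \<exists>v\<in>E. Q d v"] by blast
  obtain v where v: "v \<in> E" "Q d v" using d(1) by blast
  \<comment> \<open>D_i lowers the degree by one and stays in \<open>M\<close>, where minimality of
    \<open>d\<close> rules out every \<open>F x\<close> of degree d - 1. So the expansion modulo the
    ideal has no part in that degree.\<close>
  have sing: "D i (F v) \<in> coinv" if v: "v \<in> E" "Q d v" and i: "i < n" for v i
  proof (cases "d = 0")
    case True
    then have "homog 0 (F v)" using F_props(2)[of v] v by (simp add: Q_def)
    then have "F v = pscale (coef (F v) 0) 1" by (rule homog_0_const)
    then have "D i (F v) = 0" using D_pscale[OF i, of 1 "coef (F v) 0"] D_1[OF i] by simp
    then show ?thesis using coinv_closed(2) by simp
  next
    case False
    have DM: "D i (F v) \<in> M" using MD[OF i] v by (simp add: Q_def)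
    have hD: "homog (d - 1) (D i (F v))" using D_homog[OF i F_props(1) F_props(2), of v] v by (simp add: Q_def)
    obtain u where u: "D i (F v) - (\<Sum>v\<in>E. pscale (u v) (F v)) \<in> coinv" using coinv_decompose[OF D_polys[OF i F_props(1)]] by blast
    have "hom_part (d - 1) (pscale (u x) (F x)) = 0" if x: "x \<in> E" for x
    proof (cases "u x = 0")
      case False
      then have "F x \<in> M" using hstable_F[OF M DM u x] by blast
      then have "\<not> mdeg (lm x) < d" using d(2)[of "mdeg (lm x)"] x by (auto simp: Q_def)
      then have "mdeg (lm x) \<noteq> d - 1" using \<open>d \<noteq> 0\<close> by simp
      then show ?thesis using hom_part_homog[OF homog_pscale[OF F_props(2)], of "d - 1" "u x" x] by simp
    qed simp
    then have "hom_part (d - 1) (D i (F v) - (\<Sum>v\<in>E. pscale (u v) (F v))) = D i (F v)"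
      by (simp add: hom_part_diff hom_part_sum hom_part_homog[OF hD])
    then show ?thesis using coinv_hom_part[OF u, of "d - 1"] by simp
  qed
  have "lm v = 0"
  proof (rule trivial_class[where Q = "Q d", OF r_pos p_dvd n_pos v])
    fix i v assume v: "v \<in> E" "Q d v" "allowed r n i v"
    then have i: "Suc i < n" by (simp add: allowed_def[OF r_pos p_dvd n_pos])
    have "mdeg (lm (move r n i v)) = mdeg (lm v)"
      using v i by (intro mdeg_class[OF r_pos p_dvd n_pos] move_E class_move[OF r_pos p_dvd n_pos])
    then show "Q d (move r n i v)" using hstable_move[OF M v(1) _ v(3)] v(2) by (simp add: Q_def)
  next
    fix v assume v: "v \<in> E" "Q d v"
    show "wv v (n - 1) = n - 1 \<and> kv v (n - 1) = 0"
      by (rule singular_last[OF v(1) sing[OF v]]) (use n_pos in simp)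
  qed
  then have "homog 0 (F v)" using F_props(2)[of v] by simp
  then have c: "F v = pscale (coef (F v) 0) 1" by (rule homog_0_const)
  then have "coef (F v) 0 \<noteq> 0" using F_props(3)[of v] by auto
  moreover have "pscale (1 / coef (F v) 0) (F v) \<in> M" using v by (intro hstableD(4)[OF M]) (simp add: Q_def)
  ultimately have "1 \<in> M" using c by (metis nonzero_divide_eq_eq pscale_one pscale_pscale times_divide_eq_left mult_1)
  then obtain g where g: "g \<in> N" "1 - g \<in> coinv" unfolding M_def by blast
  \<comment> \<open>Elements of the ideal have no constant term; gradedness of \<open>N\<close> then
    extracts the constant 1 from \<open>g\<close>.\<close>
  have "hom_part 0 g = 1"
  proof (rule poly_mapping_eqI)
    fix m
    show "coef (hom_part 0 g) m = coef 1 m"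
      using coinv_coef_0[OF g(2)] by (auto simp: coef_hom_part lookup_one lookup_minus when_def)
  qed
  then show "1 \<in> N" using G[OF g(1), of 0] by simp
qed

lemma Grpn_subset: "g \<in> Grpn r p n \<Longrightarrow> g \<in> Grpn r 1 n"
  by (erule Grpn_cases[OF _ r_pos p_dvd]) (simp add: mk_mat_Grpn_1)

lemma group_act_ract:
  assumes "g \<in> Grpn r p n" "f \<in> polys n"
  shows "\<exists>w k. w permutes {..<n} \<and> int p dvd (\<Sum>j<n. k j) \<and> group_act g f = ract w k f"
  using assms(1)
proof (rule Grpn_cases[OF _ r_pos p_dvd])
  fix w k assume w: "w permutes {..<n}" and "g = mk_mat r n w (\<lambda>j. int (k j))" "int p dvd (\<Sum>j<n. int (k j))"
  then show ?thesis using group_act_mk_mat[OF w assms(2)] by blast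
qed

lemma poly_act_coinv:
  assumes "h \<in> cherednik_alg" "f \<in> coinv" shows "poly_act h f \<in> coinv"
proof (rule subalgebra_gen_stable[OF _ coinv_closed(1) coinv_closed(3) coinv_pscale])
  show "h \<in> subalgebra_gen ((\<lambda>g. cclass (FT g)) ` Grpn r p n \<union>
     (\<lambda>i. cclass (FX i)) ` {..<n} \<union> (\<lambda>i. cclass (FY i)) ` {..<n})"
    using assms(1) by (simp only: cherednik_alg_def)
  show "(\<lambda>g. cclass (FT g)) ` Grpn r p n \<union> (\<lambda>i. cclass (FX i)) ` {..<n} \<union> (\<lambda>i. cclass (FY i)) ` {..<n} \<subseteq> cclass ` FC"
    using Grpn_subset fgen_FC by auto
  fix b f
  assume b: "b \<in> (\<lambda>g. cclass (FT g)) ` Grpn r p n \<union> (\<lambda>i. cclass (FX i)) ` {..<n} \<union> (\<lambda>i. cclass (FY i)) ` {..<n}"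
    and f: "f \<in> coinv"
  have fp: "f \<in> polys n" using f coinv_closed(1) by blast
  from b consider g where "g \<in> Grpn r p n" "b = cclass (FT g)" | i where "i < n" "b = cclass (FX i)"
    | i where "i < n" "b = cclass (FY i)" by blast
  then show "poly_act b f \<in> coinv"
  proof cases
    case 1
    then show ?thesis using f fp Grpn_subset group_act_ract[OF 1(1) fp] coinv_ract by (auto simp: poly_act_T)
  next
    case 2
    then show ?thesis using f fp by (simp add: poly_act_X coinv_closed(4))
  next
    case 3
    then show ?thesis using f fp by (simp add: poly_act_Y coinv_D)
  qed
qed (use assms in auto)

lemma submodule_polysD:
  assumes "subgroup N (add_monoid (poly_ring n))"
  shows "N \<subseteq> polys n" "f \<in> N \<Longrightarrow> g \<in> N \<Longrightarrow> f + g \<in> N" "0 \<in> N"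
  using subgroup.subset[OF assms] subgroup.m_closed[OF assms, of f g] subgroup.one_closed[OF assms] by simp_all

lemma graded_proper_submodule_coinv: "graded_proper_submodule coinv"
  unfolding graded_proper_submodule_def alg_submodule_def
proof (intro conjI allI ballI)
  show "subgroup coinv (add_monoid (poly_ring n))"
    using additive_subgroup.a_subgroup[OF ideal.axioms(1)[OF ideal_coinv]] .
  have "1 \<notin> coinv" using coinv_coef_0[of 1] by (auto simp: lookup_one)
  then show "coinv \<noteq> carrier (poly_ring n)" by auto
qed (auto intro: poly_act_coinv coinv_hom_part)

text \<open>Otherwise 1 would lie in the submodule, and multiplication by variables would generate
  every polynomial from it.\<close>

lemma graded_proper_submodule_subset:
  assumes "graded_proper_submodule N" shows "N \<subseteq> coinv"
proof (rule ccontr)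
  assume "\<not> N \<subseteq> coinv"
  then obtain f where f: "f \<in> N" "f \<notin> coinv" by blast
  have sub: "subgroup N (add_monoid (poly_ring n))" and act: "\<And>h f. h \<in> cherednik_alg \<Longrightarrow> f \<in> N \<Longrightarrow> poly_act h f \<in> N"
    and G: "\<And>d f. f \<in> N \<Longrightarrow> hom_part d f \<in> N" and ne: "N \<noteq> polys n"
    using assms by (auto simp: graded_proper_submodule_def alg_submodule_def)
  note ND = submodule_polysD[OF sub]
  have incl: "cclass (FX i) \<in> cherednik_alg" "cclass (FY i) \<in> cherednik_alg" if "i < n" for i
    using that unfolding cherednik_alg_def by (auto intro!: subalgebra_gen_incl(1))
  have inclT: "cclass (FT g) \<in> cherednik_alg" if "g \<in> Grpn r p n" for g
    using that unfolding cherednik_alg_def by (auto intro!: subalgebra_gen_incl(1))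
  have inclS: "cclass (fscalar a) \<in> cherednik_alg" for a
    unfolding cherednik_alg_def by (rule subalgebra_gen_incl(2))
  have sc: "pscale a f \<in> N" if "f \<in> N" for a f
    using act[OF inclS that, of a] poly_act_fscalar[of f a] that ND(1) by auto
  have X: "xvar i * f \<in> N" if "i < n" "f \<in> N" for i f
    using act[OF incl(1)[OF that(1)] that(2)] poly_act_X[OF that(1), of f] that ND(1) by auto
  have Y: "D i f \<in> N" if "i < n" "f \<in> N" for i f
    using act[OF incl(2)[OF that(1)] that(2)] poly_act_Y[OF that(1), of f] that ND(1) by auto
  have T: "ract w k f \<in> N" if w: "w permutes {..<n}" "int p dvd (\<Sum>j<n. k j)" and f: "f \<in> N" for w k f
  proof -
    have g: "mk_mat r n w k \<in> Grpn r p n" using mk_mat_in_Grpn_iff[OF r_pos p_dvd w(1)] w(2) by simp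
    have fp: "f \<in> polys n" using f ND(1) by auto
    show ?thesis using act[OF inclT[OF g] f] poly_act_T[OF mk_mat_Grpn_1[OF w(1)] fp] group_act_mk_mat[OF w(1) fp] by simp
  qed
  have one: "1 \<in> N" using ND(1,2) sc X Y T G f by (rule one_in_submodule)
  have "g \<in> N" if "g \<in> polys n" for g
    using that by (induction rule: polys_induct) (auto intro: ND(2,3) one sc X)
  then show False using ne ND(1) by blast
qed

lemma max_submodule_eq: "max_submodule = coinv"
  unfolding max_submodule_def
proof (rule the_equality)
  show "graded_proper_submodule coinv \<and> (\<forall>N'. graded_proper_submodule N' \<and> coinv \<subseteq> N' \<longrightarrow> N' = coinv)"
    using graded_proper_submodule_coinv graded_proper_submodule_subset by blast
  show "N = coinv" if "graded_proper_submodule N \<and> (\<forall>N'. graded_proper_submodule N' \<and> N \<subseteq> N' \<longrightarrow> N' = N)" for N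
    using that graded_proper_submodule_coinv graded_proper_submodule_subset by blast
qed

end

section \<open>The quotient module\<close>

context cher_gen begin

abbreviation "cls \<equiv> L1_class"

lemma L1_eq: "L1 = poly_ring n Quot coinv"
  by (simp add: L1_def max_submodule_eq)

lemma L1_coinvariant: "L1 = coinvariant_ring"
  unfolding L1_eq coinv_def coinvariant_ring_def ..

lemma mem_cls: "f \<in> polys n \<Longrightarrow> g \<in> cls f \<longleftrightarrow> g - f \<in> coinv"
proof -
  assume f: "f \<in> polys n"
  have "g \<in> cls f \<longleftrightarrow> (\<exists>h\<in>coinv. g = h + f)"
    unfolding L1_class_def max_submodule_eq using mem_coset_iff[OF ideal_coinv, of f g] f by simp
  also have "\<dots> \<longleftrightarrow> g - f \<in> coinv" by (metis add_diff_cancel_right' diff_add_cancel)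
  finally show ?thesis .
qed

lemma cls_eq_iff:
  assumes "f \<in> polys n" "g \<in> polys n" shows "cls f = cls g \<longleftrightarrow> f - g \<in> coinv"
proof
  assume "cls f = cls g"
  then have "f \<in> cls g" using mem_cls[OF assms(1), of f] coinv_closed(2) by simp
  then show "f - g \<in> coinv" using mem_cls[OF assms(2)] by simp
next
  assume fg: "f - g \<in> coinv"
  have "h - f \<in> coinv \<longleftrightarrow> h - g \<in> coinv" for h
    using coinv_closed(3)[of "h - f" "f - g"] coinv_diff[of "h - g" "f - g"] fg by auto
  then show "cls f = cls g" using mem_cls assms by blast
qed

lemma cls_hom: "cls \<in> Ring.ring_hom (poly_ring n) L1"
proof -
  have "cls = (+>\<^bsub>poly_ring n\<^esub>) coinv" by (rule ext) (simp add: L1_class_def max_submodule_eq)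
  then show ?thesis unfolding L1_eq using ideal.rcos_ring_hom[OF ideal_coinv] by simp
qed

lemma ring_L1: "ring L1"
  unfolding L1_eq by (rule ideal.quotient_is_ring[OF ideal_coinv])

lemma cls_carrier: "f \<in> polys n \<Longrightarrow> cls f \<in> carrier L1"
  using ring_hom_closed[OF cls_hom] by simp

lemma cls_add: "f \<in> polys n \<Longrightarrow> g \<in> polys n \<Longrightarrow> cls f \<oplus>\<^bsub>L1\<^esub> cls g = cls (f + g)"
  using ring_hom_add[OF cls_hom] by simp

lemma cls_0: "\<zero>\<^bsub>L1\<^esub> = cls 0"
  using ring_hom_zero[OF cls_hom ring_polys ring_L1] by simp

lemma carrier_L1: "carrier L1 = cls ` polys n"
  unfolding L1_eq FactRing_def A_RCOSETS_def' L1_class_def max_submodule_eq by auto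

lemma cls_finsum: "finite A \<Longrightarrow> (\<And>x. x \<in> A \<Longrightarrow> g x \<in> polys n) \<Longrightarrow> finsum L1 (\<lambda>x. cls (g x)) A = cls (\<Sum>x\<in>A. g x)"
proof (induction A rule: finite_induct)
  case empty
  interpret ring L1 by (rule ring_L1)
  show ?case by (simp add: cls_0)
next
  case (insert x A)
  interpret ring L1 by (rule ring_L1)
  have s: "(\<Sum>x\<in>A. g x) \<in> polys n" using insert by (intro polys_sum) auto
  have "finsum L1 (\<lambda>x. cls (g x)) (insert x A) = cls (g x) \<oplus>\<^bsub>L1\<^esub> finsum L1 (\<lambda>x. cls (g x)) A"
    using insert cls_carrier by (intro finsum_insert) auto
  then show ?case using insert s by (simp add: cls_add)
qed

lemma cls_some: "f \<in> polys n \<Longrightarrow> (SOME g. g \<in> cls f) \<in> polys n \<and> (SOME g. g \<in> cls f) - f \<in> coinv"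
proof -
  assume f: "f \<in> polys n"
  have "f \<in> cls f" using mem_cls[OF f, of f] coinv_closed(2) by simp
  then have s: "(SOME g. g \<in> cls f) - f \<in> coinv" using mem_cls[OF f] someI[of "\<lambda>g. g \<in> cls f" f] by simp
  then have "((SOME g. g \<in> cls f) - f) + f \<in> polys n" using f coinv_closed(1) by (intro polys_add) auto
  then show ?thesis using s by simp
qed

lemma L1_scale_cls: assumes f: "f \<in> polys n" shows "L1_scale a (cls f) = cls (pscale a f)"
  using cls_some[OF f] coinv_pscale[of _ a] f by (simp add: L1_scale_def cls_eq_iff flip: pscale_diff_right)

lemma hecke_gens:
  "(\<lambda>g. cclass (FT g)) ` Grpn r p n \<union> t_alg \<subseteq> cclass ` FC"
  "z_elt ` {..<n} \<union> (\<lambda>i. cclass (FT (zeta_mat r n i (int p)))) ` {..<n} \<union>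
     (\<lambda>i. cclass (FT (zeta_mat r n i (- 1) * zeta_mat r n (Suc i) 1))) ` {..<n - 1} \<subseteq> cclass ` FC"
proof -
  show 1: "z_elt ` {..<n} \<union> (\<lambda>i. cclass (FT (zeta_mat r n i (int p)))) ` {..<n} \<union>
     (\<lambda>i. cclass (FT (zeta_mat r n i (- 1) * zeta_mat r n (Suc i) 1))) ` {..<n - 1} \<subseteq> cclass ` FC"
    using z_elt_FC fgen_FC(3) zeta_mat_Grpn_1 Grpn_1_mult by (auto simp: z_elt_def)
  have "t_alg \<subseteq> cclass ` FC" unfolding t_alg_def using subalgebra_gen_subset[OF 1] by blast
  then show "(\<lambda>g. cclass (FT g)) ` Grpn r p n \<union> t_alg \<subseteq> cclass ` FC"
    using Grpn_subset fgen_FC(3) by auto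
qed

lemma hecke_FC: "h \<in> hecke_alg \<Longrightarrow> h \<in> cclass ` FC"
  unfolding hecke_alg_def by (rule subalgebra_gen_subset[OF hecke_gens(1)])

lemma hecke_incl:
  "g \<in> Grpn r p n \<Longrightarrow> cclass (FT g) \<in> hecke_alg" "i < n \<Longrightarrow> z_elt i \<in> hecke_alg" "cclass (fscalar a) \<in> hecke_alg"
proof -
  show "g \<in> Grpn r p n \<Longrightarrow> cclass (FT g) \<in> hecke_alg" "cclass (fscalar a) \<in> hecke_alg"
    unfolding hecke_alg_def by (auto intro: subalgebra_gen_incl)
  assume "i < n"
  then have "z_elt i \<in> t_alg" unfolding t_alg_def by (intro subalgebra_gen_incl(1)) auto
  then show "z_elt i \<in> hecke_alg" unfolding hecke_alg_def by (intro subalgebra_gen_incl(1)) auto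
qed

lemma diag_mat_Grpn:
  "zeta_mat r n i (int p) \<in> Grpn r p n"
  "Suc i < n \<Longrightarrow> zeta_mat r n i (- 1) * zeta_mat r n (Suc i) 1 \<in> Grpn r p n"
proof -
  have "(\<Sum>j<n. if j = i then int p else 0) = (if i < n then int p else 0)" by (simp add: sum.delta)
  then show "zeta_mat r n i (int p) \<in> Grpn r p n"
    unfolding zeta_mat_mk mk_mat_in_Grpn_iff[OF r_pos p_dvd permutes_id] by simp
  assume i: "Suc i < n"
  have "(\<Sum>j<n. (if j = i then - 1 else 0) + (if j = Suc i then 1 else 0)) = (0::int)"
    using i by (simp add: sum.distrib sum.delta)
  then show "zeta_mat r n i (- 1) * zeta_mat r n (Suc i) 1 \<in> Grpn r p n"
    unfolding zeta_mat_mk mk_mat_mult[OF permutes_id] by (simp add: mk_mat_in_Grpn_iff[OF r_pos p_dvd permutes_id] del: id_apply) simp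
qed

lemma hstable_T:
  assumes "hstable X" "g \<in> Grpn r p n" "f \<in> X" shows "poly_act (cclass (FT g)) f \<in> X"
proof -
  have f: "f \<in> polys n" using hstableD(2)[OF assms(1)] assms(3) by auto
  show ?thesis
    using group_act_ract[OF assms(2) f] poly_act_T[OF Grpn_subset[OF assms(2)] f] hstableD(6)[OF assms(1) _ _ assms(3)] by auto
qed

lemma hecke_stable:
  assumes X: "hstable X" and h: "h \<in> hecke_alg" and f: "f \<in> X" shows "poly_act h f \<in> X"
proof -
  note XD = hstableD[OF X]
  have t: "poly_act b g \<in> X" if b: "b \<in> t_alg" and g: "g \<in> X" for b g
  proof (rule subalgebra_gen_stable[OF hecke_gens(2) XD(2-4) _ _ g])
    show "b \<in> subalgebra_gen (z_elt ` {..<n} \<union> (\<lambda>i. cclass (FT (zeta_mat r n i (int p)))) ` {..<n} \<union>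
     (\<lambda>i. cclass (FT (zeta_mat r n i (- 1) * zeta_mat r n (Suc i) 1))) ` {..<n - 1})"
      using b by (simp only: t_alg_def)
    fix b f
    assume b: "b \<in> z_elt ` {..<n} \<union> (\<lambda>i. cclass (FT (zeta_mat r n i (int p)))) ` {..<n} \<union>
     (\<lambda>i. cclass (FT (zeta_mat r n i (- 1) * zeta_mat r n (Suc i) 1))) ` {..<n - 1}" and f: "f \<in> X"
    then have fp: "f \<in> polys n" using XD(2) by auto
    from b consider i where "i < n" "b = z_elt i" | i where "b = cclass (FT (zeta_mat r n i (int p)))"
      | i where "i < n - 1" "b = cclass (FT (zeta_mat r n i (- 1) * zeta_mat r n (Suc i) 1))"
      by blast
    then show "poly_act b f \<in> X"
    proof cases
      case 1
      then show ?thesis using XD(5)[OF 1(1) f] poly_act_z[OF 1(1) fp] by simp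
    next
      case 2
      then show ?thesis using hstable_T[OF X diag_mat_Grpn(1) f] by simp
    next
      case 3
      have "Suc i < n" using 3(1) by linarith
      then show ?thesis unfolding 3(2) by (rule hstable_T[OF X diag_mat_Grpn(2) f])
    qed
  qed
  show ?thesis
  proof (rule subalgebra_gen_stable[OF hecke_gens(1) XD(2-4) _ _ f])
    show "h \<in> subalgebra_gen ((\<lambda>g. cclass (FT g)) ` Grpn r p n \<union> t_alg)" using h by (simp only: hecke_alg_def)
    show "poly_act b f \<in> X" if "b \<in> (\<lambda>g. cclass (FT g)) ` Grpn r p n \<union> t_alg" "f \<in> X" for b f
      using that t hstable_T[OF X] by auto
  qed
qed

lemma hstable_coinv: "hstable coinv"
  unfolding hstable_def
proof (intro conjI allI ballI impI)
  show "coinv \<subseteq> polys n" by (rule coinv_closed(1))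
qed (simp_all add: coinv_closed(3) coinv_pscale coinv_Z coinv_ract)

text \<open>The representative chosen by \<open>SOME\<close> is irrelevant since the Hecke algebra
  maps the ideal into itself.\<close>

lemma L1_act_cls:
  assumes h: "h \<in> hecke_alg" and f: "f \<in> polys n" shows "L1_act h (cls f) = cls (poly_act h f)"
proof -
  let ?g = "SOME g. g \<in> cls f"
  have g: "?g \<in> polys n" "?g - f \<in> coinv" using cls_some[OF f] by auto
  have d: "poly_act h (?g - f) \<in> coinv" by (rule hecke_stable[OF hstable_coinv h g(2)])
  note lin = poly_act_linear[OF hecke_FC[OF h]]
  have "poly_act h (?g - f) + poly_act h f = poly_act h ?g"
    using lin(2)[of "?g - f" f] g(1) f by simp
  then have "poly_act h ?g - poly_act h f \<in> coinv" using d by (metis add_diff_cancel_right')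
  then show ?thesis using lin(1) g(1) f by (simp add: L1_act_def cls_eq_iff)
qed

lemma L1_basis_F: "L1_basis E (\<lambda>v. cls (F v))"
  unfolding L1_basis_def
proof (intro conjI ballI)
  show "(\<lambda>v. cls (F v)) ` E \<subseteq> carrier L1" using cls_carrier F_props(1) by auto
  fix a assume "a \<in> carrier L1"
  then obtain f where f: "f \<in> polys n" "a = cls f" unfolding carrier_L1 by blast
  have fs: "finsum L1 (\<lambda>i. L1_scale (u i) (cls (F i))) E = cls (\<Sum>i\<in>E. pscale (u i) (F i))" for u
    using cls_finsum[OF finite_E, of "\<lambda>i. pscale (u i) (F i)"] by (simp add: L1_scale_cls F_props)
  have sp: "(\<Sum>i\<in>E. pscale (u i) (F i)) \<in> polys n" for u by (intro polys_sum polys_pscale F_props)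
  have eq: "a = finsum L1 (\<lambda>i. L1_scale (u i) (cls (F i))) E \<longleftrightarrow> f - (\<Sum>i\<in>E. pscale (u i) (F i)) \<in> coinv" for u
    unfolding fs f(2) by (rule cls_eq_iff[OF f(1) sp])
  show "\<exists>!u. u \<in> E \<rightarrow>\<^sub>E UNIV \<and> a = finsum L1 (\<lambda>i. L1_scale (u i) (cls (F i))) E"
    unfolding eq
  proof (rule ex_ex1I)
    obtain u where u: "f - (\<Sum>v\<in>E. pscale (u v) (F v)) \<in> coinv" using coinv_decompose[OF f(1)] by blast
    have "(\<Sum>v\<in>E. pscale (restrict u E v) (F v)) = (\<Sum>v\<in>E. pscale (u v) (F v))" by (intro sum.cong) auto
    then show "\<exists>u. u \<in> E \<rightarrow>\<^sub>E UNIV \<and> f - (\<Sum>v\<in>E. pscale (u v) (F v)) \<in> coinv"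
      using u by (intro exI[of _ "restrict u E"]) auto
  next
    fix u u' :: "complex mat \<Rightarrow> 'k"
    assume u: "u \<in> E \<rightarrow>\<^sub>E UNIV \<and> f - (\<Sum>v\<in>E. pscale (u v) (F v)) \<in> coinv"
      and u': "u' \<in> E \<rightarrow>\<^sub>E UNIV \<and> f - (\<Sum>v\<in>E. pscale (u' v) (F v)) \<in> coinv"
    have "(f - (\<Sum>v\<in>E. pscale (u' v) (F v))) - (f - (\<Sum>v\<in>E. pscale (u v) (F v))) = (\<Sum>v\<in>E. pscale (u v - u' v) (F v))"
      by (simp add: pscale_diff_left sum_subtractf)
    from coinv_diff[OF u'[THEN conjunct2] u[THEN conjunct2], unfolded this]
    have "(\<Sum>v\<in>E. pscale (u v - u' v) (F v)) \<in> coinv" .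
    then have "u v = u' v" if "v \<in> E" for v using coinv_independent[of "\<lambda>v. u v - u' v" v] that by simp
    then show "u = u'" using u u' by (intro PiE_ext[of u E "\<lambda>_. UNIV"]) auto
  qed
qed

section \<open>The modules attached to the descent classes\<close>

definition class_module :: "nat set \<times> nat list \<Rightarrow> 'k mpol set set" where
  "class_module d = cls ` mpol.span (F ` class_set d)"

lemma class_module_class_space: "class_module d = cls ` class_space d"
proof
  show "class_module d \<subseteq> cls ` class_space d" unfolding class_module_def using class_space_span by blast
  show "cls ` class_space d \<subseteq> class_module d"
  proof
    fix a assume "a \<in> cls ` class_space d"
    then obtain f s where f: "a = cls f" "f \<in> polys n" "s \<in> mpol.span (F ` class_set d)" "f - s \<in> coinv"
      unfolding class_space_def by blast
    have sp: "s \<in> polys n" using f(3) span_polys by blast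
    have "a = cls s" unfolding f(1) using cls_eq_iff[OF f(2) sp] f(4) by (rule iffD2)
    then show "a \<in> class_module d" unfolding class_module_def using f(3) by blast
  qed
qed

lemma class_module_mem: "f \<in> polys n \<Longrightarrow> cls f \<in> class_module d \<longleftrightarrow> f \<in> class_space d"
proof
  assume f: "f \<in> polys n" and "cls f \<in> class_module d"
  then obtain g where g: "g \<in> class_space d" "cls f = cls g" unfolding class_module_class_space by blast
  then have "f - g \<in> coinv" using f class_space_closed(2)[of d] cls_eq_iff by blast
  then have "(f - g) + g \<in> class_space d" using g(1) class_space_closed(1)[of d] by (intro class_space_closed(3)) auto
  then show "f \<in> class_space d" by simp
qed (auto simp: class_module_class_space)

text \<open>The descent classes partition the index set \<open>E\<close> of the basis. For
  uniqueness, a family of components is merged into one coefficient function on \<open>E\<close>, to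
  which independence modulo the ideal applies.\<close>

lemma class_module_decomposition: "internal_direct_sum L1 (descent_classes r p n) class_module"
  unfolding internal_direct_sum_def
proof (intro conjI ballI)
  let ?D = "descent_classes r p n"
  have finD: "finite ?D" unfolding descent_classes_def using finite_E by simp
  show class_module_sub: "class_module d \<subseteq> carrier L1" for d
    unfolding class_module_def carrier_L1 using span_polys by blast
  have grp: "(\<Sum>d\<in>?D. \<Sum>v\<in>class_set d. g v) = (\<Sum>v\<in>E. g v)" for g :: "complex mat \<Rightarrow> 'k mpol"
    unfolding class_set_def by (rule sum.group) (use finD finite_E in \<open>auto simp: descent_classes_def\<close>)
  fix a assume "a \<in> carrier L1"
  then obtain f where f: "f \<in> polys n" "a = cls f" unfolding carrier_L1 by blast
  have sp: "(\<Sum>v\<in>A. pscale (x v) (F v)) \<in> polys n" for x A by (intro polys_sum polys_pscale F_props)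
  have fs: "finsum L1 u ?D = cls (\<Sum>v\<in>E. pscale (x (colored_descent_class r n v) v) (F v))"
    if u: "\<And>d. d \<in> ?D \<Longrightarrow> u d = cls (\<Sum>v\<in>class_set d. pscale (x d v) (F v))" for u x
  proof -
    interpret ring L1 by (rule ring_L1)
    have "finsum L1 u ?D = finsum L1 (\<lambda>d. cls (\<Sum>v\<in>class_set d. pscale (x d v) (F v))) ?D"
      by (rule finsum_cong') (auto simp: u intro!: cls_carrier sp)
    also have "\<dots> = cls (\<Sum>d\<in>?D. \<Sum>v\<in>class_set d. pscale (x d v) (F v))" by (rule cls_finsum[OF finD sp])
    also have "(\<Sum>d\<in>?D. \<Sum>v\<in>class_set d. pscale (x d v) (F v)) =
        (\<Sum>d\<in>?D. \<Sum>v\<in>class_set d. pscale (x (colored_descent_class r n v) v) (F v))"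
      by (intro sum.cong refl) (auto simp: class_set_def)
    finally show ?thesis unfolding grp .
  qed
  have rep: "\<exists>x. \<forall>d\<in>?D. u d = cls (\<Sum>v\<in>class_set d. pscale (x d v) (F v))" if u: "u \<in> (\<Pi>\<^sub>E d\<in>?D. class_module d)" for u
  proof -
    have "\<exists>x. u d = cls (\<Sum>v\<in>class_set d. pscale (x v) (F v))" if "d \<in> ?D" for d
    proof -
      have "u d \<in> class_module d" using u that by blast
      then obtain s where "s \<in> mpol.span (F ` class_set d)" "u d = cls s" unfolding class_module_def by blast
      then show ?thesis using span_image_sum[OF class_set_E(2), of s F d] by blast
    qed
    then show ?thesis by (intro bchoice ballI)
  qed
  show "\<exists>!u. u \<in> (\<Pi>\<^sub>E d\<in>?D. class_module d) \<and> a = finsum L1 u ?D"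
  proof (rule ex_ex1I)
    obtain x where x: "f - (\<Sum>v\<in>E. pscale (x v) (F v)) \<in> coinv" using coinv_decompose[OF f(1)] by blast
    let ?u = "\<lambda>d\<in>?D. cls (\<Sum>v\<in>class_set d. pscale (x v) (F v))"
    have "(\<Sum>v\<in>class_set d. pscale (x v) (F v)) \<in> mpol.span (F ` class_set d)" for d
      by (intro mpol.span_sum mpol.span_scale mpol.span_base) auto
    then have "?u \<in> (\<Pi>\<^sub>E d\<in>?D. class_module d)" unfolding class_module_def by auto
    moreover have "a = finsum L1 ?u ?D"
      using fs[of ?u "\<lambda>_. x"] x f sp by (simp add: cls_eq_iff)
    ultimately show "\<exists>u. u \<in> (\<Pi>\<^sub>E d\<in>?D. class_module d) \<and> a = finsum L1 u ?D" by blast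
  next
    fix u u' assume u: "u \<in> (\<Pi>\<^sub>E d\<in>?D. class_module d) \<and> a = finsum L1 u ?D" and u': "u' \<in> (\<Pi>\<^sub>E d\<in>?D. class_module d) \<and> a = finsum L1 u' ?D"
    obtain x where x1: "\<forall>d\<in>?D. u d = cls (\<Sum>v\<in>class_set d. pscale (x d v) (F v))"
      using rep[OF u[THEN conjunct1]] by (rule exE)
    obtain x' where x2: "\<forall>d\<in>?D. u' d = cls (\<Sum>v\<in>class_set d. pscale (x' d v) (F v))"
      using rep[OF u'[THEN conjunct1]] by (rule exE)
    note x = x1 x2
    let ?c = "colored_descent_class r n"
    have "a = cls (\<Sum>v\<in>E. pscale (x (?c v) v) (F v))"
      by (rule trans[OF u[THEN conjunct2] fs]) (rule x(1)[rule_format])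
    moreover have "a = cls (\<Sum>v\<in>E. pscale (x' (?c v) v) (F v))"
      by (rule trans[OF u'[THEN conjunct2] fs]) (rule x(2)[rule_format])
    ultimately have "cls (\<Sum>v\<in>E. pscale (x (?c v) v) (F v)) = cls (\<Sum>v\<in>E. pscale (x' (?c v) v) (F v))"
      by (rule subst)
    then have "(\<Sum>v\<in>E. pscale (x (?c v) v - x' (?c v) v) (F v)) \<in> coinv"
      by (simp add: cls_eq_iff sp pscale_diff_left sum_subtractf)
    then have e: "x (?c v) v = x' (?c v) v" if "v \<in> E" for v
      using coinv_independent[of "\<lambda>v. x (?c v) v - x' (?c v) v" v] that by simp
    have "u d = u' d" if d: "d \<in> ?D" for d
    proof -
      have "(\<Sum>v\<in>class_set d. pscale (x d v) (F v)) = (\<Sum>v\<in>class_set d. pscale (x' d v) (F v))"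
        by (intro sum.cong refl) (use e in \<open>auto simp: class_set_def\<close>)
      then show ?thesis using x d by simp
    qed
    then show "u = u'" using u u' by (intro PiE_ext[of u ?D class_module]) auto
  qed
qed

lemma descent_class_nonempty: "d \<in> descent_classes r p n \<Longrightarrow> \<exists>v. v \<in> class_set d"
  by (auto simp: descent_classes_def class_set_def)

text \<open>Scalars, the z_i and the matrices of W all belong to the Hecke algebra, so a stable
  subgroup is automatically a subspace closed under the remaining operators.\<close>

lemma preimage_hstable:
  assumes V: "alg_submodule hecke_alg L1_act L1 V"
  shows "hstable {f \<in> polys n. cls f \<in> V}"
proof -
  have sub: "subgroup V (add_monoid L1)" and act: "\<And>h a. h \<in> hecke_alg \<Longrightarrow> a \<in> V \<Longrightarrow> L1_act h a \<in> V"
    using V by (auto simp: alg_submodule_def)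
  have zero: "cls 0 \<in> V" using subgroup.one_closed[OF sub] by (simp add: cls_0)
  have add: "cls f \<oplus>\<^bsub>L1\<^esub> cls g \<in> V" if "cls f \<in> V" "cls g \<in> V" for f g
    using subgroup.m_closed[OF sub that] by simp
  have A: "cls (poly_act h f) \<in> V" if "h \<in> hecke_alg" "f \<in> polys n" "cls f \<in> V" for h f
    using act[OF that(1,3)] L1_act_cls[OF that(1,2)] by simp
  show ?thesis unfolding hstable_def
  proof (intro conjI allI ballI impI)
    show "coinv \<subseteq> {f \<in> polys n. cls f \<in> V}"
    proof
      fix f assume f: "f \<in> coinv"
      then have fp: "f \<in> polys n" using coinv_closed(1) by blast
      have "cls f = cls 0" using f by (simp add: cls_eq_iff[OF fp polys_0])
      then show "f \<in> {f \<in> polys n. cls f \<in> V}" using fp zero by simp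
    qed
    show "{f \<in> polys n. cls f \<in> V} \<subseteq> polys n" by blast
    fix f assume f: "f \<in> {f \<in> polys n. cls f \<in> V}"
    then have fp: "f \<in> polys n" "cls f \<in> V" by auto
    show "f + g \<in> {f \<in> polys n. cls f \<in> V}" if "g \<in> {f \<in> polys n. cls f \<in> V}" for g
      using that fp add[of f g] by (simp add: cls_add)
    show "pscale a f \<in> {f \<in> polys n. cls f \<in> V}" for a
      using A[OF hecke_incl(3)[of a] fp] fp by (simp add: poly_act_fscalar)
    show "Z i f \<in> {f \<in> polys n. cls f \<in> V}" if "i < n" for i
      using A[OF hecke_incl(2)[OF that] fp] fp that by (simp add: poly_act_z)
    fix w k assume w: "w permutes {..<n}" "int p dvd (\<Sum>j<n. k j)"
    have "mk_mat r n w k \<in> Grpn r p n" using mk_mat_in_Grpn_iff[OF r_pos p_dvd w(1)] w(2) by simp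
    from A[OF hecke_incl(1)[OF this] fp]
    show "ract w k f \<in> {f \<in> polys n. cls f \<in> V}"
      using fp w by (simp add: poly_act_T mk_mat_Grpn_1 group_act_mk_mat)
  qed
qed

lemma alg_submodule_class_module: "alg_submodule hecke_alg L1_act L1 (class_module d)"
  unfolding alg_submodule_def
proof (intro conjI ballI)
  interpret L: ring L1 by (rule ring_L1)
  show "subgroup (class_module d) (add_monoid L1)"
  proof (rule group.subgroupI[OF L.a_group])
    show "class_module d \<subseteq> carrier (add_monoid L1)" unfolding class_module_def carrier_L1 using span_polys by auto
    show "class_module d \<noteq> {}" unfolding class_module_def using mpol.span_zero by auto
    fix a assume "a \<in> class_module d"
    then obtain f where f: "f \<in> class_space d" "a = cls f" unfolding class_module_class_space by blast
    have fp: "f \<in> polys n" using f(1) class_space_closed(2)[of d] by blast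
    have "cls (- f) \<oplus>\<^bsub>L1\<^esub> cls f = \<zero>\<^bsub>L1\<^esub>" using fp by (simp add: cls_add cls_0)
    then have "\<ominus>\<^bsub>L1\<^esub> cls f = cls (- f)" using fp cls_carrier by (intro L.minus_equality) auto
    moreover have "- f \<in> class_space d" using class_space_closed(4)[OF f(1), of "- 1"] by (simp add: pscale_minus_left)
    ultimately show "inv\<^bsub>add_monoid L1\<^esub> a \<in> class_module d" unfolding class_module_class_space f(2) a_inv_def by auto
    fix b assume "b \<in> class_module d"
    then obtain g where g: "g \<in> class_space d" "b = cls g" unfolding class_module_class_space by blast
    have gp: "g \<in> polys n" using g(1) class_space_closed(2)[of d] by blast
    show "a \<otimes>\<^bsub>add_monoid L1\<^esub> b \<in> class_module d"
      using class_space_closed(3)[OF f(1) g(1)] fp gp unfolding class_module_class_space f(2) g(2) by (simp add: cls_add)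
  qed
  fix h a assume h: "h \<in> hecke_alg" and "a \<in> class_module d"
  then obtain f where f: "f \<in> class_space d" "a = cls f" unfolding class_module_class_space by blast
  have "f \<in> polys n" using f(1) class_space_closed(2)[of d] by blast
  then show "L1_act h a \<in> class_module d"
    using hecke_stable[OF hstable_class_space h f(1)] unfolding class_module_class_space f(2) by (simp add: L1_act_cls[OF h])
qed

lemma cls_F_neq_0: "v \<in> E \<Longrightarrow> cls (F v) \<noteq> \<zero>\<^bsub>L1\<^esub>"
  using F_notin_coinv[of v] cls_eq_iff[OF F_props(1) polys_0, of v] by (simp add: cls_0)

lemma class_module_irreducible:
  assumes d: "d \<in> descent_classes r p n" shows "alg_irreducible hecke_alg L1_act L1 (class_module d)"
  unfolding alg_irreducible_def
proof (intro conjI allI impI)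
  show "alg_submodule hecke_alg L1_act L1 (class_module d)" by (rule alg_submodule_class_module)
  obtain v where v: "v \<in> class_set d" using descent_class_nonempty[OF d] by blast
  have "cls (F v) \<in> class_module d" unfolding class_module_class_space using class_space_F[OF v] by blast
  then show "class_module d \<noteq> {\<zero>\<^bsub>L1\<^esub>}" using cls_F_neq_0[OF class_set_E(1)[OF v]] by auto
  fix V assume "alg_submodule hecke_alg L1_act L1 V \<and> V \<subseteq> class_module d"
  then have V: "alg_submodule hecke_alg L1_act L1 V" "V \<subseteq> class_module d" by auto
  let ?X = "{f \<in> polys n. cls f \<in> V}"
  have X: "hstable ?X" by (rule preimage_hstable[OF V(1)])
  have VX: "V = cls ` ?X" using V(2) unfolding class_module_def using span_polys by blast
  show "V = {\<zero>\<^bsub>L1\<^esub>} \<or> V = class_module d"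
  proof (cases "?X \<subseteq> coinv")
    case True
    then have "cls f = \<zero>\<^bsub>L1\<^esub>" if "f \<in> ?X" for f using that cls_eq_iff[of f 0] by (auto simp: cls_0)
    moreover have "0 \<in> ?X" using hstableD(1)[OF X] coinv_closed(2) by blast
    ultimately have "cls ` ?X = {\<zero>\<^bsub>L1\<^esub>}" by blast
    then show ?thesis using VX by simp
  next
    case False
    then obtain f where f: "f \<in> ?X" "f \<notin> coinv" by blast
    then have "f \<in> class_space d" using V(2) class_module_mem[of f d] by auto
    then have "class_space d \<subseteq> ?X" by (rule hstable_class_space_subset[OF X f(1) _ f(2)])
    then have "class_module d \<subseteq> V" unfolding class_module_class_space using VX by blast
    then show ?thesis using V(2) by blast
  qed
qed

lemma wops_hecke:
  assumes "(A, \<alpha>) \<in> wops" obtains h where "h \<in> hecke_alg" "\<And>f. f \<in> polys n \<Longrightarrow> poly_act h f = A f"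
proof -
  from assms consider i where "i < n" "A = Z i" | a where "int p dvd (\<Sum>j<n. a j)" "A = ract id a"
    by (auto simp: wops_def)
  then show ?thesis
  proof cases
    case 1
    then show ?thesis using that[OF hecke_incl(2)] poly_act_z by blast
  next
    case 2
    have "mk_mat r n id a \<in> Grpn r p n" using mk_mat_in_Grpn_iff[OF r_pos p_dvd permutes_id] 2(1) by simp
    from that[OF hecke_incl(1)[OF this]] show ?thesis
      using 2(2) by (simp add: poly_act_T mk_mat_Grpn_1 permutes_id group_act_mk_mat)
  qed
qed

text \<open>The image of \<open>F v\<close> would be a vector of weight \<lambda>_v in a module
  spanned by the weights of another class. A separating operator multiplies each of its coefficients
  by a non-zero difference of eigenvalues and yields 0, so the image vanishes, against
  injectivity.\<close>

lemma class_module_not_isomorphic: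
  assumes d: "d \<in> descent_classes r p n" and de: "d \<noteq> e"
  shows "\<not> alg_isomorphic hecke_alg L1_act L1 (class_module d) (class_module e)"
proof
  assume "alg_isomorphic hecke_alg L1_act L1 (class_module d) (class_module e)"
  then obtain \<phi> where bij: "bij_betw \<phi> (class_module d) (class_module e)"
    and add: "\<And>a b. a \<in> class_module d \<Longrightarrow> b \<in> class_module d \<Longrightarrow> \<phi> (a \<oplus>\<^bsub>L1\<^esub> b) = \<phi> a \<oplus>\<^bsub>L1\<^esub> \<phi> b"
    and act: "\<And>h a. h \<in> hecke_alg \<Longrightarrow> a \<in> class_module d \<Longrightarrow> \<phi> (L1_act h a) = L1_act h (\<phi> a)"
    unfolding alg_isomorphic_def by blast
  obtain v where v: "v \<in> class_set d" using descent_class_nonempty[OF d] by blast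
  have vE: "v \<in> E" using class_set_E(1)[OF v] .
  have vC: "cls (F v) \<in> class_module d" unfolding class_module_class_space using class_space_F[OF v] by blast
  have "\<phi> (cls (F v)) \<in> class_module e" using bij vC by (auto simp: bij_betw_def)
  then obtain g where g: "g \<in> class_space e" "\<phi> (cls (F v)) = cls g" unfolding class_module_class_space by blast
  have gp: "g \<in> polys n" using g(1) class_space_closed(2)[of e] by blast
  have weight: "A g - pscale (\<alpha> (lm v)) g \<in> coinv" if A: "(A, \<alpha>) \<in> wops" for A \<alpha>
  proof -
    obtain h where h: "h \<in> hecke_alg" "\<And>f. f \<in> polys n \<Longrightarrow> poly_act h f = A f" using wops_hecke[OF A] by blast
    have s: "L1_act (cclass (fscalar (\<alpha> (lm v)))) (cls f) = cls (pscale (\<alpha> (lm v)) f)" if "f \<in> polys n" for f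
      using that by (simp add: L1_act_cls[OF hecke_incl(3)] poly_act_fscalar)
    have "A (F v) = pscale (\<alpha> (lm v)) (F v)" using F_Wt[of v] A by (auto simp: Wt_def)
    then have "L1_act h (cls (F v)) = L1_act (cclass (fscalar (\<alpha> (lm v)))) (cls (F v))"
      by (simp add: L1_act_cls[OF h(1) F_props(1)] h(2) F_props(1) s)
    then have "L1_act h (cls g) = L1_act (cclass (fscalar (\<alpha> (lm v)))) (cls g)"
      using act[OF h(1) vC] act[OF hecke_incl(3) vC] g(2) by metis
    then have "cls (A g) = cls (pscale (\<alpha> (lm v)) g)"
      by (simp add: L1_act_cls[OF h(1) gp] h(2)[OF gp] s[OF gp])
    moreover have "A g \<in> polys n" using poly_act_linear(1)[OF hecke_FC[OF h(1)] gp gp] h(2)[OF gp] by simp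
    ultimately show ?thesis using gp by (simp add: cls_eq_iff)
  qed
  obtain x where x: "g - (\<Sum>v\<in>E. pscale (x v) (F v)) \<in> coinv" "\<And>v. v \<notin> class_set e \<Longrightarrow> x v = 0"
    using class_space_sum[OF g(1)] by blast
  have "x y = 0" if y: "y \<in> E" for y
  proof (cases "y \<in> class_set e")
    case True
    then have "v \<noteq> y" using v de by (auto simp: class_set_def)
    from weights_distinct[OF vE y this] obtain A \<alpha> where A: "(A, \<alpha>) \<in> wops" "\<alpha> (lm v) \<noteq> \<alpha> (lm y)" by blast
    let ?s = "\<Sum>v\<in>E. pscale (x v) (F v)"
    have sp: "?s \<in> polys n" by (intro polys_sum polys_pscale F_props)
    have "A (g - ?s) \<in> coinv" by (rule hstable_wops[OF hstable_coinv A(1) x(1)])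
    moreover have "A (g - ?s) + A ?s = A g" using wops_linear(1)[OF A(1), of "g - ?s" ?s] gp sp by simp
    then have "A ?s = A g - A (g - ?s)" by (simp add: eq_diff_eq add.commute)
    moreover have "A ?s = (\<Sum>v\<in>E. pscale (x v * \<alpha> (lm v)) (F v))"
    proof -
      have "A ?s = (\<Sum>v\<in>E. A (pscale (x v) (F v)))" by (rule wops_sum[OF A(1)]) (simp add: F_props)
      also have "\<dots> = (\<Sum>v\<in>E. pscale (x v * \<alpha> (lm v)) (F v))"
      proof (intro sum.cong refl)
        fix u
        have "A (F u) = pscale (\<alpha> (lm u)) (F u)" using F_Wt[of u] A(1) by (auto simp: Wt_def)
        then show "A (pscale (x u) (F u)) = pscale (x u * \<alpha> (lm u)) (F u)"
          using wops_linear(2)[OF A(1) F_props(1) F_props(1), of "x u" u] by simp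
      qed
      finally show ?thesis .
    qed
    moreover have "pscale (\<alpha> (lm v)) ?s = (\<Sum>u\<in>E. pscale (x u * \<alpha> (lm v)) (F u))"
      by (simp add: pscale_sum_right mult.commute)
    ultimately have e: "(\<Sum>u\<in>E. pscale (x u * (\<alpha> (lm u) - \<alpha> (lm v))) (F u)) = A g - A (g - ?s) - pscale (\<alpha> (lm v)) ?s"
      by (simp add: right_diff_distrib pscale_diff_left sum_subtractf)
    have "A g - A (g - ?s) - pscale (\<alpha> (lm v)) ?s =
        (A g - pscale (\<alpha> (lm v)) g) - (A (g - ?s) - pscale (\<alpha> (lm v)) (g - ?s))"
      by (simp add: pscale_diff_right)
    also have "\<dots> \<in> coinv" by (rule coinv_diff[OF weight[OF A(1)] coinv_diff[OF \<open>A (g - ?s) \<in> coinv\<close> coinv_pscale[OF x(1)]]])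
    finally have "(\<Sum>u\<in>E. pscale (x u * (\<alpha> (lm u) - \<alpha> (lm v))) (F u)) \<in> coinv" unfolding e .
    from coinv_independent[OF this y] show "x y = 0" using A(2) by simp
  qed (rule x(2))
  then have "(\<Sum>v\<in>E. pscale (x v) (F v)) = 0" by (intro sum.neutral) simp
  then have "g \<in> coinv" using x(1) by simp
  then have g0: "\<phi> (cls (F v)) = cls 0" using g(2) gp cls_eq_iff[of g 0] by simp
  interpret L: ring L1 by (rule ring_L1)
  have zC: "cls 0 \<in> class_module d" unfolding class_module_def using mpol.span_zero by blast
  have "\<phi> (cls 0) \<oplus>\<^bsub>L1\<^esub> \<phi> (cls 0) = \<phi> (cls 0)" using add[OF zC zC] by (simp add: cls_add)
  moreover have "\<phi> (cls 0) \<in> carrier L1"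
  proof -
    have "\<phi> (cls 0) \<in> class_module e" using bij zC by (auto simp: bij_betw_def)
    then show ?thesis unfolding class_module_def carrier_L1 using span_polys by blast
  qed
  ultimately have "\<phi> (cls 0) = \<zero>\<^bsub>L1\<^esub>" using L.add.l_cancel_one by blast
  then have "\<phi> (cls (F v)) = \<phi> (cls 0)" using g0 by (simp add: cls_0)
  then have "cls (F v) = cls 0" using bij vC zC by (auto simp: bij_betw_def inj_on_def)
  then show False using cls_F_neq_0[OF vE] by (simp add: cls_0)
qed

end

section \<open>Rational functions\<close>

lemma ratfun_const_hom:
  "ratfun_const (x + y) = ratfun_const x + (ratfun_const y :: 'l::linorder ratfun)"
  "ratfun_const (x * y) = ratfun_const x * (ratfun_const y :: 'l ratfun)"
  "ratfun_const 1 = (1 :: 'l ratfun)"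
  by (simp_all add: ratfun_const_def single_add mult_single One_fract_def)

lemma ratfun_sum: "(\<Sum>x\<in>A. Fract (g x) 1) = Fract (\<Sum>x\<in>A. g x) 1"
  by (induction A rule: infinite_finite_induct) (simp_all add: Zero_fract_def)

text \<open>Comparison of the coefficients of the linear monomials, which are distinct because
  \<open>ix\<close> is injective on \<open>A\<close>.\<close>

lemma ratfun_var_independent:
  fixes ix :: "nat \<Rightarrow> 'l::linorder"
  assumes "finite A" "inj_on ix A" and S: "(\<Sum>l\<in>A. ratfun_const (a l) * ratfun_var (ix l)) = 0" and l: "l \<in> A"
  shows "a l = 0"
proof -
  let ?g = "\<lambda>l. Poly_Mapping.single (Poly_Mapping.single (ix l) (1::nat)) (a l)"
  have "(\<Sum>l\<in>A. ratfun_const (a l) * ratfun_var (ix l)) = Fract (\<Sum>l\<in>A. ?g l) 1"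
    unfolding ratfun_sum[symmetric] by (simp add: ratfun_const_def ratfun_var_def mult_single)
  then have "(\<Sum>l\<in>A. ?g l) = 0" using S by (simp add: Zero_fract_def eq_fract)
  then have "0 = coef (\<Sum>l\<in>A. ?g l) (Poly_Mapping.single (ix l) 1)" by simp
  also have "\<dots> = (\<Sum>l'\<in>A. if l' = l then a l else 0)"
    unfolding lookup_sum
  proof (intro sum.cong refl)
    fix l' assume l': "l' \<in> A"
    have "Poly_Mapping.single (ix l') (1::nat) = Poly_Mapping.single (ix l) 1 \<longleftrightarrow> l' = l"
      using inj_onD[OF assms(2) _ l' l] by (metis keys_single one_neq_zero singleton_insert_inj_eq)
    then show "coef (?g l') (Poly_Mapping.single (ix l) 1) = (if l' = l then a l else 0)"
      by (auto simp: lookup_single when_def)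
  qed
  also have "\<dots> = a l" using assms(1) l by (simp add: sum.delta)
  finally show ?thesis by simp
qed

theorem theorem5p2:
  fixes r p n :: nat
    and ix :: "nat \<Rightarrow> 'l::linorder"
    and c :: "nat \<Rightarrow> 'l ratfun"
  assumes "0 < r" and "0 < p" and "0 < n" and "p dvd r"
    and "bij_betw ix {l. l < r \<and> p dvd l} (UNIV :: 'l set)"
    and "\<And>l. l < r \<Longrightarrow> p dvd l \<Longrightarrow> c l = ratfun_var (ix l)"
    and "\<And>l. l < r \<Longrightarrow> \<not> p dvd l \<Longrightarrow> c l = 0"
  shows "let L = cherednik.L1 r p n ratfun_const 0 c;
             cls = cherednik.L1_class r p n ratfun_const 0 c;
             act = cherednik.L1_act r p n ratfun_const 0 c;
             \<H> = cherednik.hecke_alg r p n ratfun_const 0 c;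
             f = (\<lambda>v. jack0 r p n ratfun_const c (steinberg_weight r n v));
             U = (\<lambda>d. cls ` module.span pscale
                    {f v | v. v \<in> G1_sub r p n \<and> colored_descent_class r n v = d})
         in L = cherednik.coinvariant_ring r p n ratfun_const
          \<and> cherednik.L1_basis r p n ratfun_const 0 c (G1_sub r p n) (\<lambda>v. cls (f v))
          \<and> internal_direct_sum L (descent_classes r p n) U
          \<and> (\<forall>d\<in>descent_classes r p n. alg_irreducible \<H> act L (U d))
          \<and> (\<forall>d\<in>descent_classes r p n. \<forall>e\<in>descent_classes r p n.
               d \<noteq> e \<longrightarrow> \<not> alg_isomorphic \<H> act L (U d) (U e))"
proof -
  \<comment> \<open>Parameters with \<open>p\<close> not dividing \<open>l\<close> vanish, so the
    relation lives on the index set where \<open>ix\<close> is injective.\<close>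
  have indep: "a l = 0"
    if S: "ratfun_const (a 0) * c 0 + (\<Sum>l = 1..<r. ratfun_const (a l) * c l) = 0" and l: "l < r" "p dvd l"
    for a :: "nat \<Rightarrow> complex" and l
  proof -
    let ?A = "{l. l < r \<and> p dvd l}"
    have "ratfun_const (a 0) * c 0 + (\<Sum>l = 1..<r. ratfun_const (a l) * c l) = (\<Sum>l<r. ratfun_const (a l) * c l)"
      using assms(1) by (simp add: lessThan_atLeast0 sum.atLeast_Suc_lessThan One_nat_def)
    also have "\<dots> = (\<Sum>l\<in>?A. ratfun_const (a l) * c l)"
      using assms(7) by (intro sum.mono_neutral_right) auto
    also have "\<dots> = (\<Sum>l\<in>?A. ratfun_const (a l) * ratfun_var (ix l))"
      using assms(6) by (intro sum.cong) auto
    finally show "a l = 0"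
      using ratfun_var_independent[of ?A ix a l] S l assms(5) by (simp add: bij_betw_def)
  qed
  \<comment> \<open>If \<open>c 0\<close> were 0, the coefficient vector supported at index 0 would
    be a non-trivial relation.\<close>
  have "c 0 \<noteq> 0"
  proof
    assume "c 0 = 0"
    moreover have "ratfun_const 0 = (0 :: 'l ratfun)" by (simp add: ratfun_const_def Zero_fract_def)
    ultimately show False using indep[of "\<lambda>l. if l = 0 then 1 else 0" 0] assms(1) by simp
  qed
  then interpret cher_gen r p n ratfun_const c
    using assms(1,3,4,7) indep by unfold_locales (auto simp: ratfun_const_hom)
  have F: "jack0 r p n ratfun_const c (steinberg_weight r n v) = F v" for v
    by (simp add: F_def lam_def[OF r_pos p_dvd n_pos])
  have U: "{F v | v. v \<in> G1_sub r p n \<and> colored_descent_class r n v = d} = F ` class_set d" for d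
    by (auto simp: class_set_def)
  have C: "(\<lambda>d. L1_class ` mpol.span (F ` class_set d)) = class_module" by (rule ext) (simp add: class_module_def)
  have CC': "L1_class ` mpol.span (F ` class_set d) = class_module d" for d by (simp add: class_module_def)
  show ?thesis unfolding Let_def F U C CC'
    using L1_coinvariant L1_basis_F class_module_decomposition class_module_irreducible class_module_not_isomorphic by blast
qed

end
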